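(* Assume that $\mathbf{F}\in C^1([0,T];\mathbf{L}^2(\Omega))$, $\frac{\partial^2\mathbf{F}}{\partial t^2}\in L^1([0,T];\mathbf{L}^2(\Omega))$, $\mathbf{v}_0\in\mathbf{H}^2(\Omega)\cap\mathbf{H}^1_0(\Omega)$ and $\mathbf{A}\mathbf{v}_0-\mathbf{F}(0)\in\mathbf{H}^1_0(\Omega)$, and that the sum-of-exponentials approximation has accuracy $\epsilon$, i.e. $\beta(t)=\sum_{j=1}^{N_{exp}}b_je^{-\frac{a_j}{\tau_\sigma}t}+\mathcal{O}(\epsilon)$ for $0<t\le T$, where $0<\epsilon<1$. Let $\mathbf{v}$ be the solution of the weak problem: $\mathbf{v}(t)\in\mathbf{H}^1_0(\Omega)$, $\mathbf{v}(0)=\mathbf{v}_0$ and, for $t\in(0,T]$, $$\Big\langle\frac{\partial\mathbf{v}}{\partial t},\mathbf{w}\Big\rangle+a(\mathbf{v},\mathbf{w})-\int_0^t\beta(t-s)\,b(\mathbf{v}(s),\mathbf{w})\,ds=\langle\mathbf{F},\mathbf{w}\rangle\quad\forall\,\mathbf{w}\in\mathbf{H}^1_0(\Omega).$$ Let $\mathbf{v}_h^n\in V_h$ $(1\le n\le N)$ be the solution of the fully discrete scheme $$\Big\langle\frac{\mathbf{v}_h^n-\mathbf{v}_h^{n-1}}{\Delta t},\mathbf{w}_h\Big\rangle+a(\mathbf{v}_h^n,\mathbf{w}_h)-\sum_{j=1}^{N_{exp}}b(H_j(\mathbf{v}_h^n),\mathbf{w}_h)=\langle\mathbf{F}(t_n),\mathbf{w}_h\rangle\quad\forall\,\mathbf{w}_h\in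 V_h,\qquad \mathbf{v}_h^0=\Pi_h\mathbf{v}_0,$$ where $H_j(\mathbf{v}_h^0)=\mathbf{0}$ and $H_j(\mathbf{v}_h^n)=e^{-\frac{a_j}{\tau_\sigma}\Delta t}H_j(\mathbf{v}_h^{n-1})+\frac{b_j\tau_\sigma}{a_j}\big(1-e^{-\frac{a_j}{\tau_\sigma}\Delta t}\big)\mathbf{v}_h^{n-1}$. Then for $n=1,2,\dots,N$, $$\|\mathbf{v}_h^n-\mathbf{v}(t_n)\|\le C(h^2+\Delta t)\Big(\|\mathbf{v}_0\|_2+\|\mathbf{v}\|_{L^\infty(\mathbf{H}^2)}+\int_0^{t_n}\Big(\Big\|\frac{\partial\mathbf{v}}{\partial t}\Big\|_2+\Big\|\frac{\partial^2\mathbf{v}}{\partial t^2}\Big\|\Big)ds\Big)+CT\epsilon\Big(\|\mathbf{v}_0\|_2+\int_0^{t_n}\Big\|\frac{\partial\mathbf{v}}{\partial t}\Big\|_2\,ds\Big),$$ with a constant $C>0$ independent of $h$, $\Delta t$ and $\epsilon$.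
   Context: Setting. $\Omega\subset\mathbb{R}^d$ ($d=2,3$) is a convex polygonal (polyhedral) domain, $T>0$, $0<\alpha<1$, $\rho>0$, $\tau_\sigma>0$, $\tau_\varepsilon\ge0$ are constants. $\mathbb{C},\mathbb{D}$ are fourth-order symmetric tensors on $\Omega$ (acting on symmetric $d\times d$ matrices) with $0<M_0\,\xi:\xi\le\mathbb{C}\xi:\xi\le M_1\,\xi:\xi$ and $0<M_0\,\xi:\xi\le\mathbb{D}\xi:\xi\le M_1\,\xi:\xi$ for every nonzero symmetric $\xi$ and a.e. $x\in\Omega$, with constants $M_0,M_1>0$, where $\xi:\zeta=\sum_{i,j}\xi_{ij}\zeta_{ij}$. Put $\mathbb{A}=\rho^{-1}\mathbb{C}$, $\mathbb{B}=\rho^{-1}(\mathbb{C}-(\tau_\varepsilon/\tau_\sigma)^\alpha\mathbb{D})$, $\varepsilon(\mathbf{u})=(\nabla\mathbf{u}+(\nabla\mathbf{u})^\top)/2$, $\beta(t)=E_\alpha(-(t/\tau_\sigma)^\alpha)$ with the Mittag-Leffler function $E_\alpha(z)=\sum_{j\ge0}z^j/\Gamma(j\alpha+1)$. Bilinear forms on $\mathbf{H}^1_0(\Omega)$: $a(\mathbf{v},\mathbf{w})=\int_\Omega\mathbb{A}\varepsilon(\mathbf{v}):\varepsilon(\mathbf{w})\,dx$, $b(\mathbf{v},\mathbf{w})=\int_\Omega\mathbb{B}\varepsilon(\mathbf{v}):\varepsilon(\mathbf{w})\,dx$. Operators from $\mathbf{H}^2(\Omega)\cap\mathbf{H}^1_0(\Omega)$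 to $\mathbf{L}^2(\Omega)$: $\mathbf{A}=-\mathrm{div}(\mathbb{A}\varepsilon(\cdot))$, $\mathbf{B}=-\mathrm{div}(\mathbb{B}\varepsilon(\cdot))$. Standing facts: $\mathbf{A}$ and $\mathbf{B}$ are bounded from $\mathbf{H}^2(\Omega)\cap\mathbf{H}^1_0(\Omega)$ to $\mathbf{L}^2(\Omega)$, and elliptic regularity holds: $\mathbf{A}$ is invertible with $\|\mathbf{v}\|_2\le C\|\mathbf{A}\mathbf{v}\|$ for all $\mathbf{v}\in\mathbf{H}^2(\Omega)\cap\mathbf{H}^1_0(\Omega)$. Finite elements. $\mathcal{T}_h$ is a shape regular partition of $\Omega$ into triangles/tetrahedra or rectangles/cuboids, $h$ is the maximal element diameter, and $V_h\subset\mathbf{H}^1_0(\Omega)$ is a linear/bilinear/trilinear finite element space satisfying (with constants independent of $h$) $\inf_{\boldsymbol\chi\in V_h}\{\|\mathbf{w}-\boldsymbol\chi\|+h\|\mathbf{w}-\boldsymbol\chi\|_1\}\le Ch^2\|\mathbf{w}\|_2$ for all $\mathbf{w}\in\mathbf{H}^2(\Omega)\cap\mathbf{H}^1_0(\Omega)$ and the inverse inequality $\|\mathbf{w}_h\|_1\le Ch^{-1}\|\mathbf{w}_h\|$ for all $\mathbf{w}_h\in V_h$. The Ritz-Volterra projection $\Pi_h$: for $\mathbf{w}(t)\in\mathbf{H}^1_0(\Omega)$, $(\Pi_h\mathbf{w})(t)\in V_h$ satisfies $a((\Pi_h\mathbf{w}-\mathbf{w})(t),\boldsymbol\chi)=\int_0^t\beta(t-s)\,b((\Pi_h\mathbf{w}-\mathbf{w})(s),\boldsymbol\chi)\,ds$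 for all $\boldsymbol\chi\in V_h$; at $t=0$ this reads $a(\Pi_h\mathbf{v}_0-\mathbf{v}_0,\boldsymbol\chi)=0$. Time grid. $N\ge1$ is an integer, $\Delta t=T/N$, $t_n=n\Delta t$. Sum-of-exponentials (SOE) approximation. Let $q>1$ and let $K,J$ be positive integers; $c_0=r_0=\frac12$, $c_k=\frac{(q+1)q^{k-1}}2$, $r_k=\frac{(q-1)q^{k-1}}2$ for $1\le k\le K$; $\omega_j,\xi_j$ ($1\le j\le J$) the weights and nodes of the $J$-point Gaussian quadrature on $[-1,1]$. Put $a_{kj}=(r_k\xi_j+c_k)^{-1/\alpha}$ and $b_{kj}=\frac{\sin(\alpha\pi)}{\alpha\pi}\cdot\frac{\omega_jr_k}{(r_k\xi_j+c_k)^2+2(r_k\xi_j+c_k)\cos\alpha\pi+1}$ for $0\le k\le K$, $1\le j\le J$, and let $(a_j,b_j)_{j=1}^{N_{exp}}$, $N_{exp}=(K+1)J$, be an enumeration of the pairs $(a_{kj},b_{kj})$; all $a_j,b_j$ are positive. The $\mathcal{O}(\epsilon)$ accuracy means $|\beta(t)-\sum_jb_je^{-a_jt/\tau_\sigma}|\le C_0\epsilon$ on $(0,T]$ with $C_0$ independent of $h,\Delta t,\epsilon$; $C$ may depend on $C_0$. Notation. Boldface denotes $\mathbb{R}^d$-valued function spaces; $\|\cdot\|_r$ is the $\mathbf{H}^r(\Omega)$ norm, $\|\cdot\|=\|\cdot\|_0$ and $\langle\cdot,\cdot\rangle$ are the $\mathbf{L}^2(\Omega)$ norm and inner product; $\|\cdot\|_{L^p(\mathbf{X})}$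 is the norm of $L^p([0,T];\mathbf{X})$. $C$ may depend on $\Omega,T$ and the model parameters $\alpha,\rho,\tau_\sigma,\tau_\varepsilon,\mathbb{C},\mathbb{D}$. Under the stated assumptions the weak solution is taken with $\mathbf{v}\in L^\infty([0,T];\mathbf{H}^2(\Omega)\cap\mathbf{H}^1_0(\Omega))$, $\frac{\partial\mathbf{v}}{\partial t}\in L^\infty([0,T];\mathbf{L}^2(\Omega))\cap L^1([0,T];\mathbf{H}^2(\Omega))$, $\frac{\partial^2\mathbf{v}}{\partial t^2}\in L^1([0,T];\mathbf{L}^2(\Omega))$. *)

theory Defs
  imports
    "HOL-Analysis.Analysis"
    "HOL-Probability.Essential_Supremum"
    "HOL-Computational_Algebra.Polynomial"
begin

section \<open>Sobolev spaces\<close>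

text \<open>
  Elements of \<open>L\<^sup>2(\<Omega>)\<close> and of the Sobolev spaces are represented by functions on the whole space
  \<open>real ^ 'd\<close>; only their values almost everywhere on \<open>\<Omega>\<close> matter, and the norms below are seminorms
  on representatives.
\<close>

type_synonym 'd vfield = "real ^ 'd \<Rightarrow> real ^ 'd"
type_synonym 'd tensor2 = "real ^ 'd ^ 'd"
type_synonym 'd tensor4 = "real ^ 'd ^ 'd ^ 'd ^ 'd"

primrec Ck :: "nat \<Rightarrow> ('a::euclidean_space \<Rightarrow> 'b::real_normed_vector) \<Rightarrow> bool" where
  "Ck 0 f \<longleftrightarrow> continuous_on UNIV f"
| "Ck (Suc k) f \<longleftrightarrow> f differentiable_on UNIV \<and>
     (\<forall>e\<in>Basis. Ck k (\<lambda>x. frechet_derivative f (at x) e))"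

definition test_functions :: "'a::euclidean_space set \<Rightarrow> ('a \<Rightarrow> 'b::real_normed_vector) set" where
  "test_functions \<Omega> = {\<phi>. (\<forall>k. Ck k \<phi>) \<and> compact (closure {x. \<phi> x \<noteq> 0}) \<and>
     closure {x. \<phi> x \<noteq> 0} \<subseteq> \<Omega>}"

definition locally_integrable :: "(real ^ 'd) set \<Rightarrow> (real ^ 'd \<Rightarrow> 'b::euclidean_space) \<Rightarrow> bool" where
  "locally_integrable \<Omega> f \<longleftrightarrow> (\<forall>K. compact K \<and> K \<subseteq> \<Omega> \<longrightarrow> set_integrable lebesgue K f)"

definition has_weak_partial ::
  "(real ^ 'd) set \<Rightarrow> 'd \<Rightarrow> (real ^ 'd \<Rightarrow> 'b::euclidean_space) \<Rightarrow> (real ^ 'd \<Rightarrow> 'b) \<Rightarrow> bool" where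
  "has_weak_partial \<Omega> j f g \<longleftrightarrow> locally_integrable \<Omega> f \<and> locally_integrable \<Omega> g \<and>
     (\<forall>\<phi>::real ^ 'd \<Rightarrow> real. \<phi> \<in> test_functions \<Omega> \<longrightarrow>
       (LINT x|lebesgue_on \<Omega>. frechet_derivative \<phi> (at x) (axis j 1) *\<^sub>R f x) =
         - (LINT x|lebesgue_on \<Omega>. \<phi> x *\<^sub>R g x))"

text \<open>A representative of the weak derivative; it is determined up to a null set where it exists.\<close>

definition weak_partial ::
  "(real ^ 'd) set \<Rightarrow> 'd \<Rightarrow> (real ^ 'd \<Rightarrow> 'b::euclidean_space) \<Rightarrow> real ^ 'd \<Rightarrow> 'b" where
  "weak_partial \<Omega> j f = (SOME g. has_weak_partial \<Omega> j f g)"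

definition L2_space :: "(real ^ 'd) set \<Rightarrow> (real ^ 'd \<Rightarrow> 'b::euclidean_space) set" where
  "L2_space \<Omega> = {f \<in> borel_measurable (lebesgue_on \<Omega>). integrable (lebesgue_on \<Omega>) (\<lambda>x. (norm (f x))\<^sup>2)}"

definition L2_inner :: "(real ^ 'd) set \<Rightarrow> (real ^ 'd \<Rightarrow> 'b::euclidean_space) \<Rightarrow> (real ^ 'd \<Rightarrow> 'b) \<Rightarrow> real" where
  "L2_inner \<Omega> f g = (LINT x|lebesgue_on \<Omega>. f x \<bullet> g x)"

primrec H_space :: "nat \<Rightarrow> (real ^ 'd) set \<Rightarrow> (real ^ 'd \<Rightarrow> 'b::euclidean_space) set" where
  "H_space 0 \<Omega> = L2_space \<Omega>"
| "H_space (Suc r) \<Omega> = {f \<in> L2_space \<Omega>. \<forall>j. \<exists>g\<in>H_space r \<Omega>. has_weak_partial \<Omega> j f g}"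

text \<open>
  For \<open>r = 2\<close> the square of the norm is the sum of the squared \<open>L\<^sup>2\<close> norms of the function, its gradient
  and its full Hessian matrix (a mixed second derivative occurs twice).
\<close>

primrec H_norm_sq :: "nat \<Rightarrow> (real ^ 'd) set \<Rightarrow> (real ^ 'd \<Rightarrow> 'b::euclidean_space) \<Rightarrow> real" where
  "H_norm_sq 0 \<Omega> f = (LINT x|lebesgue_on \<Omega>. (norm (f x))\<^sup>2)"
| "H_norm_sq (Suc r) \<Omega> f =
     (LINT x|lebesgue_on \<Omega>. (norm (f x))\<^sup>2) + (\<Sum>j\<in>UNIV. H_norm_sq r \<Omega> (weak_partial \<Omega> j f))"

definition H_norm :: "nat \<Rightarrow> (real ^ 'd) set \<Rightarrow> (real ^ 'd \<Rightarrow> 'b::euclidean_space) \<Rightarrow> real" where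
  "H_norm r \<Omega> f = sqrt (H_norm_sq r \<Omega> f)"

definition H10_space :: "(real ^ 'd) set \<Rightarrow> (real ^ 'd \<Rightarrow> 'b::euclidean_space) set" where
  "H10_space \<Omega> = {f \<in> H_space 1 \<Omega>.
     \<forall>e>0. \<exists>\<phi>\<in>test_functions \<Omega>. H_norm 1 \<Omega> (\<lambda>x. f x - \<phi> x) < e}"


section \<open>Curves in Sobolev spaces\<close>

text \<open>
  Bochner spaces \<open>L\<^sup>p([0,T]; X)\<close> for a subspace \<open>X\<close> of \<open>H\<^sup>r(\<Omega>)\<close> with the norm of \<open>H\<^sup>r(\<Omega>)\<close>: strong
  measurability is approximability almost everywhere by \<open>X\<close>-valued simple functions.
\<close>

definition strongly_measurable_curve ::
  "nat \<Rightarrow> (real ^ 'd) set \<Rightarrow> 'd vfield set \<Rightarrow> real \<Rightarrow> (real \<Rightarrow> 'd vfield) \<Rightarrow> bool" where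
  "strongly_measurable_curve r \<Omega> X T f \<longleftrightarrow>
     (AE t in lebesgue_on {0..T}. f t \<in> X) \<and>
     (\<exists>s. (\<forall>k. simple_function (lebesgue_on {0..T}) (s k) \<and> s k ` {0..T} \<subseteq> X) \<and>
        (AE t in lebesgue_on {0..T}. (\<lambda>k::nat. H_norm r \<Omega> (\<lambda>x. s k t x - f t x)) \<longlonglongrightarrow> 0))"

definition L1_curve ::
  "nat \<Rightarrow> (real ^ 'd) set \<Rightarrow> 'd vfield set \<Rightarrow> real \<Rightarrow> (real \<Rightarrow> 'd vfield) \<Rightarrow> bool" where
  "L1_curve r \<Omega> X T f \<longleftrightarrow> strongly_measurable_curve r \<Omega> X T f \<and>
     integrable (lebesgue_on {0..T}) (\<lambda>t. H_norm r \<Omega> (f t))"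

definition Linf_curve ::
  "nat \<Rightarrow> (real ^ 'd) set \<Rightarrow> 'd vfield set \<Rightarrow> real \<Rightarrow> (real \<Rightarrow> 'd vfield) \<Rightarrow> bool" where
  "Linf_curve r \<Omega> X T f \<longleftrightarrow> strongly_measurable_curve r \<Omega> X T f \<and>
     (\<exists>M. AE t in lebesgue_on {0..T}. H_norm r \<Omega> (f t) \<le> M)"

definition Linf_curve_norm :: "nat \<Rightarrow> (real ^ 'd) set \<Rightarrow> real \<Rightarrow> (real \<Rightarrow> 'd vfield) \<Rightarrow> real" where
  "Linf_curve_norm r \<Omega> T f = enn2real (esssup (lebesgue_on {0..T}) (\<lambda>t. ennreal (H_norm r \<Omega> (f t))))"

definition continuous_L2_curve :: "(real ^ 'd) set \<Rightarrow> real \<Rightarrow> (real \<Rightarrow> 'd vfield) \<Rightarrow> bool" where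
  "continuous_L2_curve \<Omega> T f \<longleftrightarrow> (\<forall>t\<in>{0..T}. f t \<in> L2_space \<Omega> \<and>
     ((\<lambda>s. H_norm 0 \<Omega> (\<lambda>x. f s x - f t x)) \<longlongrightarrow> 0) (at t within {0..T}))"

text \<open>\<open>f\<close> belongs to \<open>C\<^sup>1([0,T]; L\<^sup>2(\<Omega>))\<close> with derivative \<open>f'\<close> (one-sided at the end points).\<close>

definition C1_L2_curve ::
  "(real ^ 'd) set \<Rightarrow> real \<Rightarrow> (real \<Rightarrow> 'd vfield) \<Rightarrow> (real \<Rightarrow> 'd vfield) \<Rightarrow> bool" where
  "C1_L2_curve \<Omega> T f f' \<longleftrightarrow> continuous_L2_curve \<Omega> T f \<and> continuous_L2_curve \<Omega> T f' \<and>
     (\<forall>t\<in>{0..T}. ((\<lambda>s. H_norm 0 \<Omega> (\<lambda>x. (1 / (s - t)) *\<^sub>R (f s x - f t x) - f' t x)) \<longlongrightarrow> 0)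
        (at t within {0..T}))"

text \<open>The Bochner integral over \<open>[0,T]\<close> of an \<open>L\<^sup>2(\<Omega>)\<close>-valued curve.\<close>

definition has_L2_integral ::
  "(real ^ 'd) set \<Rightarrow> real \<Rightarrow> (real \<Rightarrow> 'd vfield) \<Rightarrow> 'd vfield \<Rightarrow> bool" where
  "has_L2_integral \<Omega> T f I \<longleftrightarrow> I \<in> L2_space \<Omega> \<and>
     (\<exists>s. (\<forall>k. simple_function (lebesgue_on {0..T}) (s k) \<and> s k ` {0..T} \<subseteq> L2_space \<Omega> \<and>
             integrable (lebesgue_on {0..T}) (\<lambda>t. H_norm 0 \<Omega> (\<lambda>x. f t x - s k t x))) \<and>
        (\<lambda>k::nat. LINT t|lebesgue_on {0..T}. H_norm 0 \<Omega> (\<lambda>x. f t x - s k t x)) \<longlonglongrightarrow> 0 \<and>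
        (\<lambda>k. H_norm 0 \<Omega> (\<lambda>x. (\<Sum>y\<in>s k ` {0..T}.
              measure (lebesgue_on {0..T}) (s k -` {y} \<inter> {0..T}) *\<^sub>R y x) - I x)) \<longlonglongrightarrow> 0)"

text \<open>\<open>g\<close> is the distributional time derivative of \<open>f\<close> on \<open>(0,T)\<close>.\<close>

definition has_weak_time_derivative ::
  "(real ^ 'd) set \<Rightarrow> real \<Rightarrow> (real \<Rightarrow> 'd vfield) \<Rightarrow> (real \<Rightarrow> 'd vfield) \<Rightarrow> bool" where
  "has_weak_time_derivative \<Omega> T f g \<longleftrightarrow>
     (\<forall>\<phi>::real \<Rightarrow> real. \<phi> \<in> test_functions {0<..<T} \<longrightarrow>
       (\<exists>I. has_L2_integral \<Omega> T (\<lambda>t x. deriv \<phi> t *\<^sub>R f t x) I \<and>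
            has_L2_integral \<Omega> T (\<lambda>t x. \<phi> t *\<^sub>R g t x) (\<lambda>x. - I x)))"


section \<open>The viscoelastic model\<close>

definition tensor_app :: "('d::finite) tensor4 \<Rightarrow> 'd tensor2 \<Rightarrow> 'd tensor2" where
  "tensor_app M \<xi> = (\<chi> i j. \<Sum>k\<in>UNIV. \<Sum>l\<in>UNIV. M $ i $ j $ k $ l * \<xi> $ k $ l)"

definition symmetric_tensor :: "('d::finite) tensor4 \<Rightarrow> bool" where
  "symmetric_tensor M \<longleftrightarrow> (\<forall>i j k l. M $ i $ j $ k $ l = M $ j $ i $ k $ l \<and>
     M $ i $ j $ k $ l = M $ i $ j $ l $ k \<and> M $ i $ j $ k $ l = M $ k $ l $ i $ j)"

definition elastic_tensor ::
  "(real ^ 'd) set \<Rightarrow> real \<Rightarrow> real \<Rightarrow> (real ^ 'd \<Rightarrow> 'd tensor4) \<Rightarrow> bool" where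
  "elastic_tensor \<Omega> M0 M1 M \<longleftrightarrow> M \<in> borel_measurable (lebesgue_on \<Omega>) \<and>
     (AE x in lebesgue_on \<Omega>. symmetric_tensor (M x)) \<and>
     (AE x in lebesgue_on \<Omega>. \<forall>\<xi>. transpose \<xi> = \<xi> \<and> \<xi> \<noteq> 0 \<longrightarrow>
        0 < M0 * (\<xi> \<bullet> \<xi>) \<and> M0 * (\<xi> \<bullet> \<xi>) \<le> tensor_app (M x) \<xi> \<bullet> \<xi> \<and>
        tensor_app (M x) \<xi> \<bullet> \<xi> \<le> M1 * (\<xi> \<bullet> \<xi>))"

definition weak_gradient :: "(real ^ 'd) set \<Rightarrow> 'd vfield \<Rightarrow> real ^ 'd \<Rightarrow> 'd tensor2" where
  "weak_gradient \<Omega> u x = (\<chi> i j. weak_partial \<Omega> j u x $ i)"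

definition strain :: "(real ^ 'd) set \<Rightarrow> 'd vfield \<Rightarrow> real ^ 'd \<Rightarrow> 'd tensor2" where
  "strain \<Omega> u x = (1 / 2) *\<^sub>R (weak_gradient \<Omega> u x + transpose (weak_gradient \<Omega> u x))"

definition elastic_form ::
  "(real ^ 'd) set \<Rightarrow> (real ^ 'd \<Rightarrow> 'd tensor4) \<Rightarrow> 'd vfield \<Rightarrow> 'd vfield \<Rightarrow> real" where
  "elastic_form \<Omega> M u w = (LINT x|lebesgue_on \<Omega>. tensor_app (M x) (strain \<Omega> u x) \<bullet> strain \<Omega> w x)"

text \<open>The row-wise divergence in the sense of distributions.\<close>

definition has_weak_divergence ::
  "(real ^ 'd) set \<Rightarrow> (real ^ 'd \<Rightarrow> 'd tensor2) \<Rightarrow> 'd vfield \<Rightarrow> bool" where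
  "has_weak_divergence \<Omega> S g \<longleftrightarrow>
     (\<forall>\<phi>::'d vfield. \<phi> \<in> test_functions \<Omega> \<longrightarrow>
       (LINT x|lebesgue_on \<Omega>. S x \<bullet> matrix (frechet_derivative \<phi> (at x))) =
         - (LINT x|lebesgue_on \<Omega>. g x \<bullet> \<phi> x))"

definition weak_divergence :: "(real ^ 'd) set \<Rightarrow> (real ^ 'd \<Rightarrow> 'd tensor2) \<Rightarrow> 'd vfield" where
  "weak_divergence \<Omega> S = (SOME g. g \<in> L2_space \<Omega> \<and> has_weak_divergence \<Omega> S g)"

definition elastic_op ::
  "(real ^ 'd) set \<Rightarrow> (real ^ 'd \<Rightarrow> 'd tensor4) \<Rightarrow> 'd vfield \<Rightarrow> 'd vfield" where
  "elastic_op \<Omega> M u = (\<lambda>x. - weak_divergence \<Omega> (\<lambda>y. tensor_app (M y) (strain \<Omega> u y)) x)"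

text \<open>
  Boundedness from \<open>H\<^sup>2(\<Omega>) \<inter> H\<^sup>1\<^sub>0(\<Omega>)\<close> to \<open>L\<^sup>2(\<Omega>)\<close>; the first conjunct says that \<^const>\<open>elastic_op\<close>
  is indeed given by a divergence in \<open>L\<^sup>2(\<Omega>)\<close>.
\<close>

definition bounded_elastic_op :: "(real ^ 'd) set \<Rightarrow> (real ^ 'd \<Rightarrow> 'd tensor4) \<Rightarrow> bool" where
  "bounded_elastic_op \<Omega> M \<longleftrightarrow> (\<exists>C. \<forall>u \<in> H_space 2 \<Omega> \<inter> H10_space \<Omega>.
     (\<exists>g\<in>L2_space \<Omega>. has_weak_divergence \<Omega> (\<lambda>y. tensor_app (M y) (strain \<Omega> u y)) g) \<and>
     H_norm 0 \<Omega> (elastic_op \<Omega> M u) \<le> C * H_norm 2 \<Omega> u)"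

definition elliptic_regularity :: "(real ^ 'd) set \<Rightarrow> (real ^ 'd \<Rightarrow> 'd tensor4) \<Rightarrow> bool" where
  "elliptic_regularity \<Omega> M \<longleftrightarrow>
     (\<forall>f\<in>L2_space \<Omega>. \<exists>u \<in> H_space 2 \<Omega> \<inter> H10_space \<Omega>.
        (AE x in lebesgue_on \<Omega>. elastic_op \<Omega> M u x = f x) \<and>
        (\<forall>u' \<in> H_space 2 \<Omega> \<inter> H10_space \<Omega>.
           (AE x in lebesgue_on \<Omega>. elastic_op \<Omega> M u' x = f x) \<longrightarrow>
           (AE x in lebesgue_on \<Omega>. u' x = u x))) \<and>
     (\<exists>C. \<forall>u \<in> H_space 2 \<Omega> \<inter> H10_space \<Omega>. H_norm 2 \<Omega> u \<le> C * H_norm 0 \<Omega> (elastic_op \<Omega> M u))"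

definition mittag_leffler :: "real \<Rightarrow> real \<Rightarrow> real" where
  "mittag_leffler \<alpha> z = (\<Sum>j. z ^ j / Gamma (real j * \<alpha> + 1))"

definition relax_kernel :: "real \<Rightarrow> real \<Rightarrow> real \<Rightarrow> real" where
  "relax_kernel \<alpha> \<tau>\<sigma> t = mittag_leffler \<alpha> (- ((t / \<tau>\<sigma>) powr \<alpha>))"

definition tensor_A :: "real \<Rightarrow> (real ^ 'd \<Rightarrow> 'd tensor4) \<Rightarrow> real ^ 'd \<Rightarrow> 'd tensor4" where
  "tensor_A \<rho> CC x = (1 / \<rho>) *\<^sub>R CC x"

definition tensor_B :: "real \<Rightarrow> real \<Rightarrow> real \<Rightarrow> real \<Rightarrow> (real ^ 'd \<Rightarrow> 'd tensor4) \<Rightarrow>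
    (real ^ 'd \<Rightarrow> 'd tensor4) \<Rightarrow> real ^ 'd \<Rightarrow> 'd tensor4" where
  "tensor_B \<alpha> \<rho> \<tau>\<sigma> \<tau>\<epsilon> CC DD x = (1 / \<rho>) *\<^sub>R (CC x - ((\<tau>\<epsilon> / \<tau>\<sigma>) powr \<alpha>) *\<^sub>R DD x)"

text \<open>
  The weak problem for \<open>v\<close> with kernel \<open>\<beta>\<close>. The weak time derivative \<open>vt\<close> is explicit. For \<open>v(0)\<close> and
  \<open>v(t)\<close> to make sense, \<open>v\<close> is the representative that is continuous into \<open>L\<^sup>2(\<Omega>)\<close>.
\<close>

definition weak_solution :: "(real ^ 'd) set \<Rightarrow> real \<Rightarrow> (real \<Rightarrow> real) \<Rightarrow>
    (real ^ 'd \<Rightarrow> 'd tensor4) \<Rightarrow> (real ^ 'd \<Rightarrow> 'd tensor4) \<Rightarrow> (real \<Rightarrow> 'd vfield) \<Rightarrow> 'd vfield \<Rightarrow>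
    (real \<Rightarrow> 'd vfield) \<Rightarrow> (real \<Rightarrow> 'd vfield) \<Rightarrow> bool" where
  "weak_solution \<Omega> T \<beta> AA BB F v0 v vt \<longleftrightarrow>
     continuous_L2_curve \<Omega> T v \<and> has_weak_time_derivative \<Omega> T v vt \<and>
     (AE x in lebesgue_on \<Omega>. v 0 x = v0 x) \<and>
     (\<forall>t\<in>{0<..T}. v t \<in> H10_space \<Omega> \<and> vt t \<in> L2_space \<Omega> \<and>
        (\<forall>w\<in>H10_space \<Omega>.
           L2_inner \<Omega> (vt t) w + elastic_form \<Omega> AA (v t) w
             - (LINT s|lebesgue_on {0..t}. \<beta> (t - s) * elastic_form \<Omega> BB (v s) w)
           = L2_inner \<Omega> (F t) w))"


section \<open>Finite elements\<close>

definition shape_regular_partition :: "(real ^ 'd) set \<Rightarrow> real \<Rightarrow> (real ^ 'd) set set \<Rightarrow> bool" where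
  "shape_regular_partition \<Omega> \<kappa> \<T> \<longleftrightarrow> finite \<T> \<and> \<Union>\<T> = closure \<Omega> \<and>
     pairwise (\<lambda>K L. interior K \<inter> interior L = {}) \<T> \<and>
     (\<forall>K\<in>\<T>. \<exists>x r. 0 < r \<and> cball x r \<subseteq> K \<and> diameter K \<le> \<kappa> * r)"

text \<open>Rectangles and cuboids may be rotated with respect to the coordinate axes.\<close>

definition box_cell :: "(real ^ 'd) set \<Rightarrow> bool" where
  "box_cell K \<longleftrightarrow> (\<exists>(R::'d vfield) a b. orthogonal_transformation R \<and> box a b \<noteq> {} \<and> K = R ` cbox a b)"

definition linear_on_cell :: "(real ^ 'd) set \<Rightarrow> 'd vfield \<Rightarrow> bool" where
  "linear_on_cell K w \<longleftrightarrow> (\<exists>c M. \<forall>x\<in>K. w x = c + M *v x)"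

text \<open>Affine in each of the variables along the edges of the cell: bilinear or trilinear.\<close>

definition multilinear_on_cell :: "(real ^ 'd) set \<Rightarrow> 'd vfield \<Rightarrow> bool" where
  "multilinear_on_cell K w \<longleftrightarrow> (\<exists>(R::'d vfield) a b c. orthogonal_transformation R \<and> box a b \<noteq> {} \<and> K = R ` cbox a b \<and>
     (\<forall>y\<in>cbox a b. w (R y) = (\<Sum>S\<in>UNIV. (\<Prod>i\<in>S. y $ i) *\<^sub>R c S)))"

definition fe_space :: "(real ^ 'd) set \<Rightarrow> (real ^ 'd) set set \<Rightarrow> 'd vfield set \<Rightarrow> bool" where
  "fe_space \<Omega> \<T> V \<longleftrightarrow>
     (\<forall>K\<in>\<T>. int CARD('d) simplex K) \<and>
       V = {w \<in> H10_space \<Omega>. continuous_on (closure \<Omega>) w \<and> (\<forall>K\<in>\<T>. linear_on_cell K w)} \<or>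
     (\<forall>K\<in>\<T>. box_cell K) \<and>
       V = {w \<in> H10_space \<Omega>. continuous_on (closure \<Omega>) w \<and> (\<forall>K\<in>\<T>. multilinear_on_cell K w)}"

definition fe_discretization :: "(real ^ 'd) set \<Rightarrow> real \<Rightarrow> real \<Rightarrow> real \<Rightarrow>
    (real ^ 'd) set set \<Rightarrow> real \<Rightarrow> 'd vfield set \<Rightarrow> bool" where
  "fe_discretization \<Omega> \<kappa> Capp Cinv \<T> h V \<longleftrightarrow>
     shape_regular_partition \<Omega> \<kappa> \<T> \<and> h = Max (diameter ` \<T>) \<and> fe_space \<Omega> \<T> V \<and>
     (\<forall>w \<in> H_space 2 \<Omega> \<inter> H10_space \<Omega>.
        (INF z\<in>V. H_norm 0 \<Omega> (\<lambda>x. w x - z x) + h * H_norm 1 \<Omega> (\<lambda>x. w x - z x))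
          \<le> Capp * h\<^sup>2 * H_norm 2 \<Omega> w) \<and>
     (\<forall>w\<in>V. H_norm 1 \<Omega> w \<le> Cinv * inverse h * H_norm 0 \<Omega> w)"

text \<open>\<open>P\<close> is a Ritz-Volterra projection of the curve \<open>w\<close> on \<open>[0,\<tau>]\<close>.\<close>

definition ritz_volterra :: "(real ^ 'd) set \<Rightarrow> (real \<Rightarrow> real) \<Rightarrow> (real ^ 'd \<Rightarrow> 'd tensor4) \<Rightarrow>
    (real ^ 'd \<Rightarrow> 'd tensor4) \<Rightarrow> 'd vfield set \<Rightarrow> real \<Rightarrow> (real \<Rightarrow> 'd vfield) \<Rightarrow> (real \<Rightarrow> 'd vfield) \<Rightarrow> bool" where
  "ritz_volterra \<Omega> \<beta> AA BB V \<tau> w P \<longleftrightarrow> (\<forall>t\<in>{0..\<tau>}. P t \<in> V \<and>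
     (\<forall>z\<in>V. elastic_form \<Omega> AA (\<lambda>x. P t x - w t x) z =
        (LINT s|lebesgue_on {0..t}. \<beta> (t - s) * elastic_form \<Omega> BB (\<lambda>x. P s x - w s x) z)))"


section \<open>Sum-of-exponentials approximation\<close>

text \<open>
  The \<open>J\<close>-point Gaussian rule on \<open>[-1,1]\<close>: the unique rule with \<open>J\<close> nodes (listed in increasing order)
  that is exact for polynomials of degree at most \<open>2 J - 1\<close>.
\<close>

definition gauss_quadrature :: "nat \<Rightarrow> (nat \<Rightarrow> real) \<Rightarrow> (nat \<Rightarrow> real) \<Rightarrow> bool" where
  "gauss_quadrature J \<omega> \<xi> \<longleftrightarrow> strict_mono_on {1..J} \<xi> \<and> \<xi> ` {1..J} \<subseteq> {-1..1} \<and>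
     (\<forall>p::real poly. degree p \<le> 2 * J - 1 \<longrightarrow>
        (\<Sum>j=1..J. \<omega> j * poly p (\<xi> j)) = integral {-1..1} (poly p))"

definition soe_c :: "real \<Rightarrow> nat \<Rightarrow> real" where
  "soe_c q k = (if k = 0 then 1 / 2 else (q + 1) * q ^ (k - 1) / 2)"

definition soe_r :: "real \<Rightarrow> nat \<Rightarrow> real" where
  "soe_r q k = (if k = 0 then 1 / 2 else (q - 1) * q ^ (k - 1) / 2)"

definition soe_a :: "real \<Rightarrow> real \<Rightarrow> (nat \<Rightarrow> real) \<Rightarrow> nat \<Rightarrow> nat \<Rightarrow> real" where
  "soe_a \<alpha> q \<xi> k j = (soe_r q k * \<xi> j + soe_c q k) powr (- 1 / \<alpha>)"

definition soe_b :: "real \<Rightarrow> real \<Rightarrow> (nat \<Rightarrow> real) \<Rightarrow> (nat \<Rightarrow> real) \<Rightarrow> nat \<Rightarrow> nat \<Rightarrow> real" where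
  "soe_b \<alpha> q \<omega> \<xi> k j = sin (\<alpha> * pi) / (\<alpha> * pi) * (\<omega> j * soe_r q k /
     ((soe_r q k * \<xi> j + soe_c q k)\<^sup>2 + 2 * (soe_r q k * \<xi> j + soe_c q k) * cos (\<alpha> * pi) + 1))"

definition soe_pairs :: "real \<Rightarrow> real \<Rightarrow> nat \<Rightarrow> nat \<Rightarrow> (nat \<Rightarrow> real) \<Rightarrow> (nat \<Rightarrow> real) \<Rightarrow> bool" where
  "soe_pairs \<alpha> q K J a b \<longleftrightarrow> (\<exists>\<omega> \<xi> e. gauss_quadrature J \<omega> \<xi> \<and>
     bij_betw e {1..(K + 1) * J} ({0..K} \<times> {1..J}) \<and>
     (\<forall>i\<in>{1..(K + 1) * J}. a i = soe_a \<alpha> q \<xi> (fst (e i)) (snd (e i)) \<and>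
        b i = soe_b \<alpha> q \<omega> \<xi> (fst (e i)) (snd (e i))))"


section \<open>The fully discrete scheme\<close>

text \<open>\<open>soe_history \<tau>\<sigma> \<Delta>t a b U j n\<close> is the history variable \<open>H\<^sub>j(U\<^sup>n)\<close> of the sequence \<open>U\<close>.\<close>

primrec soe_history :: "real \<Rightarrow> real \<Rightarrow> (nat \<Rightarrow> real) \<Rightarrow> (nat \<Rightarrow> real) \<Rightarrow> (nat \<Rightarrow> ('d::finite) vfield) \<Rightarrow>
    nat \<Rightarrow> nat \<Rightarrow> 'd vfield" where
  "soe_history \<tau>\<sigma> \<Delta>t a b U j 0 = (\<lambda>x. 0)"
| "soe_history \<tau>\<sigma> \<Delta>t a b U j (Suc n) = (\<lambda>x.
     exp (- (a j / \<tau>\<sigma>) * \<Delta>t) *\<^sub>R soe_history \<tau>\<sigma> \<Delta>t a b U j n x +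
     (b j * \<tau>\<sigma> / a j * (1 - exp (- (a j / \<tau>\<sigma>) * \<Delta>t))) *\<^sub>R U n x)"

text \<open>
  The initial value is the Ritz-Volterra projection at time \<open>0\<close>, that is, on the degenerate
  interval \<open>[0,0]\<close>.
\<close>

definition fully_discrete_solution :: "(real ^ 'd) set \<Rightarrow> (real \<Rightarrow> real) \<Rightarrow> real \<Rightarrow>
    (real ^ 'd \<Rightarrow> 'd tensor4) \<Rightarrow> (real ^ 'd \<Rightarrow> 'd tensor4) \<Rightarrow> 'd vfield set \<Rightarrow> nat \<Rightarrow> real \<Rightarrow>
    nat \<Rightarrow> (nat \<Rightarrow> real) \<Rightarrow> (nat \<Rightarrow> real) \<Rightarrow> (real \<Rightarrow> 'd vfield) \<Rightarrow> 'd vfield \<Rightarrow> (nat \<Rightarrow> 'd vfield) \<Rightarrow> bool" where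
  "fully_discrete_solution \<Omega> \<beta> \<tau>\<sigma> AA BB V N \<Delta>t Nexp a b F v0 vh \<longleftrightarrow>
     ritz_volterra \<Omega> \<beta> AA BB V 0 (\<lambda>_. v0) (\<lambda>_. vh 0) \<and>
     (\<forall>n\<in>{1..N}. vh n \<in> V \<and>
        (\<forall>w\<in>V.
           L2_inner \<Omega> (\<lambda>x. (1 / \<Delta>t) *\<^sub>R (vh n x - vh (n - 1) x)) w + elastic_form \<Omega> AA (vh n) w
             - (\<Sum>j=1..Nexp. elastic_form \<Omega> BB (soe_history \<tau>\<sigma> \<Delta>t a b vh j n) w)
           = L2_inner \<Omega> (F (real n * \<Delta>t)) w))"

end

theory Submission
  imports Defs "HOL-Library.Function_Algebras"
begin

text \<open>
  The scheme is compared with a discrete Ritz-Volterra projection that is defined on the time grid with the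
  exact integrals of the exponential sum as weights. Because the increments of such a projection solve the same
  discrete Volterra equation, its error is of second order by duality, uniformly in the grid and in the
  exponential sum, and only first time derivatives of \<open>v\<close> enter. The remaining part of the error lies in \<open>V\<close>
  and is driven by the consistency error of the scheme; an energy argument bounds it, where the memory term is
  absorbed by the elastic energy and a discrete Gronwall inequality.
  The derivatives of \<open>v\<close> are accessible at the grid points because
  the weak equation makes the pairings of \<open>vt\<close> with functions in \<open>H10_space\<close> continuous on \<open>(0, T]\<close>.
\<close>

text \<open>The constant may not depend on the exponential sum, whose length, rates and coefficients
  vary with q, K and J. So no single exponential is ever estimated: the history variables unroll
  into one discrete convolution whose weights are cell integrals of the whole sum, and the sum
  enters only through a bound \<open>G\<close> on [0,T], got from a bound of the kernel plus the
  accuracy. Projecting increments makes the H^2 norms of increments of \<open>v\<close> add up to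
  the integral of \<open>vt\<close>, so that no time derivative of a projection error has to be
  estimated. The other obstacle is that elements are functions on the whole space, of which only the
  class modulo null sets in \<Omega> matters: norms are seminorms, weak derivatives and divergences
  are selected by choice, and \<open>V\<close> is not finite-dimensional as a set of functions.
  Hence functions carry pointwise vector operations, forms are semidefinite on subspaces, linearity
  of weak derivatives rests on the fundamental lemma, and functionals on \<open>V\<close> are
  represented through finitely many representatives. Integrals of curves are handled by pairing with
  fixed functions.\<close>

instantiation "fun" :: (type, real_vector) real_vector
begin
definition scaleR_fun_def: "r *\<^sub>R f = (\<lambda>x. r *\<^sub>R f x)"
instance
  by standard (auto simp: scaleR_fun_def plus_fun_def scaleR_add_right scaleR_add_left)
end

lemma scaleR_fun_apply [simp]: "(r *\<^sub>R f) x = r *\<^sub>R f x"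
  by (simp add: scaleR_fun_def)

section \<open>Bilinear forms on subspaces\<close>

definition seminrm :: "('v \<Rightarrow> 'v \<Rightarrow> real) \<Rightarrow> 'v \<Rightarrow> real" where
  "seminrm B x = sqrt (B x x)"

text \<open>Bilinearity is asked on \<open>S\<close> only: the Bochner integral of a non-integrable
  function is 0 by default, so integral forms are not additive on arbitrary functions.\<close>

locale bilinear_on =
  fixes S :: "'v::real_vector set" and B :: "'v \<Rightarrow> 'v \<Rightarrow> real"
  assumes sub: "subspace S"
    and add_left: "x \<in> S \<Longrightarrow> y \<in> S \<Longrightarrow> z \<in> S \<Longrightarrow> B (x + y) z = B x z + B y z"
    and scale_left: "x \<in> S \<Longrightarrow> z \<in> S \<Longrightarrow> B (c *\<^sub>R x) z = c * B x z"
    and add_right: "x \<in> S \<Longrightarrow> y \<in> S \<Longrightarrow> z \<in> S \<Longrightarrow> B z (x + y) = B z x + B z y"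
    and scale_right: "x \<in> S \<Longrightarrow> z \<in> S \<Longrightarrow> B z (c *\<^sub>R x) = c * B z x"
begin

lemma diff_left: "x \<in> S \<Longrightarrow> y \<in> S \<Longrightarrow> z \<in> S \<Longrightarrow> B (x - y) z = B x z - B y z"
  using add_left[of x "- 1 *\<^sub>R y" z] scale_left[of y z "-1"] subspace_scale[OF sub, of y "-1"] by simp

lemma diff_right: "x \<in> S \<Longrightarrow> y \<in> S \<Longrightarrow> z \<in> S \<Longrightarrow> B z (x - y) = B z x - B z y"
  using add_right[of x "- 1 *\<^sub>R y" z] scale_right[of y z "-1"] subspace_scale[OF sub, of y "-1"] by simp

lemma zero_left: "z \<in> S \<Longrightarrow> B 0 z = 0"
  using scale_left[of 0 z 0] subspace_0[OF sub] by simp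

lemma sum_left: "(\<And>i. i \<in> I \<Longrightarrow> f i \<in> S) \<Longrightarrow> z \<in> S \<Longrightarrow> B (\<Sum>i\<in>I. f i) z = (\<Sum>i\<in>I. B (f i) z)"
proof (induction I rule: infinite_finite_induct)
  case (insert i I)
  then show ?case using subspace_sum[OF sub, of I f] by (simp add: add_left)
qed (simp_all add: zero_left)

end

locale semi_inner = bilinear_on +
  assumes commute: "x \<in> S \<Longrightarrow> y \<in> S \<Longrightarrow> B x y = B y x"
    and nonneg: "x \<in> S \<Longrightarrow> 0 \<le> B x x"
begin

lemma seminrm_nonneg: "x \<in> S \<Longrightarrow> 0 \<le> seminrm B x"
  by (simp add: seminrm_def nonneg)

lemma seminrm_sq: "x \<in> S \<Longrightarrow> (seminrm B x)\<^sup>2 = B x x"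
  by (simp add: seminrm_def nonneg)

lemma expand: "x \<in> S \<Longrightarrow> y \<in> S \<Longrightarrow> B (x + c *\<^sub>R y) (x + c *\<^sub>R y) = B x x + 2 * c * B x y + c\<^sup>2 * B y y"
  using subspace_scale[OF sub, of y c] subspace_add[OF sub]
  by (simp add: add_left add_right scale_left scale_right commute[of y x] power2_eq_square algebra_simps)

text \<open>The quadratic \<open>q\<close> in \<open>c\<close> is nonnegative. If
  \<open>B y y = 0\<close>, it is affine, and a nonzero slope would let it take the value -1;
  otherwise its value at the minimum \<open>c = - B x y / B y y\<close> gives the claim.\<close>

lemma Cauchy_Schwarz: assumes x: "x \<in> S" and y: "y \<in> S" shows "\<bar>B x y\<bar> \<le> seminrm B x * seminrm B y"
proof -
  have q: "0 \<le> B x x + 2 * c * B x y + c\<^sup>2 * B y y" for c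
    using nonneg[of "x + c *\<^sub>R y"] expand[OF x y, of c] x y subspace_scale[OF sub, of y c] subspace_add[OF sub] by auto
  have "(B x y)\<^sup>2 \<le> B x x * B y y"
  proof (cases "B y y = 0")
    case True
    have "B x y = 0"
    proof (rule ccontr)
      assume nz: "B x y \<noteq> 0"
      have "2 * (- (B x x + 1) / (2 * B x y)) * B x y = - (B x x + 1)" using nz by (simp add: field_simps)
      then show False using q[of "- (B x x + 1) / (2 * B x y)"] True by simp
    qed
    then show ?thesis by (simp add: True)
  next
    case False
    then have pos: "B y y > 0" using nonneg[OF y] by simp
    have "0 \<le> B y y * (B x x + 2 * (- B x y / B y y) * B x y + (- B x y / B y y)\<^sup>2 * B y y)"
      by (rule mult_nonneg_nonneg[OF less_imp_le[OF pos] q])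
    also have "\<dots> = B x x * B y y - (B x y)\<^sup>2" using pos by (simp add: field_simps power2_eq_square)
    finally show ?thesis by simp
  qed
  then have "sqrt ((B x y)\<^sup>2) \<le> sqrt (B x x * B y y)" by (rule real_sqrt_le_mono)
  then show ?thesis by (simp add: seminrm_def real_sqrt_mult)
qed

lemma triangle: assumes x: "x \<in> S" and y: "y \<in> S" shows "seminrm B (x + y) \<le> seminrm B x + seminrm B y"
proof (rule power2_le_imp_le)
  have "(seminrm B (x + y))\<^sup>2 = B x x + 2 * B x y + B y y"
    using expand[OF x y, of 1] seminrm_sq[OF subspace_add[OF sub x y]] by simp
  also have "\<dots> \<le> (seminrm B x)\<^sup>2 + 2 * (seminrm B x * seminrm B y) + (seminrm B y)\<^sup>2"
    using Cauchy_Schwarz[OF x y] by (simp add: seminrm_sq x y)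
  finally show "(seminrm B (x + y))\<^sup>2 \<le> (seminrm B x + seminrm B y)\<^sup>2"
    by (simp add: power2_eq_square algebra_simps)
qed (simp add: seminrm_nonneg x y)

lemma seminrm_scale: "x \<in> S \<Longrightarrow> seminrm B (c *\<^sub>R x) = \<bar>c\<bar> * seminrm B x"
  using subspace_scale[OF sub, of x c]
  by (simp add: seminrm_def scale_left scale_right real_sqrt_mult flip: mult.assoc power2_eq_square)

lemma seminrm_zero: "seminrm B 0 = 0"
  by (simp add: seminrm_def zero_left subspace_0[OF sub])

lemma triangle_diff: assumes x: "x \<in> S" and y: "y \<in> S" shows "seminrm B (x - y) \<le> seminrm B x + seminrm B y"
  using triangle[OF x subspace_scale[OF sub y, of "-1"]] seminrm_scale[OF y, of "-1"] by simp

lemma seminrm_sum: "(\<And>i. i \<in> I \<Longrightarrow> f i \<in> S) \<Longrightarrow> seminrm B (\<Sum>i\<in>I. f i) \<le> (\<Sum>i\<in>I. seminrm B (f i))"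
proof (induction I rule: infinite_finite_induct)
  case (insert i I)
  have "seminrm B (f i + (\<Sum>i\<in>I. f i)) \<le> seminrm B (f i) + seminrm B (\<Sum>i\<in>I. f i)"
    by (rule triangle) (use insert subspace_sum[OF sub, of I f] in auto)
  then show ?case using insert by fastforce
qed (simp_all add: seminrm_zero)

text \<open>Gram--Schmidt, allowing for degenerate directions: a functional that is bounded in the seminorm
  vanishes on those.\<close>

lemma riesz_span:
  assumes "finite Z" "Z \<subseteq> S"
    and "\<And>x y. x \<in> span Z \<Longrightarrow> y \<in> span Z \<Longrightarrow> l (x + y) = l x + l y"
    and "\<And>x c. x \<in> span Z \<Longrightarrow> l (c *\<^sub>R x) = c * l x"
    and "\<And>x. x \<in> span Z \<Longrightarrow> \<bar>l x\<bar> \<le> K * seminrm B x"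
  shows "\<exists>w\<in>span Z. \<forall>x\<in>span Z. B w x = l x"
  using assms
proof (induction Z arbitrary: l K rule: finite_induct)
  case empty
  have "l 0 = 0" using empty(3)[of 0 0] by simp
  then show ?case by (auto simp: zero_left subspace_0[OF sub])
next
  case (insert u Z)
  have sp: "span (insert u Z) \<subseteq> S" using insert.prems(1) sub by (intro span_minimal)
  have spZ: "span Z \<subseteq> span (insert u Z)" by (intro span_mono) auto
  have uS: "u \<in> S" using insert.prems(1) by auto
  have "\<exists>w\<in>span Z. \<forall>x\<in>span Z. B w x = l x"
  proof (rule insert.IH[of l K])
    show "l (x + y) = l x + l y" if "x \<in> span Z" "y \<in> span Z" for x y
      using insert.prems(2) that spZ by (simp add: subset_iff)
  qed (use insert.prems spZ in \<open>simp_all add: subset_iff\<close>)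
  then obtain w where w: "w \<in> span Z" "\<And>x. x \<in> span Z \<Longrightarrow> B w x = l x" by blast
  \<comment> \<open>The induction hypothesis, now for the functional \<open>B u\<close>, yields the
    orthogonal projection \<open>p\<close> of the new vector onto \<open>span Z\<close>.\<close>
  have "\<exists>p\<in>span Z. \<forall>x\<in>span Z. B p x = B u x"
  proof (rule insert.IH[of _ "seminrm B u"])
    have zS: "x \<in> S" if "x \<in> span Z" for x using that sp spZ by blast
    show "B u (x + y) = B u x + B u y" if "x \<in> span Z" "y \<in> span Z" for x y
      using zS[OF that(1)] zS[OF that(2)] uS by (rule add_right)
    show "B u (c *\<^sub>R x) = c * B u x" if "x \<in> span Z" for x c
      using zS[OF that] uS by (rule scale_right)
    show "\<bar>B u x\<bar> \<le> seminrm B u * seminrm B x" if "x \<in> span Z" for x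
      using uS zS[OF that] by (rule Cauchy_Schwarz)
  qed (use insert.prems(1) in auto)
  then obtain p where p: "p \<in> span Z" "\<And>x. x \<in> span Z \<Longrightarrow> B p x = B u x" by blast
  define c where "c = u - p"
  have c: "c \<in> span (insert u Z)" unfolding c_def using p(1) spZ by (auto intro: span_diff span_base)
  then have cS: "c \<in> S" using sp by auto
  have orth: "B c x = 0" if "x \<in> span Z" for x
    unfolding c_def using p that sp spZ uS by (subst diff_left) auto
  \<comment> \<open>If \<open>B c c = 0\<close>, the bound on \<open>l\<close> forces
    \<open>l c = 0\<close>, and then \<open>r * B c c = l c\<close> holds with the default value 0
    of the division.\<close>
  define r where "r = l c / B c c"
  have rc: "r * B c c = l c"
    using insert.prems(4)[OF c] by (cases "B c c = 0") (auto simp: r_def seminrm_def)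
  define W where "W = w + r *\<^sub>R c"
  have wS: "w \<in> S" using w(1) sp spZ by auto
  have rcS: "r *\<^sub>R c \<in> S" by (rule subspace_scale[OF sub cS])
  have "B W x = l x" if x: "x \<in> span (insert u Z)" for x
  proof -
    obtain k where k: "x - k *\<^sub>R u \<in> span Z" using x by (auto simp: span_breakdown_eq)
    define x0 where "x0 = x - k *\<^sub>R u + k *\<^sub>R p"
    have x0: "x0 \<in> span Z" unfolding x0_def by (intro span_add span_scale k p)
    have x0S: "x0 \<in> S" "x0 \<in> span (insert u Z)" using x0 sp spZ by auto
    have xe: "x = x0 + k *\<^sub>R c" by (simp add: x0_def c_def algebra_simps)
    have "B W x0 = l x0" unfolding W_def using wS rcS x0S x0 w(2) orth cS by (simp add: add_left scale_left)
    moreover have "B W c = l c"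
      unfolding W_def using wS rcS cS orth[OF w(1)] rc commute[OF wS cS] by (simp add: add_left scale_left)
    moreover have "W \<in> S" unfolding W_def using wS rcS sub by (intro subspace_add)
    ultimately show ?thesis unfolding xe using x0S cS c subspace_scale[OF sub cS, of k]
      by (simp add: add_right scale_right insert.prems(2)[OF x0S(2) span_scale[OF c]] insert.prems(3)[OF c])
  qed
  moreover have "W \<in> span (insert u Z)" unfolding W_def using w(1) spZ c by (auto intro: span_add span_scale)
  ultimately show ?case by blast
qed

end

section \<open>Discrete Gronwall inequalities\<close>

text \<open>Turns a Gronwall factor whose rate is proportional to the step size into a constant that
  does not depend on the number of steps.\<close>

lemma power_le_exp: fixes c :: real assumes "0 \<le> c" "real n * c \<le> K" shows "(1 + c) ^ n \<le> exp K"
proof -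
  have "(1 + c) ^ n \<le> exp c ^ n" using assms by (intro power_mono) (auto intro: exp_ge_add_one_self)
  also have "\<dots> = exp (real n * c)" by (simp add: exp_of_nat_mult)
  finally show ?thesis using assms(2) by (meson exp_le_cancel_iff order_trans)
qed

text \<open>The memory at level M + 1 is \<open>c\<close> times the previous partial sum, so the
  partial sums satisfy S(M+1) <= (1 + c) S(M) + p(M+1). Sums over time, not single terms, are what
  the error analysis of the increments needs.\<close>

lemma volterra_sum_bound:
  fixes e p :: "nat \<Rightarrow> real"
  assumes c: "0 \<le> c" and p: "\<And>n. n \<le> M \<Longrightarrow> 0 \<le> p n"
    and e: "\<And>n. n \<le> M \<Longrightarrow> e n \<le> p n + c * (\<Sum>k<n. e k)"
  shows "(\<Sum>n\<le>M. e n) \<le> (\<Sum>n\<le>M. p n) * (1 + c) ^ M"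
  using p e
proof (induction M)
  case (Suc M)
  have one: "1 \<le> (1 + c) ^ Suc M" using c by (simp add: one_le_power del: power_Suc)
  have "(\<Sum>n\<le>Suc M. e n) \<le> (1 + c) * (\<Sum>n\<le>M. e n) + p (Suc M)"
    using Suc.prems(2)[of "Suc M"] by (simp add: algebra_simps lessThan_Suc_atMost)
  also have "\<dots> \<le> (1 + c) * ((\<Sum>n\<le>M. p n) * (1 + c) ^ M) + p (Suc M) * (1 + c) ^ Suc M"
    using Suc c mult_left_mono[OF one, of "p (Suc M)"] by (intro add_mono mult_left_mono) auto
  also have "\<dots> = (\<Sum>n\<le>Suc M. p n) * (1 + c) ^ Suc M" by (simp add: algebra_simps)
  finally show ?case .
qed (use e in simp)

lemma gronwall_step:
  fixes s f :: "nat \<Rightarrow> real"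
  assumes c: "0 \<le> c" and s0: "s 0 \<le> 0" and f: "\<And>n. 0 \<le> f n"
    and step: "\<And>n. Suc n \<le> M \<Longrightarrow> s (Suc n) \<le> (1 + c) * s n + f (Suc n)"
  shows "n \<le> M \<Longrightarrow> s n \<le> (1 + c) ^ n * (\<Sum>k\<in>{1..n}. f k)"
proof (induction n)
  case (Suc n)
  have one: "1 \<le> (1 + c) ^ Suc n" using c by (simp add: one_le_power del: power_Suc)
  have "s (Suc n) \<le> (1 + c) * ((1 + c) ^ n * (\<Sum>k\<in>{1..n}. f k)) + (1 + c) ^ Suc n * f (Suc n)"
    using Suc c mult_right_mono[OF one f[of "Suc n"]]
    by (intro order_trans[OF step[OF Suc.prems]] add_mono mult_left_mono) auto
  then show ?case by (simp add: algebra_simps)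
qed (use s0 in simp)

section \<open>Abstract error analysis of the scheme\<close>

text \<open>Partial summation commutes with a discrete convolution. This carries the Volterra
  equation from the increments over to their sums.\<close>

lemma convolution_sum:
  fixes g \<beta> :: "nat \<Rightarrow> real"
  shows "(\<Sum>i\<le>n. \<Sum>k<i. g (i - k) * \<beta> k) = (\<Sum>k<n. g (n - k) * (\<Sum>i\<le>k. \<beta> i))"
proof (induction n)
  case (Suc n)
  have "(\<Sum>k<Suc n. g (Suc n - k) * (\<Sum>i\<le>k. \<beta> i)) =
      g (Suc n) * \<beta> 0 + (\<Sum>k<n. g (n - k) * (\<Sum>i\<le>k. \<beta> i)) + (\<Sum>k<n. g (n - k) * \<beta> (Suc k))"
    by (subst sum.lessThan_Suc_shift) (simp add: algebra_simps sum.distrib)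
  moreover have "(\<Sum>k<Suc n. g (Suc n - k) * \<beta> k) = g (Suc n) * \<beta> 0 + (\<Sum>k<n. g (n - k) * \<beta> (Suc k))"
    by (subst sum.lessThan_Suc_shift) simp
  ultimately show ?case using Suc by simp
qed simp

text \<open>The intended reading: \<open>X\<close> is H^1_0, \<open>Y\<close> is H^2 intersected
  with it, \<open>V\<close> the finite element space, \<open>L\<close> the L^2 product,
  \<open>a\<close> and \<open>b\<close> the elastic forms, \<open>N2\<close> the H^2 norm.
  \<open>b_dual\<close> is integration by parts onto the smooth argument, \<open>regularity\<close>
  the dual elliptic problem. The slack \<delta> in \<open>approx\<close> is there because the best
  approximation is given as an infimum. \<open>riesz\<close> is an assumption because
  \<open>a\<close> may be degenerate on \<open>V\<close>.\<close>

locale galerkin_volterra =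
  L: semi_inner X L + A: semi_inner X a + Bf: bilinear_on X b
  for X :: "'v::real_vector set" and L a b +
  fixes Y V :: "'v set" and N2 :: "'v \<Rightarrow> real" and h Cb CB CR Ca :: real
  assumes Y: "Y \<subseteq> X" "subspace Y"
    and V: "subspace V" "V \<subseteq> X"
    and consts_nonneg: "0 \<le> h" "0 \<le> Cb" "0 \<le> CB" "0 \<le> CR" "0 \<le> Ca"
    and N2_nonneg: "u \<in> Y \<Longrightarrow> 0 \<le> N2 u"
    and b_bound: "u \<in> X \<Longrightarrow> w \<in> X \<Longrightarrow> \<bar>b u w\<bar> \<le> Cb * seminrm a u * seminrm a w"
    and b_dual: "u \<in> X \<Longrightarrow> w \<in> Y \<Longrightarrow> \<bar>b u w\<bar> \<le> CB * seminrm L u * N2 w"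
    and regularity: "u \<in> X \<Longrightarrow> \<exists>\<psi>\<in>Y. (\<forall>w\<in>X. a w \<psi> = L w u) \<and> N2 \<psi> \<le> CR * seminrm L u"
    and approx: "u \<in> Y \<Longrightarrow> 0 < \<delta> \<Longrightarrow> \<exists>\<zeta>\<in>V. seminrm a (u - \<zeta>) \<le> Ca * h * N2 u + \<delta>"
    and riesz: "(\<And>x y. x \<in> V \<Longrightarrow> y \<in> V \<Longrightarrow> l (x + y) = l x + l y) \<Longrightarrow>
      (\<And>x c. x \<in> V \<Longrightarrow> l (c *\<^sub>R x) = c * l x) \<Longrightarrow>
      (\<And>x. x \<in> V \<Longrightarrow> \<bar>l x\<bar> \<le> K * seminrm a x) \<Longrightarrow> \<exists>w\<in>V. \<forall>x\<in>V. a w x = l x"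
begin

text \<open>At one time level the earlier defects \<open>d k\<close> are data, so the right-hand
  side is a functional bounded in the energy seminorm and \<open>riesz\<close> solves for the new
  value.\<close>

lemma volterra_projection_step:
  fixes \<gamma> :: "nat \<Rightarrow> real"
  assumes d: "\<And>k. k < n \<Longrightarrow> d k \<in> X" and u: "u \<in> X"
  shows "\<exists>D\<in>V. \<forall>\<zeta>\<in>V. a (D - u) \<zeta> = (\<Sum>k<n. \<gamma> k * b (d k) \<zeta>)"
proof -
  define l where "l = (\<lambda>\<zeta>. a u \<zeta> + (\<Sum>k<n. \<gamma> k * b (d k) \<zeta>))"
  define K where "K = seminrm a u + (\<Sum>k<n. \<bar>\<gamma> k\<bar> * (Cb * seminrm a (d k)))"
  have "\<exists>w\<in>V. \<forall>x\<in>V. a w x = l x"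
  proof (rule riesz[of l K])
    show "l (x + y) = l x + l y" if "x \<in> V" "y \<in> V" for x y
      using that V(2) d u
      by (auto simp: l_def A.add_right Bf.add_right subset_iff algebra_simps simp flip: sum.distrib
          intro!: sum.cong)
    show "l (c *\<^sub>R x) = c * l x" if "x \<in> V" for x c
      using that V(2) d u
      by (auto simp: l_def A.scale_right Bf.scale_right subset_iff sum_distrib_left algebra_simps intro!: sum.cong)
    show "\<bar>l x\<bar> \<le> K * seminrm a x" if "x \<in> V" for x
    proof -
      have x: "x \<in> X" using that V by auto
      have "\<bar>l x\<bar> \<le> \<bar>a u x\<bar> + (\<Sum>k<n. \<bar>\<gamma> k * b (d k) x\<bar>)"
        unfolding l_def by (intro order_trans[OF abs_triangle_ineq] add_mono sum_abs order_refl)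
      also have "\<dots> \<le> seminrm a u * seminrm a x + (\<Sum>k<n. \<bar>\<gamma> k\<bar> * (Cb * seminrm a (d k) * seminrm a x))"
        using A.Cauchy_Schwarz[OF u x] b_bound[OF d x]
        by (intro add_mono sum_mono) (auto simp: abs_mult intro!: mult_left_mono)
      also have "\<dots> = K * seminrm a x"
        by (simp add: K_def algebra_simps sum_distrib_left)
      finally show ?thesis .
    qed
  qed
  then obtain w where w: "w \<in> V" "\<And>x. x \<in> V \<Longrightarrow> a w x = l x" by blast
  have "a (w - u) \<zeta> = (\<Sum>k<n. \<gamma> k * b (d k) \<zeta>)" if "\<zeta> \<in> V" for \<zeta>
    using w that V(2) u A.diff_left[of w u \<zeta>] by (auto simp: l_def)
  then show ?thesis using w(1) by blast
qed

text \<open>Each level depends on all earlier ones, hence the choice along the well-order. The value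
  at level 0 is prescribed: with a degenerate \<open>a\<close> it is not determined by its equation,
  and it has to be the initial value of the scheme itself.\<close>

lemma volterra_projection_exists:
  fixes u :: "nat \<Rightarrow> 'v" and g :: "nat \<Rightarrow> real"
  assumes u: "\<And>n. u n \<in> Y" and D0: "D0 \<in> V" "\<And>\<zeta>. \<zeta> \<in> V \<Longrightarrow> a (D0 - u 0) \<zeta> = 0"
  shows "\<exists>D. D 0 = D0 \<and> (\<forall>n. D n \<in> V \<and> (\<forall>\<zeta>\<in>V. a (D n - u n) \<zeta> = (\<Sum>k<n. g (n - k) * b (D k - u k) \<zeta>)))"
proof -
  define P where "P = (\<lambda>D (n::nat) r. (n = 0 \<longrightarrow> r = D0) \<and> r \<in> V \<and>
    (\<forall>\<zeta>\<in>V. a (r - u n) \<zeta> = (\<Sum>k<n. g (n - k) * b (D k - u k) \<zeta>)))"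
  have "\<exists>f. \<forall>n. P f n (f n)"
  proof (rule dependent_wellorder_choice)
    show "P f x r = P f' x r" if "\<And>y. y < x \<Longrightarrow> f y = f' y" for f f' x r
      using that by (auto simp: P_def intro!: sum.cong)
    show "\<exists>r. P f n r" if "\<And>y. y < n \<Longrightarrow> P f y (f y)" for f n
    proof (cases "n = 0")
      case True
      then show ?thesis using D0 by (auto simp: P_def)
    next
      case False
      have "f k - u k \<in> X" if "k < n" for k
        using that \<open>\<And>y. y < n \<Longrightarrow> P f y (f y)\<close>[of k] V(2) u Y L.sub by (auto simp: P_def subset_iff intro!: subspace_diff)
      then show ?thesis using volterra_projection_step[of n "\<lambda>k. f k - u k" "u n" "\<lambda>k. g (n - k)"] False u Y
        by (auto simp: P_def)
    qed
  qed
  then show ?thesis by (auto simp: P_def)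
qed

text \<open>Later \<open>u\<close> consists of \<open>v 0\<close> and the increments of
  \<open>v\<close> over the time steps, and \<open>D\<close> of their projections. \<open>g\<close>
  stands for the cell integrals of the exponential sum, whence the bound proportional to
  \<Delta>.\<close>

context
  fixes g :: "nat \<Rightarrow> real" and G \<Delta> T :: real and u D :: "nat \<Rightarrow> 'v" and M :: nat
  assumes g: "\<And>m. \<bar>g m\<bar> \<le> G * \<Delta>" and \<Delta>: "0 < \<Delta>" and G: "0 \<le> G" and MT: "real M * \<Delta> \<le> T"
    and u: "\<And>n. u n \<in> Y" and D: "\<And>n. D n \<in> V"
    and eq: "\<And>n \<zeta>. \<zeta> \<in> V \<Longrightarrow> a (D n - u n) \<zeta> = (\<Sum>k<n. g (n - k) * b (D k - u k) \<zeta>)"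
begin

lemma defect_in_X: "D n - u n \<in> X"
  using subspace_diff[OF L.sub] D V(2) u Y by blast

lemma memory_bound:
  assumes "w \<in> X"
  shows "\<bar>\<Sum>k<n. g (n - k) * b (D k - u k) w\<bar> \<le> Cb * G * \<Delta> * (\<Sum>k<n. seminrm a (D k - u k)) * seminrm a w"
proof -
  have "\<bar>\<Sum>k<n. g (n - k) * b (D k - u k) w\<bar> \<le> (\<Sum>k<n. (G * \<Delta>) * (Cb * seminrm a (D k - u k) * seminrm a w))"
    unfolding abs_mult using g G \<Delta> b_bound[OF defect_in_X assms]
    by (intro order_trans[OF sum_abs] sum_mono) (auto simp: abs_mult intro!: mult_mono)
  then show ?thesis by (simp add: sum_distrib_left sum_distrib_right algebra_simps)
qed

text \<open>Comparing with a nearly best approximation \<zeta> of \<open>u n\<close>, the part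
  \<open>D n - \<zeta>\<close> is an admissible test function and meets only the memory, while
  \<open>u n - \<zeta>\<close> is small. This gives a quadratic inequality for the energy seminorm
  of the defect.\<close>

lemma energy_defect:
  "seminrm a (D n - u n) \<le> 2 * Ca * h * N2 (u n) + 2 * Cb * G * \<Delta> * (\<Sum>k<n. seminrm a (D k - u k))"
proof -
  define e where "e = (\<lambda>k. seminrm a (D k - u k))"
  define s where "s = Cb * G * \<Delta> * (\<Sum>k<n. e k)"
  have e0: "0 \<le> e k" for k unfolding e_def by (rule A.seminrm_nonneg[OF defect_in_X])
  have s0: "0 \<le> s" unfolding s_def using consts_nonneg G \<Delta> e0 by (intro mult_nonneg_nonneg sum_nonneg) auto
  have "e n \<le> 2 * (s + (Ca * h * N2 (u n) + \<delta>))" if \<delta>: "0 < \<delta>" for \<delta>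
  proof -
    obtain \<zeta> where \<zeta>: "\<zeta> \<in> V" "seminrm a (u n - \<zeta>) \<le> Ca * h * N2 (u n) + \<delta>"
      using approx[OF u \<delta>] by blast
    define x where "x = seminrm a (u n - \<zeta>)"
    have uX: "u n \<in> X" "\<zeta> \<in> X" "D n \<in> X" using u Y V \<zeta> D by auto
    have x0: "0 \<le> x" unfolding x_def using uX L.sub by (intro A.seminrm_nonneg subspace_diff)
    have DV: "D n - \<zeta> \<in> V" using D \<zeta> V by (intro subspace_diff)
    have DX: "D n - \<zeta> \<in> X" "u n - \<zeta> \<in> X" using DV V uX L.sub by (auto intro: subspace_diff)
    have split: "D n - u n = (D n - \<zeta>) - (u n - \<zeta>)" by simp
    have "(e n)\<^sup>2 = a (D n - u n) (D n - \<zeta>) - a (D n - u n) (u n - \<zeta>)"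
      using A.diff_right[OF DX defect_in_X] by (simp add: e_def A.seminrm_sq[OF defect_in_X] flip: split)
    also have "\<dots> \<le> s * seminrm a (D n - \<zeta>) + e n * x"
      using memory_bound[OF DX(1), of n] A.Cauchy_Schwarz[OF defect_in_X DX(2), of n]
      by (simp add: eq[OF DV] s_def e_def x_def)
    also have "\<dots> \<le> s * (e n + x) + e n * x"
      using A.triangle[OF defect_in_X DX(2), of n] s0 by (intro add_right_mono mult_left_mono) (auto simp: e_def x_def)
    finally have q: "(e n)\<^sup>2 \<le> s * (e n + x) + e n * x" .
    \<comment> \<open>Otherwise \<open>s * x \<le> (s + x) * (e n / 2)\<close>, so the right side of
      \<open>q\<close> is at most 3/2 of \<open>(s + x) * e n\<close>, hence at most 3/4 of the
      square of \<open>e n\<close>, which is absurd for positive \<open>e n\<close>.\<close>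
    have "e n \<le> 2 * (s + x)"
    proof (rule ccontr)
      assume "\<not> e n \<le> 2 * (s + x)"
      then have big: "2 * (s + x) < e n" by (simp only: not_le)
      have "0 \<le> 2 * (s + x)" using s0 x0 by simp
      then have pos: "0 < e n" using big by (rule le_less_trans)
      have "s * x \<le> (s + x) * (e n / 2)" using s0 x0 big by (intro mult_mono) auto
      moreover have "(e n)\<^sup>2 \<le> (s + x) * e n + s * x" using q by (simp add: algebra_simps)
      ultimately have "(e n)\<^sup>2 \<le> (s + x) * e n + (s + x) * (e n / 2)" by (meson add_left_mono order_trans)
      also have "\<dots> = (s + x) * 2 * (3 / 4 * e n)" by (simp add: algebra_simps)
      also have "\<dots> \<le> e n * (3 / 4 * e n)"
        using big pos by (intro mult_right_mono) auto
      also have "\<dots> < e n * e n"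
        using pos by (intro mult_strict_left_mono) auto
      finally show False by (simp add: power2_eq_square)
    qed
    then show ?thesis using \<zeta>(2) by (simp add: x_def)
  qed
  then have "e n \<le> 2 * (s + Ca * h * N2 (u n)) + \<epsilon>" if "0 < \<epsilon>" for \<epsilon>
    using that by (fastforce dest: spec[of _ "\<epsilon> / 2"] simp: algebra_simps)
  then have "e n \<le> 2 * (s + Ca * h * N2 (u n))" by (rule field_le_epsilon)
  then show ?thesis by (simp add: e_def s_def algebra_simps)
qed

text \<open>The duality argument of Aubin and Nitsche: \<psi> solves the elliptic problem whose data
  is the defect, and its approximation error contributes the additional factor
  \<open>h\<close>.\<close>

lemma L2_defect:
  "seminrm L (D n - u n) \<le> Ca * CR * h * (seminrm a (D n - u n) + Cb * G * \<Delta> * (\<Sum>k<n. seminrm a (D k - u k)))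
     + CB * CR * G * \<Delta> * (\<Sum>k<n. seminrm L (D k - u k))"
proof -
  define e where "e = (\<lambda>k. seminrm a (D k - u k))"
  define l where "l = (\<lambda>k. seminrm L (D k - u k))"
  define s where "s = e n + Cb * G * \<Delta> * (\<Sum>k<n. e k)"
  define r where "r = CB * CR * G * \<Delta> * (\<Sum>k<n. l k)"
  have e0: "0 \<le> e k" "0 \<le> l k" for k unfolding e_def l_def
    using A.seminrm_nonneg[OF defect_in_X] L.seminrm_nonneg[OF defect_in_X] by auto
  have s0: "0 \<le> s" unfolding s_def using consts_nonneg G \<Delta> e0 by (intro add_nonneg_nonneg mult_nonneg_nonneg sum_nonneg) auto
  have r0: "0 \<le> r" unfolding r_def using consts_nonneg G \<Delta> e0 by (intro mult_nonneg_nonneg sum_nonneg) auto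
  obtain \<psi> where \<psi>: "\<psi> \<in> Y" "\<And>w. w \<in> X \<Longrightarrow> a w \<psi> = L w (D n - u n)" "N2 \<psi> \<le> CR * l n"
    using regularity[OF defect_in_X, of n] unfolding l_def by blast
  have \<psi>X: "\<psi> \<in> X" using \<psi> Y by auto
  have "(l n)\<^sup>2 \<le> s * (Ca * h * (CR * l n)) + r * l n + \<epsilon>" if \<epsilon>: "0 < \<epsilon>" for \<epsilon>
  proof -
    \<comment> \<open>The slack is scaled so that it contributes at most \<epsilon> after
      multiplication by \<open>s\<close>; the 1 keeps the quotient meaningful for
      \<open>s = 0\<close>.\<close>
    define \<delta> where "\<delta> = \<epsilon> / (s + 1)"
    have \<delta>: "0 < \<delta>" "s * \<delta> \<le> \<epsilon>" using \<epsilon> s0 by (auto simp: \<delta>_def field_simps)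
    obtain \<zeta> where \<zeta>: "\<zeta> \<in> V" "seminrm a (\<psi> - \<zeta>) \<le> Ca * h * N2 \<psi> + \<delta>"
      using approx[OF \<psi>(1) \<delta>(1)] by blast
    have \<zeta>X: "\<zeta> \<in> X" "\<psi> - \<zeta> \<in> X" using \<zeta> V \<psi>X L.sub by (auto intro: subspace_diff)
    have "(l n)\<^sup>2 = a (D n - u n) \<psi>"
      unfolding l_def L.seminrm_sq[OF defect_in_X] by (rule \<psi>(2)[OF defect_in_X, symmetric])
    also have "\<dots> = a (D n - u n) (\<psi> - \<zeta>) + a (D n - u n) \<zeta>"
      using A.diff_right[OF \<psi>X \<zeta>X(1) defect_in_X] by simp
    \<comment> \<open>The projection equation holds for \<zeta> only, but at \<psi> the form
      \<open>b\<close> is controlled by the L^2 norms of the earlier defects. So the memory is moved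
      to \<psi>, and only the small difference \<open>\<psi> - \<zeta>\<close> is paid for in the
      energy seminorm.\<close>
    also have "a (D n - u n) \<zeta> = (\<Sum>k<n. g (n - k) * b (D k - u k) \<psi>) - (\<Sum>k<n. g (n - k) * b (D k - u k) (\<psi> - \<zeta>))"
      by (simp add: eq[OF \<zeta>(1)] Bf.diff_right[OF \<psi>X \<zeta>X(1) defect_in_X] right_diff_distrib flip: sum_subtractf)
    also have "a (D n - u n) (\<psi> - \<zeta>) + ((\<Sum>k<n. g (n - k) * b (D k - u k) \<psi>) - (\<Sum>k<n. g (n - k) * b (D k - u k) (\<psi> - \<zeta>)))
      \<le> e n * seminrm a (\<psi> - \<zeta>) + \<bar>\<Sum>k<n. g (n - k) * b (D k - u k) \<psi>\<bar> + Cb * G * \<Delta> * (\<Sum>k<n. e k) * seminrm a (\<psi> - \<zeta>)"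
      using memory_bound[OF \<zeta>X(2), of n] A.Cauchy_Schwarz[OF defect_in_X \<zeta>X(2), of n] unfolding e_def by linarith
    also have "\<dots> = s * seminrm a (\<psi> - \<zeta>) + \<bar>\<Sum>k<n. g (n - k) * b (D k - u k) \<psi>\<bar>"
      by (simp add: s_def algebra_simps)
    also have "\<bar>\<Sum>k<n. g (n - k) * b (D k - u k) \<psi>\<bar> \<le> (\<Sum>k<n. (G * \<Delta>) * (CB * l k * (CR * l n)))"
      using g G \<Delta> b_dual[OF defect_in_X \<psi>(1)] \<psi>(3) consts_nonneg e0
      by (intro order_trans[OF sum_abs] sum_mono) (auto simp: abs_mult l_def
        intro!: mult_mono order_trans[OF b_dual[OF defect_in_X \<psi>(1)]] mult_left_mono)
    also have "\<dots> = r * l n" by (simp add: r_def sum_distrib_left sum_distrib_right algebra_simps)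
    also have "s * seminrm a (\<psi> - \<zeta>) \<le> s * (Ca * h * (CR * l n) + \<delta>)"
      using \<zeta>(2) \<psi>(3) s0 consts_nonneg by (intro mult_left_mono order_trans[OF \<zeta>(2)] add_right_mono) auto
    finally show ?thesis using \<delta>(2) by (simp add: algebra_simps)
  qed
  then have "(l n)\<^sup>2 \<le> s * (Ca * h * (CR * l n)) + r * l n" by (rule field_le_epsilon)
  then have "l n * l n \<le> (Ca * CR * h * s + r) * l n" by (simp add: power2_eq_square algebra_simps)
  moreover have "0 \<le> Ca * CR * h * s + r" using consts_nonneg s0 r0 by auto
  ultimately have "l n \<le> Ca * CR * h * s + r"
    using e0(2)[of n] by (cases "l n = 0") (auto simp: mult_le_cancel_right)
  then show ?thesis by (simp add: l_def s_def r_def e_def)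
qed

text \<open>Two nested Gronwall estimates: the summed energy defects are of order \<open>h\<close>
  with factor \<open>exp (2 * Cb * G * T)\<close>; multiplied by the \<open>h\<close> from duality
  they are the data of the second one, with factor \<open>exp (CB * CR * G * T)\<close>. The factor
  \<open>1 + Cb * G * T\<close> comes from the memory inside that data.\<close>

lemma sum_L2_defect:
  "(\<Sum>n\<le>M. seminrm L (D n - u n)) \<le>
     (Ca * CR * (1 + Cb * G * T) * exp (CB * CR * G * T) * (2 * Ca) * exp (2 * Cb * G * T)) * h\<^sup>2 * (\<Sum>n\<le>M. N2 (u n))"
proof -
  define e where "e = (\<lambda>k. seminrm a (D k - u k))"
  define l where "l = (\<lambda>k. seminrm L (D k - u k))"
  define S where "S = (\<Sum>n\<le>M. e n)"
  have e0: "0 \<le> e k" "0 \<le> l k" for k unfolding e_def l_def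
    using A.seminrm_nonneg[OF defect_in_X] L.seminrm_nonneg[OF defect_in_X] by auto
  have S0: "0 \<le> S" unfolding S_def by (intro sum_nonneg e0)
  have T0: "0 \<le> T" using MT \<Delta> by (meson order_trans mult_nonneg_nonneg of_nat_0_le_iff less_imp_le)
  have "S \<le> (\<Sum>n\<le>M. 2 * Ca * h * N2 (u n)) * (1 + 2 * Cb * G * \<Delta>) ^ M"
    unfolding S_def using consts_nonneg G \<Delta> N2_nonneg[OF u] energy_defect by (intro volterra_sum_bound) (auto simp: e_def)
  also have "\<dots> \<le> (\<Sum>n\<le>M. 2 * Ca * h * N2 (u n)) * exp (2 * Cb * G * T)"
    using consts_nonneg G \<Delta> N2_nonneg[OF u] mult_left_mono[OF MT, of "2 * Cb * G"]
    by (intro mult_left_mono power_le_exp sum_nonneg) (auto simp: algebra_simps)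
  also have "\<dots> = 2 * Ca * h * (\<Sum>n\<le>M. N2 (u n)) * exp (2 * Cb * G * T)"
    by (simp add: sum_distrib_left)
  finally have S: "S \<le> 2 * Ca * h * (\<Sum>n\<le>M. N2 (u n)) * exp (2 * Cb * G * T)" .
  define p where "p = (\<lambda>n. Ca * CR * h * (e n + Cb * G * \<Delta> * (\<Sum>k<n. e k)))"
  have p0: "0 \<le> p n" for n unfolding p_def using consts_nonneg G \<Delta> e0 by (intro mult_nonneg_nonneg add_nonneg_nonneg sum_nonneg) auto
  \<comment> \<open>Each inner sum is a partial sum of \<open>S\<close>; the resulting factor
    \<open>M\<close> is compensated by \<Delta>, since \<open>M * \<Delta> \<le> T\<close>.\<close>
  have "(\<Sum>n\<le>M. \<Sum>k<n. e k) = (\<Sum>n<M. \<Sum>k\<le>n. e k)"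
    by (cases M) (simp_all only: atMost_0 lessThan_0 lessThan_Suc_atMost sum.atMost_Suc_shift, simp_all add: lessThan_Suc_atMost)
  also have "\<dots> \<le> (\<Sum>n<M. S)"
    unfolding S_def using e0 by (intro sum_mono sum_mono2) auto
  finally have dbl: "(\<Sum>n\<le>M. \<Sum>k<n. e k) \<le> real M * S" by simp
  have "(\<Sum>n\<le>M. p n) = Ca * CR * h * (S + Cb * G * \<Delta> * (\<Sum>n\<le>M. \<Sum>k<n. e k))"
    unfolding p_def S_def by (simp add: sum.distrib flip: sum_distrib_left)
  also have "\<dots> \<le> Ca * CR * h * (S + Cb * G * \<Delta> * (real M * S))"
    using consts_nonneg G \<Delta> dbl by (intro mult_left_mono add_left_mono) auto
  also have "\<dots> = Ca * CR * h * (S + Cb * G * (real M * \<Delta>) * S)" by (simp add: algebra_simps)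
  also have "\<dots> \<le> Ca * CR * h * (S + Cb * G * T * S)"
    using consts_nonneg G S0 MT by (intro mult_left_mono add_left_mono mult_right_mono) auto
  finally have P: "(\<Sum>n\<le>M. p n) \<le> Ca * CR * h * (1 + Cb * G * T) * S" by (simp add: algebra_simps)
  have expo: "(1 + CB * CR * G * \<Delta>) ^ M \<le> exp (CB * CR * G * T)"
    using consts_nonneg G \<Delta> mult_left_mono[OF MT, of "CB * CR * G"]
    by (intro power_le_exp) (auto simp: algebra_simps)
  have "(\<Sum>n\<le>M. l n) \<le> (\<Sum>n\<le>M. p n) * (1 + CB * CR * G * \<Delta>) ^ M"
    using consts_nonneg G \<Delta> p0 L2_defect by (intro volterra_sum_bound) (auto simp: p_def l_def e_def)
  also have "\<dots> \<le> (Ca * CR * h * (1 + Cb * G * T) * S) * exp (CB * CR * G * T)"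
    using consts_nonneg G \<Delta> S0 T0 by (intro mult_mono[OF P expo]) auto
  also have "\<dots> \<le> (Ca * CR * h * (1 + Cb * G * T) * (2 * Ca * h * (\<Sum>n\<le>M. N2 (u n)) * exp (2 * Cb * G * T))) * exp (CB * CR * G * T)"
    using consts_nonneg G S T0 by (intro mult_right_mono mult_left_mono) auto
  finally show ?thesis by (simp add: l_def power2_eq_square algebra_simps)
qed

end

text \<open>With \<eta> the accumulated projection defects of the increments and \<theta> the part
  of the error in \<open>V\<close>, \<open>U m - v m = \<eta> m + \<theta> m\<close>. The sequence
  \<theta> starts at 0 because the projection starts at \<open>U 0\<close>.\<close>

lemma galerkin_error:
  fixes v U :: "nat \<Rightarrow> 'v" and g \<rho> :: "nat \<Rightarrow> real" and G \<Delta> T :: real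
  assumes g: "\<And>m. \<bar>g m\<bar> \<le> G * \<Delta>" and \<Delta>: "0 < \<Delta>" and G: "0 \<le> G" and NT: "real n * \<Delta> \<le> T"
    and v: "\<And>m. v m \<in> Y" and U: "\<And>m. m \<le> n \<Longrightarrow> U m \<in> V"
    and U0: "\<And>\<zeta>. \<zeta> \<in> V \<Longrightarrow> a (U 0 - v 0) \<zeta> = 0"
    and \<rho>: "\<And>m. 0 \<le> \<rho> m"
    and consistency: "\<And>m \<zeta>. 1 \<le> m \<Longrightarrow> m \<le> n \<Longrightarrow> \<zeta> \<in> V \<Longrightarrow>
      \<bar>(L (U m - U (m - 1)) \<zeta> + \<Delta> * a (U m) \<zeta> - \<Delta> * (\<Sum>k<m. g (m - k) * b (U k) \<zeta>)) -
       (L (v m - v (m - 1)) \<zeta> + \<Delta> * a (v m) \<zeta> - \<Delta> * (\<Sum>k<m. g (m - k) * b (v k) \<zeta>))\<bar> \<le> \<rho> m * seminrm L \<zeta>"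
  shows "seminrm L (U n - v n) \<le> 2 * exp ((Cb * G)\<^sup>2 * T * T) * (\<Sum>m=1..n. \<rho> m) +
    (2 * exp ((Cb * G)\<^sup>2 * T * T) + 1) * (Ca * CR * (1 + Cb * G * T) * exp (CB * CR * G * T) * (2 * Ca) * exp (2 * Cb * G * T)) *
    h\<^sup>2 * (N2 (v 0) + (\<Sum>m=1..n. N2 (v m - v (m - 1))))"
proof -
  define E where "E = exp ((Cb * G)\<^sup>2 * T * T)"
  define K where "K = Ca * CR * (1 + Cb * G * T) * exp (CB * CR * G * T) * (2 * Ca) * exp (2 * Cb * G * T)"
  \<comment> \<open>The initial value counts as an increment, so that the partial sums of
    \<open>u\<close> reproduce \<open>v\<close>.\<close>
  define u where "u = (\<lambda>m. if m = 0 then v 0 else v m - v (m - 1))"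
  have T0: "0 \<le> T" using NT \<Delta> by (meson order_trans mult_nonneg_nonneg of_nat_0_le_iff less_imp_le)
  have uY: "u m \<in> Y" for m using v Y(2) by (auto simp: u_def intro: subspace_diff)
  have vX: "v m \<in> X" for m using v Y by auto
  obtain D where D: "D 0 = U 0" "\<And>m. D m \<in> V"
    "\<And>m \<zeta>. \<zeta> \<in> V \<Longrightarrow> a (D m - u m) \<zeta> = (\<Sum>k<m. g (m - k) * b (D k - u k) \<zeta>)"
    using volterra_projection_exists[of u "U 0" g] uY U[of 0] U0 by (auto simp: u_def)
  define d where "d = (\<lambda>m. D m - u m)"
  define \<eta> where "\<eta> = (\<lambda>m. \<Sum>i\<le>m. d i)"
  define \<theta> where "\<theta> = (\<lambda>m. U m - (\<Sum>i\<le>m. D i))"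
  have dX: "d m \<in> X" for m
    unfolding d_def using subspace_diff[OF L.sub] D(2) V(2) uY Y by blast
  have \<eta>X: "\<eta> m \<in> X" for m unfolding \<eta>_def by (intro subspace_sum[OF L.sub] dX)
  have \<theta>V: "\<theta> m \<in> V" if "m \<le> n" for m unfolding \<theta>_def using U[OF that] D(2) by (intro subspace_diff subspace_sum V(1)) auto
  have \<theta>X: "\<theta> m \<in> X" if "m \<le> n" for m using \<theta>V[OF that] V by auto
  have sum_u: "(\<Sum>i\<le>m. u i) = v m" for m by (induction m) (auto simp: u_def)
  have U_split: "U m = v m + (\<eta> m + \<theta> m)" for m
    by (simp add: \<eta>_def d_def \<theta>_def sum_subtractf sum_u)
  \<comment> \<open>Summing the equations of the increments shows that \<eta> satisfies the
    projection equation belonging to \<open>v\<close> itself. So in the scheme its contributions to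
    \<open>a\<close> and to the memory cancel.\<close>
  have \<eta>_eq: "a (\<eta> m) \<zeta> = (\<Sum>k<m. g (m - k) * b (\<eta> k) \<zeta>)" if \<zeta>: "\<zeta> \<in> V" for m \<zeta>
  proof -
    have \<zeta>X: "\<zeta> \<in> X" using \<zeta> V by auto
    have "a (\<eta> m) \<zeta> = (\<Sum>i\<le>m. \<Sum>k<i. g (i - k) * b (d k) \<zeta>)"
      unfolding \<eta>_def by (subst A.sum_left[OF dX \<zeta>X]) (simp add: d_def D(3)[OF \<zeta>])
    also have "\<dots> = (\<Sum>k<m. g (m - k) * (\<Sum>i\<le>k. b (d i) \<zeta>))" by (rule convolution_sum)
    finally show ?thesis unfolding \<eta>_def by (subst Bf.sum_left) (auto simp: dX \<zeta>X)
  qed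
  have \<eta>_diff: "\<eta> m - \<eta> (m - 1) = d m" if "1 \<le> m" for m
    using that by (cases m) (auto simp: \<eta>_def)
  define l where "l = (\<lambda>m. seminrm L (d m))"
  have l0: "0 \<le> l m" for m unfolding l_def by (rule L.seminrm_nonneg[OF dX])
  define f where "f = (\<lambda>m. \<rho> m + l m)"
  have f0: "0 \<le> f m" for m using \<rho>[of m] l0[of m] by (simp add: f_def)
  have lsum: "(\<Sum>m\<le>n. l m) \<le> K * h\<^sup>2 * (N2 (v 0) + (\<Sum>m=1..n. N2 (v m - v (m - 1))))"
  proof -
    have "(\<Sum>m\<le>n. N2 (u m)) = N2 (v 0) + (\<Sum>m=1..n. N2 (v m - v (m - 1)))"
      by (simp add: u_def sum.atMost_shift sum.atLeast1_atMost_eq)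
    then show ?thesis
      using sum_L2_defect[where g = g and G = G and \<Delta> = \<Delta> and T = T and u = u and D = D and M = n, OF g \<Delta> G NT uY D(2) D(3)]
      by (simp add: l_def d_def K_def)
  qed
  define y where "y = (\<lambda>m. seminrm L (\<theta> m))"
  define z where "z = (\<lambda>m. seminrm a (\<theta> m))"
  have y0: "0 \<le> y m" "0 \<le> z m" if "m \<le> n" for m unfolding y_def z_def
    using A.seminrm_nonneg[OF \<theta>X[OF that]] L.seminrm_nonneg[OF \<theta>X[OF that]] by auto
  have z00: "y 0 = 0" "z 0 = 0" by (auto simp: y_def z_def \<theta>_def D(1) A.seminrm_zero L.seminrm_zero)
  \<comment> \<open>L^2 energy plus the accumulated elastic energy; the second part is what bounds
    the memory of earlier levels.\<close>
  define s where "s = (\<lambda>m. (y m)\<^sup>2 + \<Delta> * (\<Sum>k\<le>m. (z k)\<^sup>2))"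
  have step: "s (Suc m) \<le> (1 + \<Delta> * ((Cb * G)\<^sup>2 * T)) * s m + 2 * (f (Suc m) * y (Suc m))" if m: "Suc m \<le> n" for m
  proof -
    \<comment> \<open>The energy test function. By \<open>\<eta>_eq\<close> the equation for
      \<theta> is driven only by the consistency bound \<rho> and by \<open>d (Suc m)\<close>, which
      is what remains of \<eta> in the time difference.\<close>
    define \<zeta> where "\<zeta> = \<theta> (Suc m)"
    have \<zeta>: "\<zeta> \<in> V" "\<zeta> \<in> X" unfolding \<zeta>_def using \<theta>V[OF m] \<theta>X[OF m] by auto
    define Z where "Z = (\<Sum>k<Suc m. z k)"
    have \<theta>m: "\<theta> m \<in> X" using \<theta>X m by simp
    have LU: "L (U (Suc m) - U m) \<zeta> - L (v (Suc m) - v m) \<zeta> = L (d (Suc m)) \<zeta> + (L \<zeta> \<zeta> - L (\<theta> m) \<zeta>)"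
      using \<eta>_diff[of "Suc m"] m
      by (simp add: U_split L.add_left L.diff_left vX \<eta>X \<theta>X \<theta>m \<zeta> subspace_add[OF L.sub] \<zeta>_def flip: \<eta>_diff[of "Suc m"])
    have aU: "a (U (Suc m)) \<zeta> - a (v (Suc m)) \<zeta> = a (\<eta> (Suc m)) \<zeta> + a \<zeta> \<zeta>"
      using m by (simp add: U_split A.add_left vX \<eta>X \<theta>X \<zeta> subspace_add[OF L.sub] flip: \<zeta>_def)
    have bU: "b (U k) \<zeta> = b (v k) \<zeta> + (b (\<eta> k) \<zeta> + b (\<theta> k) \<zeta>)" if "k < Suc m" for k
      using m that by (simp add: U_split Bf.add_left vX \<eta>X \<theta>X \<zeta> subspace_add[OF L.sub])
    have "(\<Sum>k<Suc m. g (Suc m - k) * b (U k) \<zeta>) =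
      (\<Sum>k<Suc m. g (Suc m - k) * b (v k) \<zeta> + (g (Suc m - k) * b (\<eta> k) \<zeta> + g (Suc m - k) * b (\<theta> k) \<zeta>))"
      by (intro sum.cong refl) (simp only: bU lessThan_iff distrib_left)
    then have bsum: "(\<Sum>k<Suc m. g (Suc m - k) * b (U k) \<zeta>) =
      (\<Sum>k<Suc m. g (Suc m - k) * b (v k) \<zeta>) + a (\<eta> (Suc m)) \<zeta> + (\<Sum>k<Suc m. g (Suc m - k) * b (\<theta> k) \<zeta>)"
      by (simp only: sum.distrib \<eta>_eq[OF \<zeta>(1)])
    have "\<bar>\<Sum>k<Suc m. g (Suc m - k) * b (\<theta> k) \<zeta>\<bar> \<le> (\<Sum>k<Suc m. (G * \<Delta>) * (Cb * z k * z (Suc m)))"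
      using g G \<Delta> m b_bound[OF \<theta>X \<zeta>(2)]
      by (intro order_trans[OF sum_abs] sum_mono) (auto simp: abs_mult z_def \<zeta>_def intro!: mult_mono)
    also have "\<dots> = Cb * G * (\<Delta> * Z) * z (Suc m)" by (simp add: Z_def sum_distrib_left sum_distrib_right algebra_simps del: sum.lessThan_Suc)
    finally have mem: "\<bar>\<Sum>k<Suc m. g (Suc m - k) * b (\<theta> k) \<zeta>\<bar> \<le> Cb * G * (\<Delta> * Z) * z (Suc m)" .
    have "L (d (Suc m)) \<zeta> + (L \<zeta> \<zeta> - L (\<theta> m) \<zeta>) + \<Delta> * a \<zeta> \<zeta> - \<Delta> * (\<Sum>k<Suc m. g (Suc m - k) * b (\<theta> k) \<zeta>)
      = (L (U (Suc m) - U m) \<zeta> + \<Delta> * a (U (Suc m)) \<zeta> - \<Delta> * (\<Sum>k<Suc m. g (Suc m - k) * b (U k) \<zeta>)) -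
       (L (v (Suc m) - v m) \<zeta> + \<Delta> * a (v (Suc m)) \<zeta> - \<Delta> * (\<Sum>k<Suc m. g (Suc m - k) * b (v k) \<zeta>))"
      unfolding bsum LU[symmetric] using arg_cong[OF aU, of "\<lambda>x. \<Delta> * x"] by (simp only: algebra_simps)
    also have "\<dots> \<le> \<rho> (Suc m) * y (Suc m)"
      using consistency[of "Suc m" \<zeta>] m \<zeta>(1) by (simp add: y_def \<zeta>_def)
    finally have 1: "L (d (Suc m)) \<zeta> + (L \<zeta> \<zeta> - L (\<theta> m) \<zeta>) + \<Delta> * a \<zeta> \<zeta> - \<Delta> * (\<Sum>k<Suc m. g (Suc m - k) * b (\<theta> k) \<zeta>)
      \<le> \<rho> (Suc m) * y (Suc m)" .
    have 2: "- L (d (Suc m)) \<zeta> \<le> l (Suc m) * y (Suc m)"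
      using L.Cauchy_Schwarz[OF dX \<zeta>(2), of "Suc m"] by (simp add: l_def y_def \<zeta>_def)
    have 3: "L (\<theta> m) \<zeta> \<le> y m * y (Suc m)"
      using L.Cauchy_Schwarz[OF \<theta>m \<zeta>(2)] by (simp add: y_def \<zeta>_def)
    have 4: "2 * (y m * y (Suc m)) \<le> (y m)\<^sup>2 + (y (Suc m))\<^sup>2"
      using sum_squares_bound[of "y m" "y (Suc m)"] by simp
    \<comment> \<open>Doubling the tested equation yields two copies of the squared energy seminorm
      of the test function, each with factor \<Delta>. One is spent here on the memory, the other
      enters \<open>s (Suc m)\<close>.\<close>
    have 5: "2 * ((Cb * G * (\<Delta> * Z)) * z (Suc m)) \<le> (Cb * G)\<^sup>2 * (\<Delta> * Z)\<^sup>2 + (z (Suc m))\<^sup>2"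
      using sum_squares_bound[of "Cb * G * (\<Delta> * Z)" "z (Suc m)"] by (simp add: power_mult_distrib)
    \<comment> \<open>Cauchy-Schwarz for the sum over the levels: one factor \<Delta> completes the
      accumulated energy in \<open>s m\<close>, the other turns the number of levels into at most
      \<open>T\<close>.\<close>
    have "(\<Delta> * Z)\<^sup>2 \<le> \<Delta>\<^sup>2 * ((\<Sum>k<Suc m. (z k)\<^sup>2) * real (Suc m))"
      using sum_squared_le_sum_of_squares[of z "{..<Suc m}"] \<Delta>
      by (simp add: Z_def power_mult_distrib del: sum.lessThan_Suc)
    also have "\<dots> = \<Delta> * (\<Sum>k\<le>m. (z k)\<^sup>2) * (real (Suc m) * \<Delta>)"
      by (simp add: power2_eq_square lessThan_Suc_atMost algebra_simps)
    also have "\<dots> \<le> s m * T"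
    proof (rule mult_mono)
      show "real (Suc m) * \<Delta> \<le> T"
        using m \<Delta> by (intro order_trans[OF mult_right_mono NT]) auto
    qed (use \<Delta> in \<open>auto simp: s_def intro!: add_nonneg_nonneg mult_nonneg_nonneg sum_nonneg\<close>)
    finally have 6: "(\<Delta> * Z)\<^sup>2 \<le> s m * T" .
    have 7: "\<Delta> * ((Cb * G)\<^sup>2 * (\<Delta> * Z)\<^sup>2) \<le> \<Delta> * ((Cb * G)\<^sup>2 * (s m * T))"
      using 6 \<Delta> by (intro mult_left_mono) auto
    have 8: "\<Delta> * (\<Sum>k<Suc m. g (Suc m - k) * b (\<theta> k) \<zeta>) \<le> \<Delta> * (Cb * G * (\<Delta> * Z) * z (Suc m))"
      using mem \<Delta> by (intro mult_left_mono) auto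
    have 9: "\<Delta> * (2 * ((Cb * G * (\<Delta> * Z)) * z (Suc m))) \<le> \<Delta> * ((Cb * G)\<^sup>2 * (\<Delta> * Z)\<^sup>2 + (z (Suc m))\<^sup>2)"
      using 5 \<Delta> by (intro mult_left_mono) auto
    have LL: "L \<zeta> \<zeta> = (y (Suc m))\<^sup>2" "a \<zeta> \<zeta> = (z (Suc m))\<^sup>2"
      using L.seminrm_sq[OF \<zeta>(2)] A.seminrm_sq[OF \<zeta>(2)] by (auto simp: y_def z_def \<zeta>_def)
    have s_Suc: "s (Suc m) = s m - (y m)\<^sup>2 + (y (Suc m))\<^sup>2 + \<Delta> * (z (Suc m))\<^sup>2" by (simp add: s_def algebra_simps)
    show ?thesis using 1 2 3 4 7 8 9 unfolding s_Suc LL f_def by (simp add: algebra_simps)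
  qed
  \<comment> \<open>The recursion for the squares has the unknown norm on its right side. Replacing
    it by the maximum, attained at \<open>p\<close>, allows division by \<open>Ym\<close> and gives
    a bound that is linear in the data.\<close>
  define Ym where "Ym = Max (y ` {..n})"
  have Ym: "y m \<le> Ym" if "m \<le> n" for m unfolding Ym_def using that by (intro Max_ge) auto
  have Ym0: "0 \<le> Ym" using Ym[of 0] y0(1)[of 0] by simp
  have "Ym \<in> y ` {..n}" unfolding Ym_def by (intro Max_in) auto
  then obtain p where p: "p \<le> n" "Ym = y p" by auto
  have "s p \<le> (1 + \<Delta> * ((Cb * G)\<^sup>2 * T)) ^ p * (\<Sum>k\<in>{1..p}. 2 * (f k * Ym))"
  proof (rule gronwall_step[OF _ _ _ _ p(1)])
    show "s (Suc m) \<le> (1 + \<Delta> * ((Cb * G)\<^sup>2 * T)) * s m + 2 * (f (Suc m) * Ym)" if "Suc m \<le> n" for m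
      using step[OF that] mult_left_mono[OF Ym[OF that] f0[of "Suc m"]] by linarith
  qed (use \<Delta> T0 f0 Ym0 z00 in \<open>auto simp: s_def\<close>)
  also have "\<dots> \<le> E * (2 * (\<Sum>k\<in>{1..n}. f k) * Ym)"
  proof (rule mult_mono)
    have "real p * \<Delta> \<le> T" using p(1) \<Delta> by (intro order_trans[OF mult_right_mono NT]) auto
    then have "(real p * \<Delta>) * ((Cb * G)\<^sup>2 * T) \<le> T * ((Cb * G)\<^sup>2 * T)" using T0 by (intro mult_right_mono) auto
    then show "(1 + \<Delta> * ((Cb * G)\<^sup>2 * T)) ^ p \<le> E"
      unfolding E_def using \<Delta> T0 by (intro power_le_exp) (auto simp: algebra_simps)
    have "(\<Sum>k\<in>{1..p}. f k) \<le> (\<Sum>k\<in>{1..n}. f k)" using p(1) f0 by (intro sum_mono2) auto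
    then show "(\<Sum>k\<in>{1..p}. 2 * (f k * Ym)) \<le> 2 * (\<Sum>k\<in>{1..n}. f k) * Ym"
      using Ym0 by (simp add: sum_distrib_left[symmetric] sum_distrib_right[symmetric] mult_right_mono)
  qed (use f0 Ym0 in \<open>auto simp: E_def intro!: sum_nonneg\<close>)
  finally have "Ym * Ym \<le> E * (2 * (\<Sum>k\<in>{1..n}. f k) * Ym)"
    using \<Delta> sum_nonneg[of "{..p}" "\<lambda>k. (z k)\<^sup>2"] p(2) by (simp add: s_def power2_eq_square) (smt (verit) mult_nonneg_nonneg)
  then have "Ym * Ym \<le> (2 * E * (\<Sum>k\<in>{1..n}. f k)) * Ym" by (simp add: algebra_simps)
  moreover have F0: "0 \<le> 2 * E * (\<Sum>k\<in>{1..n}. f k)" using f0 by (auto simp: E_def intro!: mult_nonneg_nonneg sum_nonneg)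
  ultimately have "Ym \<le> 2 * E * (\<Sum>k\<in>{1..n}. f k)"
    using Ym0 by (cases "Ym = 0") (auto simp: mult_le_cancel_right)
  also have "\<dots> \<le> 2 * E * ((\<Sum>k\<in>{1..n}. \<rho> k) + (\<Sum>k\<le>n. l k))"
    using l0 by (auto simp: f_def sum.distrib E_def intro!: mult_left_mono sum_mono2)
  finally have "y n \<le> 2 * E * (\<Sum>k\<in>{1..n}. \<rho> k) + 2 * E * (\<Sum>k\<le>n. l k)"
    using Ym[of n] by (simp add: algebra_simps)
  moreover have "seminrm L (U n - v n) \<le> (\<Sum>k\<le>n. l k) + y n"
  proof -
    have "seminrm L (U n - v n) = seminrm L (\<eta> n + \<theta> n)" by (simp add: U_split)
    also have "\<dots> \<le> seminrm L (\<eta> n) + y n" unfolding y_def by (rule L.triangle[OF \<eta>X \<theta>X]) simp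
    also have "seminrm L (\<eta> n) \<le> (\<Sum>k\<le>n. l k)" unfolding \<eta>_def l_def by (rule L.seminrm_sum[OF dX])
    finally show ?thesis by simp
  qed
  moreover have "(2 * E + 1) * (\<Sum>k\<le>n. l k) \<le> (2 * E + 1) * (K * h\<^sup>2 * (N2 (v 0) + (\<Sum>m=1..n. N2 (v m - v (m - 1)))))"
    using lsum by (intro mult_left_mono) (auto simp: E_def)
  ultimately have "seminrm L (U n - v n) \<le> 2 * E * (\<Sum>k\<in>{1..n}. \<rho> k) +
      (2 * E + 1) * (K * h\<^sup>2 * (N2 (v 0) + (\<Sum>m=1..n. N2 (v m - v (m - 1)))))"
    by (simp add: algebra_simps)
  then show ?thesis by (simp only: E_def K_def mult.assoc)
qed

end

section \<open>Smooth functions with compact support\<close>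

lemma frechet_derivative_real:
  assumes "(f has_real_derivative D) (at x)"
  shows "frechet_derivative f (at x) e = D * e"
  using assms frechet_derivative_at[of f "(*) D" x] by (simp add: has_field_derivative_def)

lemma Ck_SucD: "Ck (Suc k) f \<Longrightarrow> Ck k f"
proof (induction k arbitrary: f)
  case 0
  then show ?case by (auto intro: differentiable_imp_continuous_on)
next
  case (Suc k)
  then show ?case by (metis Ck.simps(2))
qed

lemma Ck_const: "Ck k (\<lambda>x. c)"
  by (induction k arbitrary: c) (auto simp: frechet_derivative_const)

lemma Ck_differentiable: "Ck (Suc k) f \<Longrightarrow> f differentiable at x"
  by (simp add: differentiable_on_eq_differentiable_at)

lemma Ck_add: "Ck k f \<Longrightarrow> Ck k g \<Longrightarrow> Ck k (\<lambda>x. f x + g x)"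
proof (induction k arbitrary: f g)
  case 0
  then show ?case by (auto intro: continuous_on_add)
next
  case (Suc k)
  have "frechet_derivative (\<lambda>x. f x + g x) (at x) = (\<lambda>e. frechet_derivative f (at x) e + frechet_derivative g (at x) e)" for x
    using Ck_differentiable[OF Suc.prems(1)] Ck_differentiable[OF Suc.prems(2)]
    by (intro frechet_derivative_at[symmetric] has_derivative_add) (simp_all add: frechet_derivative_works)
  then show ?case using Suc by (auto intro!: derivative_intros)
qed

lemma Ck_scaleR: "Ck k f \<Longrightarrow> Ck k (\<lambda>x. c *\<^sub>R f x)"
proof (induction k arbitrary: f)
  case 0
  then show ?case by (auto intro: continuous_intros)
next
  case (Suc k)
  have "frechet_derivative (\<lambda>x. c *\<^sub>R f x) (at x) = (\<lambda>e. c *\<^sub>R frechet_derivative f (at x) e)" for x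
    using Ck_differentiable[OF Suc.prems]
    by (intro frechet_derivative_at[symmetric] has_derivative_scaleR_right) (simp add: frechet_derivative_works)
  moreover have "(\<lambda>x. c *\<^sub>R f x) differentiable_on UNIV"
    using Suc.prems by (auto intro: differentiable_on_scaleR)
  ultimately show ?case using Suc by auto
qed

lemma Ck_mult:
  fixes f g :: "'a::euclidean_space \<Rightarrow> real"
  shows "Ck k f \<Longrightarrow> Ck k g \<Longrightarrow> Ck k (\<lambda>x. f x * g x)"
proof (induction k arbitrary: f g)
  case 0
  then show ?case by (auto intro: continuous_intros)
next
  case (Suc k)
  have D: "((\<lambda>x. f x * g x) has_derivative (\<lambda>e. f x * frechet_derivative g (at x) e + frechet_derivative f (at x) e * g x)) (at x)" for x
    using Ck_differentiable[OF Suc.prems(1)] Ck_differentiable[OF Suc.prems(2)]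
    by (intro has_derivative_mult) (auto simp: frechet_derivative_works)
  have "frechet_derivative (\<lambda>x. f x * g x) (at x) e = f x * frechet_derivative g (at x) e + frechet_derivative f (at x) e * g x" for x e
    using frechet_derivative_at[OF D] by metis
  moreover have "(\<lambda>x. f x * g x) differentiable_on UNIV"
    using D by (auto simp: differentiable_on_def differentiable_def intro: has_derivative_at_withinI)
  ultimately show ?case using Suc.IH Suc.prems Ck_SucD[OF Suc.prems(1)] Ck_SucD[OF Suc.prems(2)]
    by (auto intro!: Ck_add)
qed

lemma Ck_prod:
  fixes f :: "'i \<Rightarrow> 'a::euclidean_space \<Rightarrow> real"
  shows "(\<And>i. i \<in> I \<Longrightarrow> Ck k (f i)) \<Longrightarrow> Ck k (\<lambda>x. \<Prod>i\<in>I. f i x)"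
  by (induction I rule: infinite_finite_induct) (auto intro: Ck_const Ck_mult)

text \<open>This special chain rule suffices for the cutoffs: those in space are products of
  one-dimensional profiles, those in time are rescaled smooth steps.\<close>

lemma Ck_affine:
  fixes f :: "real \<Rightarrow> real" and w :: "'a::euclidean_space"
  shows "Ck k f \<Longrightarrow> Ck k (\<lambda>x. f (x \<bullet> w + c))"
proof (induction k arbitrary: f)
  case 0
  have "continuous_on UNIV f" using 0 by simp
  moreover have "continuous_on UNIV (\<lambda>x. x \<bullet> w + c)" by (intro continuous_intros)
  ultimately have "continuous_on UNIV (\<lambda>x. f (x \<bullet> w + c))" by (rule continuous_on_compose2) simp
  then show ?case by simp
next
  case (Suc k)
  have D: "((\<lambda>x. f (x \<bullet> w + c)) has_derivative (\<lambda>e. (e \<bullet> w) *\<^sub>R frechet_derivative f (at (x \<bullet> w + c)) 1)) (at x)" for x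
  proof -
    have "(f has_derivative frechet_derivative f (at (x \<bullet> w + c))) (at (x \<bullet> w + c))"
      using Ck_differentiable[OF Suc.prems] by (simp add: frechet_derivative_works)
    moreover have "((\<lambda>x. x \<bullet> w + c) has_derivative (\<lambda>e. e \<bullet> w)) (at x)"
      by (auto intro!: derivative_eq_intros)
    ultimately have "((\<lambda>x. f (x \<bullet> w + c)) has_derivative (\<lambda>e. frechet_derivative f (at (x \<bullet> w + c)) (e \<bullet> w))) (at x)"
      using has_derivative_compose[of "\<lambda>x. x \<bullet> w + c" "\<lambda>e. e \<bullet> w" x UNIV f] by blast
    moreover have "frechet_derivative f (at (x \<bullet> w + c)) (e \<bullet> w) = (e \<bullet> w) *\<^sub>R frechet_derivative f (at (x \<bullet> w + c)) 1" for e
      using linear_frechet_derivative[OF Ck_differentiable[OF Suc.prems], of "x \<bullet> w + c"]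
      using linear_scale[of "frechet_derivative f (at (x \<bullet> w + c))" "e \<bullet> w" 1] by simp
    ultimately show ?thesis by simp
  qed
  have "frechet_derivative (\<lambda>x. f (x \<bullet> w + c)) (at x) e = (e \<bullet> w) *\<^sub>R frechet_derivative f (at (x \<bullet> w + c)) 1" for x e
    using frechet_derivative_at[OF D] by metis
  moreover have "(\<lambda>x. f (x \<bullet> w + c)) differentiable_on UNIV"
    using D by (auto simp: differentiable_on_def differentiable_def intro: has_derivative_at_withinI)
  moreover have "Ck k (\<lambda>x. (e \<bullet> w) *\<^sub>R frechet_derivative f (at (x \<bullet> w + c)) 1)" for e
    using Suc.prems by (intro Ck_scaleR Suc.IH) simp
  ultimately show ?case by simp
qed

text \<open>The classical function exp(-1/x), extended by zero to x <= 0. With a polynomial in 1/x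
  as factor the family is closed under differentiation, so smoothness becomes an induction.\<close>

definition flat :: "real poly \<Rightarrow> real \<Rightarrow> real" where
  "flat p x = (if 0 < x then poly p (1 / x) * exp (- (1 / x)) else 0)"

lemma poly_exp_tendsto_0: "((\<lambda>y. poly p y * exp (- y)) \<longlongrightarrow> (0::real)) at_top"
proof (induction p)
  case (pCons a p)
  have "((\<lambda>y. poly q y * y * exp (- y)) \<longlongrightarrow> (0::real)) at_top" if "((\<lambda>y. poly q y * exp (- y)) \<longlongrightarrow> (0::real)) at_top" for q
  proof -
    have "((\<lambda>y. \<Sum>i\<le>degree q. coeff q i * (y ^ Suc i / exp y)) \<longlongrightarrow> (\<Sum>i\<le>degree q. coeff q i * 0)) at_top"
      by (intro tendsto_intros tendsto_power_div_exp_0)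
    then show ?thesis
      by (simp add: poly_altdef sum_distrib_left sum_distrib_right exp_minus field_simps)
  qed
  from this[OF pCons(2)] have 1: "((\<lambda>y. poly p y * y * exp (- y)) \<longlongrightarrow> (0::real)) at_top" .
  have "((\<lambda>y. a * (y ^ 0 / exp y)) \<longlongrightarrow> a * (0::real)) at_top" by (intro tendsto_intros tendsto_power_div_exp_0)
  from tendsto_add[OF this 1] show ?case by (simp add: field_simps exp_minus)
qed simp

text \<open>With y = 1/x the factor \<open>[:0, 0, 1:]\<close> is y^2, coming from dy/dx = - y^2. At
  0 the right difference quotient is again a polynomial in y times exp(-y), which tends to
  0.\<close>

lemma flat_has_derivative:
  "(flat p has_real_derivative flat ((p - pderiv p) * [:0, 0, 1:]) x) (at x)"
proof -
  consider "x < 0" | "x = 0" | "x > 0" by linarith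
  then show ?thesis
  proof cases
    case 1
    have "((\<lambda>x. 0) has_real_derivative 0) (at x)" by simp
    moreover have "eventually (\<lambda>y. 0 = flat p y) (nhds x)"
      using eventually_nhds_in_open[of "{..<0}" x] 1 by (auto simp: flat_def elim!: eventually_mono)
    ultimately show ?thesis using 1 by (simp add: flat_def DERIV_cong_ev)
  next
    case 3
    have "((\<lambda>x. poly p (1 / x) * exp (- (1 / x))) has_real_derivative
        flat ((p - pderiv p) * [:0, 0, 1:]) x) (at x)"
      using 3 by (auto intro!: derivative_eq_intros DERIV_chain2[OF poly_DERIV] simp: flat_def field_simps power2_eq_square)
    moreover have "eventually (\<lambda>y. poly p (1 / y) * exp (- (1 / y)) = flat p y) (nhds x)"
      using eventually_nhds_in_open[of "{0<..}" x] 3 by (auto simp: flat_def elim!: eventually_mono)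
    ultimately show ?thesis by (simp add: DERIV_cong_ev)
  next
    case 2
    have "((\<lambda>h. poly (pCons 0 p) (1 / h) * exp (- (1 / h))) \<longlongrightarrow> (0::real)) (at_right 0)"
      using filterlim_compose[OF poly_exp_tendsto_0[of "pCons 0 p"] filterlim_inverse_at_top_right]
      by (simp add: inverse_eq_divide)
    moreover have "eventually (\<lambda>h. poly (pCons 0 p) (1 / h) * exp (- (1 / h)) = flat p h / h) (at_right (0::real))"
      by (auto simp: flat_def eventually_at_filter)
    ultimately have R: "((\<lambda>h. flat p h / h) \<longlongrightarrow> 0) (at_right 0)" by (rule Lim_transform_eventually)
    have "eventually (\<lambda>h. 0 = flat p h / h) (at_left (0::real))"
      by (auto simp: flat_def eventually_at_filter)
    then have L: "((\<lambda>h. flat p h / h) \<longlongrightarrow> 0) (at_left 0)" by (rule Lim_transform_eventually[OF tendsto_const])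
    have "((\<lambda>h. flat p h / h) \<longlongrightarrow> 0) (at 0)" by (rule filterlim_split_at[OF L R])
    then show ?thesis using 2 by (simp add: DERIV_def flat_def)
  qed
qed

lemma Ck_flat: "Ck k (flat p)"
proof (induction k arbitrary: p)
  case 0
  show ?case by (auto intro!: continuous_at_imp_continuous_on DERIV_isCont[OF flat_has_derivative])
next
  case (Suc k)
  have "flat p differentiable_on UNIV"
    using flat_has_derivative by (auto simp: differentiable_on_def has_field_derivative_def differentiable_def intro: has_derivative_at_withinI)
  then show ?case using Suc by (simp add: frechet_derivative_real[OF flat_has_derivative])
qed

text \<open>A product of flat profiles of the distances to all faces. The scale \<open>Suc n\<close>
  makes the cutoffs tend to the indicator of the open box; the arguments are written as inner
  product plus constant to match \<open>Ck_affine\<close>.\<close>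

definition box_cutoff :: "'a::euclidean_space \<Rightarrow> 'a \<Rightarrow> nat \<Rightarrow> 'a \<Rightarrow> real" where
  "box_cutoff a b n x = (\<Prod>i\<in>Basis. flat 1 (x \<bullet> (real (Suc n) *\<^sub>R i) + (- real (Suc n) * (a \<bullet> i))) *
     flat 1 (x \<bullet> (- real (Suc n) *\<^sub>R i) + real (Suc n) * (b \<bullet> i)))"

lemma box_cutoff_eq:
  "box_cutoff a b n x = (\<Prod>i\<in>Basis. flat 1 (real (Suc n) * (x \<bullet> i - a \<bullet> i)) * flat 1 (real (Suc n) * (b \<bullet> i - x \<bullet> i)))"
  by (simp add: box_cutoff_def algebra_simps)

lemma Ck_box_cutoff: "Ck k (box_cutoff a b n)"
  unfolding box_cutoff_def by (intro Ck_prod Ck_mult Ck_affine Ck_flat)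

lemma flat_1_bounds: "0 \<le> flat 1 x" "flat 1 x \<le> 1"
  by (auto simp: flat_def)

lemma box_cutoff_bounds: "0 \<le> box_cutoff a b n x" "box_cutoff a b n x \<le> 1"
  unfolding box_cutoff_def
  by (auto intro!: prod_nonneg prod_le_1 mult_nonneg_nonneg mult_le_one simp: flat_1_bounds simp del: of_nat_Suc)

lemma box_cutoff_pos_iff: "box_cutoff a b n x \<noteq> 0 \<longleftrightarrow> x \<in> box a b"
  by (auto simp: box_cutoff_eq mem_box flat_def zero_less_mult_iff simp del: of_nat_Suc)

lemma box_cutoff_tendsto: "(\<lambda>n. box_cutoff a b n x) \<longlonglongrightarrow> indicator (box a b) x"
proof (cases "x \<in> box a b")
  case True
  have f: "(\<lambda>n. flat 1 (real (Suc n) * c)) \<longlonglongrightarrow> 1" if "0 < c" for c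
  proof -
    have "(\<lambda>n. exp (- (inverse (real (Suc n)) * (1 / c)))) \<longlonglongrightarrow> exp (- (0 * (1 / c)))"
      by (intro tendsto_intros LIMSEQ_inverse_real_of_nat)
    moreover have "exp (- (inverse (real (Suc n)) * (1 / c))) = flat 1 (real (Suc n) * c)" for n
      using that by (simp add: flat_def field_simps del: of_nat_Suc)
    ultimately show ?thesis by simp
  qed
  have "(\<lambda>n. box_cutoff a b n x) \<longlonglongrightarrow> (\<Prod>i\<in>(Basis::'a set). 1 * 1)"
    unfolding box_cutoff_eq using True by (intro tendsto_intros f) (auto simp: mem_box)
  then show ?thesis using True by simp
next
  case False
  then have "box_cutoff a b n x = 0" for n using box_cutoff_pos_iff[of a b n x] by auto
  then show ?thesis using False by simp
qed

lemma box_cutoff_test: assumes "cbox a b \<subseteq> \<Omega>" shows "box_cutoff a b n \<in> test_functions \<Omega>"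
proof -
  have "closure {x. box_cutoff a b n x \<noteq> 0} \<subseteq> cbox a b"
    by (intro closure_minimal) (auto simp: box_cutoff_pos_iff box_subset_cbox subset_iff simp flip: mem_box intro: subsetD[OF box_subset_cbox])
  moreover from this have "compact (closure {x. box_cutoff a b n x \<noteq> 0})"
    by (meson bounded_cbox bounded_subset closed_closure compact_eq_bounded_closed)
  ultimately show ?thesis using assms Ck_box_cutoff[of _ a b n] by (auto simp: test_functions_def)
qed

section \<open>The fundamental lemma of the calculus of variations\<close>

text \<open>The cutoffs are bounded by 1 and tend to the indicator of the open box, so the vanishing
  integrals pass to the limit by dominated convergence; the faces of the box are negligible.\<close>

lemma weak_zero_box:
  fixes g :: "real ^ 'd \<Rightarrow> 'b::euclidean_space"
  assumes \<Omega>: "open \<Omega>" and g: "locally_integrable \<Omega> g"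
    and zero: "\<And>\<phi>::real ^ 'd \<Rightarrow> real. \<phi> \<in> test_functions \<Omega> \<Longrightarrow> (LINT x|lebesgue_on \<Omega>. \<phi> x *\<^sub>R g x) = 0"
    and ab: "cbox a b \<subseteq> \<Omega>"
  shows "integral (cbox a b) g = 0"
proof -
  have gi: "integrable lebesgue (\<lambda>x. indicator (cbox a b) x *\<^sub>R g x)"
    using g ab by (auto simp: locally_integrable_def set_integrable_def)
  have "(\<lambda>n. LINT x|lebesgue. box_cutoff a b n x *\<^sub>R (indicator (cbox a b) x *\<^sub>R g x)) \<longlonglongrightarrow>
      (LINT x|lebesgue. indicator (box a b) x *\<^sub>R (indicator (cbox a b) x *\<^sub>R g x))"
  proof (rule integral_dominated_convergence[where w = "\<lambda>x. norm (indicator (cbox a b) x *\<^sub>R g x)"])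
    have c: "continuous_on UNIV (box_cutoff a b n)" for n using Ck_box_cutoff[of 0 a b n] by simp
    have "box_cutoff a b n \<in> borel_measurable lebesgue" for n
      using borel_measurable_continuous_onI[OF c] by (simp add: measurable_completion)
    then show "(\<lambda>x. box_cutoff a b n x *\<^sub>R (indicator (cbox a b) x *\<^sub>R g x)) \<in> borel_measurable lebesgue" for n
      by (rule borel_measurable_scaleR[OF _ borel_measurable_integrable[OF gi]])
    show "(\<lambda>x. indicator (box a b) x *\<^sub>R (indicator (cbox a b) x *\<^sub>R g x)) \<in> borel_measurable lebesgue"
      by (rule borel_measurable_scaleR[OF _ borel_measurable_integrable[OF gi]]) (simp add: borel_measurable_indicator)
    show "AE x in lebesgue. (\<lambda>n. box_cutoff a b n x *\<^sub>R (indicator (cbox a b) x *\<^sub>R g x)) \<longlonglongrightarrow>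
        indicator (box a b) x *\<^sub>R (indicator (cbox a b) x *\<^sub>R g x)"
      by (intro AE_I2 tendsto_intros box_cutoff_tendsto)
    show "AE x in lebesgue. norm (box_cutoff a b n x *\<^sub>R (indicator (cbox a b) x *\<^sub>R g x)) \<le> norm (indicator (cbox a b) x *\<^sub>R g x)" for n
      using box_cutoff_bounds[of a b n] by (intro AE_I2) (auto simp: indicator_def intro!: mult_left_le_one_le)
  qed (use integrable_norm[OF gi] in auto)
  moreover have "(LINT x|lebesgue. box_cutoff a b n x *\<^sub>R (indicator (cbox a b) x *\<^sub>R g x)) = 0" for n
  proof -
    have "(LINT x|lebesgue. box_cutoff a b n x *\<^sub>R (indicator (cbox a b) x *\<^sub>R g x)) =
      (LINT x|lebesgue. indicator \<Omega> x *\<^sub>R (box_cutoff a b n x *\<^sub>R g x))"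
      using ab box_cutoff_pos_iff[of a b n] box_subset_cbox[of a b]
      by (intro Bochner_Integration.integral_cong) (auto simp: indicator_def)
    also have "\<dots> = (LINT x|lebesgue_on \<Omega>. box_cutoff a b n x *\<^sub>R g x)"
      using \<Omega> by (simp add: integral_restrict_space)
    finally show ?thesis using zero[OF box_cutoff_test[OF ab]] by simp
  qed
  ultimately have "(LINT x|lebesgue. indicator (box a b) x *\<^sub>R (indicator (cbox a b) x *\<^sub>R g x)) = 0"
    by (simp add: LIMSEQ_const_iff)
  moreover have "(\<lambda>x. indicator (box a b) x *\<^sub>R (indicator (cbox a b) x *\<^sub>R g x)) = (\<lambda>x. indicator (box a b) x *\<^sub>R g x)"
    using box_subset_cbox[of a b] by (auto simp: indicator_def fun_eq_iff)
  ultimately have z: "(LINT x:box a b|lebesgue. g x) = 0" by (simp add: set_lebesgue_integral_def)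
  have "set_integrable lebesgue (cbox a b) g" using gi by (simp add: set_integrable_def)
  then have "set_integrable lebesgue (box a b) g" by (rule set_integrable_subset) (simp_all add: box_subset_cbox)
  then have "integral (box a b) g = 0" using z set_lebesgue_integral_eq_integral(2)[of "box a b" g] by simp
  then show ?thesis by (simp add: integral_open_interval)
qed

text \<open>By Lebesgue differentiation \<open>g x\<close> is, for almost every \<open>x\<close>, a
  limit of averages over small cubes with corner \<open>x\<close>, and \<open>weak_zero_box\<close>
  makes these averages vanish. Countably many closed boxes cover the open set.\<close>

lemma weak_zero_imp_AE_zero:
  fixes g :: "real ^ 'd \<Rightarrow> 'b::euclidean_space"
  assumes \<Omega>: "open \<Omega>" and g: "locally_integrable \<Omega> g"
    and zero: "\<And>\<phi>::real ^ 'd \<Rightarrow> real. \<phi> \<in> test_functions \<Omega> \<Longrightarrow> (LINT x|lebesgue_on \<Omega>. \<phi> x *\<^sub>R g x) = 0"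
  shows "AE x in lebesgue_on \<Omega>. g x = 0"
proof -
  have box: "negligible {x \<in> box c d. g x \<noteq> 0}" if cd: "cbox c d \<subseteq> \<Omega>" for c d
  proof -
    \<comment> \<open>The differentiation theorem asks for integrability on every box, so
      \<open>g\<close> is cut off to the box under consideration; small cubes at an interior point
      do not see the cut.\<close>
    define f where "f = (\<lambda>x. indicator (cbox c d) x *\<^sub>R g x)"
    have fi: "integrable lebesgue f"
      using g cd by (auto simp: locally_integrable_def set_integrable_def f_def)
    have "f absolutely_integrable_on UNIV" using fi by (simp add: set_integrable_def)
    then have "f integrable_on cbox a b" for a b
      by (intro integrable_on_subcbox[of f UNIV]) (auto intro: set_lebesgue_integral_eq_integral(1))
    then obtain N where N: "negligible N" "\<And>x e. \<lbrakk>x \<notin> N; 0 < e\<rbrakk> \<Longrightarrow> \<exists>\<delta>>0. \<forall>h. 0 < h \<and> h < \<delta> \<longrightarrow>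
        norm (integral (cbox x (x + h *\<^sub>R One)) f /\<^sub>R h ^ DIM(real ^ 'd) - f x) < e"
      using integrable_ccontinuous_explicit[of f] by blast
    have "g x = 0" if x: "x \<in> box c d" "x \<notin> N" for x
    proof (rule ccontr)
      assume "g x \<noteq> 0"
      have xc: "x \<in> cbox c d" using x box_subset_cbox by blast
      obtain \<delta> where \<delta>: "0 < \<delta>" "\<And>h. 0 < h \<Longrightarrow> h < \<delta> \<Longrightarrow>
          norm (integral (cbox x (x + h *\<^sub>R One)) f /\<^sub>R h ^ DIM(real ^ 'd) - f x) < norm (g x)"
        using N(2)[OF x(2), of "norm (g x)"] \<open>g x \<noteq> 0\<close> by auto
      have "eventually (\<lambda>h. x + h *\<^sub>R One \<in> box c d) (at_right 0)"
      proof -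
        have "((\<lambda>h. x + h *\<^sub>R One) \<longlongrightarrow> x + 0 *\<^sub>R One) (at_right (0::real))" by (intro tendsto_intros)
        then show ?thesis using x(1) open_box topological_tendstoD by fastforce
      qed
      moreover have "eventually (\<lambda>h. h < \<delta>) (at_right 0)" using \<delta>(1) eventually_at_right by auto
      moreover have "eventually (\<lambda>h. 0 < h) (at_right (0::real))" by (simp add: eventually_at_filter)
      ultimately have "eventually (\<lambda>h. x + h *\<^sub>R One \<in> box c d \<and> h < \<delta> \<and> 0 < h) (at_right 0)"
        by eventually_elim auto
      then obtain h where h: "x + h *\<^sub>R One \<in> box c d" "0 < h" "h < \<delta>"
        using eventually_happens[of _ "at_right (0::real)"] by auto
      have sub: "cbox x (x + h *\<^sub>R One) \<subseteq> cbox c d"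
      proof
        fix y assume y: "y \<in> cbox x (x + h *\<^sub>R One)"
        have "c \<bullet> i \<le> y \<bullet> i \<and> y \<bullet> i \<le> d \<bullet> i" if i: "i \<in> Basis" for i
        proof -
          have "c \<bullet> i \<le> x \<bullet> i" using xc i unfolding mem_box by blast
          moreover have "x \<bullet> i \<le> y \<bullet> i" "y \<bullet> i \<le> (x + h *\<^sub>R One) \<bullet> i" using y i unfolding mem_box by blast+
          moreover have "(x + h *\<^sub>R One) \<bullet> i < d \<bullet> i" using h(1) i unfolding mem_box by blast
          ultimately show ?thesis by linarith
        qed
        then show "y \<in> cbox c d" unfolding mem_box by blast
      qed
      have "integral (cbox x (x + h *\<^sub>R One)) f = integral (cbox x (x + h *\<^sub>R One)) g"
        using sub by (intro integral_cong) (auto simp: f_def indicator_def)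
      also have "\<dots> = 0" using sub cd by (intro weak_zero_box[OF \<Omega> g zero]) auto
      finally show False using \<delta>(2)[OF h(2,3)] xc by (simp add: f_def)
    qed
    then show ?thesis by (intro negligible_subset[OF N(1)]) auto
  qed
  obtain \<D> where D: "countable \<D>" "\<D> \<subseteq> Pow \<Omega>" "\<And>X. X \<in> \<D> \<Longrightarrow> \<exists>a b. X = cbox a b"
     and un: "\<Union>\<D> = \<Omega>"
    using open_countable_Union_open_cbox[OF \<Omega>] by blast
  have neg: "negligible {x \<in> X. g x \<noteq> 0}" if "X \<in> \<D>" for X
  proof -
    obtain c d where X: "X = cbox c d" using D(3)[OF \<open>X \<in> \<D>\<close>] by blast
    have "negligible {x \<in> box c d. g x \<noteq> 0}" using D(2) that X by (intro box) auto
    moreover have "negligible (cbox c d - box c d)" by (rule negligible_frontier_interval)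
    ultimately have "negligible ({x \<in> box c d. g x \<noteq> 0} \<union> (cbox c d - box c d))" by (rule negligible_Un)
    moreover    have "{x \<in> X. g x \<noteq> 0} \<subseteq> {x \<in> box c d. g x \<noteq> 0} \<union> (cbox c d - box c d)" using X by auto
    ultimately show ?thesis by (rule negligible_subset)
  qed
  have "{x \<in> \<Omega>. g x \<noteq> 0} = (\<Union>X\<in>\<D>. {x \<in> X. g x \<noteq> 0})" using un by auto
  then have "negligible {x \<in> \<Omega>. g x \<noteq> 0}" using negligible_countable_Union[of "(\<lambda>X. {x \<in> X. g x \<noteq> 0}) ` \<D>"] D(1) neg by auto
  then have "AE x in lebesgue. x \<notin> {x \<in> \<Omega>. g x \<noteq> 0}" by (intro AE_not_in) (simp add: negligible_iff_null_sets)
  then have "AE x in lebesgue. x \<in> \<Omega> \<longrightarrow> g x = 0" by (rule AE_mp) auto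
  then show ?thesis using \<Omega> by (subst AE_restrict_space_iff) auto
qed

section \<open>Integration by parts against test functions\<close>

lemma test_functionsD:
  assumes "\<phi> \<in> test_functions \<Omega>"
  shows "Ck k \<phi>" "compact (closure {x. \<phi> x \<noteq> 0})" "closure {x. \<phi> x \<noteq> 0} \<subseteq> \<Omega>" "continuous_on UNIV \<phi>"
    "(\<phi> has_derivative frechet_derivative \<phi> (at x)) (at x)"
  using assms Ck_differentiable[of 0 \<phi> x]
  by (auto simp: test_functions_def frechet_derivative_works dest: spec[of _ 0] spec[of _ "Suc 0"])

lemma test_functions_diff:
  assumes "\<phi> \<in> test_functions \<Omega>" "\<psi> \<in> test_functions \<Omega>"
  shows "(\<lambda>x. \<phi> x - \<psi> x) \<in> test_functions \<Omega>"
proof -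
  have "Ck k (\<lambda>x. \<phi> x + (-1) *\<^sub>R \<psi> x)" for k
    by (intro Ck_add Ck_scaleR test_functionsD[OF assms(1)] test_functionsD[OF assms(2)])
  moreover have sub: "closure {x. \<phi> x - \<psi> x \<noteq> 0} \<subseteq> closure {x. \<phi> x \<noteq> 0} \<union> closure {x. \<psi> x \<noteq> 0}"
    unfolding closure_Un[symmetric] by (intro closure_mono) auto
  moreover have "compact (closure {x. \<phi> x - \<psi> x \<noteq> 0})"
    using compact_Un[OF test_functionsD(2)[OF assms(1)] test_functionsD(2)[OF assms(2)]] sub
    by (meson bounded_subset closed_closure compact_eq_bounded_closed)
  ultimately show ?thesis using test_functionsD(3)[OF assms(1)] test_functionsD(3)[OF assms(2)]
    by (auto simp: test_functions_def)
qed

lemma test_functions_scaleR: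
  assumes "\<phi> \<in> test_functions \<Omega>" shows "(\<lambda>x. c *\<^sub>R \<phi> x) \<in> test_functions \<Omega>"
proof -
  have sub: "closure {x. c *\<^sub>R \<phi> x \<noteq> 0} \<subseteq> closure {x. \<phi> x \<noteq> 0}" by (intro closure_mono) auto
  moreover have "compact (closure {x. c *\<^sub>R \<phi> x \<noteq> 0})"
    using test_functionsD(2)[OF assms] sub by (meson bounded_subset closed_closure compact_eq_bounded_closed)
  ultimately show ?thesis using test_functionsD(1,3)[OF assms]
    by (auto simp: test_functions_def intro: Ck_scaleR)
qed

lemma test_functions_zero: "(\<lambda>x. 0) \<in> test_functions \<Omega>"
  by (auto simp: test_functions_def Ck_const)

lemma has_derivative_zero_outside:
  assumes "(u has_derivative D) (at x)" "closed K" "\<And>y. y \<notin> K \<Longrightarrow> u y = 0" "x \<notin> K"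
  shows "D e = 0"
proof -
  have "((\<lambda>y. 0) has_derivative D) (at x)"
    using assms by (intro has_derivative_transform_within_open[OF assms(1), of "- K"]) auto
  then have "D = (\<lambda>h. 0)" using has_derivative_unique has_derivative_const by blast
  then show ?thesis by simp
qed

lemma test_functions_partial:
  fixes \<phi> :: "'a::euclidean_space \<Rightarrow> 'b::real_normed_vector"
  assumes "\<phi> \<in> test_functions \<Omega>" "e \<in> Basis"
  shows "(\<lambda>x. frechet_derivative \<phi> (at x) e) \<in> test_functions \<Omega>"
proof -
  have "Ck k (\<lambda>x. frechet_derivative \<phi> (at x) e)" for k
    using test_functionsD(1)[OF assms(1), of "Suc k"] assms(2) by simp
  moreover have "{x. frechet_derivative \<phi> (at x) e \<noteq> 0} \<subseteq> closure {x. \<phi> x \<noteq> 0}"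
    using has_derivative_zero_outside[OF test_functionsD(5)[OF assms(1)] closed_closure]
      closure_subset[of "{x. \<phi> x \<noteq> 0}"] by blast
  then have sub: "closure {x. frechet_derivative \<phi> (at x) e \<noteq> 0} \<subseteq> closure {x. \<phi> x \<noteq> 0}"
    by (simp add: closure_minimal)
  moreover have "compact (closure {x. frechet_derivative \<phi> (at x) e \<noteq> 0})"
    using test_functionsD(2)[OF assms(1)] sub by (meson bounded_subset closed_closure compact_eq_bounded_closed)
  ultimately show ?thesis using test_functionsD(3)[OF assms(1)] by (auto simp: test_functions_def)
qed

lemma integrable_continuous_compact_support:
  fixes f :: "'a::euclidean_space \<Rightarrow> 'b::euclidean_space"
  assumes "continuous_on UNIV f" "compact K" "\<And>x. x \<notin> K \<Longrightarrow> f x = 0"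
  shows "integrable lborel f" "integrable lebesgue f"
proof -
  have "(\<lambda>x. indicator K x *\<^sub>R f x) = f" using assms(3) by (auto simp: indicator_def fun_eq_iff)
  then show "integrable lborel f"
    using borel_integrable_compact[OF assms(2) continuous_on_subset[OF assms(1)]] by (metis subset_UNIV)
  then show "integrable lebesgue f"
    by (simp add: integrable_completion)
qed

text \<open>Differentiation under the translation-invariant integral.\<close>

lemma integral_directional_derivative_zero:
  fixes u :: "'a::euclidean_space \<Rightarrow> real"
  assumes D: "\<And>x. (u has_derivative D x) (at x)" and c: "continuous_on UNIV (\<lambda>x. D x e)"
    and K: "compact K" "\<And>x. x \<notin> K \<Longrightarrow> u x = 0"
  shows "(LINT x|lebesgue. D x e) = 0"
proof -
  have cu: "continuous_on UNIV u" by (intro continuous_at_imp_continuous_on ballI has_derivative_continuous[OF D])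
  note [measurable] = borel_measurable_continuous_onI[OF cu] borel_measurable_continuous_onI[OF c]
  have D0: "D x e = 0" if "x \<notin> K" for x using has_derivative_zero_outside[OF D compact_imp_closed[OF K(1)] K(2) that] .
  have "bounded ((\<lambda>x. D x e) ` K)"
    by (intro compact_imp_bounded compact_continuous_image K continuous_on_subset[OF c]) auto
  then obtain B where B: "0 < B" "\<And>x. x \<in> K \<Longrightarrow> \<bar>D x e\<bar> \<le> B" by (auto simp: bounded_pos)
  then have Ball: "\<bar>D x e\<bar> \<le> B" for x using D0[of x] by (cases "x \<in> K") auto
  \<comment> \<open>The support swept backwards along \<open>e\<close> over unit time. Outside it
    all difference quotients with step at most 1 vanish, so a multiple of its indicator dominates
    them.\<close>
  define K' where "K' = (\<lambda>(x, t). x - t *\<^sub>R e) ` (K \<times> {0..1})"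
  have K': "compact K'"
    unfolding K'_def by (intro compact_continuous_image compact_Times K) (auto simp: case_prod_unfold intro!: continuous_intros)
  have inK': "x \<in> K'" if "x + t *\<^sub>R e \<in> K" "0 \<le> t" "t \<le> 1" for x t
    unfolding K'_def using that by (intro image_eqI[of _ _ "(x + t *\<^sub>R e, t)"]) auto
  \<comment> \<open>Each difference quotient has integral 0, since the two integrals differ by a
    translation; the mean value theorem bounds it by a maximum of the derivative.\<close>
  define F where "F = (\<lambda>n x. (u (x + inverse (real (Suc n)) *\<^sub>R e) - u x) / inverse (real (Suc n)))"
  have DF: "((\<lambda>t. u (x + t *\<^sub>R e)) has_real_derivative D (x + t *\<^sub>R e) e) (at t)" for x t
  proof -
    have "((\<lambda>t. u (x + t *\<^sub>R e)) has_derivative (\<lambda>h. D (x + t *\<^sub>R e) (h *\<^sub>R e))) (at t)"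
      by (rule has_derivative_compose[OF _ D]) (auto intro!: derivative_eq_intros)
    moreover have "D (x + t *\<^sub>R e) (h *\<^sub>R e) = D (x + t *\<^sub>R e) e * h" for h
      using linear_scale[OF has_derivative_linear[OF D], of "x + t *\<^sub>R e" h e] by simp
    ultimately show ?thesis by (simp add: has_field_derivative_def)
  qed
  have "(\<lambda>n. LINT x|lborel. F n x) \<longlonglongrightarrow> (LINT x|lborel. D x e)"
  proof (rule integral_dominated_convergence[where w = "\<lambda>x. indicator K' x *\<^sub>R B"])
    show "F n \<in> borel_measurable lborel" for n unfolding F_def by measurable
    show "(\<lambda>x. D x e) \<in> borel_measurable lborel" by measurable
    show "integrable lborel (\<lambda>x. indicator K' x *\<^sub>R B)"
      by (intro borel_integrable_compact K') auto
    show "AE x in lborel. (\<lambda>n. F n x) \<longlonglongrightarrow> D x e"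
    proof (rule AE_I2)
      fix x
      have "((\<lambda>h. (u (x + h *\<^sub>R e) - u x) / h) \<longlongrightarrow> D x e) (at 0)"
        using DF[of x 0] by (simp add: DERIV_def)
      moreover have "filterlim (\<lambda>n. inverse (real (Suc n))) (at 0) sequentially"
        using LIMSEQ_inverse_real_of_nat by (auto simp: filterlim_at)
      ultimately show "(\<lambda>n. F n x) \<longlonglongrightarrow> D x e" unfolding F_def by (rule filterlim_compose)
    qed
    show "AE x in lborel. norm (F n x) \<le> indicator K' x *\<^sub>R B" for n
    proof (rule AE_I2)
      fix x
      define t where "t = inverse (real (Suc n))"
      have t: "0 < t" "t \<le> 1" by (auto simp: t_def field_simps)
      obtain \<xi> where \<xi>: "0 < \<xi>" "\<xi> < t" "u (x + t *\<^sub>R e) - u (x + 0 *\<^sub>R e) = (t - 0) * D (x + \<xi> *\<^sub>R e) e"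
        using MVT2[of 0 t "\<lambda>t. u (x + t *\<^sub>R e)" "\<lambda>t. D (x + t *\<^sub>R e) e"] DF t by auto
      then have "F n x = D (x + \<xi> *\<^sub>R e) e" using t by (simp add: F_def t_def[symmetric] del: of_nat_Suc)
      then show "norm (F n x) \<le> indicator K' x *\<^sub>R B"
        using Ball[of "x + \<xi> *\<^sub>R e"] D0[of "x + \<xi> *\<^sub>R e"] inK'[of x \<xi>] \<xi> t by (cases "x \<in> K'") auto
    qed
  qed
  moreover have "(LINT x|lborel. F n x) = 0" for n
  proof -
    have ui: "integrable lborel u" by (rule integrable_continuous_compact_support[OF cu K])
    have eq: "lborel = distr lborel borel (\<lambda>x. inverse (real (Suc n)) *\<^sub>R e + x)"
      using lborel_distr_plus[of "inverse (real (Suc n)) *\<^sub>R e"] by simp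
    have "integrable (distr lborel borel (\<lambda>x. inverse (real (Suc n)) *\<^sub>R e + x)) u" using ui eq by simp
    then have 1: "integrable lborel (\<lambda>x. u (inverse (real (Suc n)) *\<^sub>R e + x))"
      by (subst (asm) integrable_distr_eq) auto
    have 2: "(LINT x|lborel. u (inverse (real (Suc n)) *\<^sub>R e + x)) = (LINT x|lborel. u x)"
      by (subst (2) eq, subst integral_distr) auto
    show ?thesis using 1 2 ui unfolding F_def by (simp add: add.commute)
  qed
  ultimately have "(LINT x|lborel. D x e) = 0" by (simp add: LIMSEQ_const_iff)
  then show ?thesis by (simp add: integral_completion)
qed

lemma lebesgue_on_integral_support:
  fixes f :: "'a::euclidean_space \<Rightarrow> 'b::euclidean_space"
  assumes "\<Omega> \<in> sets lebesgue" "\<And>x. x \<notin> \<Omega> \<Longrightarrow> f x = 0"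
  shows "(LINT x|lebesgue_on \<Omega>. f x) = (LINT x|lebesgue. f x)"
  using assms by (subst integral_restrict_space) (auto intro!: Bochner_Integration.integral_cong simp: indicator_def)

lemma locally_integrable_continuous:
  assumes "continuous_on UNIV f" shows "locally_integrable \<Omega> f"
  unfolding locally_integrable_def set_integrable_def
proof (intro allI impI)
  fix K assume "compact K \<and> K \<subseteq> \<Omega>"
  then have "integrable lborel (\<lambda>x. indicator K x *\<^sub>R f x)"
    using assms by (intro borel_integrable_compact) (auto intro: continuous_on_subset)
  then show "integrable lebesgue (\<lambda>x. indicator K x *\<^sub>R f x)"
    using borel_measurable_integrable by (subst integrable_completion) auto
qed

text \<open>For each coordinate \<open>b\<close>, the product of \<psi> and the
  \<open>b\<close>-component of \<phi> has compact support, so its directional derivative integrates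
  to 0; the product rule turns this into the defining identity.\<close>

lemma has_weak_partial_test:
  fixes \<phi> :: "real ^ 'd \<Rightarrow> 'b::euclidean_space"
  assumes \<Omega>: "open \<Omega>" and \<phi>: "\<phi> \<in> test_functions \<Omega>"
  shows "has_weak_partial \<Omega> j \<phi> (\<lambda>x. frechet_derivative \<phi> (at x) (axis j 1))"
proof -
  define \<phi>' where "\<phi>' = (\<lambda>x. frechet_derivative \<phi> (at x) (axis j 1))"
  have j: "axis j 1 \<in> (Basis :: (real ^ 'd) set)" by simp
  have \<phi>'t: "\<phi>' \<in> test_functions \<Omega>" unfolding \<phi>'_def by (rule test_functions_partial[OF \<phi> j])
  have "(LINT x|lebesgue_on \<Omega>. frechet_derivative \<psi> (at x) (axis j 1) *\<^sub>R \<phi> x) = - (LINT x|lebesgue_on \<Omega>. \<psi> x *\<^sub>R \<phi>' x)"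
    if \<psi>: "\<psi> \<in> test_functions \<Omega>" for \<psi> :: "real ^ 'd \<Rightarrow> real"
  proof -
    define \<psi>' where "\<psi>' = (\<lambda>x. frechet_derivative \<psi> (at x) (axis j 1))"
    define K where "K = closure {x. \<psi> x \<noteq> 0}"
    have \<psi>'t: "\<psi>' \<in> test_functions \<Omega>" unfolding \<psi>'_def by (rule test_functions_partial[OF \<psi> j])
    have K: "compact K" "K \<subseteq> \<Omega>" "\<And>x. x \<notin> K \<Longrightarrow> \<psi> x = 0"
      using test_functionsD(2,3)[OF \<psi>] closure_subset[of "{x. \<psi> x \<noteq> 0}"] by (auto simp: K_def)
    have K0: "\<psi>' x = 0" if "x \<notin> K" for x
      unfolding \<psi>'_def by (rule has_derivative_zero_outside[OF test_functionsD(5)[OF \<psi>] compact_imp_closed[OF K(1)] K(3) that])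
    note cont = test_functionsD(4)[OF \<phi>] test_functionsD(4)[OF \<phi>'t] test_functionsD(4)[OF \<psi>] test_functionsD(4)[OF \<psi>'t]
    have i1: "integrable lebesgue (\<lambda>x. \<psi>' x *\<^sub>R \<phi> x)" and i2: "integrable lebesgue (\<lambda>x. \<psi> x *\<^sub>R \<phi>' x)"
      by (rule integrable_continuous_compact_support(2)[OF _ K(1)]; use K K0 cont in \<open>auto intro: continuous_intros\<close>)+
    have "(LINT x|lebesgue. \<psi>' x *\<^sub>R \<phi> x + \<psi> x *\<^sub>R \<phi>' x) = 0"
    proof (rule euclidean_eqI)
      fix b :: 'b assume "b \<in> Basis"
      have "((\<lambda>x. \<psi> x * (\<phi> x \<bullet> b)) has_derivative
          (\<lambda>e. \<psi> x * (frechet_derivative \<phi> (at x) e \<bullet> b) + frechet_derivative \<psi> (at x) e * (\<phi> x \<bullet> b))) (at x)" for x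
        by (intro has_derivative_mult test_functionsD(5)[OF \<psi>] has_derivative_inner_left test_functionsD(5)[OF \<phi>])
      moreover have cont2: "continuous_on UNIV (\<lambda>x. \<psi> x * (\<phi>' x \<bullet> b) + \<psi>' x * (\<phi> x \<bullet> b))"
        by (intro continuous_intros cont)
      note calculation
      from integral_directional_derivative_zero[OF this, of "axis j 1" K]
      have "(LINT x|lebesgue. \<psi> x * (\<phi>' x \<bullet> b) + \<psi>' x * (\<phi> x \<bullet> b)) = 0"
        using K cont2 unfolding \<phi>'_def \<psi>'_def by auto
      then show "(LINT x|lebesgue. \<psi>' x *\<^sub>R \<phi> x + \<psi> x *\<^sub>R \<phi>' x) \<bullet> b = 0 \<bullet> b"
        using i1 i2 by (subst integral_inner_left[symmetric]) (auto simp: inner_add_left add.commute)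
    qed
    then have "(LINT x|lebesgue. \<psi>' x *\<^sub>R \<phi> x) = - (LINT x|lebesgue. \<psi> x *\<^sub>R \<phi>' x)"
      using i1 i2 by (simp add: eq_neg_iff_add_eq_0)
    moreover have "\<psi>' x *\<^sub>R \<phi> x = 0" "\<psi> x *\<^sub>R \<phi>' x = 0" if "x \<notin> \<Omega>" for x
      using K K0[of x] that by auto
    ultimately have "(LINT x|lebesgue_on \<Omega>. \<psi>' x *\<^sub>R \<phi> x) = - (LINT x|lebesgue_on \<Omega>. \<psi> x *\<^sub>R \<phi>' x)"
      using \<Omega> lebesgue_on_integral_support[of \<Omega> "\<lambda>x. \<psi>' x *\<^sub>R \<phi> x"]
        lebesgue_on_integral_support[of \<Omega> "\<lambda>x. \<psi> x *\<^sub>R \<phi>' x"] by simp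
    then show ?thesis by (simp add: \<psi>'_def)
  qed
  then show ?thesis unfolding has_weak_partial_def \<phi>'_def[symmetric]
    using test_functionsD(4)[OF \<phi>] test_functionsD(4)[OF \<phi>'t] by (auto intro: locally_integrable_continuous)
qed

section \<open>Weak derivatives on an interval\<close>

text \<open>The primitive of a bump on (0,1), divided by the total mass of the bump; \<sigma> is
  then a mollifier of mass 1.\<close>

lemma smooth_step_exists:
  obtains S \<sigma> :: "real \<Rightarrow> real" where "\<And>k. Ck k S" "\<And>x. (S has_real_derivative \<sigma> x) (at x)"
    "continuous_on UNIV \<sigma>" "\<And>x. 0 \<le> \<sigma> x" "\<And>x. x \<notin> {0..1} \<Longrightarrow> \<sigma> x = 0"
    "\<And>x. x \<le> 0 \<Longrightarrow> S x = 0" "\<And>x. 1 \<le> x \<Longrightarrow> S x = 1" "\<And>x. 0 \<le> S x" "\<And>x. S x \<le> 1"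
proof -
  define r where "r = box_cutoff (0::real) 1 0"
  have r: "\<And>k. Ck k r" "\<And>x. 0 \<le> r x" "\<And>x. r x \<noteq> 0 \<longleftrightarrow> x \<in> {0<..<1}"
    using Ck_box_cutoff box_cutoff_bounds box_cutoff_pos_iff[of 0 "1::real" 0] by (auto simp: r_def)
  have cr: "continuous_on A r" for A using r(1)[of 0] by (auto intro: continuous_on_subset)
  \<comment> \<open>Starting left of the support, at -1, makes every \<open>x \<ge> 0\<close> an
    interior point of the interval on which the primitive is differentiated.\<close>
  define R where "R = (\<lambda>x. integral {-1..x} r)"
  have R0: "R x = 0" if "x \<le> 0" for x
    unfolding R_def using integral_cong[of "{-1..x}" r "\<lambda>_. 0"] r(3) that by force
  have dR: "(R has_real_derivative r x) (at x)" for x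
  proof (cases "x < 0")
    case True
    have "((\<lambda>x. 0) has_real_derivative 0) (at x)" by simp
    moreover have "eventually (\<lambda>y. 0 = R y) (nhds x)"
      using eventually_nhds_in_open[of "{..<0}" x] True R0 by (auto elim!: eventually_mono)
    moreover have "r x = 0" using r(3)[of x] True by auto
    ultimately show ?thesis using DERIV_cong_ev[of x x "\<lambda>x. 0" R 0 0] by simp
  next
    case False
    have "(R has_real_derivative r x) (at x within {-1..x + 1})"
      unfolding R_def by (rule integral_has_real_derivative) (use False cr in auto)
    moreover have "at x within {-1..x + 1} = at x" using False by (intro at_within_interior) auto
    ultimately show ?thesis by simp
  qed
  have monoR: "R x \<le> R y" if "x \<le> y" for x y
    by (rule DERIV_nonneg_imp_nondecreasing[OF that]) (use dR r(2) in blast)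
  define c where "c = R 1"
  have R1: "R x = c" if "1 \<le> x" for x
  proof -
    have "R x = R 1 + integral {1..x} r"
      unfolding R_def using that cr
      by (subst Henstock_Kurzweil_Integration.integral_combine[symmetric, of "-1" 1 x]) (auto intro: integrable_continuous_interval)
    moreover have "integral {1..x} r = 0" using integral_cong[of "{1..x}" r "\<lambda>_. 0"] r(3) by force
    ultimately show ?thesis by (simp add: c_def)
  qed
  have "c \<noteq> 0"
  proof
    assume "c = 0"
    then have "\<forall>x\<in>{-1..1}. r x = 0"
      using integral_eq_0_iff[of "-1" 1 r] cr r(2) by (simp add: c_def R_def)
    then show False using r(3)[of "1/2"] by auto
  qed
  then have c: "0 < c" using monoR[of 0 1] R0[of 0] by (simp add: c_def)
  define S where "S = (\<lambda>x. R x / c)"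
  define \<sigma> where "\<sigma> = (\<lambda>x. r x / c)"
  have dS: "(S has_real_derivative \<sigma> x) (at x)" for x
    unfolding S_def \<sigma>_def by (rule DERIV_cdivide[OF dR])
  have CS: "Ck (Suc k) S" for k
  proof -
    have "(\<lambda>x. frechet_derivative S (at x) 1) = (\<lambda>x. (1 / c) *\<^sub>R r x)"
      by (simp add: frechet_derivative_real[OF dS] \<sigma>_def)
    moreover have "S differentiable_on UNIV"
      using dS by (auto simp: differentiable_on_def has_field_derivative_def differentiable_def intro: has_derivative_at_withinI)
    ultimately show ?thesis using Ck_scaleR[OF r(1), of k "1 / c"] by simp
  qed
  show ?thesis
  proof (rule that[of S \<sigma>])
    show "Ck k S" for k using Ck_SucD[OF CS] .
    show "continuous_on UNIV \<sigma>" unfolding \<sigma>_def using cr c by (intro continuous_intros) auto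
    show "S x \<le> 1" for x using monoR[of x "max x 1"] R1[of "max x 1"] c by (simp add: S_def)
    show "0 \<le> S x" for x using monoR[of "min x 0" x] R0[of "min x 0"] c by (simp add: S_def)
    show "\<sigma> x = 0" if "x \<notin> {0..1}" for x using r(3)[of x] that by (auto simp: \<sigma>_def)
  qed (use dS r c R0 R1 in \<open>auto simp: S_def \<sigma>_def\<close>)
qed

lemma integrable_mult_bounded_continuous:
  fixes f g :: "real \<Rightarrow> real"
  assumes "integrable (lebesgue_on {a..b}) g" "continuous_on UNIV f" "\<And>x. \<bar>f x\<bar> \<le> B"
  shows "integrable (lebesgue_on {a..b}) (\<lambda>x. f x * g x)"
proof (rule Bochner_Integration.integrable_bound)
  show "integrable (lebesgue_on {a..b}) (\<lambda>x. B * g x)" using assms(1) by simp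
  have "f \<in> borel_measurable (lebesgue_on {a..b})"
    using continuous_imp_measurable_on_sets_lebesgue[OF continuous_on_subset[OF assms(2)], of "{a..b}"] by simp
  then show "(\<lambda>x. f x * g x) \<in> borel_measurable (lebesgue_on {a..b})"
    using borel_measurable_integrable[OF assms(1)] by measurable
  have "0 \<le> B" using assms(3) abs_ge_zero order_trans by blast
  then show "AE x in lebesgue_on {a..b}. norm (f x * g x) \<le> norm (B * g x)"
    using assms(3) by (intro AE_I2) (auto simp: abs_mult intro!: mult_right_mono)
qed

text \<open>The rescaled mollifier lives on [s, s + 1/N], to the right of \<open>s\<close>, and has
  mass 1 on [0,T] once s + 1/N lies below \<open>T\<close>. Continuity at \<open>s\<close> then
  controls the average.\<close>

lemma approximate_identity:
  fixes p :: "real \<Rightarrow> real"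
  assumes S: "\<And>x. (S has_real_derivative \<sigma> x) (at x)" "continuous_on UNIV \<sigma>" "\<And>x. 0 \<le> \<sigma> x"
      "\<And>x. x \<notin> {0..1} \<Longrightarrow> \<sigma> x = 0" "\<And>x. x \<le> 0 \<Longrightarrow> S x = 0" "\<And>x. 1 \<le> x \<Longrightarrow> S x = 1"
    and B: "\<And>x. \<bar>\<sigma> x\<bar> \<le> B"
    and p: "integrable (lebesgue_on {0..T}) p" "isCont p s" and s: "0 < s" "s < T"
  shows "(\<lambda>n. LINT r|lebesgue_on {0..T}. real (Suc n) * \<sigma> (real (Suc n) * (r - s)) * p r) \<longlonglongrightarrow> p s"
proof (rule LIMSEQ_I)
  fix e :: real assume e: "0 < e"
  obtain \<delta> where \<delta>: "0 < \<delta>" "\<And>r. \<bar>r - s\<bar> < \<delta> \<Longrightarrow> \<bar>p r - p s\<bar> < e / 2"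
    using p(2) e unfolding continuous_at_real_range by (metis half_gt_zero real_norm_def)
  obtain n0 where n0: "inverse (real (Suc n0)) < min \<delta> (T - s)"
    using reals_Archimedean[of "min \<delta> (T - s)"] \<delta>(1) s by auto
  have "norm ((LINT r|lebesgue_on {0..T}. real (Suc n) * \<sigma> (real (Suc n) * (r - s)) * p r) - p s) < e" if "n0 \<le> n" for n
  proof -
    define N where "N = real (Suc n)"
    have "1 / N \<le> inverse (real (Suc n0))" using that by (simp add: N_def field_simps)
    then have N: "0 < N" "1 / N < \<delta>" "1 / N < T - s" using n0 by (simp_all add: N_def)
    define k where "k = (\<lambda>r. N * \<sigma> (N * (r - s)))"
    have kc: "continuous_on UNIV k"
      unfolding k_def by (intro continuous_intros continuous_on_compose2[OF S(2)]) auto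
    have kb: "\<bar>k r\<bar> \<le> N * B" for r unfolding k_def using B N by (auto simp: abs_mult intro!: mult_left_mono)
    have k0: "0 \<le> k r" for r using S(3) N by (simp add: k_def)
    have ksup: "r - s \<in> {0..1/N}" if "k r \<noteq> 0" for r
    proof -
      have "N * (r - s) \<in> {0..1}" using S(4)[of "N * (r - s)"] that by (auto simp: k_def)
      then show ?thesis using N by (auto simp: field_simps zero_le_mult_iff)
    qed
    have ki: "integrable (lebesgue_on {0..T}) k"
      by (intro continuous_imp_integrable_real continuous_on_subset[OF kc]) auto
    have "(k has_integral S (N * (T - s)) - S (N * (0 - s))) {0..T}"
    proof (rule fundamental_theorem_of_calculus)
      show "((\<lambda>r. S (N * (r - s))) has_vector_derivative k r) (at r within {0..T})" for r
        unfolding k_def has_real_derivative_iff_has_vector_derivative[symmetric]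
        by (rule DERIV_subset[OF DERIV_chain2[OF S(1), THEN DERIV_cong]]) (auto intro!: derivative_eq_intros)
    qed (use s in auto)
    moreover have "S (N * (T - s)) = 1" using N by (intro S(6)) (simp add: field_simps)
    moreover have "S (N * (0 - s)) = 0" using N s by (intro S(5)) (simp add: mult_le_0_iff)
    ultimately have k1: "(LINT r|lebesgue_on {0..T}. k r) = 1"
      using ki by (simp add: lebesgue_integral_eq_integral integral_unique)
    have kp: "integrable (lebesgue_on {0..T}) (\<lambda>r. k r * p r)"
      by (rule integrable_mult_bounded_continuous[OF p(1) kc kb])
    have "(LINT r|lebesgue_on {0..T}. k r * p r) - p s = (LINT r|lebesgue_on {0..T}. k r * p r - k r * p s)"
      using ki kp k1 by simp
    also have "norm \<dots> \<le> (LINT r|lebesgue_on {0..T}. k r * (e / 2))"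
    proof (rule Bochner_Integration.integral_norm_bound_integral)
      show "norm (k r * p r - k r * p s) \<le> k r * (e / 2)" for r
      proof (cases "k r = 0")
        case False
        then have "\<bar>p r - p s\<bar> < e / 2" using ksup[OF False] N by (intro \<delta>(2)) auto
        then have "k r * \<bar>p r - p s\<bar> \<le> k r * (e / 2)" using k0[of r] by (intro mult_left_mono) auto
        then show ?thesis using k0[of r] by (simp add: abs_mult flip: right_diff_distrib)
      qed simp
    qed (use ki kp in auto)
    also have "\<dots> < e" using k1 e by simp
    finally show ?thesis by (simp add: k_def N_def)
  qed
  then show "\<exists>n0. \<forall>n\<ge>n0. norm ((LINT r|lebesgue_on {0..T}. real (Suc n) * \<sigma> (real (Suc n) * (r - s)) * p r) - p s) < e"
    by blast
qed

text \<open>Tested with smoothed indicators of (s,t], built as the difference of two smooth steps: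
  their derivatives are mollifiers at \<open>s\<close> and at \<open>t\<close> and produce the two
  point values, while the functions themselves tend to the indicator.\<close>

lemma weak_derivative_interior:
  fixes p q :: "real \<Rightarrow> real"
  assumes p: "continuous_on {0<..<T} p" "integrable (lebesgue_on {0..T}) p"
    and q: "integrable (lebesgue_on {0..T}) q"
    and weak: "\<And>\<phi>. \<phi> \<in> test_functions {0<..<T} \<Longrightarrow>
      (LINT t|lebesgue_on {0..T}. deriv \<phi> t * p t) = - (LINT t|lebesgue_on {0..T}. \<phi> t * q t)"
    and st: "0 < s" "s < t" "t < T"
  shows "p t - p s = integral {s..t} q"
proof -
  obtain S \<sigma> :: "real \<Rightarrow> real" where S: "\<And>k. Ck k S" "\<And>x. (S has_real_derivative \<sigma> x) (at x)"
    "continuous_on UNIV \<sigma>" "\<And>x. 0 \<le> \<sigma> x" "\<And>x. x \<notin> {0..1} \<Longrightarrow> \<sigma> x = 0"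
    "\<And>x. x \<le> 0 \<Longrightarrow> S x = 0" "\<And>x. 1 \<le> x \<Longrightarrow> S x = 1" "\<And>x. 0 \<le> S x" "\<And>x. S x \<le> 1"
    using smooth_step_exists by metis
  have "bounded (\<sigma> ` {0..1})"
    by (intro compact_imp_bounded compact_continuous_image continuous_on_subset[OF S(3)]) auto
  then obtain B where "0 < B" "\<And>x. x \<in> {0..1} \<Longrightarrow> \<bar>\<sigma> x\<bar> \<le> B" by (auto simp: bounded_pos)
  then have B: "\<bar>\<sigma> x\<bar> \<le> B" for x using S(5)[of x] by (cases "x \<in> {0..1}") auto
  define \<phi> where "\<phi> = (\<lambda>n r. S (real (Suc n) * (r - s)) - S (real (Suc n) * (r - t)))"
  define k where "k = (\<lambda>x n r. real (Suc n) * \<sigma> (real (Suc n) * (r - x)))"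
  have cont: "isCont p x" if "0 < x" "x < T" for x
    using p(1) that by (simp add: continuous_on_eq_continuous_at)
  have lim: "(\<lambda>n. LINT r|lebesgue_on {0..T}. k x n r * p r) \<longlonglongrightarrow> p x" if "0 < x" "x < T" for x
    unfolding k_def by (rule approximate_identity[OF S(2,3,4,5,6,7) B p(2) cont[OF that] that])
  have dS: "((\<lambda>r. S (real (Suc n) * (r - x))) has_real_derivative k x n r) (at r)" for x n r
    unfolding k_def by (rule DERIV_chain2[OF S(2), THEN DERIV_cong]) (auto intro!: derivative_eq_intros)
  have d\<phi>: "deriv (\<phi> n) r = k s n r - k t n r" for n r
    unfolding \<phi>_def by (intro DERIV_imp_deriv DERIV_diff dS)
  have k_int: "integrable (lebesgue_on {0..T}) (\<lambda>r. k x n r * p r)" for x n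
  proof (rule integrable_mult_bounded_continuous[OF p(2), where B = "real (Suc n) * B"])
    show "continuous_on UNIV (k x n)"
      unfolding k_def by (intro continuous_intros continuous_on_compose2[OF S(3)]) auto
    show "\<bar>k x n r\<bar> \<le> real (Suc n) * B" for r unfolding k_def using B by (auto simp: abs_mult simp del: of_nat_Suc intro!: mult_left_mono)
  qed
  have C\<phi>: "Ck m (\<phi> n)" for m n
  proof -
    have "Ck m (\<lambda>r. S (r \<bullet> real (Suc n) + (- real (Suc n) * s)) + (-1) *\<^sub>R S (r \<bullet> real (Suc n) + (- real (Suc n) * t)))"
      by (intro Ck_add Ck_scaleR Ck_affine S(1))
    then show ?thesis by (simp add: \<phi>_def algebra_simps)
  qed
  \<comment> \<open>The smoothed indicator reaches up to t + 1/N, so it is an admissible test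
    function on (0,T) only from some index on.\<close>
  have test: "eventually (\<lambda>n. \<phi> n \<in> test_functions {0<..<T}) sequentially"
  proof -
    obtain n0 where n0: "inverse (real (Suc n0)) < T - t" using reals_Archimedean[of "T - t"] st by auto
    have "\<phi> n \<in> test_functions {0<..<T}" if "n0 \<le> n" for n
    proof -
      define N where "N = real (Suc n)"
      have "1 / N \<le> inverse (real (Suc n0))" using that by (simp add: N_def field_simps)
      then have N: "0 < N" "1 / N < T - t" using n0 by (simp_all add: N_def)
      have "\<phi> n r = 0" if "r \<notin> {s..t + 1 / N}" for r
      proof (cases "r < s")
        case True
        then have "N * (r - s) \<le> 0" "N * (r - t) \<le> 0" using N st by (auto simp: mult_le_0_iff)
        then show ?thesis using S(6) by (simp add: \<phi>_def N_def)
      next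
        case False
        then have "t + 1 / N < r" using that by auto
        then have "1 \<le> N * (r - t)" using N by (simp add: field_simps)
        moreover have "N * (r - t) \<le> N * (r - s)" using N st by (intro mult_left_mono) auto
        ultimately have "S (N * (r - t)) = 1" "S (N * (r - s)) = 1" by (auto intro: S(7))
        then show ?thesis by (simp add: \<phi>_def N_def)
      qed
      then have "{r. \<phi> n r \<noteq> 0} \<subseteq> {s..t + 1 / N}" by blast
      then have sub: "closure {r. \<phi> n r \<noteq> 0} \<subseteq> {s..t + 1 / N}" by (rule closure_minimal) simp
      moreover have "compact (closure {r. \<phi> n r \<noteq> 0})"
        using sub by (meson bounded_closed_interval bounded_subset closed_closure compact_eq_bounded_closed)
      moreover have "{s..t + 1 / N} \<subseteq> {0<..<T}" using st N by auto
      ultimately show ?thesis using C\<phi> by (auto simp: test_functions_def)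
    qed
    then show ?thesis by (auto simp: eventually_sequentially)
  qed
  have "(\<lambda>n. LINT r|lebesgue_on {0..T}. deriv (\<phi> n) r * p r) \<longlonglongrightarrow> p s - p t"
    unfolding d\<phi> left_diff_distrib using k_int tendsto_diff[OF lim[of s] lim[of t]] st by simp
  then have "(\<lambda>n. - (LINT r|lebesgue_on {0..T}. \<phi> n r * q r)) \<longlonglongrightarrow> p s - p t"
    by (rule Lim_transform_eventually) (use test weak in \<open>auto elim: eventually_mono\<close>)
  moreover have "(\<lambda>n. LINT r|lebesgue_on {0..T}. \<phi> n r * q r) \<longlonglongrightarrow> (LINT r|lebesgue_on {0..T}. indicator {s<..t} r * q r)"
  proof (rule integral_dominated_convergence[where w = "\<lambda>r. norm (q r)"])
    have [measurable]: "\<phi> n \<in> borel_measurable (lebesgue_on {0..T})" for n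
      using continuous_imp_measurable_on_sets_lebesgue[OF continuous_on_subset[of UNIV "\<phi> n"], of "{0..T}"] C\<phi>[of 0 n] by simp
    note [measurable] = borel_measurable_integrable[OF q]
    show "(\<lambda>r. \<phi> n r * q r) \<in> borel_measurable (lebesgue_on {0..T})" for n by measurable
    have [measurable]: "indicator {s<..t} \<in> borel_measurable (lebesgue_on {0..T})"
      by (intro measurable_restrict_space1 borel_measurable_indicator) simp
    show "(\<lambda>r. indicator {s<..t} r * q r) \<in> borel_measurable (lebesgue_on {0..T})" by measurable
    have pos: "eventually (\<lambda>n. S (real (Suc n) * (r - x)) = 1) sequentially" if "x < r" for r x
    proof -
      obtain n0 where n0: "inverse (real (Suc n0)) < r - x" using reals_Archimedean[of "r - x"] \<open>x < r\<close> by auto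
      have "1 \<le> real (Suc n) * (r - x)" if "n0 \<le> n" for n
      proof -
        have "1 \<le> real (Suc n0) * (r - x)" using n0 by (simp add: field_simps del: of_nat_Suc)
        also have "\<dots> \<le> real (Suc n) * (r - x)" using that \<open>x < r\<close> by (intro mult_right_mono) auto
        finally show ?thesis .
      qed
      then show ?thesis using S(7) by (auto simp: eventually_sequentially simp del: of_nat_Suc)
    qed
    have neg: "S (real (Suc n) * (r - x)) = 0" if "r \<le> x" for r x n
      using that by (intro S(6)) (auto simp: mult_le_0_iff)
    have "(\<lambda>n. \<phi> n r) \<longlonglongrightarrow> indicator {s<..t} r" for r
    proof -
      consider "r \<le> s" | "s < r" "r \<le> t" | "t < r" by linarith
      then show ?thesis
      proof cases
        case 1
        then have "\<phi> n r = 0" for n using neg[of r s n] neg[of r t n] st by (simp add: \<phi>_def del: of_nat_Suc)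
        then show ?thesis using 1 by simp
      next
        case 2
        have "eventually (\<lambda>n. \<phi> n r = 1) sequentially" using pos[OF 2(1)] neg[OF 2(2)] by (auto simp: \<phi>_def elim: eventually_mono)
        then show ?thesis using 2 by (simp add: tendsto_eventually)
      next
        case 3
        have "eventually (\<lambda>n. \<phi> n r = 0) sequentially" using pos[of s r] pos[of t r] 3 st by (auto simp: \<phi>_def elim: eventually_elim2)
        then show ?thesis using 3 by (simp add: tendsto_eventually)
      qed
    qed
    then show "AE r in lebesgue_on {0..T}. (\<lambda>n. \<phi> n r * q r) \<longlonglongrightarrow> indicator {s<..t} r * q r"
      by (intro AE_I2 tendsto_intros)
    have "\<bar>\<phi> n r\<bar> \<le> 1" for n r using S(8,9)[of "real (Suc n) * (r - s)"] S(8,9)[of "real (Suc n) * (r - t)"] by (simp add: \<phi>_def abs_le_iff)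
    then show "AE r in lebesgue_on {0..T}. norm (\<phi> n r * q r) \<le> norm (q r)" for n
      by (intro AE_I2) (auto simp: abs_mult intro!: mult_left_le_one_le)
  qed (use q in auto)
  ultimately have "p s - p t = - (LINT r|lebesgue_on {0..T}. indicator {s<..t} r * q r)"
    using LIMSEQ_unique tendsto_minus by blast
  moreover have "(LINT r|lebesgue_on {0..T}. indicator {s<..t} r * q r) = integral {s..t} q"
  proof -
    have q': "q absolutely_integrable_on {0..T}" using q by (simp add: integrable_restrict_space set_integrable_def)
    have "(LINT r|lebesgue_on {0..T}. indicator {s<..t} r * q r) = (LINT r:{s<..t}|lebesgue. q r)"
      unfolding set_lebesgue_integral_def using st
      by (subst integral_restrict_space) (auto intro!: Bochner_Integration.integral_cong simp: indicator_def)
    also have "\<dots> = integral {s<..t} q"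
      using st by (intro set_lebesgue_integral_eq_integral(2) absolutely_integrable_on_subinterval set_integrable_subset[OF q']) auto
    also have "\<dots> = integral {s..t} q"
      by (intro integral_subset_negligible) (auto intro: negligible_subset[of "{s}"])
    finally show ?thesis .
  qed
  ultimately show ?thesis by simp
qed

text \<open>\<open>p\<close> minus the primitive of \<open>q\<close> is constant on (0,T), and
  continuity carries this to the end points in \<open>J\<close>. These are both end points for
  pairings with \<open>v\<close>, but only \<open>T\<close> for pairings with
  \<open>vt\<close>.\<close>

lemma weak_derivative_interval:
  fixes p q :: "real \<Rightarrow> real"
  assumes J: "{0<..<T} \<subseteq> J" "J \<subseteq> {0..T}" and p: "continuous_on J p" "integrable (lebesgue_on {0..T}) p"
    and q: "integrable (lebesgue_on {0..T}) q"
    and weak: "\<And>\<phi>. \<phi> \<in> test_functions {0<..<T} \<Longrightarrow>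
      (LINT t|lebesgue_on {0..T}. deriv \<phi> t * p t) = - (LINT t|lebesgue_on {0..T}. \<phi> t * q t)"
    and T: "0 < T" and st: "s \<in> J" "t \<in> J" "s \<le> t"
  shows "p t - p s = (LINT r|lebesgue_on {s..t}. q r)"
proof -
  have qi: "q integrable_on {0..T}" using q by (simp add: integrable_on_lebesgue_on)
  define P where "P = (\<lambda>t. integral {0..t} q)"
  have Pc: "continuous_on {0..T} P" unfolding P_def by (rule indefinite_integral_continuous_1[OF qi])
  have Pd: "P t - P s = integral {s..t} q" if "0 \<le> s" "s \<le> t" "t \<le> T" for s t
    unfolding P_def using that integrable_on_subinterval[OF qi, of 0 t]
    by (subst Henstock_Kurzweil_Integration.integral_combine[symmetric, of 0 s t]) auto
  define D where "D = (\<lambda>t. p t - P t)"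
  have Dc: "continuous_on J D" unfolding D_def using p(1) continuous_on_subset[OF Pc J(2)] by (intro continuous_intros)
  have Deq: "D y = D x" if "0 < x" "x < y" "y < T" for x y
    using weak_derivative_interior[OF continuous_on_subset[OF p(1) J(1)] p(2) q weak that] Pd[of x y] that by (simp add: D_def)
  then have Deq': "D y = D (T / 2)" if "y \<in> {0<..<T}" for y
    using that T by (cases y "T / 2" rule: linorder_cases) fastforce+
  have "D x = D (T / 2)" if x: "x \<in> J" for x
  proof -
    have "(D \<longlongrightarrow> D x) (at x within {0<..<T})"
      using Dc x J(1) by (metis continuous_on_def tendsto_within_subset)
    moreover have "eventually (\<lambda>y. D (T / 2) = D y) (at x within {0<..<T})"
    proof -
      have "\<forall>y. y \<noteq> x \<longrightarrow> y \<in> {0<..<T} \<longrightarrow> D (T / 2) = D y" using Deq' by metis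
      then show ?thesis unfolding eventually_at_filter by (rule always_eventually)
    qed
    then have "(D \<longlongrightarrow> D (T / 2)) (at x within {0<..<T})" by (rule Lim_transform_eventually[OF tendsto_const])
    moreover have "x islimpt {0<..<T}"
    proof -
      consider "x = 0" | "x = T" | "x \<in> interior {0<..<T}" using x J(2) by fastforce
      then show ?thesis
        using islimpt_greaterThanLessThan1[OF T] islimpt_greaterThanLessThan2[OF T] interior_limit_point by cases blast+
    qed
    then have "at x within {0<..<T} \<noteq> bot" by (simp add: trivial_limit_within)
    ultimately show ?thesis using tendsto_unique[of "at x within {0<..<T}" D "D x" "D (T / 2)"] by simp
  qed
  from this[OF st(1)] this[OF st(2)] have "p t - p s = P t - P s" by (simp add: D_def)
  also have "\<dots> = integral {s..t} q" using st J(2) by (intro Pd) auto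
  also have "\<dots> = (LINT r|lebesgue_on {s..t}. q r)"
  proof (rule lebesgue_integral_eq_integral[symmetric])
    show "integrable (lebesgue_on {s..t}) q"
      using st J(2) by (intro integrable_subinterval[OF q]) auto
  qed auto
  finally show ?thesis .
qed

section \<open>Sobolev spaces as semi-inner product spaces\<close>

text \<open>Uses the completeness of Lebesgue measure.\<close>

lemma borel_measurable_lebesgue_on_AE:
  fixes f g :: "'a::euclidean_space \<Rightarrow> 'b::euclidean_space"
  assumes S: "S \<in> sets lebesgue" and f: "f \<in> borel_measurable (lebesgue_on S)" and eq: "AE x in lebesgue_on S. f x = g x"
  shows "g \<in> borel_measurable (lebesgue_on S)"
proof -
  have "(\<lambda>x. indicator S x *\<^sub>R f x) \<in> borel_measurable lebesgue"
    using f S by (subst borel_measurable_restrict_space_iff[symmetric]) auto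
  moreover have "AE x in lebesgue. indicator S x *\<^sub>R f x = indicator S x *\<^sub>R g x"
  proof -
    have "AE x in lebesgue. x \<in> S \<longrightarrow> f x = g x" using eq S by (simp add: AE_restrict_space_iff)
    then show ?thesis by (rule eventually_mono) (auto simp: indicator_def)
  qed
  ultimately have "(\<lambda>x. indicator S x *\<^sub>R g x) \<in> borel_measurable lebesgue" by (rule borel_measurable_AE)
  then show ?thesis using S by (subst borel_measurable_restrict_space_iff) auto
qed

text \<open>The polar form of \<open>H_norm_sq\<close>, built with the same chosen weak derivatives,
  so that the Sobolev norms become seminorms of semidefinite forms.\<close>

primrec H_inner :: "nat \<Rightarrow> (real ^ 'd) set \<Rightarrow> (real ^ 'd \<Rightarrow> 'b::euclidean_space) \<Rightarrow> (real ^ 'd \<Rightarrow> 'b) \<Rightarrow> real" where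
  "H_inner 0 \<Omega> f g = L2_inner \<Omega> f g"
| "H_inner (Suc r) \<Omega> f g = L2_inner \<Omega> f g + (\<Sum>j\<in>UNIV. H_inner r \<Omega> (weak_partial \<Omega> j f) (weak_partial \<Omega> j g))"

lemma H_norm_eq: "H_norm r \<Omega> f = seminrm (H_inner r \<Omega>) f"
proof -
  have "H_norm_sq r \<Omega> f = H_inner r \<Omega> f f"
    by (induction r arbitrary: f) (auto simp: L2_inner_def power2_norm_eq_inner)
  then show ?thesis by (simp add: H_norm_def seminrm_def)
qed

lemma H_norm_0_eq: "H_norm 0 \<Omega> f = seminrm (L2_inner \<Omega>) f"
  by (simp add: H_norm_eq seminrm_def)

locale bounded_open_set =
  fixes \<Omega> :: "(real ^ 'd) set"
  assumes op: "open \<Omega>" and bd: "bounded \<Omega>"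
begin

lemma \<Omega>_sets [simp, measurable]: "\<Omega> \<in> sets lebesgue"
  using op by simp

lemma finite_measure_\<Omega>: "finite_measure (lebesgue_on \<Omega>)"
  using op bd by (intro finite_measure_lebesgue_on lmeasurable_open)

lemma L2_measurable: "f \<in> L2_space \<Omega> \<Longrightarrow> f \<in> borel_measurable (lebesgue_on \<Omega>)"
  by (simp add: L2_space_def)

lemma L2_integrable_sq: "f \<in> L2_space \<Omega> \<Longrightarrow> integrable (lebesgue_on \<Omega>) (\<lambda>x. (norm (f x))\<^sup>2)"
  by (simp add: L2_space_def)

lemma L2_spaceI:
  assumes "f \<in> borel_measurable (lebesgue_on \<Omega>)" "integrable (lebesgue_on \<Omega>) g" "AE x in lebesgue_on \<Omega>. (norm (f x))\<^sup>2 \<le> g x"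
  shows "f \<in> L2_space \<Omega>"
proof -
  note [measurable] = assms(1)
  have "integrable (lebesgue_on \<Omega>) (\<lambda>x. (norm (f x))\<^sup>2)"
    by (rule Bochner_Integration.integrable_bound[OF assms(2)]) (use assms(3) in \<open>auto elim: eventually_mono\<close>)
  then show ?thesis using assms(1) by (simp add: L2_space_def)
qed

lemma L2_product_integrable:
  assumes "f \<in> L2_space \<Omega>" "g \<in> L2_space \<Omega>"
  shows "integrable (lebesgue_on \<Omega>) (\<lambda>x. norm (f x) * norm (g x))" "integrable (lebesgue_on \<Omega>) (\<lambda>x. f x \<bullet> g x)"
proof -
  note [measurable] = L2_measurable[OF assms(1)] L2_measurable[OF assms(2)]
  have i: "integrable (lebesgue_on \<Omega>) (\<lambda>x. (norm (f x))\<^sup>2 + (norm (g x))\<^sup>2)"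
    by (intro Bochner_Integration.integrable_add L2_integrable_sq assms)
  have b: "norm (f x) * norm (g x) \<le> (norm (f x))\<^sup>2 + (norm (g x))\<^sup>2" for x
  proof -
    have "norm (f x) * norm (g x) \<le> 2 * norm (f x) * norm (g x)" by simp
    also have "\<dots> \<le> (norm (f x))\<^sup>2 + (norm (g x))\<^sup>2" by (rule sum_squares_bound)
    finally show ?thesis .
  qed
  show "integrable (lebesgue_on \<Omega>) (\<lambda>x. norm (f x) * norm (g x))"
    by (rule Bochner_Integration.integrable_bound[OF i]) (use b in auto)
  show "integrable (lebesgue_on \<Omega>) (\<lambda>x. f x \<bullet> g x)"
    by (rule Bochner_Integration.integrable_bound[OF i])
      (use order_trans[OF Cauchy_Schwarz_ineq2 b] in auto)
qed

lemma L2_subspace: "subspace (L2_space \<Omega> :: (real ^ 'd \<Rightarrow> 'b::euclidean_space) set)"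
  unfolding subspace_def
proof (intro conjI ballI allI)
  show "0 \<in> L2_space \<Omega>" by (rule L2_spaceI[of _ "\<lambda>_. 0"]) (auto simp: zero_fun_def)
  fix f g :: "real ^ 'd \<Rightarrow> 'b" and c :: real
  assume f: "f \<in> L2_space \<Omega>"
  note [measurable] = L2_measurable[OF f]
  show "c *\<^sub>R f \<in> L2_space \<Omega>"
    by (rule L2_spaceI[of _ "\<lambda>x. c\<^sup>2 * (norm (f x))\<^sup>2"])
      (use L2_integrable_sq[OF f] in \<open>auto simp: scaleR_fun_def power_mult_distrib\<close>)
  assume g: "g \<in> L2_space \<Omega>"
  note [measurable] = L2_measurable[OF g]
  show "f + g \<in> L2_space \<Omega>"
  proof (rule L2_spaceI[of _ "\<lambda>x. 2 * (norm (f x))\<^sup>2 + 2 * (norm (g x))\<^sup>2"])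
    have "(norm (f x + g x))\<^sup>2 \<le> 2 * (norm (f x))\<^sup>2 + 2 * (norm (g x))\<^sup>2" for x
    proof -
      have "(norm (f x + g x))\<^sup>2 \<le> (norm (f x) + norm (g x))\<^sup>2" by (intro power_mono norm_triangle_ineq) auto
      also have "\<dots> \<le> 2 * (norm (f x))\<^sup>2 + 2 * (norm (g x))\<^sup>2"
        using sum_squares_bound[of "norm (f x)" "norm (g x)"] by (simp add: power2_sum)
      finally show ?thesis .
    qed
    then show "AE x in lebesgue_on \<Omega>. (norm ((f + g) x))\<^sup>2 \<le> 2 * (norm (f x))\<^sup>2 + 2 * (norm (g x))\<^sup>2" by simp
  qed (use L2_integrable_sq[OF f] L2_integrable_sq[OF g] in \<open>auto simp: plus_fun_def\<close>)
qed

lemma L2_semi_inner: "semi_inner (L2_space \<Omega> :: (real ^ 'd \<Rightarrow> 'b::euclidean_space) set) (L2_inner \<Omega>)"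
  by unfold_locales
    (auto simp: L2_subspace L2_inner_def L2_product_integrable inner_add_left inner_add_right inner_commute
      intro!: integral_nonneg_AE)

lemma L2_AE:
  assumes "f \<in> L2_space \<Omega>" "AE x in lebesgue_on \<Omega>. f x = g x" shows "g \<in> L2_space \<Omega>"
  using borel_measurable_lebesgue_on_AE[OF \<Omega>_sets L2_measurable[OF assms(1)] assms(2)] L2_integrable_sq[OF assms(1)]
  by (rule L2_spaceI) (use assms(2) in \<open>auto elim: eventually_mono\<close>)

lemma L2_inner_AE:
  assumes "f \<in> L2_space \<Omega>" "g \<in> L2_space \<Omega>" "AE x in lebesgue_on \<Omega>. f x = f' x" "AE x in lebesgue_on \<Omega>. g x = g' x"
  shows "L2_inner \<Omega> f g = L2_inner \<Omega> f' g'"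
proof -
  note [measurable] = L2_measurable[OF assms(1)] L2_measurable[OF assms(2)]
     L2_measurable[OF L2_AE[OF assms(1,3)]] L2_measurable[OF L2_AE[OF assms(2,4)]]
  show ?thesis unfolding L2_inner_def
    by (rule integral_cong_AE) (use assms(3,4) in \<open>auto elim: eventually_elim2\<close>)
qed

lemma L2_norm_zero_imp_AE:
  assumes "f \<in> L2_space \<Omega>" "L2_inner \<Omega> f f = 0" shows "AE x in lebesgue_on \<Omega>. f x = 0"
proof -
  have "AE x in lebesgue_on \<Omega>. (norm (f x))\<^sup>2 = 0"
    using assms L2_integrable_sq[OF assms(1)] integral_nonneg_eq_0_iff_AE[of "lebesgue_on \<Omega>" "\<lambda>x. (norm (f x))\<^sup>2"]
    by (simp add: L2_inner_def power2_norm_eq_inner)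
  then show ?thesis by simp
qed

lemma locally_integrable_AE:
  assumes "locally_integrable \<Omega> f" "AE x in lebesgue_on \<Omega>. f x = g x" shows "locally_integrable \<Omega> g"
  unfolding locally_integrable_def
proof (intro allI impI)
  fix K assume K: "compact K \<and> K \<subseteq> \<Omega>"
  have "AE x in lebesgue. x \<in> \<Omega> \<longrightarrow> f x = g x" using assms(2) by (simp add: AE_restrict_space_iff)
  then obtain N where N: "N \<in> null_sets lebesgue" "\<And>x. x \<notin> N \<Longrightarrow> x \<in> \<Omega> \<Longrightarrow> f x = g x"
    unfolding completion.AE_iff_null_sets by auto
  show "set_integrable lebesgue K g"
  proof (rule absolutely_integrable_spike)
    show "set_integrable lebesgue K f" using assms(1) K by (auto simp: locally_integrable_def)
    show "negligible N" using N(1) by (simp add: negligible_iff_null_sets)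
    show "g x = f x" if "x \<in> K - N" for x using that N(2) K by auto
  qed
qed

text \<open>On a set of finite measure an L^2 function is integrable, since |f| <= 1 +
  |f|^2.\<close>

lemma L2_locally_integrable:
  assumes f: "f \<in> L2_space \<Omega>" shows "locally_integrable \<Omega> f"
  unfolding locally_integrable_def
proof (intro allI impI)
  interpret finite_measure "lebesgue_on \<Omega>" by (rule finite_measure_\<Omega>)
  fix K assume K: "compact K \<and> K \<subseteq> \<Omega>"
  have "norm (f x) \<le> 1 + (norm (f x))\<^sup>2" for x
    using sum_squares_bound[of 1 "norm (f x)"] norm_ge_zero[of "f x"] by (simp del: norm_ge_zero)
  then have "integrable (lebesgue_on \<Omega>) f"
    using L2_measurable[OF f] L2_integrable_sq[OF f]
    by (intro Bochner_Integration.integrable_bound[of _ "\<lambda>x. 1 + (norm (f x))\<^sup>2" f]) auto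
  then have "set_integrable lebesgue \<Omega> f" by (simp add: integrable_restrict_space set_integrable_def)
  then show "set_integrable lebesgue K f"
    by (rule set_integrable_subset) (use K in \<open>auto intro: lmeasurable_compact fmeasurableD\<close>)
qed

lemma test_mult_integrable:
  fixes \<phi> :: "real ^ 'd \<Rightarrow> real" and g :: "real ^ 'd \<Rightarrow> 'b::euclidean_space"
  assumes g: "locally_integrable \<Omega> g" and \<phi>: "\<phi> \<in> test_functions \<Omega>"
  shows "integrable (lebesgue_on \<Omega>) (\<lambda>x. \<phi> x *\<^sub>R g x)"
proof -
  define K where "K = closure {x. \<phi> x \<noteq> 0}"
  have K: "compact K" "K \<subseteq> \<Omega>" "\<And>x. x \<notin> K \<Longrightarrow> \<phi> x = 0"
    using test_functionsD(2,3)[OF \<phi>] closure_subset[of "{x. \<phi> x \<noteq> 0}"] by (auto simp: K_def)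
  have "bounded (\<phi> ` K)" by (intro compact_imp_bounded compact_continuous_image K continuous_on_subset[OF test_functionsD(4)[OF \<phi>]]) auto
  then obtain B where B: "0 < B" "\<And>x. x \<in> K \<Longrightarrow> \<bar>\<phi> x\<bar> \<le> B" by (auto simp: bounded_pos)
  have gK: "integrable lebesgue (\<lambda>x. indicator K x *\<^sub>R g x)"
    using g K by (auto simp: locally_integrable_def set_integrable_def)
  have \<phi>m: "\<phi> \<in> borel_measurable lebesgue"
    using borel_measurable_continuous_onI[OF test_functionsD(4)[OF \<phi>]] by (simp add: measurable_completion)
  have "integrable lebesgue (\<lambda>x. \<phi> x *\<^sub>R (indicator K x *\<^sub>R g x))"
  proof (rule Bochner_Integration.integrable_bound)
    show "integrable lebesgue (\<lambda>x. B *\<^sub>R (indicator K x *\<^sub>R g x))" using gK by (rule integrable_scaleR_right)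
    show "(\<lambda>x. \<phi> x *\<^sub>R (indicator K x *\<^sub>R g x)) \<in> borel_measurable lebesgue"
      by (rule borel_measurable_scaleR[OF \<phi>m borel_measurable_integrable[OF gK]])
    show "AE x in lebesgue. norm (\<phi> x *\<^sub>R (indicator K x *\<^sub>R g x)) \<le> norm (B *\<^sub>R (indicator K x *\<^sub>R g x))"
      using B by (intro AE_I2) (auto simp: indicator_def intro!: mult_right_mono)
  qed
  moreover have "(\<lambda>x. \<phi> x *\<^sub>R (indicator K x *\<^sub>R g x)) = (\<lambda>x. indicator \<Omega> x *\<^sub>R (\<phi> x *\<^sub>R g x))"
  proof
    show "\<phi> x *\<^sub>R (indicator K x *\<^sub>R g x) = indicator \<Omega> x *\<^sub>R (\<phi> x *\<^sub>R g x)" for x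
      using K(2) K(3)[of x] by (auto simp: indicator_def)
  qed
  ultimately have "integrable lebesgue (\<lambda>x. indicator \<Omega> x *\<^sub>R (\<phi> x *\<^sub>R g x))" by (simp only:)
  then show ?thesis by (rule integrable_restrict_space[THEN iffD2, rotated]) simp
qed

lemma has_weak_partialD:
  assumes "has_weak_partial \<Omega> j f g" "\<phi> \<in> test_functions \<Omega>"
  shows "integrable (lebesgue_on \<Omega>) (\<lambda>x. frechet_derivative \<phi> (at x) (axis j 1) *\<^sub>R f x)"
    "integrable (lebesgue_on \<Omega>) (\<lambda>x. \<phi> x *\<^sub>R g x)"
    "(LINT x|lebesgue_on \<Omega>. frechet_derivative \<phi> (at x) (axis j 1) *\<^sub>R f x) = - (LINT x|lebesgue_on \<Omega>. \<phi> x *\<^sub>R g x)"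
  using assms test_mult_integrable[of f "\<lambda>x. frechet_derivative \<phi> (at x) (axis j 1)"]
    test_mult_integrable[of g \<phi>] test_functions_partial[OF assms(2), of "axis j 1"]
  by (auto simp: has_weak_partial_def)

text \<open>The key to \<open>weak_partial\<close>, which is a choice: its linearity and its
  independence of the representative hold almost everywhere, and all of them come from this
  uniqueness.\<close>

lemma has_weak_partial_unique:
  assumes "has_weak_partial \<Omega> j f g" "has_weak_partial \<Omega> j f g'"
  shows "AE x in lebesgue_on \<Omega>. g x = g' x"
proof -
  have "AE x in lebesgue_on \<Omega>. g x - g' x = 0"
  proof (rule weak_zero_imp_AE_zero[OF op])
    show "locally_integrable \<Omega> (\<lambda>x. g x - g' x)"
      using assms by (auto simp: has_weak_partial_def locally_integrable_def intro: set_integral_diff)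
    show "(LINT x|lebesgue_on \<Omega>. \<phi> x *\<^sub>R (g x - g' x)) = 0" if "\<phi> \<in> test_functions \<Omega>" for \<phi>
      using has_weak_partialD[OF assms(1) that] has_weak_partialD[OF assms(2) that]
      by (simp add: scaleR_diff_right)
  qed
  then show ?thesis by simp
qed

lemma has_weak_partial_AE:
  assumes "has_weak_partial \<Omega> j f g" "AE x in lebesgue_on \<Omega>. f x = f' x" "AE x in lebesgue_on \<Omega>. g x = g' x"
  shows "has_weak_partial \<Omega> j f' g'"
proof -
  have l: "locally_integrable \<Omega> f'" "locally_integrable \<Omega> g'"
    using assms locally_integrable_AE by (auto simp: has_weak_partial_def)
  have "(LINT x|lebesgue_on \<Omega>. frechet_derivative \<phi> (at x) (axis j 1) *\<^sub>R f' x) = - (LINT x|lebesgue_on \<Omega>. \<phi> x *\<^sub>R g' x)"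
    if \<phi>: "\<phi> \<in> test_functions \<Omega>" for \<phi> :: "real ^ 'd \<Rightarrow> real"
  proof -
    have "(LINT x|lebesgue_on \<Omega>. frechet_derivative \<phi> (at x) (axis j 1) *\<^sub>R f x) =
        (LINT x|lebesgue_on \<Omega>. frechet_derivative \<phi> (at x) (axis j 1) *\<^sub>R f' x)"
      using has_weak_partialD(1)[OF assms(1) \<phi>] assms(2)
        test_mult_integrable[OF l(1) test_functions_partial[OF \<phi>, of "axis j 1"]]
      by (intro integral_cong_AE borel_measurable_integrable) (auto elim: eventually_mono)
    moreover have "(LINT x|lebesgue_on \<Omega>. \<phi> x *\<^sub>R g x) = (LINT x|lebesgue_on \<Omega>. \<phi> x *\<^sub>R g' x)"
      using has_weak_partialD(2)[OF assms(1) \<phi>] assms(3) test_mult_integrable[OF l(2) \<phi>]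
      by (intro integral_cong_AE borel_measurable_integrable) (auto elim: eventually_mono)
    ultimately show ?thesis using has_weak_partialD(3)[OF assms(1) \<phi>] by simp
  qed
  then show ?thesis using l by (auto simp: has_weak_partial_def)
qed

lemma has_weak_partial_add:
  assumes "has_weak_partial \<Omega> j f g" "has_weak_partial \<Omega> j f' g'"
  shows "has_weak_partial \<Omega> j (f + f') (g + g')"
  unfolding has_weak_partial_def
proof (intro conjI allI impI)
  show "locally_integrable \<Omega> (f + f')" "locally_integrable \<Omega> (g + g')"
    using assms by (auto simp: has_weak_partial_def locally_integrable_def plus_fun_def intro: set_integral_add)
  fix \<phi> :: "real ^ 'd \<Rightarrow> real" assume \<phi>: "\<phi> \<in> test_functions \<Omega>"
  show "(LINT x|lebesgue_on \<Omega>. frechet_derivative \<phi> (at x) (axis j 1) *\<^sub>R (f + f') x) = - (LINT x|lebesgue_on \<Omega>. \<phi> x *\<^sub>R (g + g') x)"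
    using has_weak_partialD[OF assms(1) \<phi>] has_weak_partialD[OF assms(2) \<phi>] by (simp add: scaleR_add_right)
qed

lemma has_weak_partial_scaleR:
  assumes "has_weak_partial \<Omega> j f g" shows "has_weak_partial \<Omega> j (c *\<^sub>R f) (c *\<^sub>R g)"
  unfolding has_weak_partial_def
proof (intro conjI allI impI)
  show "locally_integrable \<Omega> (c *\<^sub>R f)" "locally_integrable \<Omega> (c *\<^sub>R g)"
    using assms by (auto simp: has_weak_partial_def locally_integrable_def scaleR_fun_def intro: set_integrable_scaleR_right)
  fix \<phi> :: "real ^ 'd \<Rightarrow> real" assume \<phi>: "\<phi> \<in> test_functions \<Omega>"
  show "(LINT x|lebesgue_on \<Omega>. frechet_derivative \<phi> (at x) (axis j 1) *\<^sub>R (c *\<^sub>R f) x) = - (LINT x|lebesgue_on \<Omega>. \<phi> x *\<^sub>R (c *\<^sub>R g) x)"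
  proof -
    have "(LINT x|lebesgue_on \<Omega>. frechet_derivative \<phi> (at x) (axis j 1) *\<^sub>R (c *\<^sub>R f) x) =
        c *\<^sub>R (LINT x|lebesgue_on \<Omega>. frechet_derivative \<phi> (at x) (axis j 1) *\<^sub>R f x)"
      by (subst integral_scaleR_right[symmetric]) (simp add: mult.commute)
    moreover have "(LINT x|lebesgue_on \<Omega>. \<phi> x *\<^sub>R (c *\<^sub>R g) x) = c *\<^sub>R (LINT x|lebesgue_on \<Omega>. \<phi> x *\<^sub>R g x)"
      by (subst integral_scaleR_right[symmetric]) (simp add: mult.commute)
    ultimately show ?thesis using has_weak_partialD(3)[OF assms \<phi>] by simp
  qed
qed

lemma H_space_L2: "f \<in> H_space r \<Omega> \<Longrightarrow> f \<in> L2_space \<Omega>"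
  by (cases r) auto

lemma weak_partial_has: "f \<in> H_space (Suc r) \<Omega> \<Longrightarrow> has_weak_partial \<Omega> j f (weak_partial \<Omega> j f)"
proof -
  assume "f \<in> H_space (Suc r) \<Omega>"
  then obtain g where "has_weak_partial \<Omega> j f g" by auto
  then show ?thesis using someI[of "has_weak_partial \<Omega> j f" g] by (simp add: weak_partial_def)
qed

lemma weak_partial_eqI: "has_weak_partial \<Omega> j f g \<Longrightarrow> AE x in lebesgue_on \<Omega>. weak_partial \<Omega> j f x = g x"
  using has_weak_partial_unique[of j f "SOME g. has_weak_partial \<Omega> j f g" g] someI[of "has_weak_partial \<Omega> j f" g]
  by (simp add: weak_partial_def)

lemma H_space_AE: "f \<in> H_space r \<Omega> \<Longrightarrow> AE x in lebesgue_on \<Omega>. f x = g x \<Longrightarrow> g \<in> H_space r \<Omega>"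
proof (induction r)
  case (Suc r)
  have "\<exists>h\<in>H_space r \<Omega>. has_weak_partial \<Omega> j g h" for j
  proof -
    obtain h where "h \<in> H_space r \<Omega>" "has_weak_partial \<Omega> j f h" using Suc.prems(1) by auto
    then show ?thesis using has_weak_partial_AE[of j f h g h] Suc.prems(2) by auto
  qed
  then show ?case using L2_AE[OF _ Suc.prems(2)] Suc.prems(1) by simp
qed (simp add: L2_AE)

text \<open>The derivative that witnesses membership in \<open>H_space\<close> need not be the one
  chosen by \<open>weak_partial\<close>. They agree almost everywhere, and \<open>H_space\<close> is
  invariant under such changes.\<close>

lemma weak_partial_H: assumes "f \<in> H_space (Suc r) \<Omega>" shows "weak_partial \<Omega> j f \<in> H_space r \<Omega>"
proof -
  obtain h where h: "h \<in> H_space r \<Omega>" "has_weak_partial \<Omega> j f h" using assms by auto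
  have "AE x in lebesgue_on \<Omega>. h x = weak_partial \<Omega> j f x"
    using weak_partial_eqI[OF h(2)] by (auto elim: eventually_mono)
  then show ?thesis by (rule H_space_AE[OF h(1)])
qed

lemma weak_partial_AE:
  assumes "f \<in> H_space (Suc r) \<Omega>" "AE x in lebesgue_on \<Omega>. f x = g x"
  shows "AE x in lebesgue_on \<Omega>. weak_partial \<Omega> j f x = weak_partial \<Omega> j g x"
proof -
  have "has_weak_partial \<Omega> j g (weak_partial \<Omega> j f)"
    using has_weak_partial_AE[OF weak_partial_has[OF assms(1)] assms(2)] by auto
  from weak_partial_eqI[OF this] show ?thesis by (auto elim: eventually_mono)
qed

lemma weak_partial_add:
  assumes "f \<in> H_space (Suc r) \<Omega>" "g \<in> H_space (Suc r) \<Omega>"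
  shows "AE x in lebesgue_on \<Omega>. weak_partial \<Omega> j (f + g) x = (weak_partial \<Omega> j f + weak_partial \<Omega> j g) x"
  by (intro weak_partial_eqI has_weak_partial_add weak_partial_has[OF assms(1)] weak_partial_has[OF assms(2)])

lemma weak_partial_scaleR:
  assumes "f \<in> H_space (Suc r) \<Omega>"
  shows "AE x in lebesgue_on \<Omega>. weak_partial \<Omega> j (c *\<^sub>R f) x = (c *\<^sub>R weak_partial \<Omega> j f) x"
  by (intro weak_partial_eqI has_weak_partial_scaleR weak_partial_has[OF assms])

lemma H_inner_AE:
  "f \<in> H_space r \<Omega> \<Longrightarrow> g \<in> H_space r \<Omega> \<Longrightarrow> AE x in lebesgue_on \<Omega>. f x = f' x \<Longrightarrow> AE x in lebesgue_on \<Omega>. g x = g' x \<Longrightarrow>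
    H_inner r \<Omega> f g = H_inner r \<Omega> f' g'"
proof (induction r arbitrary: f f' g g')
  case 0
  then show ?case using L2_inner_AE[of f g f' g'] by simp
next
  case (Suc r)
  have "H_inner r \<Omega> (weak_partial \<Omega> j f) (weak_partial \<Omega> j g) = H_inner r \<Omega> (weak_partial \<Omega> j f') (weak_partial \<Omega> j g')" for j
    by (rule Suc.IH[OF weak_partial_H weak_partial_H weak_partial_AE weak_partial_AE]) (fact Suc.prems)+
  moreover have "L2_inner \<Omega> f g = L2_inner \<Omega> f' g'"
    using Suc.prems by (intro L2_inner_AE) auto
  ultimately show ?case by simp
qed

text \<open>Weak derivatives are additive and homogeneous only almost everywhere;
  \<open>H_inner_AE\<close> at the lower order absorbs the difference in the induction.\<close>

lemma H_semi_inner: "semi_inner (H_space r \<Omega> :: (real ^ 'd \<Rightarrow> 'b::euclidean_space) set) (H_inner r \<Omega>)"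
proof (induction r)
  case 0
  have "H_inner 0 \<Omega> = (L2_inner \<Omega> :: (real ^ 'd \<Rightarrow> 'b) \<Rightarrow> _)" by (intro ext) simp
  then show ?case using L2_semi_inner by simp
next
  case (Suc r)
  interpret L2: semi_inner "L2_space \<Omega> :: (real ^ 'd \<Rightarrow> 'b) set" "L2_inner \<Omega>" by (rule L2_semi_inner)
  interpret H: semi_inner "H_space r \<Omega> :: (real ^ 'd \<Rightarrow> 'b) set" "H_inner r \<Omega>" by (rule Suc)
  have hw1: "has_weak_partial \<Omega> j f (weak_partial \<Omega> j f)" and hw2: "weak_partial \<Omega> j f \<in> H_space r \<Omega>"
    if "f \<in> H_space (Suc r) \<Omega>" for f :: "real ^ 'd \<Rightarrow> 'b" and j
    using weak_partial_has[OF that] weak_partial_H[OF that] by auto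
  have hw3: "f \<in> L2_space \<Omega>" if "f \<in> H_space (Suc r) \<Omega>" for f :: "real ^ 'd \<Rightarrow> 'b" using that by auto
  have add: "f + g \<in> H_space (Suc r) \<Omega>" if "f \<in> H_space (Suc r) \<Omega>" "g \<in> H_space (Suc r) \<Omega>" for f g :: "real ^ 'd \<Rightarrow> 'b"
  proof -
    have "\<exists>h\<in>H_space r \<Omega>. has_weak_partial \<Omega> j (f + g) h" for j
      using has_weak_partial_add[OF hw1[OF that(1)] hw1[OF that(2)]]
        subspace_add[OF H.sub hw2[OF that(1)] hw2[OF that(2)]] by blast
    then show ?thesis using subspace_add[OF L2.sub hw3[OF that(1)] hw3[OF that(2)]] by simp
  qed
  have scale: "c *\<^sub>R f \<in> H_space (Suc r) \<Omega>" if "f \<in> H_space (Suc r) \<Omega>" for f :: "real ^ 'd \<Rightarrow> 'b" and c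
  proof -
    have "\<exists>h\<in>H_space r \<Omega>. has_weak_partial \<Omega> j (c *\<^sub>R f) h" for j
      using has_weak_partial_scaleR[OF hw1[OF that]]
        subspace_scale[OF H.sub hw2[OF that]] by blast
    then show ?thesis using subspace_scale[OF L2.sub hw3[OF that]] by simp
  qed
  have zero: "0 \<in> (H_space (Suc r) \<Omega> :: (real ^ 'd \<Rightarrow> 'b) set)"
  proof -
    have "has_weak_partial \<Omega> j (0 :: real ^ 'd \<Rightarrow> 'b) 0" for j
      by (auto simp: has_weak_partial_def locally_integrable_def set_integrable_def)
    then show ?thesis using subspace_0[OF L2.sub] subspace_0[OF H.sub] by auto
  qed
  have comm: "H_inner (Suc r) \<Omega> x y = H_inner (Suc r) \<Omega> y x"
    if "x \<in> H_space (Suc r) \<Omega>" "y \<in> H_space (Suc r) \<Omega>" for x y :: "real ^ 'd \<Rightarrow> 'b"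
    using L2.commute[OF hw3[OF that(1)] hw3[OF that(2)]] H.commute[OF hw2[OF that(1)] hw2[OF that(2)]] by simp
  have addl: "H_inner (Suc r) \<Omega> (x + y) z = H_inner (Suc r) \<Omega> x z + H_inner (Suc r) \<Omega> y z"
    if "x \<in> H_space (Suc r) \<Omega>" "y \<in> H_space (Suc r) \<Omega>" "z \<in> H_space (Suc r) \<Omega>" for x y z :: "real ^ 'd \<Rightarrow> 'b"
  proof -
    have "H_inner r \<Omega> (weak_partial \<Omega> j (x + y)) (weak_partial \<Omega> j z) =
        H_inner r \<Omega> (weak_partial \<Omega> j x) (weak_partial \<Omega> j z) + H_inner r \<Omega> (weak_partial \<Omega> j y) (weak_partial \<Omega> j z)" for j
    proof -
      have "H_inner r \<Omega> (weak_partial \<Omega> j (x + y)) (weak_partial \<Omega> j z) = H_inner r \<Omega> (weak_partial \<Omega> j x + weak_partial \<Omega> j y) (weak_partial \<Omega> j z)"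
        by (rule H_inner_AE[OF hw2[OF add[OF that(1,2)]] hw2[OF that(3)] weak_partial_add[OF that(1,2)]]) simp
      then show ?thesis using H.add_left[OF hw2[OF that(1)] hw2[OF that(2)] hw2[OF that(3)]] by simp
    qed
    then show ?thesis using L2.add_left[OF hw3[OF that(1)] hw3[OF that(2)] hw3[OF that(3)]]
      by (simp add: sum.distrib)
  qed
  have scalel: "H_inner (Suc r) \<Omega> (c *\<^sub>R x) z = c * H_inner (Suc r) \<Omega> x z"
    if "x \<in> H_space (Suc r) \<Omega>" "z \<in> H_space (Suc r) \<Omega>" for x z :: "real ^ 'd \<Rightarrow> 'b" and c
  proof -
    have "H_inner r \<Omega> (weak_partial \<Omega> j (c *\<^sub>R x)) (weak_partial \<Omega> j z) =
        c * H_inner r \<Omega> (weak_partial \<Omega> j x) (weak_partial \<Omega> j z)" for j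
    proof -
      have "H_inner r \<Omega> (weak_partial \<Omega> j (c *\<^sub>R x)) (weak_partial \<Omega> j z) = H_inner r \<Omega> (c *\<^sub>R weak_partial \<Omega> j x) (weak_partial \<Omega> j z)"
        by (rule H_inner_AE[OF hw2[OF scale[OF that(1)]] hw2[OF that(2)] weak_partial_scaleR[OF that(1)]]) simp
      then show ?thesis using H.scale_left[OF hw2[OF that(1)] hw2[OF that(2)]] by simp
    qed
    then show ?thesis using L2.scale_left[OF hw3[OF that(1)] hw3[OF that(2)], of c]
      by (simp add: sum_distrib_left algebra_simps)
  qed
  show ?case
  proof
    show "subspace (H_space (Suc r) \<Omega> :: (real ^ 'd \<Rightarrow> 'b) set)"
      unfolding subspace_def using zero add scale by blast
    fix x y z :: "real ^ 'd \<Rightarrow> 'b" and c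
    assume x: "x \<in> H_space (Suc r) \<Omega>"
    show "0 \<le> H_inner (Suc r) \<Omega> x x"
      using L2.nonneg[OF hw3[OF x]] H.nonneg[OF hw2[OF x]] by (auto intro!: add_nonneg_nonneg sum_nonneg)
    assume z: "z \<in> H_space (Suc r) \<Omega>"
    show "H_inner (Suc r) \<Omega> (c *\<^sub>R x) z = c * H_inner (Suc r) \<Omega> x z"
      by (rule scalel[OF x z])
    show "H_inner (Suc r) \<Omega> z (c *\<^sub>R x) = c * H_inner (Suc r) \<Omega> z x"
      using scalel[OF x z] comm[OF z scale[OF x]] comm[OF z x] by simp
    assume y: "y \<in> H_space (Suc r) \<Omega>"
    show "H_inner (Suc r) \<Omega> (x + y) z = H_inner (Suc r) \<Omega> x z + H_inner (Suc r) \<Omega> y z"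
      by (rule addl[OF x y z])
    show "H_inner (Suc r) \<Omega> z (x + y) = H_inner (Suc r) \<Omega> z x + H_inner (Suc r) \<Omega> z y"
      using addl[OF x y z] comm[OF z add[OF x y]] comm[OF z x] comm[OF z y] by simp
    show "H_inner (Suc r) \<Omega> x y = H_inner (Suc r) \<Omega> y x" by (rule comm[OF x y])
  qed
qed

lemma H_space_mono: "f \<in> H_space (Suc r) \<Omega> \<Longrightarrow> f \<in> H_space r \<Omega>"
proof (induction r arbitrary: f)
  case (Suc r)
  have "\<exists>g\<in>H_space r \<Omega>. has_weak_partial \<Omega> j f g" for j
    using Suc.IH[OF weak_partial_H[OF Suc.prems]] weak_partial_has[OF Suc.prems] by blast
  then show ?case using H_space_L2[OF Suc.prems] by simp
qed simp

lemma H_inner_mono: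
  fixes f :: "real ^ 'd \<Rightarrow> 'b::euclidean_space"
  shows "f \<in> H_space (Suc r) \<Omega> \<Longrightarrow> H_inner r \<Omega> f f \<le> H_inner (Suc r) \<Omega> f f"
proof (induction r arbitrary: f)
  case 0
  interpret L2: semi_inner "L2_space \<Omega> :: (real ^ 'd \<Rightarrow> 'b) set" "L2_inner \<Omega>" by (rule L2_semi_inner)
  have "weak_partial \<Omega> j f \<in> L2_space \<Omega>" for j using weak_partial_H[OF 0, of j] by simp
  then have "0 \<le> (\<Sum>j\<in>UNIV. L2_inner \<Omega> (weak_partial \<Omega> j f) (weak_partial \<Omega> j f))"
    by (intro sum_nonneg L2.nonneg)
  then show ?case by simp
next
  case (Suc r)
  have "H_inner (Suc r) \<Omega> f f \<le> L2_inner \<Omega> f f + (\<Sum>j\<in>UNIV. H_inner (Suc r) \<Omega> (weak_partial \<Omega> j f) (weak_partial \<Omega> j f))"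
    using sum_mono[of UNIV, OF Suc.IH[OF weak_partial_H[OF Suc.prems]]] by simp
  also have "\<dots> = H_inner (Suc (Suc r)) \<Omega> f f" by (rule H_inner.simps(2)[symmetric])
  finally show ?case .
qed

lemma H_norm_mono: "f \<in> H_space (Suc r) \<Omega> \<Longrightarrow> H_norm r \<Omega> f \<le> H_norm (Suc r) \<Omega> f"
  unfolding H_norm_eq seminrm_def by (intro real_sqrt_le_mono H_inner_mono)

lemma L2_norm_le_H_norm:
  fixes f :: "real ^ 'd \<Rightarrow> 'b::euclidean_space"
  shows "f \<in> H_space r \<Omega> \<Longrightarrow> seminrm (L2_inner \<Omega>) f \<le> H_norm r \<Omega> f"
proof (induction r)
  case (Suc r)
  then show ?case using H_norm_mono[OF Suc.prems] H_space_mono[OF Suc.prems] by simp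
qed (simp add: H_norm_0_eq)

lemma weak_partial_norm_le:
  fixes f :: "real ^ 'd \<Rightarrow> 'b::euclidean_space"
  assumes "f \<in> H_space (Suc r) \<Omega>" shows "H_norm r \<Omega> (weak_partial \<Omega> j f) \<le> H_norm (Suc r) \<Omega> f"
proof -
  interpret L2: semi_inner "L2_space \<Omega> :: (real ^ 'd \<Rightarrow> 'b) set" "L2_inner \<Omega>" by (rule L2_semi_inner)
  interpret H: semi_inner "H_space r \<Omega> :: (real ^ 'd \<Rightarrow> 'b) set" "H_inner r \<Omega>" by (rule H_semi_inner)
  have "H_inner r \<Omega> (weak_partial \<Omega> j f) (weak_partial \<Omega> j f) \<le> (\<Sum>j\<in>UNIV. H_inner r \<Omega> (weak_partial \<Omega> j f) (weak_partial \<Omega> j f))"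
    by (intro member_le_sum) (auto intro: H.nonneg weak_partial_H[OF assms])
  also have "\<dots> \<le> H_inner (Suc r) \<Omega> f f" using L2.nonneg[OF H_space_L2[OF assms]] by simp
  finally show ?thesis unfolding H_norm_eq seminrm_def by simp
qed

lemma weak_partial_diff:
  assumes f: "f \<in> H_space (Suc r) \<Omega>" and g: "g \<in> H_space (Suc r) \<Omega>"
  shows "AE x in lebesgue_on \<Omega>. weak_partial \<Omega> j (f - g) x = (weak_partial \<Omega> j f - weak_partial \<Omega> j g) x"
proof -
  have "has_weak_partial \<Omega> j (f + (-1) *\<^sub>R g) (weak_partial \<Omega> j f + (-1) *\<^sub>R weak_partial \<Omega> j g)"
    by (intro has_weak_partial_add has_weak_partial_scaleR weak_partial_has[OF f] weak_partial_has[OF g])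
  from weak_partial_eqI[OF this] show ?thesis by simp
qed

lemma H_norm_AE: "f \<in> H_space r \<Omega> \<Longrightarrow> AE x in lebesgue_on \<Omega>. f x = g x \<Longrightarrow> H_norm r \<Omega> f = H_norm r \<Omega> g"
  using H_inner_AE[of f r f g g] by (simp add: H_norm_eq seminrm_def)

end

section \<open>Completeness\<close>

context bounded_open_set
begin

text \<open>The Riesz-Fischer argument: along a subsequence with geometrically decaying increments
  there is convergence almost everywhere, and Fatou's lemma recovers convergence in the
  norm.\<close>

lemma L2_complete:
  fixes f :: "nat \<Rightarrow> real ^ 'd \<Rightarrow> 'b::euclidean_space"
  assumes f: "\<And>n. f n \<in> L2_space \<Omega>"
    and cauchy: "\<And>e. 0 < e \<Longrightarrow> \<exists>N. \<forall>m\<ge>N. \<forall>n\<ge>N. seminrm (L2_inner \<Omega>) (f m - f n) < e"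
  shows "\<exists>g\<in>L2_space \<Omega>. (\<lambda>n. seminrm (L2_inner \<Omega>) (f n - g)) \<longlonglongrightarrow> 0"
proof -
  interpret L2: semi_inner "L2_space \<Omega> :: (real ^ 'd \<Rightarrow> 'b) set" "L2_inner \<Omega>" by (rule L2_semi_inner)
  interpret finite_measure "lebesgue_on \<Omega>" by (rule finite_measure_\<Omega>)
  let ?M = "lebesgue_on \<Omega>"
  note [measurable] = L2_measurable[OF f]
  have diffL2: "f m - f n \<in> L2_space \<Omega>" for m n by (rule subspace_diff[OF L2.sub f f])
  have "\<exists>r. \<forall>k. strict_mono r \<and> (\<forall>m\<ge>r k. \<forall>n\<ge>r k. seminrm (L2_inner \<Omega>) (f m - f n) < (1/2) ^ k)" for k :: nat
  proof -
    define P where "P = (\<lambda>k N. \<forall>m\<ge>N. \<forall>n\<ge>N. seminrm (L2_inner \<Omega>) (f m - f n) < (1/2) ^ k)"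
    have "\<exists>r. strict_mono r \<and> (\<forall>k. P k (r k))"
    proof -
      have "\<exists>N. P k N" for k unfolding P_def by (rule cauchy) simp
      then obtain N where N: "\<And>k. P k (N k)" by metis
      define r where "r = rec_nat (N 0) (\<lambda>k x. max (Suc x) (N (Suc k)))"
      have "strict_mono r" by (rule strict_mono_Suc_iff[THEN iffD2]) (auto simp: r_def less_max_iff_disj)
      moreover have "N k \<le> r k" for k by (cases k) (auto simp: r_def)
      then have "P k (r k)" for k using N[of k] unfolding P_def by (meson order_trans)
      ultimately show ?thesis by blast
    qed
    then show ?thesis unfolding P_def by blast
  qed
  then obtain r where r: "strict_mono r" "\<And>k m n. r k \<le> m \<Longrightarrow> r k \<le> n \<Longrightarrow> seminrm (L2_inner \<Omega>) (f m - f n) < (1/2) ^ k"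
    by metis
  define d where "d = (\<lambda>k x. f (r (Suc k)) x - f (r k) x)"
  have dL2: "d k \<in> L2_space \<Omega>" for k using diffL2[of "r (Suc k)" "r k"] by (simp add: d_def fun_diff_def)
  note [measurable] = L2_measurable[OF dL2]
  have sq: "(LINT x|?M. (norm (d k x))\<^sup>2) \<le> (1/4) ^ k" for k
  proof -
    have "seminrm (L2_inner \<Omega>) (d k) < (1/2) ^ k"
      using r(2)[of k "r (Suc k)" "r k"] strict_mono_leD[OF r(1), of k "Suc k"] by (simp add: d_def fun_diff_def)
    then have "(seminrm (L2_inner \<Omega>) (d k))\<^sup>2 \<le> ((1/2) ^ k)\<^sup>2"
      by (intro power_mono) (auto intro: L2.seminrm_nonneg dL2)
    also have "((1/2) ^ k)\<^sup>2 = (1/4 :: real) ^ k" by (simp add: power2_eq_square flip: power_mult_distrib)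
    finally show ?thesis by (simp add: L2.seminrm_sq[OF dL2] L2_inner_def power2_norm_eq_inner)
  qed
  have dint: "integrable ?M (\<lambda>x. norm (d k x))" and dbound: "(LINT x|?M. norm (d k x)) \<le> (1/2) ^ k * (1 + measure ?M (space ?M))" for k
  proof -
    \<comment> \<open>On a set of finite measure this weighted inequality trades L^2 smallness for
      L^1 smallness: the squares integrate to at most (1/4)^k, so both terms become of order
      (1/2)^k.\<close>
    have pt: "norm (d k x) \<le> 2 ^ k * (norm (d k x))\<^sup>2 + (1/2) ^ k" for x
    proof -
      have "2 * 1 * (2 ^ k * norm (d k x)) \<le> 1\<^sup>2 + (2 ^ k * norm (d k x))\<^sup>2" by (rule sum_squares_bound)
      then have "2 ^ k * norm (d k x) \<le> 1 + (2 ^ k)\<^sup>2 * (norm (d k x))\<^sup>2" by (simp add: power_mult_distrib) (smt (verit) mult_nonneg_nonneg norm_ge_zero zero_le_power)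
      then show ?thesis by (simp add: field_simps power2_eq_square)
    qed
    have i: "integrable ?M (\<lambda>x. 2 ^ k * (norm (d k x))\<^sup>2 + (1/2) ^ k)" using L2_integrable_sq[OF dL2] by auto
    show di: "integrable ?M (\<lambda>x. norm (d k x))"
      by (rule Bochner_Integration.integrable_bound[OF i]) (use pt in auto)
    have "(LINT x|?M. norm (d k x)) \<le> (LINT x|?M. 2 ^ k * (norm (d k x))\<^sup>2 + (1/2) ^ k)"
      by (rule integral_mono[OF di i pt])
    also have "\<dots> = 2 ^ k * (LINT x|?M. (norm (d k x))\<^sup>2) + measure ?M (space ?M) * (1/2) ^ k"
      using L2_integrable_sq[OF dL2] by simp
    also have "\<dots> \<le> 2 ^ k * (1/4) ^ k + measure ?M (space ?M) * (1/2) ^ k"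
      using sq by (intro add_right_mono mult_left_mono) auto
    also have "2 ^ k * (1/4) ^ k = (1/2 :: real) ^ k" by (simp flip: power_mult_distrib)
    finally show "(LINT x|?M. norm (d k x)) \<le> (1/2) ^ k * (1 + measure ?M (space ?M))" by (simp add: algebra_simps)
  qed
  have "(\<integral>\<^sup>+x. (\<Sum>k. ennreal (norm (d k x))) \<partial>?M) = (\<Sum>k. \<integral>\<^sup>+x. ennreal (norm (d k x)) \<partial>?M)"
    by (intro nn_integral_suminf) measurable
  also have "\<dots> \<le> (\<Sum>k. ennreal ((1/2) ^ k * (1 + measure ?M (space ?M))))"
    using dint dbound by (intro suminf_le) (auto simp: nn_integral_eq_integral intro!: ennreal_leI)
  also have "\<dots> = ennreal (\<Sum>k. (1/2) ^ k * (1 + measure ?M (space ?M)))"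
    by (intro suminf_ennreal2 summable_mult2) auto
  finally have "(\<integral>\<^sup>+x. (\<Sum>k. ennreal (norm (d k x))) \<partial>?M) \<noteq> \<infinity>"
    using ennreal_less_top le_less_trans by (metis infinity_ennreal_def less_irrefl top.not_eq_extremum)
  then have "AE x in ?M. (\<Sum>k. ennreal (norm (d k x))) \<noteq> \<infinity>"
    by (intro nn_integral_PInf_AE) measurable
  then have conv: "AE x in ?M. convergent (\<lambda>k. f (r k) x)"
  proof (rule eventually_mono)
    fix x assume "(\<Sum>k. ennreal (norm (d k x))) \<noteq> \<infinity>"
    then have "summable (\<lambda>k. norm (d k x))" by (intro summable_suminf_not_top) auto
    then have "summable (\<lambda>k. d k x)" by (rule summable_norm_cancel)
    then have "convergent (\<lambda>n. \<Sum>k<n. d k x)" by (simp add: summable_iff_convergent)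
    then have "convergent (\<lambda>n. f (r n) x - f (r 0) x)" using sum_lessThan_telescope[of "\<lambda>n. f (r n) x"] by (simp add: d_def)
    then obtain L where "(\<lambda>n. f (r n) x - f (r 0) x) \<longlonglongrightarrow> L" by (auto simp: convergent_def)
    from tendsto_add[OF this tendsto_const[of "f (r 0) x"]] show "convergent (\<lambda>k. f (r k) x)" by (auto simp: convergent_def)
  qed
  define g where "g = (\<lambda>x. lim (\<lambda>k. f (r k) x))"
  have gm [measurable]: "g \<in> borel_measurable ?M" unfolding g_def by measurable
  have lim: "AE x in ?M. (\<lambda>k. f (r k) x) \<longlonglongrightarrow> g x" using conv by (simp add: g_def convergent_LIMSEQ_iff)
  \<comment> \<open>Fatou along the subsequence \<open>r\<close> bounds the distance to
    \<open>g\<close> of every \<open>f n\<close> with \<open>n \<ge> r k\<close>. It yields at once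
    that this difference is square integrable and that the whole sequence converges.\<close>
  have fatou: "(\<integral>\<^sup>+x. ennreal ((norm (f n x - g x))\<^sup>2) \<partial>?M) \<le> ennreal (((1/2) ^ k)\<^sup>2)" if n: "r k \<le> n" for n k
  proof -
    have "(\<integral>\<^sup>+x. ennreal ((norm (f n x - g x))\<^sup>2) \<partial>?M) \<le> (\<integral>\<^sup>+x. liminf (\<lambda>i. ennreal ((norm (f n x - f (r i) x))\<^sup>2)) \<partial>?M)"
    proof (rule nn_integral_mono_AE, use lim in \<open>rule eventually_mono\<close>)
      fix x assume "(\<lambda>k. f (r k) x) \<longlonglongrightarrow> g x"
      then have "(\<lambda>i. ennreal ((norm (f n x - f (r i) x))\<^sup>2)) \<longlonglongrightarrow> ennreal ((norm (f n x - g x))\<^sup>2)"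
        by (intro tendsto_intros)
      from lim_imp_Liminf[OF _ this]
      show "ennreal ((norm (f n x - g x))\<^sup>2) \<le> liminf (\<lambda>i. ennreal ((norm (f n x - f (r i) x))\<^sup>2))" by simp
    qed
    also have "\<dots> \<le> liminf (\<lambda>i. \<integral>\<^sup>+x. ennreal ((norm (f n x - f (r i) x))\<^sup>2) \<partial>?M)"
      by (rule nn_integral_liminf) measurable
    also have "\<dots> \<le> limsup (\<lambda>i. \<integral>\<^sup>+x. ennreal ((norm (f n x - f (r i) x))\<^sup>2) \<partial>?M)" by (rule Liminf_le_Limsup) simp
    also have "\<dots> \<le> ennreal (((1/2) ^ k)\<^sup>2)"
    proof (rule Limsup_bounded, rule eventually_sequentiallyI)
      fix i assume "k \<le> i"
      then have "seminrm (L2_inner \<Omega>) (f n - f (r i)) < (1/2) ^ k"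
        using n strict_mono_leD[OF r(1)] by (intro r(2))
      then have "(seminrm (L2_inner \<Omega>) (f n - f (r i)))\<^sup>2 \<le> ((1/2) ^ k)\<^sup>2"
        by (intro power_mono) (auto intro: L2.seminrm_nonneg diffL2)
      moreover have "(seminrm (L2_inner \<Omega>) (f n - f (r i)))\<^sup>2 = (LINT x|?M. (norm (f n x - f (r i) x))\<^sup>2)"
        by (simp add: L2.seminrm_sq[OF diffL2] L2_inner_def power2_norm_eq_inner)
      moreover have "integrable ?M (\<lambda>x. (norm (f n x - f (r i) x))\<^sup>2)" using L2_integrable_sq[OF diffL2[of n "r i"]] by simp
      ultimately show "(\<integral>\<^sup>+x. ennreal ((norm (f n x - f (r i) x))\<^sup>2) \<partial>?M) \<le> ennreal (((1/2) ^ k)\<^sup>2)"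
        by (simp add: nn_integral_eq_integral ennreal_leI)
    qed
    finally show ?thesis .
  qed
  have fgL2: "f n - g \<in> L2_space \<Omega>" and fgb: "seminrm (L2_inner \<Omega>) (f n - g) \<le> (1/2) ^ k" if n: "r k \<le> n" for n k
  proof -
    have "integrable ?M (\<lambda>x. (norm (f n x - g x))\<^sup>2)"
      using fatou[OF n] le_less_trans[OF fatou[OF n] ennreal_less_top] by (intro integrableI_bounded) auto
    then show L: "f n - g \<in> L2_space \<Omega>" using gm L2_measurable[OF f[of n]] by (simp add: L2_space_def fun_diff_def)
    have "ennreal (LINT x|?M. (norm (f n x - g x))\<^sup>2) \<le> ennreal (((1/2) ^ k)\<^sup>2)"
      using fatou[OF n] \<open>integrable ?M (\<lambda>x. (norm (f n x - g x))\<^sup>2)\<close> by (simp add: nn_integral_eq_integral)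
    then have "(seminrm (L2_inner \<Omega>) (f n - g))\<^sup>2 \<le> ((1/2) ^ k)\<^sup>2"
      by (simp add: L2.seminrm_sq[OF L] L2_inner_def power2_norm_eq_inner)
    then show "seminrm (L2_inner \<Omega>) (f n - g) \<le> (1/2) ^ k" by (rule power2_le_imp_le) simp
  qed
  have "g = f (r 0) - (f (r 0) - g)" by simp
  then have gL2: "g \<in> L2_space \<Omega>" using subspace_diff[OF L2.sub f[of "r 0"] fgL2[of 0 "r 0"]] by simp
  have "(\<lambda>n. seminrm (L2_inner \<Omega>) (f n - g)) \<longlonglongrightarrow> 0"
  proof (rule LIMSEQ_I)
    fix e :: real assume "0 < e"
    then obtain k where k: "(1/2) ^ k < e" using real_arch_pow_inv[of e "1/2"] by auto
    have "norm (seminrm (L2_inner \<Omega>) (f n - g) - 0) < e" if "r k \<le> n" for n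
      using fgb[OF that] k L2.seminrm_nonneg[OF fgL2[OF that]] by simp
    then show "\<exists>n0. \<forall>n\<ge>n0. norm (seminrm (L2_inner \<Omega>) (f n - g) - 0) < e" by blast
  qed
  then show ?thesis using gL2 by blast
qed

lemma L2_inner_tendsto:
  fixes f :: "nat \<Rightarrow> real ^ 'd \<Rightarrow> 'b::euclidean_space"
  assumes "\<And>n. f n \<in> L2_space \<Omega>" "g \<in> L2_space \<Omega>" "w \<in> L2_space \<Omega>"
    and "(\<lambda>n. seminrm (L2_inner \<Omega>) (f n - g)) \<longlonglongrightarrow> 0"
  shows "(\<lambda>n. L2_inner \<Omega> (f n) w) \<longlonglongrightarrow> L2_inner \<Omega> g w"
proof -
  interpret L2: semi_inner "L2_space \<Omega> :: (real ^ 'd \<Rightarrow> 'b) set" "L2_inner \<Omega>" by (rule L2_semi_inner)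
  have d: "f n - g \<in> L2_space \<Omega>" for n by (rule subspace_diff[OF L2.sub assms(1,2)])
  have "(\<lambda>n. seminrm (L2_inner \<Omega>) (f n - g) * seminrm (L2_inner \<Omega>) w) \<longlonglongrightarrow> 0"
    using assms(4) by (rule tendsto_mult_left_zero)
  then have "(\<lambda>n. L2_inner \<Omega> (f n - g) w) \<longlonglongrightarrow> 0"
    by (rule Lim_null_comparison[rotated]) (use L2.Cauchy_Schwarz[OF d assms(3)] in simp)
  then show ?thesis using L2.diff_left[OF assms(1,2,3)] by (simp add: LIM_zero_iff)
qed

lemma test_scaled_L2:
  fixes \<phi> :: "real ^ 'd \<Rightarrow> real" and c :: "'b::euclidean_space"
  assumes \<phi>: "\<phi> \<in> test_functions \<Omega>" shows "(\<lambda>x. \<phi> x *\<^sub>R c) \<in> L2_space \<Omega>"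
proof -
  define K where "K = closure {x. \<phi> x \<noteq> 0}"
  have K: "compact K" "\<And>x. x \<notin> K \<Longrightarrow> \<phi> x = 0"
    using test_functionsD(2)[OF \<phi>] closure_subset[of "{x. \<phi> x \<noteq> 0}"] by (auto simp: K_def)
  have c: "continuous_on UNIV (\<lambda>x. (\<phi> x)\<^sup>2 * (norm c)\<^sup>2)" using test_functionsD(4)[OF \<phi>] by (intro continuous_intros)
  have "integrable lebesgue (\<lambda>x. (\<phi> x)\<^sup>2 * (norm c)\<^sup>2)"
    by (rule integrable_continuous_compact_support(2)[OF c K(1)]) (use K(2) in simp)
  then have "integrable lebesgue (\<lambda>x. indicator \<Omega> x *\<^sub>R ((\<phi> x)\<^sup>2 * (norm c)\<^sup>2))"
    using integrable_mult_indicator[OF \<Omega>_sets] by blast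
  then have i: "integrable (lebesgue_on \<Omega>) (\<lambda>x. (\<phi> x)\<^sup>2 * (norm c)\<^sup>2)"
    by (rule integrable_restrict_space[THEN iffD2, rotated]) simp
  have "\<phi> \<in> borel_measurable (lebesgue_on \<Omega>)"
    using test_functionsD(4)[OF \<phi>] by (intro continuous_imp_measurable_on_sets_lebesgue) (auto intro: continuous_on_subset)
  then show ?thesis by (intro L2_spaceI[OF _ i]) (auto simp: power_mult_distrib)
qed

text \<open>Taking the component along \<open>c\<close> writes the vector-valued identity as L^2
  products with \<phi> times \<open>c\<close>, and these pass to the limit. So the weak derivative
  is a closed operator.\<close>

lemma has_weak_partial_limit:
  fixes f :: "nat \<Rightarrow> real ^ 'd \<Rightarrow> 'b::euclidean_space"
  assumes w: "\<And>n. has_weak_partial \<Omega> j (f n) (g n)" and L2: "\<And>n. f n \<in> L2_space \<Omega>" "\<And>n. g n \<in> L2_space \<Omega>" "u \<in> L2_space \<Omega>" "v \<in> L2_space \<Omega>"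
    and lim: "(\<lambda>n. seminrm (L2_inner \<Omega>) (f n - u)) \<longlonglongrightarrow> 0" "(\<lambda>n. seminrm (L2_inner \<Omega>) (g n - v)) \<longlonglongrightarrow> 0"
  shows "has_weak_partial \<Omega> j u v"
  unfolding has_weak_partial_def
proof (intro conjI allI impI)
  show li: "locally_integrable \<Omega> u" "locally_integrable \<Omega> v" by (intro L2_locally_integrable L2)+
  fix \<phi> :: "real ^ 'd \<Rightarrow> real" assume \<phi>: "\<phi> \<in> test_functions \<Omega>"
  define \<phi>' where "\<phi>' = (\<lambda>x. frechet_derivative \<phi> (at x) (axis j 1))"
  have \<phi>': "\<phi>' \<in> test_functions \<Omega>" unfolding \<phi>'_def by (rule test_functions_partial[OF \<phi>]) simp
  have comp: "L2_inner \<Omega> u (\<lambda>x. \<psi> x *\<^sub>R c) = (LINT x|lebesgue_on \<Omega>. \<psi> x *\<^sub>R u x) \<bullet> c"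
    if "u \<in> L2_space \<Omega>" "\<psi> \<in> test_functions \<Omega>" for u :: "real ^ 'd \<Rightarrow> 'b" and \<psi> c
    unfolding L2_inner_def
    by (subst integral_inner_left[symmetric]) (auto intro: test_mult_integrable L2_locally_integrable that)
  show "(LINT x|lebesgue_on \<Omega>. frechet_derivative \<phi> (at x) (axis j 1) *\<^sub>R u x) = - (LINT x|lebesgue_on \<Omega>. \<phi> x *\<^sub>R v x)"
  proof (rule euclidean_eqI)
    fix c :: 'b
    have "(\<lambda>n. L2_inner \<Omega> (f n) (\<lambda>x. \<phi>' x *\<^sub>R c)) \<longlonglongrightarrow> L2_inner \<Omega> u (\<lambda>x. \<phi>' x *\<^sub>R c)"
      by (intro L2_inner_tendsto L2 test_scaled_L2 \<phi>' lim)
    moreover have "(\<lambda>n. - L2_inner \<Omega> (g n) (\<lambda>x. \<phi> x *\<^sub>R c)) \<longlonglongrightarrow> - L2_inner \<Omega> v (\<lambda>x. \<phi> x *\<^sub>R c)"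
      by (intro tendsto_minus L2_inner_tendsto L2 test_scaled_L2 \<phi> lim)
    moreover have "L2_inner \<Omega> (f n) (\<lambda>x. \<phi>' x *\<^sub>R c) = - L2_inner \<Omega> (g n) (\<lambda>x. \<phi> x *\<^sub>R c)" for n
      using has_weak_partialD(3)[OF w[of n] \<phi>] by (simp add: comp L2 \<phi> \<phi>') (simp add: \<phi>'_def)
    ultimately have "L2_inner \<Omega> u (\<lambda>x. \<phi>' x *\<^sub>R c) = - L2_inner \<Omega> v (\<lambda>x. \<phi> x *\<^sub>R c)"
      using LIMSEQ_unique by simp
    then show "(LINT x|lebesgue_on \<Omega>. frechet_derivative \<phi> (at x) (axis j 1) *\<^sub>R u x) \<bullet> c = - (LINT x|lebesgue_on \<Omega>. \<phi> x *\<^sub>R v x) \<bullet> c"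
      by (simp add: comp L2 \<phi> \<phi>') (simp add: \<phi>'_def)
  qed
qed

text \<open>Induction on the order: the function and its derivatives converge in the lower-order
  spaces, and closedness of the weak derivative identifies the limits. Completeness is what later
  puts increments of the solution into H^2.\<close>

lemma H_complete:
  fixes f :: "nat \<Rightarrow> real ^ 'd \<Rightarrow> 'b::euclidean_space"
  assumes "\<And>n. f n \<in> H_space r \<Omega>"
    and "\<And>e. 0 < e \<Longrightarrow> \<exists>N. \<forall>m\<ge>N. \<forall>n\<ge>N. H_norm r \<Omega> (f m - f n) < e"
  shows "\<exists>g\<in>H_space r \<Omega>. (\<lambda>n. H_norm r \<Omega> (f n - g)) \<longlonglongrightarrow> 0"
  using assms
proof (induction r arbitrary: f)
  case 0
  then show ?case unfolding H_norm_0_eq H_space.simps by (rule L2_complete)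
next
  case (Suc r)
  interpret L2: semi_inner "L2_space \<Omega> :: (real ^ 'd \<Rightarrow> 'b) set" "L2_inner \<Omega>" by (rule L2_semi_inner)
  interpret H: semi_inner "H_space r \<Omega> :: (real ^ 'd \<Rightarrow> 'b) set" "H_inner r \<Omega>" by (rule H_semi_inner)
  interpret H': semi_inner "H_space (Suc r) \<Omega> :: (real ^ 'd \<Rightarrow> 'b) set" "H_inner (Suc r) \<Omega>" by (rule H_semi_inner)
  have fL2: "f n \<in> L2_space \<Omega>" for n by (rule H_space_L2[OF Suc.prems(1)])
  have dH: "f m - f n \<in> H_space (Suc r) \<Omega>" for m n by (rule subspace_diff[OF H'.sub Suc.prems(1) Suc.prems(1)])
  have "\<exists>N. \<forall>m\<ge>N. \<forall>n\<ge>N. seminrm (L2_inner \<Omega>) (f m - f n) < e" if "0 < e" for e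
    using Suc.prems(2)[OF that] L2_norm_le_H_norm[OF dH] le_less_trans by meson
  then obtain g where g: "g \<in> L2_space \<Omega>" "(\<lambda>n. seminrm (L2_inner \<Omega>) (f n - g)) \<longlonglongrightarrow> 0"
    using L2_complete[of f] fL2 by blast
  define w where "w = (\<lambda>j n. weak_partial \<Omega> j (f n))"
  have wH: "w j n \<in> H_space r \<Omega>" for j n unfolding w_def by (rule weak_partial_H[OF Suc.prems(1)])
  have "H_norm r \<Omega> (w j m - w j n) \<le> H_norm (Suc r) \<Omega> (f m - f n)" for j m n
  proof -
    have "H_norm r \<Omega> (weak_partial \<Omega> j (f m - f n)) = H_norm r \<Omega> (w j m - w j n)"
      using weak_partial_diff[OF Suc.prems(1)[of m] Suc.prems(1)[of n], of j] unfolding w_def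
      by (intro H_norm_AE weak_partial_H[OF dH])
    then show ?thesis using weak_partial_norm_le[OF dH[of m n], of j] by simp
  qed
  then have "\<exists>N. \<forall>m\<ge>N. \<forall>n\<ge>N. H_norm r \<Omega> (w j m - w j n) < e" if "0 < e" for j e
    using Suc.prems(2)[OF that] le_less_trans by meson
  then have "\<exists>h\<in>H_space r \<Omega>. (\<lambda>n. H_norm r \<Omega> (w j n - h)) \<longlonglongrightarrow> 0" for j
    using Suc.IH[of "w j"] wH by blast
  then obtain h where h: "\<And>j. h j \<in> H_space r \<Omega>" "\<And>j. (\<lambda>n. H_norm r \<Omega> (w j n - h j)) \<longlonglongrightarrow> 0" by metis
  have hp: "has_weak_partial \<Omega> j g (h j)" for j
  proof (rule has_weak_partial_limit)
    show "has_weak_partial \<Omega> j (f n) (w j n)" for n unfolding w_def by (rule weak_partial_has[OF Suc.prems(1)])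
    show "(\<lambda>n. seminrm (L2_inner \<Omega>) (w j n - h j)) \<longlonglongrightarrow> 0"
      by (rule tendsto_sandwich[OF _ _ tendsto_const h(2)[of j]])
        (auto intro!: always_eventually L2.seminrm_nonneg L2_norm_le_H_norm H_space_L2 subspace_diff[OF H.sub] wH h(1))
  qed (use fL2 H_space_L2[OF wH] g H_space_L2[OF h(1)] in auto)
  have gH: "g \<in> H_space (Suc r) \<Omega>" using g(1) hp h(1) by auto
  have fgH: "f n - g \<in> H_space (Suc r) \<Omega>" for n by (rule subspace_diff[OF H'.sub Suc.prems(1) gH])
  have "(H_norm (Suc r) \<Omega> (f n - g))\<^sup>2 = (seminrm (L2_inner \<Omega>) (f n - g))\<^sup>2 + (\<Sum>j\<in>UNIV. (H_norm r \<Omega> (w j n - h j))\<^sup>2)" for n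
  proof -
    have "H_inner r \<Omega> (weak_partial \<Omega> j (f n - g)) (weak_partial \<Omega> j (f n - g)) = (H_norm r \<Omega> (w j n - h j))\<^sup>2" for j
    proof -
      have "has_weak_partial \<Omega> j (f n + (-1) *\<^sub>R g) (w j n + (-1) *\<^sub>R h j)"
        unfolding w_def by (intro has_weak_partial_add has_weak_partial_scaleR weak_partial_has[OF Suc.prems(1)] hp)
      from weak_partial_eqI[OF this] have "AE x in lebesgue_on \<Omega>. weak_partial \<Omega> j (f n - g) x = (w j n - h j) x" by simp
      then have "H_norm r \<Omega> (weak_partial \<Omega> j (f n - g)) = H_norm r \<Omega> (w j n - h j)"
        by (rule H_norm_AE[OF weak_partial_H[OF fgH]])
      then show ?thesis
        using H.seminrm_sq[OF weak_partial_H[OF fgH[of n], of j]] by (simp add: H_norm_eq)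
    qed
    then show ?thesis
      using H'.seminrm_sq[OF fgH, of n] L2.seminrm_sq[OF H_space_L2[OF fgH], of n] by (simp add: H_norm_eq)
  qed
  moreover have "(\<lambda>n. (seminrm (L2_inner \<Omega>) (f n - g))\<^sup>2 + (\<Sum>j\<in>UNIV. (H_norm r \<Omega> (w j n - h j))\<^sup>2)) \<longlonglongrightarrow> 0\<^sup>2 + (\<Sum>j\<in>(UNIV::'d set). 0\<^sup>2)"
    by (intro tendsto_intros g h)
  ultimately have "(\<lambda>n. (H_norm (Suc r) \<Omega> (f n - g))\<^sup>2) \<longlonglongrightarrow> 0" by simp
  then have "(\<lambda>n. sqrt ((H_norm (Suc r) \<Omega> (f n - g))\<^sup>2)) \<longlonglongrightarrow> sqrt 0" by (intro tendsto_intros)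
  moreover have "sqrt ((H_norm (Suc r) \<Omega> (f n - g))\<^sup>2) = H_norm (Suc r) \<Omega> (f n - g)" for n
    using H'.seminrm_nonneg[OF fgH] by (simp add: H_norm_eq)
  ultimately have "(\<lambda>n. H_norm (Suc r) \<Omega> (f n - g)) \<longlonglongrightarrow> 0" by simp
  then show ?case using gH by blast
qed

end

section \<open>Elastic bilinear forms\<close>

declare H_space.simps(2) [simp del] H_inner.simps(2) [simp del]

lemma sum4_swap:
  fixes f :: "'a \<Rightarrow> 'b \<Rightarrow> 'c \<Rightarrow> 'd \<Rightarrow> real"
  shows "(\<Sum>i\<in>I. \<Sum>j\<in>J. \<Sum>k\<in>K. \<Sum>l\<in>L. f i j k l) = (\<Sum>k\<in>K. \<Sum>l\<in>L. \<Sum>i\<in>I. \<Sum>j\<in>J. f i j k l)"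
proof -
  have "(\<Sum>i\<in>I. \<Sum>j\<in>J. \<Sum>k\<in>K. \<Sum>l\<in>L. f i j k l) = (\<Sum>i\<in>I. \<Sum>k\<in>K. \<Sum>j\<in>J. \<Sum>l\<in>L. f i j k l)"
    by (rule sum.cong[OF refl], rule sum.swap)
  also have "\<dots> = (\<Sum>k\<in>K. \<Sum>i\<in>I. \<Sum>j\<in>J. \<Sum>l\<in>L. f i j k l)" by (rule sum.swap)
  also have "\<dots> = (\<Sum>k\<in>K. \<Sum>i\<in>I. \<Sum>l\<in>L. \<Sum>j\<in>J. f i j k l)"
    by (rule sum.cong[OF refl], rule sum.cong[OF refl], rule sum.swap)
  also have "\<dots> = (\<Sum>k\<in>K. \<Sum>l\<in>L. \<Sum>i\<in>I. \<Sum>j\<in>J. f i j k l)"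
    by (rule sum.cong[OF refl], rule sum.swap)
  finally show ?thesis .
qed

lemma symmetric_tensorD:
  assumes "symmetric_tensor M"
  shows "M $ i $ j $ k $ l = M $ j $ i $ k $ l" "M $ i $ j $ k $ l = M $ i $ j $ l $ k" "M $ i $ j $ k $ l = M $ k $ l $ i $ j"
  using assms unfolding symmetric_tensor_def by blast+

lemma tensor_app_component: "tensor_app M \<xi> $ i $ j = (\<Sum>k\<in>UNIV. \<Sum>l\<in>UNIV. M $ i $ j $ k $ l * \<xi> $ k $ l)"
  by (simp add: tensor_app_def)

lemma tensor_app_add: "tensor_app M (\<xi> + \<zeta>) = tensor_app M \<xi> + tensor_app M \<zeta>"
  by (simp add: vec_eq_iff tensor_app_component distrib_left sum.distrib)

lemma tensor_app_scaleR: "tensor_app M (c *\<^sub>R \<xi>) = c *\<^sub>R tensor_app M \<xi>"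
  by (simp add: vec_eq_iff tensor_app_component sum_distrib_left mult_ac)

lemma tensor_app_add_tensor: "tensor_app (M + M') \<xi> = tensor_app M \<xi> + tensor_app M' \<xi>"
  by (simp add: vec_eq_iff tensor_app_component distrib_right sum.distrib)

lemma tensor_app_scaleR_tensor: "tensor_app (c *\<^sub>R M) \<xi> = c *\<^sub>R tensor_app M \<xi>"
  by (simp add: vec_eq_iff tensor_app_component sum_distrib_left mult_ac)

lemma matrix_inner: "(A :: real ^ 'n ^ 'm) \<bullet> B = (\<Sum>i\<in>UNIV. \<Sum>j\<in>UNIV. A $ i $ j * B $ i $ j)"
  by (simp add: inner_vec_def)

lemma tensor_app_commute:
  assumes "symmetric_tensor M" shows "tensor_app M \<xi> \<bullet> \<zeta> = tensor_app M \<zeta> \<bullet> \<xi>"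
proof -
  have "tensor_app M \<xi> \<bullet> \<zeta> = (\<Sum>i\<in>UNIV. \<Sum>j\<in>UNIV. \<Sum>k\<in>UNIV. \<Sum>l\<in>UNIV. M $ i $ j $ k $ l * \<xi> $ k $ l * \<zeta> $ i $ j)"
    by (simp add: matrix_inner tensor_app_component sum_distrib_right)
  also have "\<dots> = (\<Sum>k\<in>UNIV. \<Sum>l\<in>UNIV. \<Sum>i\<in>UNIV. \<Sum>j\<in>UNIV. M $ i $ j $ k $ l * \<xi> $ k $ l * \<zeta> $ i $ j)"
    by (rule sum4_swap)
  also have "\<dots> = (\<Sum>k\<in>UNIV. \<Sum>l\<in>UNIV. \<Sum>i\<in>UNIV. \<Sum>j\<in>UNIV. M $ k $ l $ i $ j * \<zeta> $ i $ j * \<xi> $ k $ l)"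
    by (intro sum.cong refl) (subst symmetric_tensorD(3)[OF assms], simp only: mult_ac)
  also have "\<dots> = tensor_app M \<zeta> \<bullet> \<xi>"
    by (simp add: matrix_inner tensor_app_component sum_distrib_right)
  finally show ?thesis .
qed

lemma tensor_app_symmetric:
  assumes "symmetric_tensor M" shows "transpose (tensor_app M \<xi>) = tensor_app M \<xi>"
proof -
  have "M $ i $ j = M $ j $ i" for i j
    unfolding vec_eq_iff using symmetric_tensorD(1)[OF assms] by blast
  then show ?thesis by (simp add: vec_eq_iff transpose_def tensor_app_component)
qed

lemma norm_transpose: "norm (transpose (A :: real ^ 'n ^ 'n)) = norm A"
proof -
  have "transpose A \<bullet> transpose A = A \<bullet> A" unfolding matrix_inner transpose_def by simp (rule sum.swap)
  then show ?thesis by (simp add: norm_eq_sqrt_inner)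
qed

lemma inner_transpose: "transpose (A :: real ^ 'n ^ 'n) \<bullet> B = A \<bullet> transpose B"
  unfolding matrix_inner transpose_def by simp (rule sum.swap)

lemma transpose_add: "transpose (A + B :: real ^ 'n ^ 'm) = transpose A + transpose B"
  by (simp add: vec_eq_iff transpose_def)

lemma transpose_scaleR: "transpose (c *\<^sub>R (A :: real ^ 'n ^ 'm)) = c *\<^sub>R transpose A"
  by (simp add: vec_eq_iff transpose_def)

definition sym_part :: "real ^ 'n ^ 'n \<Rightarrow> real ^ 'n ^ 'n" where
  "sym_part A = (1 / 2) *\<^sub>R (A + transpose A)"

lemma sym_part_transpose: "transpose (sym_part A) = sym_part A"
  by (simp add: sym_part_def transpose_add transpose_scaleR add.commute)

lemma sym_part_add: "sym_part (A + B) = sym_part A + sym_part B"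
  by (simp add: sym_part_def transpose_add algebra_simps)

lemma sym_part_scaleR: "sym_part (c *\<^sub>R A) = c *\<^sub>R sym_part A"
  by (simp add: sym_part_def transpose_scaleR algebra_simps)

lemma norm_sym_part_le: "norm (sym_part A) \<le> norm A"
  using norm_triangle_ineq[of A "transpose A"] by (simp add: sym_part_def norm_transpose)

lemma inner_sym_part: "transpose S = S \<Longrightarrow> S \<bullet> sym_part A = S \<bullet> A"
  using inner_transpose[of S A] by (simp add: sym_part_def inner_add_right)

lemma strain_eq: "strain \<Omega> u x = sym_part (weak_gradient \<Omega> u x)"
  by (simp add: strain_def sym_part_def)

text \<open>The common ground of both coefficient tensors: \<open>tensor_B\<close> is built from a
  difference of elastic tensors and need not be positive, so a bound on the bilinear form over
  symmetric matrices is kept instead of definiteness.\<close>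

definition bounded_tensor :: "(real ^ 'd) set \<Rightarrow> real \<Rightarrow> (real ^ 'd \<Rightarrow> ('d::finite) tensor4) \<Rightarrow> bool" where
  "bounded_tensor \<Omega> K M \<longleftrightarrow> 0 \<le> K \<and> M \<in> borel_measurable (lebesgue_on \<Omega>) \<and>
     (AE x in lebesgue_on \<Omega>. symmetric_tensor (M x)) \<and>
     (AE x in lebesgue_on \<Omega>. \<forall>\<xi> \<zeta>. transpose \<xi> = \<xi> \<longrightarrow> transpose \<zeta> = \<zeta> \<longrightarrow>
        \<bar>tensor_app (M x) \<xi> \<bullet> \<zeta>\<bar> \<le> K * norm \<xi> * norm \<zeta>)"

text \<open>The ellipticity conditions speak of the quadratic form only; Cauchy-Schwarz for the
  semidefinite form on symmetric matrices gives the bilinear bound with the same constant.\<close>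

lemma tensor_Cauchy_Schwarz:
  assumes sym: "symmetric_tensor M" and K: "0 \<le> K"
    and pos: "\<And>\<xi>. transpose \<xi> = \<xi> \<Longrightarrow> 0 \<le> tensor_app M \<xi> \<bullet> \<xi> \<and> tensor_app M \<xi> \<bullet> \<xi> \<le> K * (\<xi> \<bullet> \<xi>)"
    and s: "transpose \<xi> = \<xi>" "transpose \<zeta> = \<zeta>"
  shows "\<bar>tensor_app M \<xi> \<bullet> \<zeta>\<bar> \<le> K * norm \<xi> * norm \<zeta>"
proof -
  interpret semi_inner "{\<xi>. transpose \<xi> = \<xi>}" "\<lambda>\<xi> \<zeta>. tensor_app M \<xi> \<bullet> \<zeta>"
    by unfold_locales (auto simp: subspace_def transpose_add transpose_scaleR tensor_app_add tensor_app_scaleR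
      inner_add_left inner_add_right pos tensor_app_commute[OF sym] vec_eq_iff transpose_def)
  have "\<bar>tensor_app M \<xi> \<bullet> \<zeta>\<bar> \<le> sqrt (tensor_app M \<xi> \<bullet> \<xi>) * sqrt (tensor_app M \<zeta> \<bullet> \<zeta>)"
    using Cauchy_Schwarz[of \<xi> \<zeta>] s by (simp add: seminrm_def)
  also have "\<dots> \<le> sqrt (K * (\<xi> \<bullet> \<xi>)) * sqrt (K * (\<zeta> \<bullet> \<zeta>))"
    using pos s K by (intro mult_mono real_sqrt_le_mono) auto
  also have "\<dots> = K * norm \<xi> * norm \<zeta>"
    using K by (simp add: real_sqrt_mult norm_eq_sqrt_inner)
  finally show ?thesis .
qed

lemma elastic_tensor_bounded:
  fixes \<Omega> :: "(real ^ 'd) set"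
  assumes "elastic_tensor \<Omega> M0 M1 M" "0 < M0" "0 < M1"
  shows "bounded_tensor \<Omega> M1 M"
proof -
  have "AE x in lebesgue_on \<Omega>. \<forall>\<xi> \<zeta>. transpose \<xi> = \<xi> \<longrightarrow> transpose \<zeta> = \<zeta> \<longrightarrow>
        \<bar>tensor_app (M x) \<xi> \<bullet> \<zeta>\<bar> \<le> M1 * norm \<xi> * norm \<zeta>"
  proof -
    have "AE x in lebesgue_on \<Omega>. symmetric_tensor (M x) \<and> (\<forall>\<xi>. transpose \<xi> = \<xi> \<and> \<xi> \<noteq> 0 \<longrightarrow>
        0 < M0 * (\<xi> \<bullet> \<xi>) \<and> M0 * (\<xi> \<bullet> \<xi>) \<le> tensor_app (M x) \<xi> \<bullet> \<xi> \<and>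
        tensor_app (M x) \<xi> \<bullet> \<xi> \<le> M1 * (\<xi> \<bullet> \<xi>))"
      using assms(1) by (simp add: elastic_tensor_def)
    then show ?thesis
    proof (rule eventually_mono, intro allI impI)
      fix x and \<xi> \<zeta> :: "'d tensor2" assume *: "symmetric_tensor (M x) \<and> (\<forall>\<xi>. transpose \<xi> = \<xi> \<and> \<xi> \<noteq> 0 \<longrightarrow>
        0 < M0 * (\<xi> \<bullet> \<xi>) \<and> M0 * (\<xi> \<bullet> \<xi>) \<le> tensor_app (M x) \<xi> \<bullet> \<xi> \<and>
        tensor_app (M x) \<xi> \<bullet> \<xi> \<le> M1 * (\<xi> \<bullet> \<xi>))" and s: "transpose \<xi> = \<xi>" "transpose \<zeta> = \<zeta>"
      show "\<bar>tensor_app (M x) \<xi> \<bullet> \<zeta>\<bar> \<le> M1 * norm \<xi> * norm \<zeta>"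
      proof (rule tensor_Cauchy_Schwarz)
        show "0 \<le> tensor_app (M x) \<xi> \<bullet> \<xi> \<and> tensor_app (M x) \<xi> \<bullet> \<xi> \<le> M1 * (\<xi> \<bullet> \<xi>)" if "transpose \<xi> = \<xi>" for \<xi>
          using * that by (cases "\<xi> = 0") (auto intro: order_trans less_imp_le)
      qed (use * s assms in auto)
    qed
  qed
  then show ?thesis using assms by (simp add: bounded_tensor_def elastic_tensor_def)
qed

lemma symmetric_tensor_add: "symmetric_tensor M \<Longrightarrow> symmetric_tensor M' \<Longrightarrow> symmetric_tensor (M + M')"
  unfolding symmetric_tensor_def[of "M + M'"] vector_add_component
  by (intro allI conjI arg_cong2[of _ _ _ _ "(+)"] symmetric_tensorD)

lemma symmetric_tensor_scaleR: "symmetric_tensor M \<Longrightarrow> symmetric_tensor (c *\<^sub>R M)"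
  unfolding symmetric_tensor_def[of "c *\<^sub>R M"] vector_scaleR_component
  by (intro allI conjI arg_cong[of _ _ "(*\<^sub>R) c"] symmetric_tensorD)

lemma bounded_tensor_nonneg: "bounded_tensor \<Omega> K M \<Longrightarrow> 0 \<le> K"
  by (simp add: bounded_tensor_def)

lemma bounded_tensor_add:
  assumes "bounded_tensor \<Omega> K M" "bounded_tensor \<Omega> K' M'"
  shows "bounded_tensor \<Omega> (K + K') (\<lambda>x. M x + M' x)"
proof -
  have 1: "AE x in lebesgue_on \<Omega>. symmetric_tensor (M x + M' x)"
    using assms by (auto simp: bounded_tensor_def elim: eventually_elim2 intro: symmetric_tensor_add)
  have "AE x in lebesgue_on \<Omega>. \<forall>\<xi> \<zeta>. transpose \<xi> = \<xi> \<longrightarrow> transpose \<zeta> = \<zeta> \<longrightarrow> \<bar>tensor_app (M x) \<xi> \<bullet> \<zeta>\<bar> \<le> K * norm \<xi> * norm \<zeta>"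
    "AE x in lebesgue_on \<Omega>. \<forall>\<xi> \<zeta>. transpose \<xi> = \<xi> \<longrightarrow> transpose \<zeta> = \<zeta> \<longrightarrow> \<bar>tensor_app (M' x) \<xi> \<bullet> \<zeta>\<bar> \<le> K' * norm \<xi> * norm \<zeta>"
    using assms by (auto simp: bounded_tensor_def)
  then have 2: "AE x in lebesgue_on \<Omega>. \<forall>\<xi> \<zeta>. transpose \<xi> = \<xi> \<longrightarrow> transpose \<zeta> = \<zeta> \<longrightarrow>
      \<bar>tensor_app (M x + M' x) \<xi> \<bullet> \<zeta>\<bar> \<le> (K + K') * norm \<xi> * norm \<zeta>"
    by eventually_elim (simp add: tensor_app_add_tensor inner_add_left distrib_right order_trans[OF abs_triangle_ineq add_mono])
  show ?thesis using 1 2 assms by (auto simp: bounded_tensor_def)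
qed

lemma bounded_tensor_scaleR:
  assumes "bounded_tensor \<Omega> K M"
  shows "bounded_tensor \<Omega> (\<bar>c\<bar> * K) (\<lambda>x. c *\<^sub>R M x)"
proof -
  have 1: "AE x in lebesgue_on \<Omega>. symmetric_tensor (c *\<^sub>R M x)"
    using assms by (auto simp: bounded_tensor_def elim: eventually_mono intro: symmetric_tensor_scaleR)
  have "AE x in lebesgue_on \<Omega>. \<forall>\<xi> \<zeta>. transpose \<xi> = \<xi> \<longrightarrow> transpose \<zeta> = \<zeta> \<longrightarrow> \<bar>tensor_app (M x) \<xi> \<bullet> \<zeta>\<bar> \<le> K * norm \<xi> * norm \<zeta>"
    using assms by (auto simp: bounded_tensor_def)
  then have 2: "AE x in lebesgue_on \<Omega>. \<forall>\<xi> \<zeta>. transpose \<xi> = \<xi> \<longrightarrow> transpose \<zeta> = \<zeta> \<longrightarrow>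
      \<bar>tensor_app (c *\<^sub>R M x) \<xi> \<bullet> \<zeta>\<bar> \<le> (\<bar>c\<bar> * K) * norm \<xi> * norm \<zeta>"
    by eventually_elim (simp add: tensor_app_scaleR_tensor abs_mult mult.assoc mult_left_mono)
  show ?thesis using 1 2 assms by (auto simp: bounded_tensor_def)
qed

lemma bounded_tensor_A:
  assumes "elastic_tensor \<Omega> M0 M1 CC" "0 < M0" "0 < M1" "0 < \<rho>"
  shows "bounded_tensor \<Omega> (M1 / \<rho>) (tensor_A \<rho> CC)"
  using bounded_tensor_scaleR[OF elastic_tensor_bounded[OF assms(1-3)], of "1 / \<rho>"] assms(4)
  unfolding tensor_A_def[abs_def] by simp

lemma bounded_tensor_B:
  assumes "elastic_tensor \<Omega> M0 M1 CC" "elastic_tensor \<Omega> M0 M1 DD" "0 < M0" "0 < M1"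
  shows "\<exists>K. bounded_tensor \<Omega> K (tensor_B \<alpha> \<rho> \<tau>\<sigma> \<tau>\<epsilon> CC DD)"
  using bounded_tensor_scaleR[OF bounded_tensor_add[OF elastic_tensor_bounded[OF assms(1,3,4)]
      bounded_tensor_scaleR[OF elastic_tensor_bounded[OF assms(2-4)], of "- ((\<tau>\<epsilon> / \<tau>\<sigma>) powr \<alpha>)"]], of "1 / \<rho>"]
  unfolding tensor_B_def[abs_def] by auto

lemma borel_measurable_vec_nth':
  fixes f :: "'a \<Rightarrow> ('b::euclidean_space) ^ 'n"
  assumes "f \<in> borel_measurable M" shows "(\<lambda>x. f x $ i) \<in> borel_measurable M"
  using borel_measurable_continuous_on[OF linear_continuous_on[OF bounded_linear_vec_nth], OF assms] .

lemma borel_measurable_matrixI: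
  fixes f :: "'a \<Rightarrow> real ^ 'n ^ 'm"
  assumes "\<And>i j. (\<lambda>x. f x $ i $ j) \<in> borel_measurable M" shows "f \<in> borel_measurable M"
proof (subst borel_measurable_euclidean_space, intro ballI)
  fix e :: "real ^ 'n ^ 'm" assume "e \<in> Basis"
  then obtain i j where "e = axis i (axis j 1)" by (auto simp: Basis_vec_def)
  then show "(\<lambda>x. f x \<bullet> e) \<in> borel_measurable M" using assms by (simp add: inner_axis)
qed

section \<open>Strain fields and the elastic form on H^1\<close>

context bounded_open_set
begin

lemma weak_gradient_L2:
  assumes "u \<in> H_space 1 \<Omega>"
  shows "weak_gradient \<Omega> u \<in> L2_space \<Omega>"
    "(LINT x|lebesgue_on \<Omega>. (norm (weak_gradient \<Omega> u x))\<^sup>2) = (\<Sum>j\<in>UNIV. L2_inner \<Omega> (weak_partial \<Omega> j u) (weak_partial \<Omega> j u))"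
proof -
  have w: "weak_partial \<Omega> j u \<in> L2_space \<Omega>" for j using weak_partial_H[of u 0 j] assms by simp
  have sq: "(norm (weak_gradient \<Omega> u x))\<^sup>2 = (\<Sum>j\<in>UNIV. (norm (weak_partial \<Omega> j u x))\<^sup>2)" for x
  proof -
    have "(norm (weak_gradient \<Omega> u x))\<^sup>2 = (\<Sum>i\<in>UNIV. \<Sum>j\<in>UNIV. (weak_partial \<Omega> j u x $ i)\<^sup>2)"
      unfolding power2_norm_eq_inner matrix_inner by (simp add: weak_gradient_def power2_eq_square)
    also have "\<dots> = (\<Sum>j\<in>UNIV. \<Sum>i\<in>UNIV. (weak_partial \<Omega> j u x $ i)\<^sup>2)" by (rule sum.swap)
    also have "\<dots> = (\<Sum>j\<in>UNIV. (norm (weak_partial \<Omega> j u x))\<^sup>2)"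
      unfolding power2_norm_eq_inner inner_vec_def by (simp add: power2_eq_square)
    finally show ?thesis .
  qed
  have i: "integrable (lebesgue_on \<Omega>) (\<lambda>x. \<Sum>j\<in>UNIV. (norm (weak_partial \<Omega> j u x))\<^sup>2)"
    by (intro Bochner_Integration.integrable_sum L2_integrable_sq w)
  show "weak_gradient \<Omega> u \<in> L2_space \<Omega>"
  proof (rule L2_spaceI[OF _ i])
    show "weak_gradient \<Omega> u \<in> borel_measurable (lebesgue_on \<Omega>)"
      by (rule borel_measurable_matrixI) (simp add: weak_gradient_def borel_measurable_vec_nth' L2_measurable w)
  qed (simp add: sq)
  show "(LINT x|lebesgue_on \<Omega>. (norm (weak_gradient \<Omega> u x))\<^sup>2) = (\<Sum>j\<in>UNIV. L2_inner \<Omega> (weak_partial \<Omega> j u) (weak_partial \<Omega> j u))"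
    unfolding sq using L2_integrable_sq[OF w] by (simp add: L2_inner_def power2_norm_eq_inner)
qed

lemma strain_L2:
  assumes "u \<in> H_space 1 \<Omega>"
  shows "strain \<Omega> u \<in> L2_space \<Omega>" "seminrm (L2_inner \<Omega>) (strain \<Omega> u) \<le> H_norm 1 \<Omega> u"
proof -
  note g = weak_gradient_L2[OF assms]
  note [measurable] = borel_measurable_vec_nth'[OF borel_measurable_vec_nth'[OF L2_measurable[OF g(1)]]]
  have "strain \<Omega> u \<in> borel_measurable (lebesgue_on \<Omega>)"
    by (rule borel_measurable_matrixI) (simp add: strain_def transpose_def)
  then show s: "strain \<Omega> u \<in> L2_space \<Omega>"
    by (rule L2_spaceI[OF _ L2_integrable_sq[OF g(1)]]) (auto simp: strain_eq intro!: power_mono norm_sym_part_le)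
  have "L2_inner \<Omega> (strain \<Omega> u) (strain \<Omega> u) \<le> (LINT x|lebesgue_on \<Omega>. (norm (weak_gradient \<Omega> u x))\<^sup>2)"
    unfolding L2_inner_def power2_norm_eq_inner[symmetric]
    by (intro integral_mono L2_integrable_sq s g) (auto simp: strain_eq intro!: power_mono norm_sym_part_le)
  also have "\<dots> \<le> H_inner 1 \<Omega> u u"
    using semi_inner.nonneg[OF L2_semi_inner H_space_L2[OF assms]] by (simp add: g(2) H_inner.simps(2))
  finally show "seminrm (L2_inner \<Omega>) (strain \<Omega> u) \<le> H_norm 1 \<Omega> u"
    by (simp add: H_norm_eq seminrm_def)
qed

lemma strain_cong:
  assumes "\<And>j. AE x in lebesgue_on \<Omega>. weak_partial \<Omega> j u x = w j x"
  shows "AE x in lebesgue_on \<Omega>. strain \<Omega> u x = sym_part (\<chi> i j. w j x $ i)"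
proof -
  have "AE x in lebesgue_on \<Omega>. \<forall>j\<in>UNIV. weak_partial \<Omega> j u x = w j x"
    by (subst AE_finite_all) (use assms in auto)
  then show ?thesis by (rule eventually_mono) (simp add: strain_eq weak_gradient_def)
qed

lemma strain_add:
  assumes "u \<in> H_space 1 \<Omega>" "v \<in> H_space 1 \<Omega>"
  shows "AE x in lebesgue_on \<Omega>. strain \<Omega> (u + v) x = (strain \<Omega> u + strain \<Omega> v) x"
proof -
  have "sym_part (\<chi> i j. (weak_partial \<Omega> j u + weak_partial \<Omega> j v) x $ i) = (strain \<Omega> u + strain \<Omega> v) x" for x
    by (simp add: strain_eq sym_part_add[symmetric] weak_gradient_def) (simp add: vec_eq_iff plus_vec_def)
  then show ?thesis using strain_cong[OF weak_partial_add[of u 0 v]] assms by simp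
qed

lemma strain_scaleR:
  assumes "u \<in> H_space 1 \<Omega>"
  shows "AE x in lebesgue_on \<Omega>. strain \<Omega> (c *\<^sub>R u) x = (c *\<^sub>R strain \<Omega> u) x"
proof -
  have "sym_part (\<chi> i j. (c *\<^sub>R weak_partial \<Omega> j u) x $ i) = (c *\<^sub>R strain \<Omega> u) x" for x
    by (simp add: strain_eq sym_part_scaleR[symmetric] weak_gradient_def) (simp add: vec_eq_iff scaleR_vec_def)
  then show ?thesis using strain_cong[OF weak_partial_scaleR[of u 0 _ c]] assms by simp
qed

lemma strain_AE:
  assumes "u \<in> H_space 1 \<Omega>" "AE x in lebesgue_on \<Omega>. u x = v x"
  shows "AE x in lebesgue_on \<Omega>. strain \<Omega> u x = strain \<Omega> v x"
  using strain_cong[OF weak_partial_AE[of u 0 v]] assms by (simp add: strain_eq weak_gradient_def)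

lemma strain_transpose: "transpose (strain \<Omega> u x) = strain \<Omega> u x"
  by (simp add: strain_eq sym_part_transpose)

lemma L2_norm_product:
  fixes f :: "real ^ 'd \<Rightarrow> 'b::euclidean_space" and g :: "real ^ 'd \<Rightarrow> 'c::euclidean_space"
  assumes "f \<in> L2_space \<Omega>" "g \<in> L2_space \<Omega>"
  shows "(LINT x|lebesgue_on \<Omega>. norm (f x) * norm (g x)) \<le> seminrm (L2_inner \<Omega>) f * seminrm (L2_inner \<Omega>) g"
proof -
  interpret L2: semi_inner "L2_space \<Omega> :: (real ^ 'd \<Rightarrow> real) set" "L2_inner \<Omega>" by (rule L2_semi_inner)
  have n: "(\<lambda>x. norm (f x)) \<in> L2_space \<Omega>" if "f \<in> L2_space \<Omega>" for f :: "real ^ 'd \<Rightarrow> 'b"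
    using that by (auto simp: L2_space_def intro: borel_measurable_norm)
  have n': "(\<lambda>x. norm (f x)) \<in> L2_space \<Omega>" if "f \<in> L2_space \<Omega>" for f :: "real ^ 'd \<Rightarrow> 'c"
    using that by (auto simp: L2_space_def intro: borel_measurable_norm)
  show ?thesis
    using L2.Cauchy_Schwarz[OF n[OF assms(1)] n'[OF assms(2)]]
    by (simp add: seminrm_def L2_inner_def dot_square_norm power2_eq_square flip: power2_norm_eq_inner)
qed

lemma tensor_stress_integrable:
  assumes M: "bounded_tensor \<Omega> K M" and f: "f \<in> L2_space \<Omega>" "g \<in> L2_space \<Omega>"
    and s: "\<And>x. transpose (f x) = f x" "\<And>x. transpose (g x) = g x"
  shows "integrable (lebesgue_on \<Omega>) (\<lambda>x. tensor_app (M x) (f x) \<bullet> g x)"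
    "\<bar>LINT x|lebesgue_on \<Omega>. tensor_app (M x) (f x) \<bullet> g x\<bar> \<le> K * seminrm (L2_inner \<Omega>) f * seminrm (L2_inner \<Omega>) g"
proof -
  have Mm: "M \<in> borel_measurable (lebesgue_on \<Omega>)" and K: "0 \<le> K" using M by (auto simp: bounded_tensor_def)
  note [measurable] = borel_measurable_vec_nth'[OF borel_measurable_vec_nth'[OF borel_measurable_vec_nth'[OF borel_measurable_vec_nth'[OF Mm]]]]
    borel_measurable_vec_nth'[OF borel_measurable_vec_nth'[OF L2_measurable[OF f(1)]]]
    borel_measurable_vec_nth'[OF borel_measurable_vec_nth'[OF L2_measurable[OF f(2)]]]
  have m: "(\<lambda>x. tensor_app (M x) (f x) \<bullet> g x) \<in> borel_measurable (lebesgue_on \<Omega>)"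
    unfolding matrix_inner tensor_app_component by measurable
  have b: "AE x in lebesgue_on \<Omega>. \<bar>tensor_app (M x) (f x) \<bullet> g x\<bar> \<le> K * (norm (f x) * norm (g x))"
  proof -
    have "AE x in lebesgue_on \<Omega>. \<forall>\<xi> \<zeta>. transpose \<xi> = \<xi> \<longrightarrow> transpose \<zeta> = \<zeta> \<longrightarrow>
        \<bar>tensor_app (M x) \<xi> \<bullet> \<zeta>\<bar> \<le> K * norm \<xi> * norm \<zeta>" using M by (simp add: bounded_tensor_def)
    then show ?thesis by (rule eventually_mono) (use s in \<open>auto simp: mult.assoc\<close>)
  qed
  have i: "integrable (lebesgue_on \<Omega>) (\<lambda>x. K * (norm (f x) * norm (g x)))"
    by (intro integrable_mult_right L2_product_integrable f)
  show i': "integrable (lebesgue_on \<Omega>) (\<lambda>x. tensor_app (M x) (f x) \<bullet> g x)"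
    by (rule Bochner_Integration.integrable_bound[OF i m]) (use b K in \<open>auto elim: eventually_mono\<close>)
  have "\<bar>LINT x|lebesgue_on \<Omega>. tensor_app (M x) (f x) \<bullet> g x\<bar> \<le> (LINT x|lebesgue_on \<Omega>. \<bar>tensor_app (M x) (f x) \<bullet> g x\<bar>)"
    by (rule integral_abs_bound)
  also have "\<dots> \<le> (LINT x|lebesgue_on \<Omega>. K * (norm (f x) * norm (g x)))"
    using i' i b by (intro integral_mono_AE) auto
  also have "\<dots> = K * (LINT x|lebesgue_on \<Omega>. norm (f x) * norm (g x))" by simp
  also have "\<dots> \<le> K * (seminrm (L2_inner \<Omega>) f * seminrm (L2_inner \<Omega>) g)"
    using K by (intro mult_left_mono L2_norm_product f)
  finally show "\<bar>LINT x|lebesgue_on \<Omega>. tensor_app (M x) (f x) \<bullet> g x\<bar> \<le> K * seminrm (L2_inner \<Omega>) f * seminrm (L2_inner \<Omega>) g"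
    by (simp add: mult.assoc)
qed

lemma elastic_form_integrable:
  assumes "bounded_tensor \<Omega> K M" "u \<in> H_space 1 \<Omega>" "w \<in> H_space 1 \<Omega>"
  shows "integrable (lebesgue_on \<Omega>) (\<lambda>x. tensor_app (M x) (strain \<Omega> u x) \<bullet> strain \<Omega> w x)"
  by (rule tensor_stress_integrable[OF assms(1)]) (intro strain_L2(1) assms strain_transpose)+

lemma elastic_form_bound:
  assumes "bounded_tensor \<Omega> K M" "u \<in> H_space 1 \<Omega>" "w \<in> H_space 1 \<Omega>"
  shows "\<bar>elastic_form \<Omega> M u w\<bar> \<le> K * seminrm (L2_inner \<Omega>) (strain \<Omega> u) * seminrm (L2_inner \<Omega>) (strain \<Omega> w)"
  unfolding elastic_form_def by (rule tensor_stress_integrable[OF assms(1)]) (intro strain_L2(1) assms strain_transpose)+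

lemma elastic_form_commute:
  assumes "bounded_tensor \<Omega> K M" "u \<in> H_space 1 \<Omega>" "w \<in> H_space 1 \<Omega>"
  shows "elastic_form \<Omega> M u w = elastic_form \<Omega> M w u"
proof -
  have "AE x in lebesgue_on \<Omega>. tensor_app (M x) (strain \<Omega> u x) \<bullet> strain \<Omega> w x = tensor_app (M x) (strain \<Omega> w x) \<bullet> strain \<Omega> u x"
    using assms(1) by (auto simp: bounded_tensor_def elim: eventually_mono intro: tensor_app_commute)
  then show ?thesis unfolding elastic_form_def
    using elastic_form_integrable[OF assms] elastic_form_integrable[OF assms(1,3,2)] by (intro integral_cong_AE) auto
qed

lemma elastic_form_AE:
  assumes "bounded_tensor \<Omega> K M" "u \<in> H_space 1 \<Omega>" "w \<in> H_space 1 \<Omega>" "AE x in lebesgue_on \<Omega>. u x = v x"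
  shows "elastic_form \<Omega> M u w = elastic_form \<Omega> M v w"
proof -
  have v: "v \<in> H_space 1 \<Omega>" by (rule H_space_AE[OF assms(2,4)])
  have "AE x in lebesgue_on \<Omega>. tensor_app (M x) (strain \<Omega> u x) \<bullet> strain \<Omega> w x = tensor_app (M x) (strain \<Omega> v x) \<bullet> strain \<Omega> w x"
    using strain_AE[OF assms(2,4)] by (rule eventually_mono) simp
  then show ?thesis unfolding elastic_form_def
    using elastic_form_integrable[OF assms(1,2,3)] elastic_form_integrable[OF assms(1) v assms(3)] by (intro integral_cong_AE) auto
qed

lemma H1_subspace: "subspace (H_space r \<Omega> :: (real ^ 'd \<Rightarrow> 'b::euclidean_space) set)"
  by (rule bilinear_on.sub[OF semi_inner.axioms(1)[OF H_semi_inner]])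

lemma elastic_form_bilinear:
  assumes M: "bounded_tensor \<Omega> K M"
  shows "bilinear_on (H_space 1 \<Omega>) (elastic_form \<Omega> M)"
proof -
  have add: "elastic_form \<Omega> M (u + v) w = elastic_form \<Omega> M u w + elastic_form \<Omega> M v w"
    if "u \<in> H_space 1 \<Omega>" "v \<in> H_space 1 \<Omega>" "w \<in> H_space 1 \<Omega>" for u v w
  proof -
    have uv: "u + v \<in> H_space 1 \<Omega>" using subspace_add[OF H1_subspace that(1,2)] .
    have "elastic_form \<Omega> M (u + v) w = (LINT x|lebesgue_on \<Omega>. tensor_app (M x) (strain \<Omega> u x) \<bullet> strain \<Omega> w x +
        tensor_app (M x) (strain \<Omega> v x) \<bullet> strain \<Omega> w x)"
      unfolding elastic_form_def
    proof (rule integral_cong_AE)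
      show "AE x in lebesgue_on \<Omega>. tensor_app (M x) (strain \<Omega> (u + v) x) \<bullet> strain \<Omega> w x =
          tensor_app (M x) (strain \<Omega> u x) \<bullet> strain \<Omega> w x + tensor_app (M x) (strain \<Omega> v x) \<bullet> strain \<Omega> w x"
        using strain_add[OF that(1,2)] by (rule eventually_mono) (simp add: tensor_app_add inner_add_left)
    qed (use elastic_form_integrable[OF M uv that(3)] elastic_form_integrable[OF M that(1,3)] elastic_form_integrable[OF M that(2,3)]
        in \<open>auto intro!: borel_measurable_integrable\<close>)
    then show ?thesis
      using elastic_form_integrable[OF M that(1,3)] elastic_form_integrable[OF M that(2,3)] by (simp add: elastic_form_def)
  qed
  have scale: "elastic_form \<Omega> M (c *\<^sub>R u) w = c * elastic_form \<Omega> M u w"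
    if "u \<in> H_space 1 \<Omega>" "w \<in> H_space 1 \<Omega>" for u w c
  proof -
    have cu: "c *\<^sub>R u \<in> H_space 1 \<Omega>" using subspace_scale[OF H1_subspace that(1)] .
    have "elastic_form \<Omega> M (c *\<^sub>R u) w = (LINT x|lebesgue_on \<Omega>. c * (tensor_app (M x) (strain \<Omega> u x) \<bullet> strain \<Omega> w x))"
      unfolding elastic_form_def
    proof (rule integral_cong_AE)
      show "AE x in lebesgue_on \<Omega>. tensor_app (M x) (strain \<Omega> (c *\<^sub>R u) x) \<bullet> strain \<Omega> w x =
          c * (tensor_app (M x) (strain \<Omega> u x) \<bullet> strain \<Omega> w x)"
        using strain_scaleR[OF that(1), of c] by (rule eventually_mono) (simp add: tensor_app_scaleR)
    qed (use elastic_form_integrable[OF M cu that(2)] elastic_form_integrable[OF M that]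
        in \<open>auto intro!: borel_measurable_integrable\<close>)
    then show ?thesis by (simp add: elastic_form_def)
  qed
  show ?thesis
  proof
    show "subspace (H_space 1 \<Omega> :: (real ^ 'd \<Rightarrow> real ^ 'd) set)" by (rule H1_subspace)
    fix x y z :: "real ^ 'd \<Rightarrow> real ^ 'd" and c
    assume x: "x \<in> H_space 1 \<Omega>" and z: "z \<in> H_space 1 \<Omega>"
    show "elastic_form \<Omega> M (c *\<^sub>R x) z = c * elastic_form \<Omega> M x z" by (rule scale[OF x z])
    show "elastic_form \<Omega> M z (c *\<^sub>R x) = c * elastic_form \<Omega> M z x"
      using scale[OF x z] elastic_form_commute[OF M z] x subspace_scale[OF H1_subspace x] by simp
    assume y: "y \<in> H_space 1 \<Omega>"
    show "elastic_form \<Omega> M (x + y) z = elastic_form \<Omega> M x z + elastic_form \<Omega> M y z" by (rule add[OF x y z])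
    show "elastic_form \<Omega> M z (x + y) = elastic_form \<Omega> M z x + elastic_form \<Omega> M z y"
      using add[OF x y z] elastic_form_commute[OF M z] x y subspace_add[OF H1_subspace x y] by simp
  qed
qed

text \<open>Coercivity is measured by the L^2 norm of the strain, the same quantity that bounds both
  elastic forms. Hence \<open>b\<close> is bounded in the energy seminorm of
  \<open>a\<close>.\<close>

lemma elastic_form_coercive:
  assumes el: "elastic_tensor \<Omega> M0 M1 CC" and M: "0 < M0" "0 < M1" "0 < \<rho>" and u: "u \<in> H_space 1 \<Omega>"
  shows "M0 / \<rho> * (seminrm (L2_inner \<Omega>) (strain \<Omega> u))\<^sup>2 \<le> elastic_form \<Omega> (tensor_A \<rho> CC) u u"
proof -
  have sL: "strain \<Omega> u \<in> L2_space \<Omega>" by (rule strain_L2[OF u])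
  have "M0 / \<rho> * (seminrm (L2_inner \<Omega>) (strain \<Omega> u))\<^sup>2 = (LINT x|lebesgue_on \<Omega>. M0 / \<rho> * (strain \<Omega> u x \<bullet> strain \<Omega> u x))"
    by (subst semi_inner.seminrm_sq[OF L2_semi_inner sL]) (simp add: L2_inner_def)
  also have "\<dots> \<le> (LINT x|lebesgue_on \<Omega>. tensor_app (tensor_A \<rho> CC x) (strain \<Omega> u x) \<bullet> strain \<Omega> u x)"
  proof (rule integral_mono_AE)
    show "integrable (lebesgue_on \<Omega>) (\<lambda>x. M0 / \<rho> * (strain \<Omega> u x \<bullet> strain \<Omega> u x))"
      by (intro integrable_mult_right L2_product_integrable sL)
    show "integrable (lebesgue_on \<Omega>) (\<lambda>x. tensor_app (tensor_A \<rho> CC x) (strain \<Omega> u x) \<bullet> strain \<Omega> u x)"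
      by (rule elastic_form_integrable[OF bounded_tensor_A[OF el M] u u])
    have "AE x in lebesgue_on \<Omega>. \<forall>\<xi>. transpose \<xi> = \<xi> \<and> \<xi> \<noteq> 0 \<longrightarrow> 0 < M0 * (\<xi> \<bullet> \<xi>) \<and> M0 * (\<xi> \<bullet> \<xi>) \<le> tensor_app (CC x) \<xi> \<bullet> \<xi> \<and>
        tensor_app (CC x) \<xi> \<bullet> \<xi> \<le> M1 * (\<xi> \<bullet> \<xi>)" using el by (simp add: elastic_tensor_def)
    then show "AE x in lebesgue_on \<Omega>. M0 / \<rho> * (strain \<Omega> u x \<bullet> strain \<Omega> u x) \<le> tensor_app (tensor_A \<rho> CC x) (strain \<Omega> u x) \<bullet> strain \<Omega> u x"
    proof (rule eventually_mono)
      fix x assume *: "\<forall>\<xi>. transpose \<xi> = \<xi> \<and> \<xi> \<noteq> 0 \<longrightarrow> 0 < M0 * (\<xi> \<bullet> \<xi>) \<and> M0 * (\<xi> \<bullet> \<xi>) \<le> tensor_app (CC x) \<xi> \<bullet> \<xi> \<and>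
        tensor_app (CC x) \<xi> \<bullet> \<xi> \<le> M1 * (\<xi> \<bullet> \<xi>)"
      have "M0 * (strain \<Omega> u x \<bullet> strain \<Omega> u x) \<le> tensor_app (CC x) (strain \<Omega> u x) \<bullet> strain \<Omega> u x"
        using *[rule_format, of "strain \<Omega> u x"] strain_transpose[of u x] by (cases "strain \<Omega> u x = 0") auto
      then have "(1 / \<rho>) * (M0 * (strain \<Omega> u x \<bullet> strain \<Omega> u x)) \<le> (1 / \<rho>) * (tensor_app (CC x) (strain \<Omega> u x) \<bullet> strain \<Omega> u x)"
        using M by (intro mult_left_mono) auto
      then show "M0 / \<rho> * (strain \<Omega> u x \<bullet> strain \<Omega> u x) \<le> tensor_app (tensor_A \<rho> CC x) (strain \<Omega> u x) \<bullet> strain \<Omega> u x"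
        by (simp add: tensor_A_def tensor_app_scaleR_tensor)
    qed
  qed
  finally show ?thesis by (simp add: elastic_form_def)
qed

section \<open>The space of functions vanishing on the boundary\<close>

lemma test_H_space:
  fixes \<phi> :: "real ^ 'd \<Rightarrow> 'b::euclidean_space"
  assumes "\<phi> \<in> test_functions \<Omega>" shows "\<phi> \<in> H_space r \<Omega>"
  using assms
proof (induction r arbitrary: \<phi>)
  case 0
  define K where "K = closure {x. \<phi> x \<noteq> 0}"
  have K: "compact K" "\<And>x. x \<notin> K \<Longrightarrow> \<phi> x = 0"
    using test_functionsD(2)[OF 0] closure_subset[of "{x. \<phi> x \<noteq> 0}"] by (auto simp: K_def)
  have c: "continuous_on UNIV (\<lambda>x. (norm (\<phi> x))\<^sup>2)" using test_functionsD(4)[OF 0] by (intro continuous_intros)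
  have "integrable lebesgue (\<lambda>x. (norm (\<phi> x))\<^sup>2)"
    by (rule integrable_continuous_compact_support(2)[OF c K(1)]) (use K(2) in simp)
  then have "integrable lebesgue (\<lambda>x. indicator \<Omega> x *\<^sub>R ((norm (\<phi> x))\<^sup>2))"
    using integrable_mult_indicator[OF \<Omega>_sets] by blast
  then have i: "integrable (lebesgue_on \<Omega>) (\<lambda>x. (norm (\<phi> x))\<^sup>2)"
    by (rule integrable_restrict_space[THEN iffD2, rotated]) simp
  have "\<phi> \<in> borel_measurable (lebesgue_on \<Omega>)"
    using test_functionsD(4)[OF 0] by (intro continuous_imp_measurable_on_sets_lebesgue) (auto intro: continuous_on_subset)
  then show ?case using i by (simp add: L2_space_def)
next
  case (Suc r)
  have "\<phi> \<in> L2_space \<Omega>" using Suc.IH[OF Suc.prems] by (rule H_space_L2)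
  moreover have "(\<lambda>x. frechet_derivative \<phi> (at x) (axis j 1)) \<in> H_space r \<Omega>" for j
    by (rule Suc.IH[OF test_functions_partial[OF Suc.prems]]) simp
  ultimately show ?case using has_weak_partial_test[OF op Suc.prems] by (auto simp: H_space.simps(2))
qed

lemma H10_H1: "f \<in> H10_space \<Omega> \<Longrightarrow> f \<in> H_space 1 \<Omega>"
  by (simp add: H10_space_def)

lemma H10_approx:
  assumes "f \<in> H10_space \<Omega>" "0 < e"
  obtains \<phi> where "\<phi> \<in> test_functions \<Omega>" "H_norm 1 \<Omega> (f - \<phi>) < e"
  using assms by (auto simp: H10_space_def fun_diff_def)

lemma H10_AE:
  fixes f :: "real ^ 'd \<Rightarrow> 'b::euclidean_space"
  assumes f: "f \<in> H10_space \<Omega>" and eq: "AE x in lebesgue_on \<Omega>. f x = g x"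
  shows "g \<in> H10_space \<Omega>"
proof -
  have "\<exists>\<phi>\<in>test_functions \<Omega>. H_norm 1 \<Omega> (\<lambda>x. g x - \<phi> x) < e" if e: "0 < e" for e
  proof -
    obtain \<phi> where \<phi>: "\<phi> \<in> test_functions \<Omega>" "H_norm 1 \<Omega> (f - \<phi>) < e" using H10_approx[OF f e] .
    have "H_norm 1 \<Omega> (f - \<phi>) = H_norm 1 \<Omega> (g - \<phi>)"
      by (rule H_norm_AE[OF subspace_diff[OF H1_subspace H10_H1[OF f] test_H_space[OF \<phi>(1)]]])
        (use eq in \<open>auto elim: eventually_mono\<close>)
    then show ?thesis using \<phi> by (auto simp: fun_diff_def)
  qed
  then show ?thesis using H_space_AE[OF H10_H1[OF f] eq] by (auto simp: H10_space_def)
qed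

lemma H10_subspace: "subspace (H10_space \<Omega> :: (real ^ 'd \<Rightarrow> 'b::euclidean_space) set)"
  unfolding subspace_def
proof (intro conjI ballI allI)
  interpret H: semi_inner "H_space 1 \<Omega> :: (real ^ 'd \<Rightarrow> 'b) set" "H_inner 1 \<Omega>" by (rule H_semi_inner)
  have "H_norm 1 \<Omega> (0 - 0 :: real ^ 'd \<Rightarrow> 'b) = 0" by (simp only: diff_self H_norm_eq H.seminrm_zero)
  then have "H_norm 1 \<Omega> (\<lambda>x. 0 - 0 :: 'b) = 0" by (simp add: fun_diff_def zero_fun_def)
  then show "0 \<in> (H10_space \<Omega> :: (real ^ 'd \<Rightarrow> 'b) set)"
    using subspace_0[OF H.sub] test_functions_zero[of \<Omega>] by (auto simp: H10_space_def zero_fun_def intro!: bexI[of _ "\<lambda>x. 0"])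
  fix f g :: "real ^ 'd \<Rightarrow> 'b" and c :: real
  assume f: "f \<in> H10_space \<Omega>"
  have tsum: "H_norm 1 \<Omega> ((\<lambda>x. c *\<^sub>R f x) - (\<lambda>x. c *\<^sub>R \<phi> x)) = \<bar>c\<bar> * H_norm 1 \<Omega> (f - \<phi>)" if "\<phi> \<in> test_functions \<Omega>" for \<phi> c
  proof -
    have "(\<lambda>x. c *\<^sub>R f x) - (\<lambda>x. c *\<^sub>R \<phi> x) = c *\<^sub>R (f - \<phi>)" by (auto simp: fun_eq_iff scaleR_diff_right)
    then show ?thesis unfolding H_norm_eq
      using H.seminrm_scale[OF subspace_diff[OF H.sub H10_H1[OF f] test_H_space[OF that]]] by simp
  qed
  have "\<exists>\<phi>\<in>test_functions \<Omega>. H_norm 1 \<Omega> (\<lambda>x. (c *\<^sub>R f) x - \<phi> x) < e" if e: "0 < e" for e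
  proof -
    obtain \<phi> where \<phi>: "\<phi> \<in> test_functions \<Omega>" "H_norm 1 \<Omega> (f - \<phi>) < e / (\<bar>c\<bar> + 1)"
      using H10_approx[OF f, of "e / (\<bar>c\<bar> + 1)"] e by auto
    have "0 \<le> H_norm 1 \<Omega> (f - \<phi>)"
      unfolding H_norm_eq by (rule H.seminrm_nonneg[OF subspace_diff[OF H.sub H10_H1[OF f] test_H_space[OF \<phi>(1)]]])
    then have "\<bar>c\<bar> * H_norm 1 \<Omega> (f - \<phi>) \<le> (\<bar>c\<bar> + 1) * H_norm 1 \<Omega> (f - \<phi>)" by (intro mult_right_mono) auto
    also have "\<dots> < e" using \<phi>(2) by (simp add: field_simps)
    finally have "H_norm 1 \<Omega> (\<lambda>x. (c *\<^sub>R f) x - c *\<^sub>R \<phi> x) < e" using tsum[OF \<phi>(1)] by (simp add: fun_diff_def)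
    then show ?thesis using test_functions_scaleR[OF \<phi>(1), of c] by (intro bexI[where x = "\<lambda>x. c *\<^sub>R \<phi> x"])
  qed
  then show "c *\<^sub>R f \<in> H10_space \<Omega>" using subspace_scale[OF H.sub H10_H1[OF f]] by (auto simp: H10_space_def)
  assume g: "g \<in> H10_space \<Omega>"
  have "\<exists>\<phi>\<in>test_functions \<Omega>. H_norm 1 \<Omega> (\<lambda>x. (f + g) x - \<phi> x) < e" if e: "0 < e" for e
  proof -
    obtain \<phi> where \<phi>: "\<phi> \<in> test_functions \<Omega>" "H_norm 1 \<Omega> (f - \<phi>) < e / 2" using H10_approx[OF f, of "e / 2"] e by auto
    obtain \<psi> where \<psi>: "\<psi> \<in> test_functions \<Omega>" "H_norm 1 \<Omega> (g - \<psi>) < e / 2" using H10_approx[OF g, of "e / 2"] e by auto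
    have "(\<lambda>x. \<phi> x - (-1) *\<^sub>R \<psi> x) \<in> test_functions \<Omega>" by (intro test_functions_diff test_functions_scaleR \<phi> \<psi>)
    moreover have "(\<lambda>x. (f + g) x - (\<phi> x - (-1) *\<^sub>R \<psi> x)) = (f - \<phi>) + (g - \<psi>)" by (auto simp: fun_eq_iff)
    moreover have "H_norm 1 \<Omega> ((f - \<phi>) + (g - \<psi>)) \<le> H_norm 1 \<Omega> (f - \<phi>) + H_norm 1 \<Omega> (g - \<psi>)"
      unfolding H_norm_eq by (intro H.triangle subspace_diff[OF H.sub] H10_H1 f g test_H_space \<phi> \<psi>)
    ultimately show ?thesis using \<phi>(2) \<psi>(2) by (intro bexI[of _ "\<lambda>x. \<phi> x - (-1) *\<^sub>R \<psi> x"]) auto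
  qed
  then show "f + g \<in> H10_space \<Omega>" using subspace_add[OF H.sub H10_H1[OF f] H10_H1[OF g]] by (auto simp: H10_space_def)
qed

section \<open>Green's formula and elliptic duality\<close>

lemma elastic_op_L2:
  assumes "bounded_elastic_op \<Omega> M" "u \<in> H_space 2 \<Omega>" "u \<in> H10_space \<Omega>"
  shows "elastic_op \<Omega> M u \<in> L2_space \<Omega>"
    "has_weak_divergence \<Omega> (\<lambda>y. tensor_app (M y) (strain \<Omega> u y)) (\<lambda>x. - elastic_op \<Omega> M u x)"
proof -
  let ?S = "\<lambda>y. tensor_app (M y) (strain \<Omega> u y)"
  have "\<exists>g. g \<in> L2_space \<Omega> \<and> has_weak_divergence \<Omega> ?S g"
    using assms by (auto simp: bounded_elastic_op_def)
  then have *: "weak_divergence \<Omega> ?S \<in> L2_space \<Omega>" "has_weak_divergence \<Omega> ?S (weak_divergence \<Omega> ?S)"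
    using someI_ex[of "\<lambda>g. g \<in> L2_space \<Omega> \<and> has_weak_divergence \<Omega> ?S g"] by (simp_all only: weak_divergence_def)
  have e: "elastic_op \<Omega> M u = (-1) *\<^sub>R weak_divergence \<Omega> ?S" by (auto simp: elastic_op_def fun_eq_iff)
  show "elastic_op \<Omega> M u \<in> L2_space \<Omega>" unfolding e by (rule subspace_scale[OF L2_subspace *(1)])
  show "has_weak_divergence \<Omega> ?S (\<lambda>x. - elastic_op \<Omega> M u x)" using *(2) by (simp add: e)
qed

text \<open>The strain of a test function is the symmetric part of its Jacobian. The stress is a
  symmetric matrix, so contracting it with the symmetric part or with the full Jacobian is the same,
  and the latter is the definition of the weak divergence.\<close>

lemma elastic_form_eq_op_test:
  assumes M: "bounded_tensor \<Omega> K M" and bop: "bounded_elastic_op \<Omega> M"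
    and u: "u \<in> H_space 2 \<Omega>" "u \<in> H10_space \<Omega>" and \<phi>: "\<phi> \<in> test_functions \<Omega>"
  shows "elastic_form \<Omega> M u \<phi> = L2_inner \<Omega> (elastic_op \<Omega> M u) \<phi>"
proof -
  let ?S = "\<lambda>y. tensor_app (M y) (strain \<Omega> u y)"
  let ?G = "\<lambda>x. matrix (frechet_derivative \<phi> (at x))"
  have str: "AE x in lebesgue_on \<Omega>. strain \<Omega> \<phi> x = sym_part (?G x)"
    using strain_cong[OF weak_partial_eqI[OF has_weak_partial_test[OF op \<phi>]]] by (simp add: matrix_def)
  have "AE x in lebesgue_on \<Omega>. symmetric_tensor (M x)" using M by (simp add: bounded_tensor_def)
  with str have ae: "AE x in lebesgue_on \<Omega>. ?S x \<bullet> strain \<Omega> \<phi> x = ?S x \<bullet> ?G x"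
    by eventually_elim (simp add: inner_sym_part tensor_app_symmetric)
  have i: "integrable (lebesgue_on \<Omega>) (\<lambda>x. ?S x \<bullet> strain \<Omega> \<phi> x)"
    by (rule elastic_form_integrable[OF M H10_H1[OF u(2)] test_H_space[OF \<phi>]])
  have "elastic_form \<Omega> M u \<phi> = (LINT x|lebesgue_on \<Omega>. ?S x \<bullet> ?G x)"
    unfolding elastic_form_def
    by (rule integral_cong_AE[OF borel_measurable_integrable[OF i]
          borel_measurable_lebesgue_on_AE[OF \<Omega>_sets borel_measurable_integrable[OF i] ae] ae])
  also have "\<dots> = - (LINT x|lebesgue_on \<Omega>. - elastic_op \<Omega> M u x \<bullet> \<phi> x)"
    using elastic_op_L2(2)[OF bop u] \<phi> by (simp add: has_weak_divergence_def)
  finally show ?thesis by (simp add: L2_inner_def)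
qed

text \<open>Both sides are continuous in \<open>w\<close> for the H^1 norm and agree on test
  functions, which are dense in \<open>H10_space\<close> by definition.\<close>

lemma elastic_form_eq_op:
  assumes M: "bounded_tensor \<Omega> K M" and bop: "bounded_elastic_op \<Omega> M"
    and u: "u \<in> H_space 2 \<Omega>" "u \<in> H10_space \<Omega>" and w: "w \<in> H10_space \<Omega>"
  shows "elastic_form \<Omega> M u w = L2_inner \<Omega> (elastic_op \<Omega> M u) w"
proof -
  interpret L2: semi_inner "L2_space \<Omega> :: (real ^ 'd \<Rightarrow> real ^ 'd) set" "L2_inner \<Omega>" by (rule L2_semi_inner)
  interpret E: bilinear_on "H_space 1 \<Omega>" "elastic_form \<Omega> M" by (rule elastic_form_bilinear[OF M])
  have uH: "u \<in> H_space 1 \<Omega>" and wH: "w \<in> H_space 1 \<Omega>" using H10_H1 u w by auto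
  have uop: "elastic_op \<Omega> M u \<in> L2_space \<Omega>" by (rule elastic_op_L2(1)[OF bop u])
  \<comment> \<open>Bounds the dependence of both sides on \<open>w\<close> in the H^1 norm
    together.\<close>
  define C where "C = K * seminrm (L2_inner \<Omega>) (strain \<Omega> u) + seminrm (L2_inner \<Omega>) (elastic_op \<Omega> M u)"
  have C: "0 \<le> C" unfolding C_def
    by (intro add_nonneg_nonneg mult_nonneg_nonneg L2.seminrm_nonneg uop bounded_tensor_nonneg[OF M]
        semi_inner.seminrm_nonneg[OF L2_semi_inner] strain_L2(1) uH)
  have "\<bar>elastic_form \<Omega> M u w - L2_inner \<Omega> (elastic_op \<Omega> M u) w\<bar> \<le> 0 + e" if e: "0 < e" for e
  proof -
    obtain \<phi> where \<phi>: "\<phi> \<in> test_functions \<Omega>" "H_norm 1 \<Omega> (w - \<phi>) < e / (C + 1)"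
      using H10_approx[OF w, of "e / (C + 1)"] e C by auto
    have \<phi>H: "\<phi> \<in> H_space 1 \<Omega>" by (rule test_H_space[OF \<phi>(1)])
    have dH: "w - \<phi> \<in> H_space 1 \<Omega>" by (rule subspace_diff[OF H1_subspace wH \<phi>H])
    have split: "elastic_form \<Omega> M u w - L2_inner \<Omega> (elastic_op \<Omega> M u) w =
        elastic_form \<Omega> M u (w - \<phi>) - L2_inner \<Omega> (elastic_op \<Omega> M u) (w - \<phi>)"
      using elastic_form_eq_op_test[OF M bop u \<phi>(1)] E.diff_right[OF wH \<phi>H uH]
        L2.diff_right[OF H_space_L2[OF wH] H_space_L2[OF \<phi>H] uop] by simp
    have "\<bar>elastic_form \<Omega> M u (w - \<phi>) - L2_inner \<Omega> (elastic_op \<Omega> M u) (w - \<phi>)\<bar> \<le> K * seminrm (L2_inner \<Omega>) (strain \<Omega> u) * H_norm 1 \<Omega> (w - \<phi>) + seminrm (L2_inner \<Omega>) (elastic_op \<Omega> M u) * H_norm 1 \<Omega> (w - \<phi>)"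
    proof (rule order_trans[OF abs_triangle_ineq4], rule add_mono)
      have "\<bar>elastic_form \<Omega> M u (w - \<phi>)\<bar> \<le> K * seminrm (L2_inner \<Omega>) (strain \<Omega> u) * seminrm (L2_inner \<Omega>) (strain \<Omega> (w - \<phi>))"
        by (rule elastic_form_bound[OF M uH dH])
      also have "\<dots> \<le> K * seminrm (L2_inner \<Omega>) (strain \<Omega> u) * H_norm 1 \<Omega> (w - \<phi>)"
        by (intro mult_left_mono strain_L2(2) dH mult_nonneg_nonneg bounded_tensor_nonneg[OF M]
            semi_inner.seminrm_nonneg[OF L2_semi_inner] strain_L2(1) uH)
      finally show "\<bar>elastic_form \<Omega> M u (w - \<phi>)\<bar> \<le> K * seminrm (L2_inner \<Omega>) (strain \<Omega> u) * H_norm 1 \<Omega> (w - \<phi>)" .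
      have "\<bar>L2_inner \<Omega> (elastic_op \<Omega> M u) (w - \<phi>)\<bar> \<le> seminrm (L2_inner \<Omega>) (elastic_op \<Omega> M u) * seminrm (L2_inner \<Omega>) (w - \<phi>)"
        by (rule L2.Cauchy_Schwarz[OF uop H_space_L2[OF dH]])
      also have "\<dots> \<le> seminrm (L2_inner \<Omega>) (elastic_op \<Omega> M u) * H_norm 1 \<Omega> (w - \<phi>)"
        by (intro mult_left_mono L2_norm_le_H_norm dH L2.seminrm_nonneg uop)
      finally show "\<bar>L2_inner \<Omega> (elastic_op \<Omega> M u) (w - \<phi>)\<bar> \<le> seminrm (L2_inner \<Omega>) (elastic_op \<Omega> M u) * H_norm 1 \<Omega> (w - \<phi>)" .
    qed
    also have "\<dots> = C * H_norm 1 \<Omega> (w - \<phi>)" by (simp only: C_def distrib_right)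
    also have "\<dots> \<le> C * (e / (C + 1))" by (rule mult_left_mono[OF less_imp_le[OF \<phi>(2)] C])
    also have "\<dots> \<le> e" using C e by (simp add: field_simps)
    finally show ?thesis unfolding split by simp
  qed
  then have "\<bar>elastic_form \<Omega> M u w - L2_inner \<Omega> (elastic_op \<Omega> M u) w\<bar> \<le> 0" by (rule field_le_epsilon)
  then show ?thesis by simp
qed

text \<open>All derivatives are moved onto the H^2 argument, so the other one is measured in L^2
  only. With this the consistency terms are bounded by the L^2 norm of the test function. The
  constant in \<open>bounded_elastic_op\<close> has no sign, hence \<open>max C 0\<close>.\<close>

lemma elastic_form_dual_bound:
  assumes M: "bounded_tensor \<Omega> K M" and bop: "bounded_elastic_op \<Omega> M"
  shows "\<exists>C\<ge>0. \<forall>u w. u \<in> H_space 2 \<Omega> \<inter> H10_space \<Omega> \<longrightarrow> w \<in> H10_space \<Omega> \<longrightarrow>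
    \<bar>elastic_form \<Omega> M u w\<bar> \<le> C * seminrm (L2_inner \<Omega>) w * H_norm 2 \<Omega> u"
proof -
  interpret L2: semi_inner "L2_space \<Omega> :: (real ^ 'd \<Rightarrow> real ^ 'd) set" "L2_inner \<Omega>" by (rule L2_semi_inner)
  obtain C where C: "\<And>u. u \<in> H_space 2 \<Omega> \<inter> H10_space \<Omega> \<Longrightarrow> H_norm 0 \<Omega> (elastic_op \<Omega> M u) \<le> C * H_norm 2 \<Omega> u"
    using bop by (auto simp: bounded_elastic_op_def)
  have "\<bar>elastic_form \<Omega> M u w\<bar> \<le> max C 0 * seminrm (L2_inner \<Omega>) w * H_norm 2 \<Omega> u"
    if u: "u \<in> H_space 2 \<Omega> \<inter> H10_space \<Omega>" and w: "w \<in> H10_space \<Omega>" for u w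
  proof -
    have wL: "w \<in> L2_space \<Omega>" using H_space_L2[OF H10_H1[OF w]] .
    have "\<bar>elastic_form \<Omega> M u w\<bar> = \<bar>L2_inner \<Omega> (elastic_op \<Omega> M u) w\<bar>" using elastic_form_eq_op[OF M bop _ _ w] u by simp
    also have "\<dots> \<le> H_norm 0 \<Omega> (elastic_op \<Omega> M u) * seminrm (L2_inner \<Omega>) w"
      unfolding H_norm_0_eq using u by (intro L2.Cauchy_Schwarz elastic_op_L2[OF bop] wL) auto
    also have "\<dots> \<le> (max C 0 * H_norm 2 \<Omega> u) * seminrm (L2_inner \<Omega>) w"
    proof (rule mult_right_mono)
      have "0 \<le> H_norm 2 \<Omega> u" unfolding H_norm_eq using u by (intro semi_inner.seminrm_nonneg[OF H_semi_inner]) auto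
      then have "C * H_norm 2 \<Omega> u \<le> max C 0 * H_norm 2 \<Omega> u" by (intro mult_right_mono) auto
      then show "H_norm 0 \<Omega> (elastic_op \<Omega> M u) \<le> max C 0 * H_norm 2 \<Omega> u" using C[OF u] by linarith
    qed (rule L2.seminrm_nonneg[OF wL])
    finally show ?thesis by (simp add: mult_ac)
  qed
  then show ?thesis by (intro exI[of _ "max C 0"]) auto
qed

text \<open>Elliptic regularity combined with Green's formula; by symmetry of the form, the solution
  of the primal problem also solves the dual one.\<close>

lemma elliptic_dual_solution:
  assumes M: "bounded_tensor \<Omega> K M" and bop: "bounded_elastic_op \<Omega> M" and reg: "elliptic_regularity \<Omega> M"
  shows "\<exists>C\<ge>0. \<forall>u\<in>L2_space \<Omega>. \<exists>\<psi>\<in>H_space 2 \<Omega> \<inter> H10_space \<Omega>.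
    (\<forall>w\<in>H10_space \<Omega>. elastic_form \<Omega> M w \<psi> = L2_inner \<Omega> w u) \<and> H_norm 2 \<Omega> \<psi> \<le> C * seminrm (L2_inner \<Omega>) u"
proof -
  interpret L2: semi_inner "L2_space \<Omega> :: (real ^ 'd \<Rightarrow> real ^ 'd) set" "L2_inner \<Omega>" by (rule L2_semi_inner)
  obtain C where C: "\<And>u. u \<in> H_space 2 \<Omega> \<inter> H10_space \<Omega> \<Longrightarrow> H_norm 2 \<Omega> u \<le> C * H_norm 0 \<Omega> (elastic_op \<Omega> M u)"
    using reg by (auto simp: elliptic_regularity_def)
  have "\<exists>\<psi>\<in>H_space 2 \<Omega> \<inter> H10_space \<Omega>. (\<forall>w\<in>H10_space \<Omega>. elastic_form \<Omega> M w \<psi> = L2_inner \<Omega> w u) \<and>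
      H_norm 2 \<Omega> \<psi> \<le> max C 0 * seminrm (L2_inner \<Omega>) u" if u: "u \<in> L2_space \<Omega>" for u
  proof -
    obtain \<psi> where \<psi>: "\<psi> \<in> H_space 2 \<Omega>" "\<psi> \<in> H10_space \<Omega>" "AE x in lebesgue_on \<Omega>. elastic_op \<Omega> M \<psi> x = u x"
      using reg u unfolding elliptic_regularity_def by blast
    have op\<psi>: "elastic_op \<Omega> M \<psi> \<in> L2_space \<Omega>" by (rule elastic_op_L2[OF bop \<psi>(1,2)])
    have "elastic_form \<Omega> M w \<psi> = L2_inner \<Omega> w u" if w: "w \<in> H10_space \<Omega>" for w
    proof -
      have wL: "w \<in> L2_space \<Omega>" using H_space_L2[OF H10_H1[OF w]] .
      have "elastic_form \<Omega> M w \<psi> = L2_inner \<Omega> (elastic_op \<Omega> M \<psi>) w"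
        using elastic_form_commute[OF M H10_H1[OF w] H10_H1[OF \<psi>(2)]] elastic_form_eq_op[OF M bop \<psi>(1,2) w] by simp
      also have "\<dots> = L2_inner \<Omega> u w" by (rule L2_inner_AE[OF op\<psi> wL \<psi>(3)]) simp
      also have "\<dots> = L2_inner \<Omega> w u" by (rule L2.commute[OF u wL])
      finally show ?thesis .
    qed
    moreover have "H_norm 2 \<Omega> \<psi> \<le> max C 0 * seminrm (L2_inner \<Omega>) u"
    proof -
      have "H_norm 0 \<Omega> (elastic_op \<Omega> M \<psi>) = seminrm (L2_inner \<Omega>) u"
        unfolding H_norm_0_eq seminrm_def using L2_inner_AE[OF op\<psi> op\<psi> \<psi>(3,3)] by simp
      moreover have "C * seminrm (L2_inner \<Omega>) u \<le> max C 0 * seminrm (L2_inner \<Omega>) u"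
        by (intro mult_right_mono L2.seminrm_nonneg u) auto
      ultimately show ?thesis using C[of \<psi>] \<psi> by simp
    qed
    ultimately show ?thesis using \<psi> by blast
  qed
  then show ?thesis by (intro exI[of _ "max C 0"]) auto
qed

end

section \<open>Curves with values in Sobolev spaces\<close>

lemma sum_fun_apply: "(\<Sum>i\<in>I. f i) x = (\<Sum>i\<in>I. f i x :: 'a::comm_monoid_add)"
  by (induction I rule: infinite_finite_induct) auto

lemma borel_measurable_AE_LIMSEQ:
  fixes f :: "nat \<Rightarrow> 'a::euclidean_space \<Rightarrow> 'b::euclidean_space"
  assumes S: "S \<in> sets lebesgue" and f: "\<And>n. f n \<in> borel_measurable (lebesgue_on S)"
    and lim: "AE x in lebesgue_on S. (\<lambda>n. f n x) \<longlonglongrightarrow> g x"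
  shows "g \<in> borel_measurable (lebesgue_on S)"
proof (rule borel_measurable_lebesgue_on_AE[OF S])
  show "(\<lambda>x. lim (\<lambda>n. f n x)) \<in> borel_measurable (lebesgue_on S)" using f by measurable
  show "AE x in lebesgue_on S. lim (\<lambda>n. f n x) = g x" using lim by (rule eventually_mono) (rule limI)
qed

lemma simple_function_lebesgue_on_subset:
  fixes s :: "real \<Rightarrow> 'a"
  assumes "simple_function (lebesgue_on {0..T}) s" "{a..b} \<subseteq> {0..T}"
  shows "simple_function (lebesgue_on {a..b}) s"
  unfolding simple_function_def
proof (intro conjI ballI)
  show "finite (s ` space (lebesgue_on {a..b}))"
    using assms(1) finite_subset[OF image_mono[OF assms(2)], of s] by (simp add: simple_function_def)
  fix y assume "y \<in> s ` space (lebesgue_on {a..b})"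
  then have "s -` {y} \<inter> {0..T} \<in> sets (lebesgue_on {0..T})"
    using assms by (auto simp: simple_function_def)
  then have "s -` {y} \<inter> {0..T} \<in> sets lebesgue" by (simp add: sets_restrict_space_iff)
  then have "(s -` {y} \<inter> {0..T}) \<inter> {a..b} \<in> sets lebesgue" by (rule sets.Int) simp
  moreover have "(s -` {y} \<inter> {0..T}) \<inter> {a..b} = s -` {y} \<inter> {a..b}" using assms(2) by auto
  ultimately show "s -` {y} \<inter> space (lebesgue_on {a..b}) \<in> sets (lebesgue_on {a..b})"
    by (simp add: sets_restrict_space_iff)
qed

text \<open>The integral of a simple function with values in a vector space without a topology.\<close>

definition simple_integral :: "real \<Rightarrow> real \<Rightarrow> (real \<Rightarrow> 'v::real_vector) \<Rightarrow> 'v" where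
  "simple_integral a b s = (\<Sum>y\<in>s ` {a..b}. measure (lebesgue_on {a..b}) (s -` {y} \<inter> {a..b}) *\<^sub>R y)"

lemma finite_measure_interval: "finite_measure (lebesgue_on {a..b::real})"
  by (intro finite_measure_lebesgue_on) simp

lemma simple_function_range:
  "simple_function (lebesgue_on {a..b::real}) s \<Longrightarrow> finite (s ` {a..b})"
  by (simp add: simple_function_def)

text \<open>A simple function has finite range, so \<open>h\<close> may be any real function of its
  values, in particular a pairing or a norm on a space without topology.\<close>

lemma simple_function_integrable:
  fixes h :: "'v \<Rightarrow> real"
  assumes "simple_function (lebesgue_on {a..b::real}) s"
  shows "(\<lambda>t. h (s t)) \<in> borel_measurable (lebesgue_on {a..b})"
    "integrable (lebesgue_on {a..b}) (\<lambda>t. h (s t))"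
    "(LINT t|lebesgue_on {a..b}. h (s t)) = (\<Sum>y\<in>s ` {a..b}. measure (lebesgue_on {a..b}) (s -` {y} \<inter> {a..b}) * h y)"
proof -
  interpret finite_measure "lebesgue_on {a..b}" by (rule finite_measure_interval)
  have "simple_function (lebesgue_on {a..b}) (\<lambda>t. h (s t))" using assms by (rule simple_function_compose1)
  then show "(\<lambda>t. h (s t)) \<in> borel_measurable (lebesgue_on {a..b})" by (rule borel_measurable_simple_function)
  have fin: "finite (s ` {a..b})" by (rule simple_function_range[OF assms])
  have m: "s -` {y} \<inter> {a..b} \<in> sets (lebesgue_on {a..b})" for y
    using simple_functionD(2)[OF assms, of "{y}"] by simp
  have eq: "h (s t) = (\<Sum>y\<in>s ` {a..b}. indicator (s -` {y} \<inter> {a..b}) t * h y)" if "t \<in> {a..b}" for t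
  proof -
    have "(\<Sum>y\<in>s ` {a..b}. indicator (s -` {y} \<inter> {a..b}) t * h y) = (\<Sum>y\<in>s ` {a..b}. (if y = s t then h y else 0))"
      using that by (intro sum.cong) (auto simp: indicator_def)
    also have "\<dots> = h (s t)" using fin that by simp
    finally show ?thesis by simp
  qed
  have int: "integrable (lebesgue_on {a..b}) (\<lambda>t. \<Sum>y\<in>s ` {a..b}. indicator (s -` {y} \<inter> {a..b}) t * h y)"
    using m by (intro Bochner_Integration.integrable_sum integrable_mult_left) (auto simp: emeasure_finite less_top[symmetric])
  show "integrable (lebesgue_on {a..b}) (\<lambda>t. h (s t))"
    by (subst Bochner_Integration.integrable_cong[OF refl eq]) (use int in auto)
  have "(LINT t|lebesgue_on {a..b}. h (s t)) = (LINT t|lebesgue_on {a..b}. (\<Sum>y\<in>s ` {a..b}. indicator (s -` {y} \<inter> {a..b}) t * h y))"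
    by (intro Bochner_Integration.integral_cong eq) auto
  also have "\<dots> = (\<Sum>y\<in>s ` {a..b}. (LINT t|lebesgue_on {a..b}. indicator (s -` {y} \<inter> {a..b}) t * h y))"
    using m by (intro Bochner_Integration.integral_sum integrable_mult_left) (auto simp: emeasure_finite less_top[symmetric])
  also have "\<dots> = (\<Sum>y\<in>s ` {a..b}. measure (lebesgue_on {a..b}) (s -` {y} \<inter> {a..b}) * h y)"
    using m by (intro sum.cong refl) (simp add: Int_absorb2 sets.sets_into_space)
  finally show "(LINT t|lebesgue_on {a..b}. h (s t)) = (\<Sum>y\<in>s ` {a..b}. measure (lebesgue_on {a..b}) (s -` {y} \<inter> {a..b}) * h y)" .
qed

lemma (in bilinear_on) simple_integral_form:
  assumes s: "simple_function (lebesgue_on {a..b}) s" "s ` {a..b} \<subseteq> S" and z: "z \<in> S"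
  shows "B (simple_integral a b s) z = (LINT t|lebesgue_on {a..b}. B (s t) z)" "simple_integral a b s \<in> S"
proof -
  have y: "measure (lebesgue_on {a..b}) (s -` {y} \<inter> {a..b}) *\<^sub>R y \<in> S" if "y \<in> s ` {a..b}" for y
    using that s(2) by (intro subspace_scale[OF sub]) auto
  then show "simple_integral a b s \<in> S" unfolding simple_integral_def by (intro subspace_sum[OF sub])
  have "B (simple_integral a b s) z = (\<Sum>y\<in>s ` {a..b}. measure (lebesgue_on {a..b}) (s -` {y} \<inter> {a..b}) * B y z)"
    unfolding simple_integral_def using y z s(2) by (subst sum_left) (auto intro!: sum.cong scale_left)
  then show "B (simple_integral a b s) z = (LINT t|lebesgue_on {a..b}. B (s t) z)"
    by (simp add: simple_function_integrable(3)[OF s(1), of "\<lambda>y. B y z"])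
qed

section \<open>Weak integrals and time derivatives through scalar pairings\<close>

context bounded_open_set
begin

text \<open>Pairing with \<psi> is exact on the simple approximants, and both limits in the
  definition of \<open>has_L2_integral\<close> survive it by Cauchy-Schwarz. Measurability of the
  pairing is a separate hypothesis; it ultimately comes from continuity for \<open>v\<close> and
  from strong measurability for its derivatives.\<close>

lemma has_L2_integral_inner:
  assumes I: "has_L2_integral \<Omega> T f I" and f: "AE t in lebesgue_on {0..T}. f t \<in> L2_space \<Omega>"
    and \<psi>: "\<psi> \<in> L2_space \<Omega>" and m: "(\<lambda>t. L2_inner \<Omega> (f t) \<psi>) \<in> borel_measurable (lebesgue_on {0..T})"
  shows "L2_inner \<Omega> I \<psi> = (LINT t|lebesgue_on {0..T}. L2_inner \<Omega> (f t) \<psi>)"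
proof -
  interpret L2: semi_inner "L2_space \<Omega> :: (real ^ 'd \<Rightarrow> real ^ 'd) set" "L2_inner \<Omega>" by (rule L2_semi_inner)
  let ?M = "lebesgue_on {0..T}"
  obtain s where IL: "I \<in> L2_space \<Omega>" and s': "\<forall>k. simple_function ?M (s k) \<and> s k ` {0..T} \<subseteq> L2_space \<Omega> \<and>
      integrable ?M (\<lambda>t. H_norm 0 \<Omega> (\<lambda>x. f t x - s k t x))"
     and lim1: "(\<lambda>k. LINT t|?M. H_norm 0 \<Omega> (\<lambda>x. f t x - s k t x)) \<longlonglongrightarrow> 0"
     and lim2: "(\<lambda>k. H_norm 0 \<Omega> (\<lambda>x. (\<Sum>y\<in>s k ` {0..T}. measure ?M (s k -` {y} \<inter> {0..T}) *\<^sub>R y x) - I x)) \<longlonglongrightarrow> 0"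
    using I unfolding has_L2_integral_def by blast
  have s: "simple_function ?M (s k)" "s k ` {0..T} \<subseteq> L2_space \<Omega>" "integrable ?M (\<lambda>t. H_norm 0 \<Omega> (\<lambda>x. f t x - s k t x))" for k
    using s' by blast+
  have eqI: "(\<lambda>x. (\<Sum>y\<in>s k ` {0..T}. measure ?M (s k -` {y} \<inter> {0..T}) *\<^sub>R y x) - I x) = simple_integral 0 T (s k) - I" for k
    by (auto simp: simple_integral_def sum_fun_apply fun_eq_iff)
  have sub: "(\<lambda>x. f t x - s k t x) = f t - s k t" for t k by (auto simp: fun_eq_iff)
  note SI = L2.simple_integral_form[OF s(1,2) \<psi>]
  have "(\<lambda>k. L2_inner \<Omega> (simple_integral 0 T (s k)) \<psi>) \<longlonglongrightarrow> L2_inner \<Omega> I \<psi>"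
    using lim2 unfolding eqI H_norm_0_eq by (intro L2_inner_tendsto SI(2) IL \<psi>)
  then have A: "(\<lambda>k. LINT t|?M. L2_inner \<Omega> (s k t) \<psi>) \<longlonglongrightarrow> L2_inner \<Omega> I \<psi>" by (simp add: SI(1))
  have sint: "integrable ?M (\<lambda>t. L2_inner \<Omega> (s k t) \<psi>)" for k
    by (rule simple_function_integrable(2)[OF s(1), where h = "\<lambda>y. L2_inner \<Omega> y \<psi>"])
  have bound: "AE t in ?M. \<bar>L2_inner \<Omega> (f t) \<psi> - L2_inner \<Omega> (s k t) \<psi>\<bar> \<le> H_norm 0 \<Omega> (f t - s k t) * seminrm (L2_inner \<Omega>) \<psi>" for k
  proof -
    have "AE t in ?M. t \<in> {0..T}" by (simp add: AE_restrict_space_iff)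
    with f show ?thesis
    proof eventually_elim
      case (elim t)
      then have st: "s k t \<in> L2_space \<Omega>" using s(2)[of k] by auto
      show ?case using L2.Cauchy_Schwarz[OF subspace_diff[OF L2.sub elim(1) st] \<psi>] L2.diff_left[OF elim(1) st \<psi>]
        by (simp add: H_norm_0_eq)
    qed
  qed
  have dint: "integrable ?M (\<lambda>t. L2_inner \<Omega> (f t) \<psi> - L2_inner \<Omega> (s k t) \<psi>)" for k
  proof (rule Bochner_Integration.integrable_bound)
    show "integrable ?M (\<lambda>t. H_norm 0 \<Omega> (f t - s k t) * seminrm (L2_inner \<Omega>) \<psi>)"
      using s(3)[of k] unfolding sub by (rule integrable_mult_left)
    show "(\<lambda>t. L2_inner \<Omega> (f t) \<psi> - L2_inner \<Omega> (s k t) \<psi>) \<in> borel_measurable ?M"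
      by (intro borel_measurable_diff m borel_measurable_integrable[OF sint])
    show "AE t in ?M. norm (L2_inner \<Omega> (f t) \<psi> - L2_inner \<Omega> (s k t) \<psi>) \<le> norm (H_norm 0 \<Omega> (f t - s k t) * seminrm (L2_inner \<Omega>) \<psi>)"
      using bound[of k] by (rule eventually_mono) simp
  qed
  have fint: "integrable ?M (\<lambda>t. L2_inner \<Omega> (f t) \<psi>)"
    using Bochner_Integration.integrable_add[OF dint[of 0] sint[of 0]] by simp
  have "(\<lambda>k. (LINT t|?M. L2_inner \<Omega> (s k t) \<psi>) - (LINT t|?M. L2_inner \<Omega> (f t) \<psi>)) \<longlonglongrightarrow> 0"
  proof (rule Lim_null_comparison)
    show "(\<lambda>k. (LINT t|?M. H_norm 0 \<Omega> (f t - s k t)) * seminrm (L2_inner \<Omega>) \<psi>) \<longlonglongrightarrow> 0"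
      using lim1 unfolding sub by (rule tendsto_mult_left_zero)
    show "\<forall>\<^sub>F k in sequentially. norm ((LINT t|?M. L2_inner \<Omega> (s k t) \<psi>) - (LINT t|?M. L2_inner \<Omega> (f t) \<psi>))
        \<le> (LINT t|?M. H_norm 0 \<Omega> (f t - s k t)) * seminrm (L2_inner \<Omega>) \<psi>"
    proof (rule always_eventually, rule allI)
      fix k
      have "norm ((LINT t|?M. L2_inner \<Omega> (s k t) \<psi>) - (LINT t|?M. L2_inner \<Omega> (f t) \<psi>)) =
          \<bar>LINT t|?M. L2_inner \<Omega> (f t) \<psi> - L2_inner \<Omega> (s k t) \<psi>\<bar>"
        using fint sint[of k] by simp
      also have "\<dots> \<le> (LINT t|?M. \<bar>L2_inner \<Omega> (f t) \<psi> - L2_inner \<Omega> (s k t) \<psi>\<bar>)" by (rule integral_abs_bound)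
      also have "\<dots> \<le> (LINT t|?M. H_norm 0 \<Omega> (f t - s k t) * seminrm (L2_inner \<Omega>) \<psi>)"
        using integrable_abs[OF dint[of k]] integrable_mult_left[OF s(3)[of k, unfolded sub]] bound[of k]
        by (intro integral_mono_AE) auto
      finally show "norm ((LINT t|?M. L2_inner \<Omega> (s k t) \<psi>) - (LINT t|?M. L2_inner \<Omega> (f t) \<psi>))
        \<le> (LINT t|?M. H_norm 0 \<Omega> (f t - s k t)) * seminrm (L2_inner \<Omega>) \<psi>" by simp
    qed
  qed
  then have "(\<lambda>k. LINT t|?M. L2_inner \<Omega> (s k t) \<psi>) \<longlonglongrightarrow> (LINT t|?M. L2_inner \<Omega> (f t) \<psi>)" by (rule LIM_zero_cancel)
  then show ?thesis by (rule LIMSEQ_unique[OF A])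
qed

text \<open>Reduces the derivative of a curve to weak derivatives of real functions, to which
  \<open>weak_derivative_interval\<close> applies.\<close>

lemma weak_time_derivative_scalar:
  assumes D: "has_weak_time_derivative \<Omega> T f g"
    and fL: "AE t in lebesgue_on {0..T}. f t \<in> L2_space \<Omega>" and gL: "AE t in lebesgue_on {0..T}. g t \<in> L2_space \<Omega>"
    and \<psi>: "\<psi> \<in> L2_space \<Omega>" and fm: "(\<lambda>t. L2_inner \<Omega> (f t) \<psi>) \<in> borel_measurable (lebesgue_on {0..T})"
    and gm: "(\<lambda>t. L2_inner \<Omega> (g t) \<psi>) \<in> borel_measurable (lebesgue_on {0..T})"
    and \<phi>: "\<phi> \<in> test_functions {0<..<T}"
  shows "(LINT t|lebesgue_on {0..T}. deriv \<phi> t * L2_inner \<Omega> (f t) \<psi>) = - (LINT t|lebesgue_on {0..T}. \<phi> t * L2_inner \<Omega> (g t) \<psi>)"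
proof -
  interpret L2: semi_inner "L2_space \<Omega> :: (real ^ 'd \<Rightarrow> real ^ 'd) set" "L2_inner \<Omega>" by (rule L2_semi_inner)
  obtain I where I: "has_L2_integral \<Omega> T (\<lambda>t x. deriv \<phi> t *\<^sub>R f t x) I" "has_L2_integral \<Omega> T (\<lambda>t x. \<phi> t *\<^sub>R g t x) (\<lambda>x. - I x)"
    using D \<phi> by (auto simp: has_weak_time_derivative_def)
  \<comment> \<open>The class of test functions is defined with Frechet derivatives, the time
    derivative with \<open>deriv\<close>.\<close>
  have deriv: "deriv \<phi> = (\<lambda>t. frechet_derivative \<phi> (at t) 1)"
  proof
    fix t
    have "(\<phi> has_derivative frechet_derivative \<phi> (at t)) (at t)" by (rule test_functionsD(5)[OF \<phi>])
    moreover have "frechet_derivative \<phi> (at t) = (*) (frechet_derivative \<phi> (at t) 1)"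
    proof
      fix r
      have "frechet_derivative \<phi> (at t) (r *\<^sub>R 1) = r *\<^sub>R frechet_derivative \<phi> (at t) 1"
        by (rule linear_scale[OF has_derivative_linear[OF test_functionsD(5)[OF \<phi>]]])
      then show "frechet_derivative \<phi> (at t) r = frechet_derivative \<phi> (at t) 1 * r" by (simp add: mult.commute)
    qed
    ultimately show "deriv \<phi> t = frechet_derivative \<phi> (at t) 1"
      by (intro DERIV_imp_deriv) (simp add: has_field_derivative_def)
  qed
  have cm: "h \<in> borel_measurable (lebesgue_on {0..T})" if "h \<in> test_functions {0<..<T}" for h :: "real \<Rightarrow> real"
    using continuous_imp_measurable_on_sets_lebesgue[OF continuous_on_subset[OF test_functionsD(4)[OF that]], of "{0..T}"] by simp
  have dm: "deriv \<phi> \<in> borel_measurable (lebesgue_on {0..T})"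
    unfolding deriv by (intro cm test_functions_partial[OF \<phi>]) simp
  have key: "L2_inner \<Omega> J \<psi> = (LINT t|lebesgue_on {0..T}. h t * L2_inner \<Omega> (k t) \<psi>)"
    if J: "has_L2_integral \<Omega> T (\<lambda>t x. h t *\<^sub>R k t x) J" and k: "AE t in lebesgue_on {0..T}. k t \<in> L2_space \<Omega>"
      and hm: "h \<in> borel_measurable (lebesgue_on {0..T})" and km: "(\<lambda>t. L2_inner \<Omega> (k t) \<psi>) \<in> borel_measurable (lebesgue_on {0..T})" for h k J
  proof -
    have e: "(\<lambda>x. h t *\<^sub>R k t x) = h t *\<^sub>R k t" for t by (auto simp: fun_eq_iff)
    have ae: "AE t in lebesgue_on {0..T}. h t * L2_inner \<Omega> (k t) \<psi> = L2_inner \<Omega> (h t *\<^sub>R k t) \<psi>"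
      using k by (rule eventually_mono) (simp add: L2.scale_left \<psi>)
    have m1: "(\<lambda>t. h t * L2_inner \<Omega> (k t) \<psi>) \<in> borel_measurable (lebesgue_on {0..T})" using hm km by measurable
    have m2: "(\<lambda>t. L2_inner \<Omega> (h t *\<^sub>R k t) \<psi>) \<in> borel_measurable (lebesgue_on {0..T})"
      by (rule borel_measurable_lebesgue_on_AE[OF _ m1 ae]) simp
    have "L2_inner \<Omega> J \<psi> = (LINT t|lebesgue_on {0..T}. L2_inner \<Omega> (h t *\<^sub>R k t) \<psi>)"
      using J unfolding e
      by (rule has_L2_integral_inner[OF _ _ \<psi> m2]) (use k in \<open>auto elim: eventually_mono intro: subspace_scale[OF L2.sub]\<close>)
    also have "\<dots> = (LINT t|lebesgue_on {0..T}. h t * L2_inner \<Omega> (k t) \<psi>)"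
      by (rule integral_cong_AE[OF m2 m1]) (use ae in \<open>auto elim: eventually_mono\<close>)
    finally show ?thesis .
  qed
  have "L2_inner \<Omega> (\<lambda>x. - I x) \<psi> = - L2_inner \<Omega> I \<psi>" by (simp add: L2_inner_def)
  then show ?thesis using key[OF I(1) fL dm fm] key[OF I(2) gL cm[OF \<phi>] gm] by simp
qed

text \<open>The H^r norm dominates the L^2 norm, so the pairings of the simple approximants converge
  almost everywhere to the pairing of the curve.\<close>

lemma strongly_measurable_inner:
  assumes f: "strongly_measurable_curve r \<Omega> X T f" and X: "X \<subseteq> H_space r \<Omega>" and \<psi>: "\<psi> \<in> L2_space \<Omega>"
  shows "(\<lambda>t. L2_inner \<Omega> (f t) \<psi>) \<in> borel_measurable (lebesgue_on {0..T})" "AE t in lebesgue_on {0..T}. f t \<in> L2_space \<Omega>"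
proof -
  interpret L2: semi_inner "L2_space \<Omega> :: (real ^ 'd \<Rightarrow> real ^ 'd) set" "L2_inner \<Omega>" by (rule L2_semi_inner)
  obtain s where s': "\<forall>k. simple_function (lebesgue_on {0..T}) (s k) \<and> s k ` {0..T} \<subseteq> X"
    and lim: "AE t in lebesgue_on {0..T}. (\<lambda>k. H_norm r \<Omega> (\<lambda>x. s k t x - f t x)) \<longlonglongrightarrow> 0"
    and fX: "AE t in lebesgue_on {0..T}. f t \<in> X"
    using f unfolding strongly_measurable_curve_def by blast
  have s: "simple_function (lebesgue_on {0..T}) (s k)" "s k ` {0..T} \<subseteq> X" for k
    using s' by blast+
  show fL: "AE t in lebesgue_on {0..T}. f t \<in> L2_space \<Omega>" using fX by (rule eventually_mono) (use X H_space_L2 in auto)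
  have tI: "AE t in lebesgue_on {0..T}. t \<in> {0..T}" by (simp add: AE_restrict_space_iff)
  show "(\<lambda>t. L2_inner \<Omega> (f t) \<psi>) \<in> borel_measurable (lebesgue_on {0..T})"
  proof (rule borel_measurable_AE_LIMSEQ)
    show "(\<lambda>t. L2_inner \<Omega> (s k t) \<psi>) \<in> borel_measurable (lebesgue_on {0..T})" for k
      by (rule simple_function_integrable(1)[OF s(1), where h = "\<lambda>y. L2_inner \<Omega> y \<psi>"])
    show "AE t in lebesgue_on {0..T}. (\<lambda>k. L2_inner \<Omega> (s k t) \<psi>) \<longlonglongrightarrow> L2_inner \<Omega> (f t) \<psi>"
      using lim fX tI
    proof eventually_elim
      case (elim t)
      have st: "s k t \<in> H_space r \<Omega>" for k using s(2)[of k] X imageI[OF elim(3), of "s k"] by blast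
      have ft: "f t \<in> H_space r \<Omega>" using elim(2) X by auto
      have e: "(\<lambda>x. s k t x - f t x) = s k t - f t" for k by (auto simp: fun_eq_iff)
      have d: "s k t - f t \<in> H_space r \<Omega>" for k by (rule subspace_diff[OF H1_subspace st ft])
      have "(\<lambda>k. seminrm (L2_inner \<Omega>) (s k t - f t)) \<longlonglongrightarrow> 0"
      proof (rule tendsto_sandwich[OF _ _ tendsto_const elim(1)[unfolded e]])
        show "\<forall>\<^sub>F k in sequentially. 0 \<le> seminrm (L2_inner \<Omega>) (s k t - f t)"
          by (intro always_eventually allI L2.seminrm_nonneg H_space_L2[OF d])
        show "\<forall>\<^sub>F k in sequentially. seminrm (L2_inner \<Omega>) (s k t - f t) \<le> H_norm r \<Omega> (s k t - f t)"
          by (intro always_eventually allI L2_norm_le_H_norm d)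
      qed
      then show ?case by (intro L2_inner_tendsto H_space_L2[OF st] H_space_L2[OF ft] \<psi>)
    qed
  qed simp
qed

text \<open>A weak integral of an integrable curve in a Sobolev space is a limit of integrals of simple functions,
  hence lies in that space by completeness.\<close>

lemma weak_integral_in_H_space:
  fixes g :: "real \<Rightarrow> real ^ 'd \<Rightarrow> real ^ 'd"
  assumes ab: "a \<le> b" and u: "u \<in> L2_space \<Omega>"
    and s: "\<And>k. simple_function (lebesgue_on {a..b}) (s k)" "\<And>k::nat. s k ` {a..b} \<subseteq> H_space r \<Omega>"
    and gH: "AE t in lebesgue_on {a..b}. g t \<in> H_space r \<Omega>"
    and lim: "AE t in lebesgue_on {a..b}. (\<lambda>k. H_norm r \<Omega> (s k t - g t)) \<longlonglongrightarrow> 0"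
    and gint: "integrable (lebesgue_on {a..b}) (\<lambda>t. H_norm r \<Omega> (g t))"
    and weak: "\<And>\<psi>. \<psi> \<in> L2_space \<Omega> \<Longrightarrow> L2_inner \<Omega> u \<psi> = (LINT t|lebesgue_on {a..b}. L2_inner \<Omega> (g t) \<psi>)"
  shows "u \<in> H_space r \<Omega>" "H_norm r \<Omega> u \<le> (LINT t|lebesgue_on {a..b}. H_norm r \<Omega> (g t))"
proof -
  interpret L2: semi_inner "L2_space \<Omega> :: (real ^ 'd \<Rightarrow> real ^ 'd) set" "L2_inner \<Omega>" by (rule L2_semi_inner)
  interpret H: semi_inner "H_space r \<Omega> :: (real ^ 'd \<Rightarrow> real ^ 'd) set" "H_inner r \<Omega>" by (rule H_semi_inner)
  let ?M = "lebesgue_on {a..b}"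
  have tI: "AE t in ?M. t \<in> {a..b}" by (simp add: AE_restrict_space_iff)
  have N0: "0 \<le> H_norm r \<Omega> w" if "w \<in> H_space r \<Omega>" for w :: "real ^ 'd \<Rightarrow> real ^ 'd"
    unfolding H_norm_eq by (rule H.seminrm_nonneg[OF that])
  have tri: "H_norm r \<Omega> (w - w') \<le> H_norm r \<Omega> w + H_norm r \<Omega> w'" if "w \<in> H_space r \<Omega>" "w' \<in> H_space r \<Omega>" for w w' :: "real ^ 'd \<Rightarrow> real ^ 'd"
    unfolding H_norm_eq by (rule H.triangle_diff[OF that])
  note sH = H.sub
  \<comment> \<open>The given approximants need not be dominated by \<open>g\<close>. They are
    replaced by 0 where their norm exceeds twice that of \<open>g\<close>; where \<open>g t\<close>
    has positive norm this eventually changes nothing, and where it has norm 0 the result has norm 0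
    too.\<close>
  define A where "A = (\<lambda>k. {t \<in> {a..b}. H_norm r \<Omega> (s k t) \<le> 2 * H_norm r \<Omega> (g t)})"
  define \<sigma> where "\<sigma> = (\<lambda>k t. if t \<in> A k then s k t else 0)"
  have Am: "A k \<in> sets ?M" for k
  proof -
    have [measurable]: "(\<lambda>t. H_norm r \<Omega> (s k t)) \<in> borel_measurable ?M"
      by (rule simple_function_integrable(1)[OF s(1)])
    note [measurable] = borel_measurable_integrable[OF gint]
    have "{t \<in> space ?M. H_norm r \<Omega> (s k t) \<le> 2 * H_norm r \<Omega> (g t)} \<in> sets ?M" by measurable
    then show ?thesis by (simp add: A_def)
  qed
  have \<sigma>s: "simple_function ?M (\<sigma> k)" for k
    unfolding \<sigma>_def using Am[of k] sets.sets_into_space[OF Am[of k]] s(1)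
    by (intro simple_function_If_set) (auto simp: Int_absorb2)
  have \<sigma>H: "\<sigma> k ` {a..b} \<subseteq> H_space r \<Omega>" for k
    unfolding \<sigma>_def using s(2)[of k] subspace_0[OF sH] by auto
  have \<sigma>H': "\<sigma> k t \<in> H_space r \<Omega>" if "t \<in> {a..b}" for k t using \<sigma>H[of k] that by auto
  have \<sigma>b: "H_norm r \<Omega> (\<sigma> k t) \<le> 2 * H_norm r \<Omega> (g t)" if "g t \<in> H_space r \<Omega>" for k t
    using N0[OF that] H.seminrm_zero by (auto simp: \<sigma>_def A_def H_norm_eq)
  have \<sigma>lim: "AE t in ?M. (\<lambda>k. H_norm r \<Omega> (\<sigma> k t - g t)) \<longlonglongrightarrow> 0"
    using lim gH tI
  proof eventually_elim
    case (elim t)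
    have st: "s k t \<in> H_space r \<Omega>" for k using s(2)[of k] elim(3) by auto
    show ?case
    proof (cases "H_norm r \<Omega> (g t) = 0")
      case True
      have "H_norm r \<Omega> (\<sigma> k t - g t) = 0" for k
        using tri[OF \<sigma>H'[OF elim(3)] elim(2), of k] \<sigma>b[OF elim(2), of k] True
          N0[OF subspace_diff[OF sH \<sigma>H'[OF elim(3), of k] elim(2)]] by linarith
      then show ?thesis by simp
    next
      case False
      then have pos: "0 < H_norm r \<Omega> (g t)" using N0[OF elim(2)] by simp
      have "\<forall>\<^sub>F k in sequentially. H_norm r \<Omega> (s k t - g t) < H_norm r \<Omega> (g t)"
        using order_tendstoD(2)[OF elim(1) pos] .
      then have "\<forall>\<^sub>F k in sequentially. H_norm r \<Omega> (s k t - g t) = H_norm r \<Omega> (\<sigma> k t - g t)"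
      proof eventually_elim
        case (elim k)
        have "H_norm r \<Omega> (s k t) = H_norm r \<Omega> ((s k t - g t) + g t)" by simp
        also have "\<dots> \<le> H_norm r \<Omega> (s k t - g t) + H_norm r \<Omega> (g t)"
          unfolding H_norm_eq by (intro H.triangle subspace_diff[OF sH] st \<open>g t \<in> H_space r \<Omega>\<close>)
        finally have "t \<in> A k" using elim \<open>t \<in> {a..b}\<close> by (simp add: A_def)
        then show ?case by (simp only: \<sigma>_def if_True)
      qed
      then show ?thesis by (rule Lim_transform_eventually[OF elim(1)])
    qed
  qed
  \<comment> \<open>Norms of differences of two simple functions are measurable, and the distance to
    \<open>g\<close> is their limit almost everywhere.\<close>
  have \<sigma>gm: "(\<lambda>t. H_norm r \<Omega> (\<sigma> k t - g t)) \<in> borel_measurable ?M" for k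
  proof (rule borel_measurable_AE_LIMSEQ)
    have "simple_function ?M (\<lambda>t. (\<sigma> k t, \<sigma> m t))" for m by (rule simple_function_Pair[OF \<sigma>s \<sigma>s])
    from simple_function_integrable(1)[OF this, where h = "\<lambda>p. H_norm r \<Omega> (fst p - snd p)"]
    show "(\<lambda>t. H_norm r \<Omega> (\<sigma> k t - \<sigma> m t)) \<in> borel_measurable ?M" for m by simp
    show "AE t in ?M. (\<lambda>m. H_norm r \<Omega> (\<sigma> k t - \<sigma> m t)) \<longlonglongrightarrow> H_norm r \<Omega> (\<sigma> k t - g t)"
      using \<sigma>lim gH tI
    proof eventually_elim
      case (elim t)
      note \<sigma>t = \<sigma>H'[OF elim(3)]
      have "(\<lambda>m. H_norm r \<Omega> (\<sigma> k t - \<sigma> m t) - H_norm r \<Omega> (\<sigma> k t - g t)) \<longlonglongrightarrow> 0"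
      proof (rule Lim_null_comparison[OF _ elim(1)], intro always_eventually allI)
        fix m
        note d = subspace_diff[OF sH]
        have e1: "\<sigma> k t - \<sigma> m t = (\<sigma> k t - g t) - (\<sigma> m t - g t)" and e2: "\<sigma> k t - g t = (\<sigma> k t - \<sigma> m t) + (\<sigma> m t - g t)" by simp_all
        have "H_norm r \<Omega> (\<sigma> k t - \<sigma> m t) \<le> H_norm r \<Omega> (\<sigma> k t - g t) + H_norm r \<Omega> (\<sigma> m t - g t)"
          by (subst e1) (intro tri d \<sigma>t elim(2))
        moreover have "H_norm r \<Omega> (\<sigma> k t - g t) \<le> H_norm r \<Omega> (\<sigma> k t - \<sigma> m t) + H_norm r \<Omega> (\<sigma> m t - g t)"
          unfolding H_norm_eq by (subst e2) (intro H.triangle d \<sigma>t elim(2))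
        ultimately show "norm (H_norm r \<Omega> (\<sigma> k t - \<sigma> m t) - H_norm r \<Omega> (\<sigma> k t - g t)) \<le> H_norm r \<Omega> (\<sigma> m t - g t)"
          unfolding real_norm_def by linarith
      qed
      then show ?case by (rule LIM_zero_cancel)
    qed
  qed simp
  define e where "e = (\<lambda>k. LINT t|?M. H_norm r \<Omega> (\<sigma> k t - g t))"
  have dom: "AE t in ?M. norm (H_norm r \<Omega> (\<sigma> k t - g t)) \<le> 3 * H_norm r \<Omega> (g t)" for k
    using gH tI
  proof eventually_elim
    case (elim t)
    show ?case using tri[OF \<sigma>H'[OF elim(2)] elim(1), of k] \<sigma>b[OF elim(1), of k]
        N0[OF subspace_diff[OF sH \<sigma>H'[OF elim(2), of k] elim(1)]] unfolding real_norm_def by linarith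
  qed
  have e0: "e \<longlonglongrightarrow> 0"
  proof -
    have "(\<lambda>k. LINT t|?M. H_norm r \<Omega> (\<sigma> k t - g t)) \<longlonglongrightarrow> (LINT t|?M. 0)"
      by (rule integral_dominated_convergence[where w = "\<lambda>t. 3 * H_norm r \<Omega> (g t)"])
        (use \<sigma>gm \<sigma>lim dom gint in auto)
    then show ?thesis by (simp add: e_def)
  qed
  have \<sigma>gi: "integrable ?M (\<lambda>t. H_norm r \<Omega> (\<sigma> k t - g t))" for k
  proof (rule Bochner_Integration.integrable_bound[OF _ \<sigma>gm])
    show "integrable ?M (\<lambda>t. 3 * H_norm r \<Omega> (g t))" using gint by simp
    show "AE t in ?M. norm (H_norm r \<Omega> (\<sigma> k t - g t)) \<le> norm (3 * H_norm r \<Omega> (g t))"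
      using dom[of k] by (rule eventually_mono) simp
  qed
  define I where "I = (\<lambda>k. simple_integral a b (\<sigma> k))"
  have IH: "I k \<in> H_space r \<Omega>" for k unfolding I_def by (rule H.simple_integral_form(2)[OF \<sigma>s \<sigma>H subspace_0[OF sH]])
  have IB: "H_inner r \<Omega> (I k) z = (LINT t|?M. H_inner r \<Omega> (\<sigma> k t) z)" if "z \<in> H_space r \<Omega>" for k z
    unfolding I_def by (rule H.simple_integral_form(1)[OF \<sigma>s \<sigma>H that])
  have \<sigma>L: "\<sigma> k ` {a..b} \<subseteq> L2_space \<Omega>" for k using \<sigma>H[of k] H_space_L2 by blast
  have IB': "L2_inner \<Omega> (I k) z = (LINT t|?M. L2_inner \<Omega> (\<sigma> k t) z)" if "z \<in> L2_space \<Omega>" for k z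
    unfolding I_def by (rule L2.simple_integral_form(1)[OF \<sigma>s \<sigma>L that])
  have hint: "integrable ?M (\<lambda>t. h (\<sigma> k t))" for h :: "_ \<Rightarrow> real" and k by (rule simple_function_integrable(2)[OF \<sigma>s])
  \<comment> \<open>The difference \<open>z\<close> of the two integrals is tested with itself in
    the H^r product. Its squared norm becomes an integral of pairings, and Cauchy-Schwarz leaves one
    factor to divide by.\<close>
  have bd: "H_norm r \<Omega> (I k - I m) \<le> e k + e m" for k m
  proof -
    define z where "z = I k - I m"
    have z: "z \<in> H_space r \<Omega>" unfolding z_def by (rule subspace_diff[OF sH IH IH])
    have "(H_norm r \<Omega> z)\<^sup>2 = H_inner r \<Omega> (I k) z - H_inner r \<Omega> (I m) z"
      unfolding H_norm_eq H.seminrm_sq[OF z] using H.diff_left[OF IH IH z, of k m] by (simp only: z_def[symmetric])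
    also have "\<dots> = (LINT t|?M. H_inner r \<Omega> (\<sigma> k t) z - H_inner r \<Omega> (\<sigma> m t) z)"
      unfolding IB[OF z] using hint by (intro Bochner_Integration.integral_diff[symmetric])
    also have "\<dots> \<le> (LINT t|?M. (H_norm r \<Omega> (\<sigma> k t - g t) + H_norm r \<Omega> (\<sigma> m t - g t)) * H_norm r \<Omega> z)"
    proof (rule integral_mono_AE)
      show "integrable ?M (\<lambda>t. H_inner r \<Omega> (\<sigma> k t) z - H_inner r \<Omega> (\<sigma> m t) z)" using hint by (intro Bochner_Integration.integrable_diff)
      show "integrable ?M (\<lambda>t. (H_norm r \<Omega> (\<sigma> k t - g t) + H_norm r \<Omega> (\<sigma> m t - g t)) * H_norm r \<Omega> z)"
        by (intro integrable_mult_left Bochner_Integration.integrable_add \<sigma>gi)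
      show "AE t in ?M. H_inner r \<Omega> (\<sigma> k t) z - H_inner r \<Omega> (\<sigma> m t) z \<le> (H_norm r \<Omega> (\<sigma> k t - g t) + H_norm r \<Omega> (\<sigma> m t - g t)) * H_norm r \<Omega> z"
        using gH tI
      proof eventually_elim
        case (elim t)
        note \<sigma>t = \<sigma>H'[OF elim(2)]
        have "H_inner r \<Omega> (\<sigma> k t) z - H_inner r \<Omega> (\<sigma> m t) z = H_inner r \<Omega> (\<sigma> k t - \<sigma> m t) z"
          using H.diff_left[OF \<sigma>t \<sigma>t z] by simp
        also have "\<dots> \<le> H_norm r \<Omega> (\<sigma> k t - \<sigma> m t) * H_norm r \<Omega> z"
          using H.Cauchy_Schwarz[OF subspace_diff[OF sH \<sigma>t \<sigma>t] z, of k m] unfolding H_norm_eq by (rule order_trans[OF abs_ge_self])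
        also have "\<dots> \<le> (H_norm r \<Omega> (\<sigma> k t - g t) + H_norm r \<Omega> (\<sigma> m t - g t)) * H_norm r \<Omega> z"
        proof (rule mult_right_mono[OF _ N0[OF z]])
          have e1: "\<sigma> k t - \<sigma> m t = (\<sigma> k t - g t) - (\<sigma> m t - g t)" by simp
          show "H_norm r \<Omega> (\<sigma> k t - \<sigma> m t) \<le> H_norm r \<Omega> (\<sigma> k t - g t) + H_norm r \<Omega> (\<sigma> m t - g t)"
            by (subst e1) (intro tri subspace_diff[OF sH] \<sigma>t elim(1))
        qed
        finally show ?case .
      qed
    qed
    also have "\<dots> = (e k + e m) * H_norm r \<Omega> z" using \<sigma>gi by (simp add: e_def)
    finally have "H_norm r \<Omega> z * H_norm r \<Omega> z \<le> (e k + e m) * H_norm r \<Omega> z" by (simp add: power2_eq_square)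
    moreover have "0 \<le> e k + e m"
    proof -
      have "0 \<le> e j" for j unfolding e_def
      proof (rule integral_nonneg_AE)
        show "AE t in ?M. 0 \<le> H_norm r \<Omega> (\<sigma> j t - g t)"
          using gH tI by eventually_elim (intro N0 subspace_diff[OF sH] \<sigma>H')
      qed
      then show ?thesis by (simp add: add_nonneg_nonneg)
    qed
    ultimately have "H_norm r \<Omega> z \<le> e k + e m" using N0[OF z] by (cases "H_norm r \<Omega> z = 0") (auto simp: mult_le_cancel_right)
    then show ?thesis by (simp only: z_def)
  qed
  have "\<exists>N. \<forall>m\<ge>N. \<forall>n\<ge>N. H_norm r \<Omega> (I m - I n) < d" if "0 < d" for d
  proof -
    obtain N where N: "\<And>n. N \<le> n \<Longrightarrow> e n < d / 2"
      using order_tendstoD(2)[OF e0, of "d / 2"] \<open>0 < d\<close> unfolding eventually_sequentially by (meson half_gt_zero)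
    have "H_norm r \<Omega> (I m - I n) < d" if "N \<le> m" "N \<le> n" for m n
      using bd[of m n] N[OF that(1)] N[OF that(2)] by linarith
    then show ?thesis by blast
  qed
  then obtain w where w: "w \<in> H_space r \<Omega>" "(\<lambda>n. H_norm r \<Omega> (I n - w)) \<longlonglongrightarrow> 0"
    using H_complete[of I r] IH by blast
  have Iw: "I n - w \<in> H_space r \<Omega>" for n by (rule subspace_diff[OF sH IH w(1)])
  have "(\<lambda>n. seminrm (L2_inner \<Omega>) (I n - w)) \<longlonglongrightarrow> 0"
    by (rule tendsto_sandwich[OF _ _ tendsto_const w(2)])
      (intro always_eventually allI L2.seminrm_nonneg H_space_L2[OF Iw] L2_norm_le_H_norm Iw)+
  then have L1: "(\<lambda>n. L2_inner \<Omega> (I n) \<psi>) \<longlonglongrightarrow> L2_inner \<Omega> w \<psi>" if "\<psi> \<in> L2_space \<Omega>" for \<psi>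
    using that by (intro L2_inner_tendsto H_space_L2[OF IH] H_space_L2[OF w(1)])
  have L2: "(\<lambda>n. L2_inner \<Omega> (I n) \<psi>) \<longlonglongrightarrow> L2_inner \<Omega> u \<psi>" if \<psi>: "\<psi> \<in> L2_space \<Omega>" for \<psi>
    unfolding IB'[OF \<psi>] weak[OF \<psi>]
  proof (rule integral_dominated_convergence[where w = "\<lambda>t. 2 * H_norm r \<Omega> (g t) * seminrm (L2_inner \<Omega>) \<psi>"])
    show m: "(\<lambda>t. L2_inner \<Omega> (\<sigma> k t) \<psi>) \<in> borel_measurable ?M" for k by (rule borel_measurable_integrable[OF hint])
    show l: "AE t in ?M. (\<lambda>k. L2_inner \<Omega> (\<sigma> k t) \<psi>) \<longlonglongrightarrow> L2_inner \<Omega> (g t) \<psi>"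
      using \<sigma>lim gH tI
    proof eventually_elim
      case (elim t)
      note \<sigma>t = \<sigma>H'[OF elim(3)]
      have d: "\<sigma> k t - g t \<in> H_space r \<Omega>" for k by (rule subspace_diff[OF sH \<sigma>t elim(2)])
      have "(\<lambda>k. seminrm (L2_inner \<Omega>) (\<sigma> k t - g t)) \<longlonglongrightarrow> 0"
        by (rule tendsto_sandwich[OF _ _ tendsto_const elim(1)])
          (intro always_eventually allI L2.seminrm_nonneg H_space_L2[OF d] L2_norm_le_H_norm d)+
      then show ?case by (intro L2_inner_tendsto H_space_L2[OF \<sigma>t] H_space_L2[OF elim(2)] \<psi>)
    qed
    show "(\<lambda>t. L2_inner \<Omega> (g t) \<psi>) \<in> borel_measurable ?M" by (rule borel_measurable_AE_LIMSEQ[OF _ m l]) simp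
    show "integrable ?M (\<lambda>t. 2 * H_norm r \<Omega> (g t) * seminrm (L2_inner \<Omega>) \<psi>)" using gint by simp
    show "AE t in ?M. norm (L2_inner \<Omega> (\<sigma> k t) \<psi>) \<le> 2 * H_norm r \<Omega> (g t) * seminrm (L2_inner \<Omega>) \<psi>" for k
      using gH tI
    proof eventually_elim
      case (elim t)
      have "norm (L2_inner \<Omega> (\<sigma> k t) \<psi>) \<le> seminrm (L2_inner \<Omega>) (\<sigma> k t) * seminrm (L2_inner \<Omega>) \<psi>"
        using L2.Cauchy_Schwarz[OF H_space_L2[OF \<sigma>H'[OF elim(2)]] \<psi>] by simp
      also have "\<dots> \<le> 2 * H_norm r \<Omega> (g t) * seminrm (L2_inner \<Omega>) \<psi>"
        using L2_norm_le_H_norm[OF \<sigma>H'[OF elim(2)], of k] \<sigma>b[OF elim(1), of k]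
        by (intro mult_right_mono L2.seminrm_nonneg \<psi>) linarith
      finally show ?case .
    qed
  qed
  \<comment> \<open>The H^r limit \<open>w\<close> and the weak integral \<open>u\<close> have the
    same products with all L^2 functions. Taking \<open>w - u\<close> itself shows that they agree
    almost everywhere.\<close>
  have wL: "w \<in> L2_space \<Omega>" by (rule H_space_L2[OF w(1)])
  have dL: "w - u \<in> L2_space \<Omega>" by (rule subspace_diff[OF L2.sub wL u])
  have "L2_inner \<Omega> (w - u) (w - u) = L2_inner \<Omega> w (w - u) - L2_inner \<Omega> u (w - u)" by (rule L2.diff_left[OF wL u dL])
  also have "\<dots> = 0" using LIMSEQ_unique[OF L1[OF dL] L2[OF dL]] by simp
  finally have "AE x in lebesgue_on \<Omega>. (w - u) x = 0" by (rule L2_norm_zero_imp_AE[OF dL])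
  then have wu: "AE x in lebesgue_on \<Omega>. w x = u x" by (rule eventually_mono) simp
  show "u \<in> H_space r \<Omega>" by (rule H_space_AE[OF w(1) wu])
  have "H_norm r \<Omega> (I n) \<le> (LINT t|?M. H_norm r \<Omega> (g t)) + e n" for n
  proof -
    have "(H_norm r \<Omega> (I n))\<^sup>2 = (LINT t|?M. H_inner r \<Omega> (\<sigma> n t) (I n))"
      unfolding H_norm_eq H.seminrm_sq[OF IH] by (rule IB[OF IH])
    also have "\<dots> \<le> (LINT t|?M. (H_norm r \<Omega> (g t) + H_norm r \<Omega> (\<sigma> n t - g t)) * H_norm r \<Omega> (I n))"
    proof (rule integral_mono_AE[OF hint])
      show "integrable ?M (\<lambda>t. (H_norm r \<Omega> (g t) + H_norm r \<Omega> (\<sigma> n t - g t)) * H_norm r \<Omega> (I n))"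
        by (intro integrable_mult_left Bochner_Integration.integrable_add \<sigma>gi gint)
      show "AE t in ?M. H_inner r \<Omega> (\<sigma> n t) (I n) \<le> (H_norm r \<Omega> (g t) + H_norm r \<Omega> (\<sigma> n t - g t)) * H_norm r \<Omega> (I n)"
        using gH tI
      proof eventually_elim
        case (elim t)
        note \<sigma>t = \<sigma>H'[OF elim(2)]
        have "H_inner r \<Omega> (\<sigma> n t) (I n) \<le> H_norm r \<Omega> (\<sigma> n t) * H_norm r \<Omega> (I n)"
          using H.Cauchy_Schwarz[OF \<sigma>t IH] unfolding H_norm_eq by (rule order_trans[OF abs_ge_self])
        also have "\<dots> \<le> (H_norm r \<Omega> (g t) + H_norm r \<Omega> (\<sigma> n t - g t)) * H_norm r \<Omega> (I n)"
        proof (rule mult_right_mono[OF _ N0[OF IH]])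
          have e1: "\<sigma> n t = g t + (\<sigma> n t - g t)" by simp
          show "H_norm r \<Omega> (\<sigma> n t) \<le> H_norm r \<Omega> (g t) + H_norm r \<Omega> (\<sigma> n t - g t)"
            unfolding H_norm_eq by (subst e1) (intro H.triangle subspace_diff[OF sH] \<sigma>t elim(1))
        qed
        finally show ?case .
      qed
    qed
    also have "\<dots> = ((LINT t|?M. H_norm r \<Omega> (g t)) + e n) * H_norm r \<Omega> (I n)" using gint \<sigma>gi by (simp add: e_def)
    finally have "H_norm r \<Omega> (I n) * H_norm r \<Omega> (I n) \<le> ((LINT t|?M. H_norm r \<Omega> (g t)) + e n) * H_norm r \<Omega> (I n)"
      by (simp add: power2_eq_square)
    moreover have "0 \<le> (LINT t|?M. H_norm r \<Omega> (g t)) + e n"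
      unfolding e_def
    proof (intro add_nonneg_nonneg integral_nonneg_AE)
      show "AE t in ?M. 0 \<le> H_norm r \<Omega> (g t)" using gH by eventually_elim (rule N0)
      show "AE t in ?M. 0 \<le> H_norm r \<Omega> (\<sigma> n t - g t)"
        using gH tI by eventually_elim (intro N0 subspace_diff[OF sH] \<sigma>H')
    qed
    ultimately show ?thesis using N0[OF IH, of n] by (cases "H_norm r \<Omega> (I n) = 0") (auto simp: mult_le_cancel_right)
  qed
  then have le: "H_norm r \<Omega> w \<le> (LINT t|?M. H_norm r \<Omega> (g t)) + e n + H_norm r \<Omega> (I n - w)" for n
  proof -
    have e1: "w = I n - (I n - w)" by simp
    have "H_norm r \<Omega> w \<le> H_norm r \<Omega> (I n) + H_norm r \<Omega> (I n - w)"
      by (subst e1) (rule tri[OF IH Iw])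
    then show ?thesis using \<open>\<And>n. H_norm r \<Omega> (I n) \<le> _\<close>[of n] by linarith
  qed
  have "(\<lambda>n. (LINT t|?M. H_norm r \<Omega> (g t)) + e n + H_norm r \<Omega> (I n - w)) \<longlonglongrightarrow> (LINT t|?M. H_norm r \<Omega> (g t)) + 0 + 0"
    by (intro tendsto_intros e0 w(2))
  then have "H_norm r \<Omega> w \<le> (LINT t|?M. H_norm r \<Omega> (g t)) + 0 + 0"
    by (rule LIMSEQ_le_const) (use le in blast)
  then show "H_norm r \<Omega> u \<le> (LINT t|?M. H_norm r \<Omega> (g t))" using H_norm_AE[OF w(1) wu] by simp
qed

end

section \<open>Regularity of the solution curve and consistency\<close>

lemma lebesgue_integral_interval_combine:
  fixes f :: "real \<Rightarrow> real"
  assumes "integrable (lebesgue_on {a..c}) f" "a \<le> b" "b \<le> c"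
  shows "(LINT x|lebesgue_on {a..c}. f x) = (LINT x|lebesgue_on {a..b}. f x) + (LINT x|lebesgue_on {b..c}. f x)"
proof -
  have i: "integrable (lebesgue_on {a..b}) f" "integrable (lebesgue_on {b..c}) f"
    using integrable_subinterval[OF assms(1), of a b] integrable_subinterval[OF assms(1), of b c] assms(2,3) by auto
  have "f integrable_on {a..c}" using assms(1) by (simp add: integrable_on_lebesgue_on)
  then have "integral {a..b} f + integral {b..c} f = integral {a..c} f"
    by (rule Henstock_Kurzweil_Integration.integral_combine[OF assms(2,3)])
  then show ?thesis using i assms by (simp add: lebesgue_integral_eq_integral)
qed

text \<open>Increments are bounded by those of a primitive, which is continuous. Applied to elastic
  forms of \<open>v t\<close> with a fixed second argument.\<close>

lemma continuous_on_increment_bound: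
  fixes f :: "real \<Rightarrow> real"
  assumes q: "integrable (lebesgue_on {0..T}) q"
    and f: "\<And>s t. 0 \<le> s \<Longrightarrow> s \<le> t \<Longrightarrow> t \<le> T \<Longrightarrow> \<bar>f t - f s\<bar> \<le> C * (LINT x|lebesgue_on {s..t}. q x)"
  shows "continuous_on {0..T} f"
proof -
  define P where "P = (\<lambda>t. LINT x|lebesgue_on {0..t}. q x)"
  have Pc: "continuous_on {0..T} P" unfolding P_def by (rule indefinite_integral_continuous_real[OF q])
  have Pd: "(LINT x|lebesgue_on {s..t}. q x) = P t - P s" if "0 \<le> s" "s \<le> t" "t \<le> T" for s t
    unfolding P_def using lebesgue_integral_interval_combine[of 0 t q s] integrable_subinterval[OF q, of 0 t] that by auto
  have bnd: "\<bar>f t - f s\<bar> \<le> \<bar>C * (P t - P s)\<bar>" if "s \<in> {0..T}" "t \<in> {0..T}" for s t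
  proof (cases "s \<le> t")
    case True
    then show ?thesis using f[of s t] Pd[of s t] that by (simp add: order_trans[OF _ abs_ge_self])
  next
    case False
    then have "\<bar>f s - f t\<bar> \<le> C * (P s - P t)" using f[of t s] Pd[of t s] that by simp
    then show ?thesis by (simp add: abs_mult abs_minus_commute order_trans[OF _ abs_ge_self] flip: abs_mult)
      (metis abs_ge_self abs_minus_commute abs_mult order_trans)
  qed
  show ?thesis unfolding continuous_on_def
  proof (intro ballI)
    fix s assume s: "s \<in> {0..T}"
    have "((\<lambda>t. \<bar>C * (P t - P s)\<bar>) \<longlongrightarrow> \<bar>C * (P s - P s)\<bar>) (at s within {0..T})"
      using Pc s by (intro tendsto_intros) (auto simp: continuous_on_def)
    then have "((\<lambda>t. \<bar>C * (P t - P s)\<bar>) \<longlongrightarrow> 0) (at s within {0..T})" by simp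
    then have "((\<lambda>t. f t - f s) \<longlongrightarrow> 0) (at s within {0..T})"
      by (rule Lim_null_comparison[rotated])
        (use bnd[OF s] in \<open>auto simp: eventually_at_filter intro!: always_eventually\<close>)
    then show "(f \<longlongrightarrow> f s) (at s within {0..T})" by (rule LIM_zero_cancel)
  qed
qed

text \<open>After the substitution r = t - s the kernel no longer moves with \<open>t\<close>, so it
  only has to be measurable and bounded; the continuous factor and the interval move, and dominated
  convergence applies. The points r = 0 and r = t are excluded as null sets.\<close>

lemma convolution_continuous:
  fixes \<beta> f :: "real \<Rightarrow> real"
  assumes \<beta>[measurable]: "\<beta> \<in> borel_measurable borel" and B: "\<And>r. 0 < r \<Longrightarrow> r \<le> T \<Longrightarrow> \<bar>\<beta> r\<bar> \<le> B"
    and f: "continuous_on {0..T} f"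
  shows "continuous_on {0..T} (\<lambda>t. LINT s|lebesgue_on {0..t}. \<beta> (t - s) * f s)"
proof (cases "0 \<le> T")
  case False
  then show ?thesis by simp
next
  case T: True
  \<comment> \<open>The constant extension of \<open>f\<close> beyond [0,T], so that the shifted
    values \<open>F (t - r)\<close> are defined and continuous for all \<open>r\<close>.\<close>
  define F where "F = (\<lambda>x. f (max 0 (min T x)))"
  have Fc: "continuous_on UNIV F"
    unfolding F_def using T by (intro continuous_on_compose2[OF f]) (auto intro!: continuous_intros)
  note [measurable] = borel_measurable_continuous_onI[OF Fc]
  have FI: "isCont F x" for x using Fc by (simp add: continuous_on_eq_continuous_at)
  have "bounded (f ` {0..T})" by (intro compact_imp_bounded compact_continuous_image f) auto
  then obtain Bf where Bf: "0 < Bf" "\<And>x. x \<in> {0..T} \<Longrightarrow> \<bar>f x\<bar> \<le> Bf" by (auto simp: bounded_pos)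
  have FB: "\<bar>F x\<bar> \<le> Bf" for x unfolding F_def using T by (intro Bf) auto
  have eq: "(LINT s|lebesgue_on {0..t}. \<beta> (t - s) * f s) = (LINT r|lborel. indicator {0..t} r * (\<beta> r * F (t - r)))"
    if t: "t \<in> {0..T}" for t
  proof -
    have "(LINT s|lebesgue_on {0..t}. \<beta> (t - s) * f s) = (LINT s|lebesgue. indicator {0..t} s *\<^sub>R (\<beta> (t - s) * f s))"
      by (simp add: integral_restrict_space)
    also have "\<dots> = (LINT s|lebesgue. indicator {0..t} s * (\<beta> (t - s) * F s))"
      using t by (intro Bochner_Integration.integral_cong) (auto simp: indicator_def F_def)
    also have "\<dots> = (LINT s|lborel. indicator {0..t} s * (\<beta> (t - s) * F s))"
      by (rule integral_completion) measurable
    also have "\<dots> = \<bar>-1\<bar> *\<^sub>R (LINT r|lborel. indicator {0..t} (t + (-1) * r) * (\<beta> (t - (t + (-1) * r)) * F (t + (-1) * r)))"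
      by (rule lborel_integral_real_affine) simp
    also have "\<dots> = (LINT r|lborel. indicator {0..t} r * (\<beta> r * F (t - r)))"
      by (simp, intro Bochner_Integration.integral_cong) (auto simp: indicator_def)
    finally show ?thesis .
  qed
  show ?thesis unfolding continuous_on_sequentially
  proof (intro allI ballI impI)
    fix x t assume t: "t \<in> {0..T}" and x: "(\<forall>n. x n \<in> {0..T}) \<and> x \<longlonglongrightarrow> t"
    have "(\<lambda>n. LINT r|lborel. indicator {0..x n} r * (\<beta> r * F (x n - r))) \<longlonglongrightarrow> (LINT r|lborel. indicator {0..t} r * (\<beta> r * F (t - r)))"
    proof (rule integral_dominated_convergence[where w = "\<lambda>r. indicator {0..T} r *\<^sub>R (B * Bf)"])
      show "integrable lborel (\<lambda>r. indicator {0..T} r *\<^sub>R (B * Bf))" by (intro borel_integrable_compact) auto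
      have ne: "AE r in lborel. r \<noteq> 0" "AE r in lborel. r \<noteq> t" using AE_lborel_singleton by auto
      show "AE r in lborel. (\<lambda>n. indicator {0..x n} r * (\<beta> r * F (x n - r))) \<longlonglongrightarrow> indicator {0..t} r * (\<beta> r * F (t - r))"
        using ne(2)
      proof (rule eventually_mono)
        fix r assume r: "r \<noteq> t"
        have "(\<lambda>n. indicator {0..x n} r) \<longlonglongrightarrow> (indicator {0..t} r :: real)"
        proof (rule tendsto_eventually)
          show "\<forall>\<^sub>F n in sequentially. indicator {0..x n} r = (indicator {0..t} r :: real)"
          proof (cases "r < t")
            case True
            then have "\<forall>\<^sub>F n in sequentially. r < x n" using x order_tendstoD(1) by blast
            then show ?thesis by (rule eventually_mono) (use True in \<open>auto simp: indicator_def\<close>)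
          next
            case False
            then have "\<forall>\<^sub>F n in sequentially. x n < r" using x r order_tendstoD(2)[of x t sequentially r] by auto
            then show ?thesis by (rule eventually_mono) (use False r in \<open>auto simp: indicator_def\<close>)
          qed
        qed
        moreover have "(\<lambda>n. F (x n - r)) \<longlonglongrightarrow> F (t - r)"
          using x by (intro isCont_tendsto_compose[OF FI] tendsto_intros) auto
        ultimately show "(\<lambda>n. indicator {0..x n} r * (\<beta> r * F (x n - r))) \<longlonglongrightarrow> indicator {0..t} r * (\<beta> r * F (t - r))"
          by (intro tendsto_intros)
      qed
      show "AE r in lborel. norm (indicator {0..x n} r * (\<beta> r * F (x n - r))) \<le> indicator {0..T} r *\<^sub>R (B * Bf)" for n
        using ne(1)
      proof (rule eventually_mono)
        fix r :: real assume "r \<noteq> 0"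
        then show "norm (indicator {0..x n} r * (\<beta> r * F (x n - r))) \<le> indicator {0..T} r *\<^sub>R (B * Bf)"
          using x[THEN conjunct1, rule_format, of n] B[of r] FB[of "x n - r"]
          by (auto simp: indicator_def abs_mult intro!: mult_mono)
      qed
    qed measurable
    then show "((\<lambda>t. LINT s|lebesgue_on {0..t}. \<beta> (t - s) * f s) \<circ> x) \<longlonglongrightarrow> (LINT s|lebesgue_on {0..t}. \<beta> (t - s) * f s)"
      using x t by (simp add: eq o_def)
  qed
qed

text \<open>On each cell the error splits into the kernel error \<beta> - \<kappa> against
  \<open>f\<close>, and \<kappa> against the change of \<open>f\<close> since the left end point.
  Freezing \<open>f\<close> at the left end leaves exactly the cell integrals \<open>g\<close> of
  \<kappa>.\<close>

lemma memory_quadrature_error: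
  fixes \<beta> \<kappa> f :: "real \<Rightarrow> real"
  assumes \<Delta>: "0 < \<Delta>" and \<beta>[measurable]: "\<beta> \<in> borel_measurable borel"
    and \<delta>: "\<And>r. 0 < r \<Longrightarrow> r \<le> real n * \<Delta> \<Longrightarrow> \<bar>\<beta> r - \<kappa> r\<bar> \<le> \<delta>" "0 \<le> \<delta>"
    and \<kappa>: "continuous_on UNIV \<kappa>" "\<And>r. 0 \<le> r \<Longrightarrow> r \<le> real n * \<Delta> \<Longrightarrow> \<bar>\<kappa> r\<bar> \<le> G"
    and f: "continuous_on {0..real n * \<Delta>} f" "\<And>s. s \<in> {0..real n * \<Delta>} \<Longrightarrow> \<bar>f s\<bar> \<le> Fm"
    and \<omega>: "\<And>k s. k < n \<Longrightarrow> s \<in> {real k * \<Delta>..real (Suc k) * \<Delta>} \<Longrightarrow> \<bar>f s - f (real k * \<Delta>)\<bar> \<le> \<omega> k"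
    and g: "\<And>k. k < n \<Longrightarrow> ((\<lambda>s. \<kappa> (real n * \<Delta> - s)) has_integral g (n - k)) {real k * \<Delta>..real (Suc k) * \<Delta>}"
  shows "\<bar>(LINT s|lebesgue_on {0..real n * \<Delta>}. \<beta> (real n * \<Delta> - s) * f s) - (\<Sum>k<n. g (n - k) * f (real k * \<Delta>))\<bar>
     \<le> real n * \<Delta> * \<delta> * Fm + G * \<Delta> * (\<Sum>k<n. \<omega> k)"
proof -
  define t where "t = real n * \<Delta>"
  \<comment> \<open>Closeness to \<kappa> is assumed for positive arguments only. Redefining the
    kernel at 0 makes it hold everywhere and changes the integrand at the single point s =
    t.\<close>
  define \<beta>' where "\<beta>' = (\<lambda>r. if r = 0 then \<kappa> 0 else \<beta> r)"
  note [measurable] = borel_measurable_continuous_onI[OF \<kappa>(1)]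
  have \<beta>'m[measurable]: "\<beta>' \<in> borel_measurable borel" unfolding \<beta>'_def by measurable
  have \<beta>'d: "\<bar>\<beta>' r - \<kappa> r\<bar> \<le> \<delta>" if "0 \<le> r" "r \<le> t" for r using \<delta> that by (auto simp: \<beta>'_def t_def)
  define F where "F = (\<lambda>x. f (max 0 (min t x)))"
  have t0: "0 \<le> t" using \<Delta> by (simp add: t_def)
  have Fc: "continuous_on UNIV F"
    unfolding F_def using t0 f(1) by (intro continuous_on_compose2[OF f(1)]) (auto intro!: continuous_intros simp: t_def)
  note [measurable] = borel_measurable_continuous_onI[OF Fc]
  have Ff: "F s = f s" if "0 \<le> s" "s \<le> t" for s using that by (simp add: F_def)
  have G0: "0 \<le> G" using \<kappa>(2)[of 0] t0 abs_ge_zero[of "\<kappa> 0"] by (simp add: t_def)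
  define h where "h = (\<lambda>s. \<beta>' (t - s) * F s)"
  have hm: "h \<in> borel_measurable (lebesgue_on S)" for S
  proof -
    have "h \<in> borel_measurable borel" unfolding h_def by measurable
    then have "h \<in> borel_measurable lebesgue" by (simp add: measurable_completion)
    then show ?thesis by (rule measurable_restrict_space1)
  qed
  have hb: "\<bar>h s\<bar> \<le> (\<delta> + G) * Fm" if "s \<in> {0..t}" for s
  proof -
    have "\<bar>\<beta>' (t - s)\<bar> \<le> \<delta> + G" using \<beta>'d[of "t - s"] \<kappa>(2)[of "t - s"] that by (auto simp: t_def)
    moreover have "\<bar>F s\<bar> \<le> Fm" using f(2)[of s] Ff[of s] that by (simp add: t_def)
    ultimately show ?thesis using \<delta>(2) G0 by (auto simp: h_def abs_mult intro!: mult_mono)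
  qed
  have hi: "integrable (lebesgue_on {0..t}) h"
  proof -
    interpret finite_measure "lebesgue_on {0..t}" by (rule finite_measure_interval)
    have "AE s in lebesgue_on {0..t}. s \<in> {0..t}" by (simp add: AE_restrict_space_iff)
    then have "AE s in lebesgue_on {0..t}. norm (h s) \<le> (\<delta> + G) * Fm" by (rule eventually_mono) (use hb in simp)
    then show ?thesis by (intro integrable_const_bound hm)
  qed
  have "(LINT s|lebesgue_on {0..t}. \<beta> (t - s) * f s) = (LINT s|lebesgue_on {0..t}. h s)"
  proof (rule integral_cong_AE[OF _ hm])
    have "AE s in lebesgue. s \<noteq> t" using AE_lborel_singleton[of t] by (rule AE_completion)
    then have "AE s in lebesgue_on {0..t}. s \<noteq> t" by (auto simp: AE_restrict_space_iff elim: eventually_mono)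
    moreover have "AE s in lebesgue_on {0..t}. s \<in> {0..t}" by (simp add: AE_restrict_space_iff)
    ultimately show ae: "AE s in lebesgue_on {0..t}. \<beta> (t - s) * f s = h s"
      by eventually_elim (auto simp: h_def \<beta>'_def Ff)
    have ae': "AE s in lebesgue_on {0..t}. h s = \<beta> (t - s) * f s" using ae by (rule eventually_mono) simp
    show "(\<lambda>s. \<beta> (t - s) * f s) \<in> borel_measurable (lebesgue_on {0..t})"
      by (rule borel_measurable_lebesgue_on_AE[OF _ hm ae']) simp
  qed
  also have "\<dots> = integral {0..t} h" using hi by (simp add: lebesgue_integral_eq_integral)
  also have "integral {0..t} h = (\<Sum>k<n. integral {real k * \<Delta>..real (Suc k) * \<Delta>} h)"
  proof -
    have hio: "h integrable_on {0..t}" using hi by (simp add: integrable_on_lebesgue_on)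
    have "m \<le> n \<Longrightarrow> integral {0..real m * \<Delta>} h = (\<Sum>k<m. integral {real k * \<Delta>..real (Suc k) * \<Delta>} h)" for m
    proof (induction m)
      case (Suc m)
      have "real (Suc m) * \<Delta> \<le> t" unfolding t_def using Suc.prems \<Delta> by (intro mult_right_mono) auto
      then have "h integrable_on {0..real (Suc m) * \<Delta>}" by (intro integrable_on_subinterval[OF hio]) auto
      then have "integral {0..real m * \<Delta>} h + integral {real m * \<Delta>..real (Suc m) * \<Delta>} h = integral {0..real (Suc m) * \<Delta>} h"
        using \<Delta> by (intro Henstock_Kurzweil_Integration.integral_combine) (auto simp: mult_right_mono)
      then show ?case using Suc by simp
    qed simp
    then show ?thesis by (simp add: t_def)
  qed
  finally have main: "(LINT s|lebesgue_on {0..t}. \<beta> (t - s) * f s) - (\<Sum>k<n. g (n - k) * f (real k * \<Delta>)) =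
      (\<Sum>k<n. integral {real k * \<Delta>..real (Suc k) * \<Delta>} h - g (n - k) * f (real k * \<Delta>))"
    by (simp add: sum_subtractf)
  have piece: "\<bar>integral {real k * \<Delta>..real (Suc k) * \<Delta>} h - g (n - k) * f (real k * \<Delta>)\<bar> \<le> \<Delta> * (\<delta> * Fm + G * \<omega> k)" if k: "k < n" for k
  proof -
    let ?I = "{real k * \<Delta>..real (Suc k) * \<Delta>}"
    have "real (Suc k) * \<Delta> \<le> t" unfolding t_def using k \<Delta> by (intro mult_right_mono) auto
    moreover have "0 \<le> real k * \<Delta>" using \<Delta> by simp
    ultimately have sub: "?I \<subseteq> {0..t}" by auto
    have hio: "h integrable_on ?I"
      using integrable_on_subinterval[of h "{0..t}"] hi sub by (auto simp: integrable_on_lebesgue_on)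
    have kf: "((\<lambda>s. \<kappa> (t - s) * f (real k * \<Delta>)) has_integral g (n - k) * f (real k * \<Delta>)) ?I"
      using g[OF k] unfolding t_def by (rule has_integral_mult_left)
    have "integral ?I h - g (n - k) * f (real k * \<Delta>) = integral ?I (\<lambda>s. h s - \<kappa> (t - s) * f (real k * \<Delta>))"
      by (simp only: Henstock_Kurzweil_Integration.integral_diff[OF hio has_integral_integrable[OF kf]] integral_unique[OF kf])
    moreover have "norm (integral ?I (\<lambda>s. h s - \<kappa> (t - s) * f (real k * \<Delta>))) \<le> integral ?I (\<lambda>s. \<delta> * Fm + G * \<omega> k)"
    proof (rule integral_norm_bound_integral)
      show "(\<lambda>s. h s - \<kappa> (t - s) * f (real k * \<Delta>)) integrable_on ?I"
        using hio g[OF k] unfolding t_def by (intro integrable_diff has_integral_integrable[OF has_integral_mult_left]) auto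
      fix s assume s: "s \<in> ?I"
      then have st: "0 \<le> s" "s \<le> t" using sub by auto
      have "h s - \<kappa> (t - s) * f (real k * \<Delta>) = (\<beta>' (t - s) - \<kappa> (t - s)) * f s + \<kappa> (t - s) * (f s - f (real k * \<Delta>))"
        using Ff[OF st] by (simp add: h_def algebra_simps)
      also have "\<bar>\<dots>\<bar> \<le> \<bar>\<beta>' (t - s) - \<kappa> (t - s)\<bar> * \<bar>f s\<bar> + \<bar>\<kappa> (t - s)\<bar> * \<bar>f s - f (real k * \<Delta>)\<bar>"
        using abs_triangle_ineq by (simp flip: abs_mult)
      also have "\<dots> \<le> \<delta> * Fm + G * \<omega> k"
        using \<beta>'d[of "t - s"] f(2)[of s] \<kappa>(2)[of "t - s"] \<omega>[OF k s] st \<delta>(2) G0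
        by (intro add_mono mult_mono) (auto simp: t_def)
      finally show "norm (h s - \<kappa> (t - s) * f (real k * \<Delta>)) \<le> \<delta> * Fm + G * \<omega> k" by simp
    qed auto
    moreover have "integral ?I (\<lambda>s. \<delta> * Fm + G * \<omega> k) = \<Delta> * (\<delta> * Fm + G * \<omega> k)"
      using \<Delta> by (simp add: algebra_simps)
    ultimately show ?thesis by (simp only: real_norm_def)
  qed
  have "\<bar>(LINT s|lebesgue_on {0..t}. \<beta> (t - s) * f s) - (\<Sum>k<n. g (n - k) * f (real k * \<Delta>))\<bar> \<le> (\<Sum>k<n. \<Delta> * (\<delta> * Fm + G * \<omega> k))"
    unfolding main by (intro order_trans[OF sum_abs] sum_mono piece) auto
  also have "\<dots> = real n * \<Delta> * \<delta> * Fm + G * \<Delta> * (\<Sum>k<n. \<omega> k)"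
    by (simp add: sum.distrib distrib_left sum_distrib_left mult_ac)
  finally show ?thesis by (simp add: t_def)
qed

section \<open>Increments of the solution curve and consistency of the scheme\<close>

context bounded_open_set
begin

lemma continuous_L2_curve_inner:
  assumes v: "continuous_L2_curve \<Omega> T v" and \<psi>: "\<psi> \<in> L2_space \<Omega>"
  shows "continuous_on {0..T} (\<lambda>t. L2_inner \<Omega> (v t) \<psi>)"
  unfolding continuous_on_def
proof
  interpret L2: semi_inner "L2_space \<Omega> :: (real ^ 'd \<Rightarrow> real ^ 'd) set" "L2_inner \<Omega>" by (rule L2_semi_inner)
  fix t assume t: "t \<in> {0..T}"
  have vL: "v s \<in> L2_space \<Omega>" if "s \<in> {0..T}" for s using v that by (simp add: continuous_L2_curve_def)
  have e: "(\<lambda>x. v s x - v t x) = v s - v t" for s by (auto simp: fun_eq_iff)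
  have "((\<lambda>s. H_norm 0 \<Omega> (\<lambda>x. v s x - v t x)) \<longlongrightarrow> 0) (at t within {0..T})"
    using v t unfolding continuous_L2_curve_def by blast
  then have "((\<lambda>s. H_norm 0 \<Omega> (v s - v t)) \<longlongrightarrow> 0) (at t within {0..T})" unfolding e .
  then have "((\<lambda>s. H_norm 0 \<Omega> (v s - v t) * seminrm (L2_inner \<Omega>) \<psi>) \<longlongrightarrow> 0) (at t within {0..T})"
    by (rule tendsto_mult_left_zero)
  moreover have "eventually (\<lambda>s. norm (L2_inner \<Omega> (v s) \<psi> - L2_inner \<Omega> (v t) \<psi>) \<le> H_norm 0 \<Omega> (v s - v t) * seminrm (L2_inner \<Omega>) \<psi>) (at t within {0..T})"
    unfolding eventually_at_filter
  proof (intro always_eventually allI impI)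
    fix s assume "s \<in> {0..T}"
    then show "norm (L2_inner \<Omega> (v s) \<psi> - L2_inner \<Omega> (v t) \<psi>) \<le> H_norm 0 \<Omega> (v s - v t) * seminrm (L2_inner \<Omega>) \<psi>"
      using L2.Cauchy_Schwarz[OF subspace_diff[OF L2.sub vL vL[OF t]] \<psi>, of s] L2.diff_left[OF vL vL[OF t] \<psi>, of s]
      by (simp add: H_norm_0_eq)
  qed
  ultimately have "((\<lambda>s. L2_inner \<Omega> (v s) \<psi> - L2_inner \<Omega> (v t) \<psi>) \<longlongrightarrow> 0) (at t within {0..T})"
    by (rule Lim_null_comparison[rotated])
  then show "((\<lambda>s. L2_inner \<Omega> (v s) \<psi>) \<longlongrightarrow> L2_inner \<Omega> (v t) \<psi>) (at t within {0..T})" by (rule LIM_zero_cancel)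
qed

lemma L1_curve_inner_integrable:
  assumes g: "L1_curve r \<Omega> X T g" and X: "X \<subseteq> H_space r \<Omega>" and \<psi>: "\<psi> \<in> L2_space \<Omega>"
  shows "integrable (lebesgue_on {0..T}) (\<lambda>t. L2_inner \<Omega> (g t) \<psi>)"
    "AE t in lebesgue_on {0..T}. \<bar>L2_inner \<Omega> (g t) \<psi>\<bar> \<le> H_norm r \<Omega> (g t) * seminrm (L2_inner \<Omega>) \<psi>"
proof -
  interpret L2: semi_inner "L2_space \<Omega> :: (real ^ 'd \<Rightarrow> real ^ 'd) set" "L2_inner \<Omega>" by (rule L2_semi_inner)
  have gX: "AE t in lebesgue_on {0..T}. g t \<in> X" and sm: "strongly_measurable_curve r \<Omega> X T g"
    and gi: "integrable (lebesgue_on {0..T}) (\<lambda>t. H_norm r \<Omega> (g t))"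
    using g by (auto simp: L1_curve_def strongly_measurable_curve_def)
  show b: "AE t in lebesgue_on {0..T}. \<bar>L2_inner \<Omega> (g t) \<psi>\<bar> \<le> H_norm r \<Omega> (g t) * seminrm (L2_inner \<Omega>) \<psi>"
    using gX
  proof (rule eventually_mono)
    fix t assume "g t \<in> X"
    then have gH: "g t \<in> H_space r \<Omega>" using X by auto
    have "\<bar>L2_inner \<Omega> (g t) \<psi>\<bar> \<le> seminrm (L2_inner \<Omega>) (g t) * seminrm (L2_inner \<Omega>) \<psi>"
      by (rule L2.Cauchy_Schwarz[OF H_space_L2[OF gH] \<psi>])
    also have "\<dots> \<le> H_norm r \<Omega> (g t) * seminrm (L2_inner \<Omega>) \<psi>"
      by (intro mult_right_mono L2_norm_le_H_norm gH L2.seminrm_nonneg \<psi>)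
    finally show "\<bar>L2_inner \<Omega> (g t) \<psi>\<bar> \<le> H_norm r \<Omega> (g t) * seminrm (L2_inner \<Omega>) \<psi>" .
  qed
  show "integrable (lebesgue_on {0..T}) (\<lambda>t. L2_inner \<Omega> (g t) \<psi>)"
  proof (rule Bochner_Integration.integrable_bound)
    show "integrable (lebesgue_on {0..T}) (\<lambda>t. H_norm r \<Omega> (g t) * seminrm (L2_inner \<Omega>) \<psi>)" using gi by (rule integrable_mult_left)
    show "(\<lambda>t. L2_inner \<Omega> (g t) \<psi>) \<in> borel_measurable (lebesgue_on {0..T})" by (rule strongly_measurable_inner(1)[OF sm X \<psi>])
    show "AE t in lebesgue_on {0..T}. norm (L2_inner \<Omega> (g t) \<psi>) \<le> norm (H_norm r \<Omega> (g t) * seminrm (L2_inner \<Omega>) \<psi>)"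
      using b by (rule eventually_mono) simp
  qed
qed

lemma AE_lebesgue_on_subset:
  fixes P :: "real \<Rightarrow> bool"
  assumes "AE t in lebesgue_on {0..T}. P t" "{a..b} \<subseteq> {0..T}" shows "AE t in lebesgue_on {a..b}. P t"
  using assms by (auto simp: AE_restrict_space_iff elim!: eventually_mono)

text \<open>Each pairing of \<open>v t - v s\<close> is an integral of pairings of \<open>g\<close>,
  so the increment is the weak integral of the derivative; completeness then lifts it to the space
  in which the derivative is integrable. With \<open>g = vt\<close> and \<open>r = 2\<close> it
  yields the H^2 bounds of increments.\<close>

lemma curve_increment:
  assumes T: "0 < T" and v: "continuous_L2_curve \<Omega> T v" and D: "has_weak_time_derivative \<Omega> T v g"
    and g: "L1_curve r \<Omega> X T g" and X: "X \<subseteq> H_space r \<Omega>" and st: "0 \<le> s" "s \<le> t" "t \<le> T"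
  shows "\<psi> \<in> L2_space \<Omega> \<Longrightarrow> L2_inner \<Omega> (v t - v s) \<psi> = (LINT x|lebesgue_on {s..t}. L2_inner \<Omega> (g x) \<psi>)"
    "v t - v s \<in> H_space r \<Omega>"
    "H_norm r \<Omega> (v t - v s) \<le> (LINT x|lebesgue_on {s..t}. H_norm r \<Omega> (g x))"
proof -
  interpret L2: semi_inner "L2_space \<Omega> :: (real ^ 'd \<Rightarrow> real ^ 'd) set" "L2_inner \<Omega>" by (rule L2_semi_inner)
  have vL: "v x \<in> L2_space \<Omega>" if "x \<in> {0..T}" for x using v that by (simp add: continuous_L2_curve_def)
  have vAE: "AE x in lebesgue_on {0..T}. v x \<in> L2_space \<Omega>"
    using vL by (simp add: AE_restrict_space_iff)
  have sm: "strongly_measurable_curve r \<Omega> X T g" and gi: "integrable (lebesgue_on {0..T}) (\<lambda>t. H_norm r \<Omega> (g t))"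
    using g by (auto simp: L1_curve_def)
  have sub: "{s..t} \<subseteq> {0..T}" using st by auto
  show weak: "L2_inner \<Omega> (v t - v s) \<psi> = (LINT x|lebesgue_on {s..t}. L2_inner \<Omega> (g x) \<psi>)" if \<psi>: "\<psi> \<in> L2_space \<Omega>" for \<psi>
  proof -
    note c = continuous_L2_curve_inner[OF v \<psi>]
    have pi: "integrable (lebesgue_on {0..T}) (\<lambda>t. L2_inner \<Omega> (v t) \<psi>)" by (rule continuous_imp_integrable_real[OF c])
    note qi = L1_curve_inner_integrable(1)[OF g X \<psi>]
    have "L2_inner \<Omega> (v t) \<psi> - L2_inner \<Omega> (v s) \<psi> = (LINT x|lebesgue_on {s..t}. L2_inner \<Omega> (g x) \<psi>)"
    proof (rule weak_derivative_interval[OF _ _ c pi qi _ T])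
      show "(LINT t|lebesgue_on {0..T}. deriv \<phi> t * L2_inner \<Omega> (v t) \<psi>) = - (LINT t|lebesgue_on {0..T}. \<phi> t * L2_inner \<Omega> (g t) \<psi>)"
        if "\<phi> \<in> test_functions {0<..<T}" for \<phi>
        by (rule weak_time_derivative_scalar[OF D vAE strongly_measurable_inner(2)[OF sm X \<psi>] \<psi> borel_measurable_integrable[OF pi]
              borel_measurable_integrable[OF qi] that])
    qed (use st in auto)
    then show ?thesis using L2.diff_left[OF vL vL \<psi>, of t s] st by simp
  qed
  obtain \<sigma> where \<sigma>: "\<forall>k. simple_function (lebesgue_on {0..T}) (\<sigma> k) \<and> \<sigma> k ` {0..T} \<subseteq> X"
    and lim: "AE t in lebesgue_on {0..T}. (\<lambda>k::nat. H_norm r \<Omega> (\<lambda>x. \<sigma> k t x - g t x)) \<longlonglongrightarrow> 0"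
    and gX: "AE t in lebesgue_on {0..T}. g t \<in> X"
    using sm unfolding strongly_measurable_curve_def by blast
  have e: "(\<lambda>x. \<sigma> k t x - g t x) = \<sigma> k t - g t" for k t by (auto simp: fun_eq_iff)
  have \<sigma>1: "simple_function (lebesgue_on {s..t}) (\<sigma> k)" for k
    by (rule simple_function_lebesgue_on_subset[OF _ sub]) (use \<sigma> in blast)
  have \<sigma>2: "\<sigma> k ` {s..t} \<subseteq> H_space r \<Omega>" for k
    using \<sigma> X image_mono[OF sub, of "\<sigma> k"] by blast
  have gH: "AE t in lebesgue_on {0..T}. g t \<in> H_space r \<Omega>" using gX by (rule eventually_mono) (use X in auto)
  have uL: "v t - v s \<in> L2_space \<Omega>" using st by (intro subspace_diff[OF L2.sub] vL) auto
  note W = weak_integral_in_H_space[OF st(2) uL \<sigma>1 \<sigma>2 AE_lebesgue_on_subset[OF gH sub] AE_lebesgue_on_subset[OF lim[unfolded e] sub]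
      integrable_subinterval[OF gi sub] weak]
  show "v t - v s \<in> H_space r \<Omega>" by (rule W(1))
  show "H_norm r \<Omega> (v t - v s) \<le> (LINT x|lebesgue_on {s..t}. H_norm r \<Omega> (g x))" by (rule W(2))
qed

text \<open>H^2 regularity is needed at every time, because the scheme evaluates at grid points:
  \<open>v t\<close> is the initial value plus an H^2 increment, and its zero boundary values are
  part of \<open>weak_solution\<close>.\<close>

lemma solution_regularity:
  assumes T: "0 < T" and sol: "weak_solution \<Omega> T \<beta> AA BB F v0 v vt" and v0: "v0 \<in> H_space 2 \<Omega> \<inter> H10_space \<Omega>"
    and vt: "L1_curve 2 \<Omega> (H_space 2 \<Omega>) T vt" and t: "0 \<le> t" "t \<le> T"
  shows "v t \<in> H_space 2 \<Omega> \<inter> H10_space \<Omega>"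
    "H_norm 2 \<Omega> (v t) \<le> H_norm 2 \<Omega> v0 + (LINT x|lebesgue_on {0..t}. H_norm 2 \<Omega> (vt x))"
proof -
  interpret H: semi_inner "H_space 2 \<Omega> :: (real ^ 'd \<Rightarrow> real ^ 'd) set" "H_inner 2 \<Omega>" by (rule H_semi_inner)
  have c: "continuous_L2_curve \<Omega> T v" and D: "has_weak_time_derivative \<Omega> T v vt" and ini: "AE x in lebesgue_on \<Omega>. v 0 x = v0 x"
    and h10: "\<And>t. t \<in> {0<..T} \<Longrightarrow> v t \<in> H10_space \<Omega>"
    using sol by (auto simp: weak_solution_def)
  have ini': "AE x in lebesgue_on \<Omega>. v0 x = v 0 x" using ini by (rule eventually_mono) simp
  have v00: "v 0 \<in> H_space 2 \<Omega>" "v 0 \<in> H10_space \<Omega>" "H_norm 2 \<Omega> v0 = H_norm 2 \<Omega> (v 0)"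
    using H_space_AE[OF _ ini', of 2] H10_AE[OF _ ini'] H_norm_AE[OF _ ini', of 2] v0 by blast+
  note inc = curve_increment(2,3)[OF T c D vt subset_refl order_refl t]
  have e: "v t = v 0 + (v t - v 0)" by simp
  have "v t \<in> H_space 2 \<Omega>" by (subst e) (rule subspace_add[OF H.sub v00(1) inc(1)])
  moreover have "v t \<in> H10_space \<Omega>" using h10[of t] v00(2) t by (cases "t = 0") auto
  ultimately show "v t \<in> H_space 2 \<Omega> \<inter> H10_space \<Omega>" by blast
  have "H_norm 2 \<Omega> (v t) \<le> H_norm 2 \<Omega> (v 0) + H_norm 2 \<Omega> (v t - v 0)"
    unfolding H_norm_eq by (subst e) (rule H.triangle[OF v00(1) inc(1)])
  then show "H_norm 2 \<Omega> (v t) \<le> H_norm 2 \<Omega> v0 + (LINT x|lebesgue_on {0..t}. H_norm 2 \<Omega> (vt x))"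
    using inc(2) v00(3) by linarith
qed

text \<open>Through the dual bound \<zeta> enters by its L^2 norm only, and the increment of
  \<open>v\<close> by the integral of the H^2 norm of \<open>vt\<close>.\<close>

lemma elastic_form_increment:
  assumes T: "0 < T" and sol: "weak_solution \<Omega> T \<beta> AA BB F v0 v vt" and v0: "v0 \<in> H_space 2 \<Omega> \<inter> H10_space \<Omega>"
    and vt: "L1_curve 2 \<Omega> (H_space 2 \<Omega>) T vt" and st: "0 \<le> s" "s \<le> t" "t \<le> T"
    and M: "bounded_tensor \<Omega> K M" and C: "0 \<le> C" "\<And>u w. u \<in> H_space 2 \<Omega> \<inter> H10_space \<Omega> \<Longrightarrow> w \<in> H10_space \<Omega> \<Longrightarrow>
      \<bar>elastic_form \<Omega> M u w\<bar> \<le> C * seminrm (L2_inner \<Omega>) w * H_norm 2 \<Omega> u"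
    and \<zeta>: "\<zeta> \<in> H10_space \<Omega>"
  shows "\<bar>elastic_form \<Omega> M (v t) \<zeta> - elastic_form \<Omega> M (v s) \<zeta>\<bar> \<le>
     (C * seminrm (L2_inner \<Omega>) \<zeta>) * (LINT x|lebesgue_on {s..t}. H_norm 2 \<Omega> (vt x))"
proof -
  interpret E: bilinear_on "H_space 1 \<Omega>" "elastic_form \<Omega> M" by (rule elastic_form_bilinear[OF M])
  have vH: "v t \<in> H_space 2 \<Omega> \<inter> H10_space \<Omega>" "v s \<in> H_space 2 \<Omega> \<inter> H10_space \<Omega>"
    using solution_regularity(1)[OF T sol v0 vt] st by auto
  have c: "continuous_L2_curve \<Omega> T v" and D: "has_weak_time_derivative \<Omega> T v vt"
    using sol by (auto simp: weak_solution_def)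
  note inc = curve_increment(2,3)[OF T c D vt subset_refl st]
  have dH: "v t - v s \<in> H_space 2 \<Omega> \<inter> H10_space \<Omega>" using inc(1) subspace_diff[OF H10_subspace, of "v t" "v s"] vH by blast
  have "elastic_form \<Omega> M (v t) \<zeta> - elastic_form \<Omega> M (v s) \<zeta> = elastic_form \<Omega> M (v t - v s) \<zeta>"
    using E.diff_left[OF H10_H1[of "v t"] H10_H1[of "v s"] H10_H1[OF \<zeta>]] vH by simp
  moreover have "\<bar>elastic_form \<Omega> M (v t - v s) \<zeta>\<bar> \<le> C * seminrm (L2_inner \<Omega>) \<zeta> * H_norm 2 \<Omega> (v t - v s)"
    by (rule C(2)[OF dH \<zeta>])
  moreover have "C * seminrm (L2_inner \<Omega>) \<zeta> * H_norm 2 \<Omega> (v t - v s) \<le> C * seminrm (L2_inner \<Omega>) \<zeta> * (LINT x|lebesgue_on {s..t}. H_norm 2 \<Omega> (vt x))"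
    by (intro mult_left_mono inc(2) mult_nonneg_nonneg C(1) semi_inner.seminrm_nonneg[OF L2_semi_inner] H_space_L2[OF H10_H1[OF \<zeta>]])
  ultimately show ?thesis by linarith
qed

text \<open>The difference \<open>v t - v s\<close> paired with \<zeta> is the integral of the
  pairings of \<open>vt\<close>, so the error is the integral of their deviation from the value at
  the right end point, and each deviation is an integral of \<open>vtt\<close>.\<close>

lemma time_difference_consistency:
  assumes T: "0 < T" and sol: "weak_solution \<Omega> T \<beta> AA BB F v0 v vt" and v0: "v0 \<in> H_space 2 \<Omega> \<inter> H10_space \<Omega>"
    and vt: "L1_curve 2 \<Omega> (H_space 2 \<Omega>) T vt" and F: "continuous_L2_curve \<Omega> T F"
    and Dvt: "has_weak_time_derivative \<Omega> T vt vtt" and vtt: "L1_curve 0 \<Omega> (L2_space \<Omega>) T vtt"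
    and AA: "bounded_tensor \<Omega> KA AA" and CA: "0 \<le> CA" "\<And>u w. u \<in> H_space 2 \<Omega> \<inter> H10_space \<Omega> \<Longrightarrow> w \<in> H10_space \<Omega> \<Longrightarrow>
      \<bar>elastic_form \<Omega> AA u w\<bar> \<le> CA * seminrm (L2_inner \<Omega>) w * H_norm 2 \<Omega> u"
    and BB: "bounded_tensor \<Omega> KB BB" and CB: "0 \<le> CB" "\<And>u w. u \<in> H_space 2 \<Omega> \<inter> H10_space \<Omega> \<Longrightarrow> w \<in> H10_space \<Omega> \<Longrightarrow>
      \<bar>elastic_form \<Omega> BB u w\<bar> \<le> CB * seminrm (L2_inner \<Omega>) w * H_norm 2 \<Omega> u"
    and \<beta>: "\<beta> \<in> borel_measurable borel" "\<And>r. 0 < r \<Longrightarrow> r \<le> T \<Longrightarrow> \<bar>\<beta> r\<bar> \<le> B"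
    and st: "0 \<le> s" "s < t" "t \<le> T" and \<zeta>: "\<zeta> \<in> H10_space \<Omega>"
  shows "\<bar>L2_inner \<Omega> (v t - v s) \<zeta> - (t - s) * L2_inner \<Omega> (vt t) \<zeta>\<bar> \<le>
    (t - s) * (LINT x|lebesgue_on {s..t}. H_norm 0 \<Omega> (vtt x)) * seminrm (L2_inner \<Omega>) \<zeta>"
proof -
  have \<zeta>L: "\<zeta> \<in> L2_space \<Omega>" by (rule H_space_L2[OF H10_H1[OF \<zeta>]])
  have c: "continuous_L2_curve \<Omega> T v" and D: "has_weak_time_derivative \<Omega> T v vt"
    and eq: "\<And>t. t \<in> {0<..T} \<Longrightarrow> L2_inner \<Omega> (vt t) \<zeta> + elastic_form \<Omega> AA (v t) \<zeta>
             - (LINT s|lebesgue_on {0..t}. \<beta> (t - s) * elastic_form \<Omega> BB (v s) \<zeta>) = L2_inner \<Omega> (F t) \<zeta>"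
    using sol \<zeta> by (auto simp: weak_solution_def)
  have vti: "integrable (lebesgue_on {0..T}) (\<lambda>t. H_norm 2 \<Omega> (vt t))" using vt by (simp add: L1_curve_def)
  define p where "p = (\<lambda>t. L2_inner \<Omega> (vt t) \<zeta>)"
  define q where "q = (\<lambda>t. L2_inner \<Omega> (vtt t) \<zeta>)"
  have cA: "continuous_on {0..T} (\<lambda>t. elastic_form \<Omega> AA (v t) \<zeta>)"
    by (rule continuous_on_increment_bound[OF vti elastic_form_increment[OF T sol v0 vt _ _ _ AA CA \<zeta>]])
  have cB: "continuous_on {0..T} (\<lambda>t. elastic_form \<Omega> BB (v t) \<zeta>)"
    by (rule continuous_on_increment_bound[OF vti elastic_form_increment[OF T sol v0 vt _ _ _ BB CB \<zeta>]])
  have "continuous_on {0..T} (\<lambda>t. L2_inner \<Omega> (F t) \<zeta> - elastic_form \<Omega> AA (v t) \<zeta> +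
      (LINT s|lebesgue_on {0..t}. \<beta> (t - s) * elastic_form \<Omega> BB (v s) \<zeta>))"
    by (intro continuous_intros continuous_L2_curve_inner[OF F \<zeta>L] cA convolution_continuous[OF \<beta> cB])
  then have "continuous_on {0<..T} (\<lambda>t. L2_inner \<Omega> (F t) \<zeta> - elastic_form \<Omega> AA (v t) \<zeta> +
      (LINT s|lebesgue_on {0..t}. \<beta> (t - s) * elastic_form \<Omega> BB (v s) \<zeta>))"
    by (rule continuous_on_subset) auto
  \<comment> \<open>The weak equation expresses the pairing of \<open>vt\<close> through terms
    already known to be continuous; this holds at positive times only.\<close>
  then have pc: "continuous_on {0<..T} p"
    by (rule continuous_on_eq) (use eq in \<open>simp add: p_def algebra_simps\<close>)
  have pi: "integrable (lebesgue_on {0..T}) p" unfolding p_def by (rule L1_curve_inner_integrable(1)[OF vt subset_refl \<zeta>L])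
  have L20: "L2_space \<Omega> \<subseteq> (H_space 0 \<Omega> :: (real ^ 'd \<Rightarrow> real ^ 'd) set)" by simp
  have qi: "integrable (lebesgue_on {0..T}) q" unfolding q_def by (rule L1_curve_inner_integrable(1)[OF vtt L20 \<zeta>L])
  have vtL: "AE t in lebesgue_on {0..T}. vt t \<in> L2_space \<Omega>"
    using vt strongly_measurable_inner(2)[OF _ subset_refl \<zeta>L] by (auto simp: L1_curve_def)
  have vttL: "AE t in lebesgue_on {0..T}. vtt t \<in> L2_space \<Omega>"
    using vtt strongly_measurable_inner(2)[OF _ L20 \<zeta>L] by (auto simp: L1_curve_def)
  have pq: "p b - p a = (LINT x|lebesgue_on {a..b}. q x)" if "0 < a" "a \<le> b" "b \<le> T" for a b
  proof (rule weak_derivative_interval[OF _ _ pc pi qi _ T])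
    show "(LINT t|lebesgue_on {0..T}. deriv \<phi> t * p t) = - (LINT t|lebesgue_on {0..T}. \<phi> t * q t)" if "\<phi> \<in> test_functions {0<..<T}" for \<phi>
      unfolding p_def q_def
      by (rule weak_time_derivative_scalar[OF Dvt vtL vttL \<zeta>L borel_measurable_integrable[OF pi[unfolded p_def]]
            borel_measurable_integrable[OF qi[unfolded q_def]] that])
  qed (use that in auto)
  have sub: "{s..t} \<subseteq> {0..T}" using st by auto
  let ?R = "(LINT x|lebesgue_on {s..t}. H_norm 0 \<Omega> (vtt x)) * seminrm (L2_inner \<Omega>) \<zeta>"
  have vtti: "integrable (lebesgue_on {0..T}) (\<lambda>t. H_norm 0 \<Omega> (vtt t))" using vtt by (simp add: L1_curve_def)
  have bnd: "\<bar>p x - p t\<bar> \<le> ?R" if x: "s \<le> x" "x \<le> t" "0 < x" for x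
  proof -
    have "\<bar>p x - p t\<bar> = \<bar>LINT y|lebesgue_on {x..t}. q y\<bar>" using pq[of x t] x st by simp
    also have "\<dots> \<le> (LINT y|lebesgue_on {x..t}. \<bar>q y\<bar>)" by (rule integral_abs_bound)
    also have "\<dots> \<le> (LINT y|lebesgue_on {s..x}. \<bar>q y\<bar>) + (LINT y|lebesgue_on {x..t}. \<bar>q y\<bar>)"
      using integral_nonneg_AE[of "\<lambda>y. \<bar>q y\<bar>" "lebesgue_on {s..x}"] by simp
    also have "\<dots> = (LINT y|lebesgue_on {s..t}. \<bar>q y\<bar>)"
      by (rule lebesgue_integral_interval_combine[symmetric, OF integrable_abs[OF integrable_subinterval[OF qi sub]] x(1,2)])
    also have "\<dots> \<le> (LINT y|lebesgue_on {s..t}. H_norm 0 \<Omega> (vtt y) * seminrm (L2_inner \<Omega>) \<zeta>)"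
    proof (rule integral_mono_AE)
      show "AE y in lebesgue_on {s..t}. \<bar>q y\<bar> \<le> H_norm 0 \<Omega> (vtt y) * seminrm (L2_inner \<Omega>) \<zeta>"
        unfolding q_def by (rule AE_lebesgue_on_subset[OF L1_curve_inner_integrable(2)[OF vtt L20 \<zeta>L] sub])
    qed (intro integrable_abs integrable_mult_left integrable_subinterval[OF qi sub] integrable_subinterval[OF vtti sub])+
    finally show ?thesis by simp
  qed
  have pis: "integrable (lebesgue_on {s..t}) p" by (rule integrable_subinterval[OF pi sub])
  have ci: "integrable (lebesgue_on {s..t}) (\<lambda>_. c)" for c :: real by simp
  have m: "measure (lebesgue_on {s..t}) (space (lebesgue_on {s..t})) = t - s"
    using st by (simp add: measure_restrict_space)
  have "L2_inner \<Omega> (v t - v s) \<zeta> - (t - s) * p t = (LINT x|lebesgue_on {s..t}. p x) - (LINT x|lebesgue_on {s..t}. p t)"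
    using curve_increment(1)[OF T c D vt subset_refl st(1) less_imp_le[OF st(2)] st(3) \<zeta>L] m by (simp add: p_def)
  also have "\<dots> = (LINT x|lebesgue_on {s..t}. p x - p t)"
    by (rule Bochner_Integration.integral_diff[symmetric, OF pis ci])
  finally have "\<bar>L2_inner \<Omega> (v t - v s) \<zeta> - (t - s) * p t\<bar> \<le> (LINT x|lebesgue_on {s..t}. \<bar>p x - p t\<bar>)"
    using integral_abs_bound[of "lebesgue_on {s..t}" "\<lambda>x. p x - p t"] by simp
  also have "\<dots> \<le> (LINT x|lebesgue_on {s..t}. ?R)"
  proof (rule integral_mono_AE[OF _ ci])
    show "integrable (lebesgue_on {s..t}) (\<lambda>x. \<bar>p x - p t\<bar>)" by (intro integrable_abs Bochner_Integration.integrable_diff pis ci)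
    \<comment> \<open>The deviation is controlled for positive times only. This matters in the first
      step, where \<open>s = 0\<close>.\<close>
    have "AE x in lebesgue. x \<noteq> (0::real)" using AE_lborel_singleton[of "0::real"] by (rule AE_completion)
    then have "AE x in lebesgue_on {s..t}. x \<noteq> 0" by (auto simp: AE_restrict_space_iff elim: eventually_mono)
    moreover have "AE x in lebesgue_on {s..t}. x \<in> {s..t}" by (simp add: AE_restrict_space_iff)
    ultimately show "AE x in lebesgue_on {s..t}. \<bar>p x - p t\<bar> \<le> ?R"
      by eventually_elim (use st in \<open>auto intro!: bnd\<close>)
  qed
  also have "\<dots> = (t - s) * ?R" using m by simp
  finally show ?thesis by (simp add: p_def mult.assoc)
qed

text \<open>The quadrature estimate for the elastic form of \<open>v s\<close> with \<zeta>. Its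
  maximum is bounded by the initial value plus the integral of \<open>vt\<close>, which shapes the
  accuracy term of the final estimate; its oscillations over the cells are increments of the
  primitive \<open>P\<close> and telescope.\<close>

lemma memory_consistency:
  assumes T: "0 < T" and sol: "weak_solution \<Omega> T \<beta> AA BB F v0 v vt" and v0: "v0 \<in> H_space 2 \<Omega> \<inter> H10_space \<Omega>"
    and vt: "L1_curve 2 \<Omega> (H_space 2 \<Omega>) T vt"
    and BB: "bounded_tensor \<Omega> KB BB" and CB: "0 \<le> CB" "\<And>u w. u \<in> H_space 2 \<Omega> \<inter> H10_space \<Omega> \<Longrightarrow> w \<in> H10_space \<Omega> \<Longrightarrow>
      \<bar>elastic_form \<Omega> BB u w\<bar> \<le> CB * seminrm (L2_inner \<Omega>) w * H_norm 2 \<Omega> u"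
    and \<beta>: "\<beta> \<in> borel_measurable borel" "\<And>r. 0 < r \<Longrightarrow> r \<le> T \<Longrightarrow> \<bar>\<beta> r - \<kappa> r\<bar> \<le> \<delta>" "0 \<le> \<delta>"
    and \<kappa>: "continuous_on UNIV \<kappa>" "\<And>r. 0 \<le> r \<Longrightarrow> r \<le> T \<Longrightarrow> \<bar>\<kappa> r\<bar> \<le> G"
    and \<Delta>: "0 < \<Delta>" "real n * \<Delta> \<le> T"
    and g: "\<And>k. k < n \<Longrightarrow> ((\<lambda>s. \<kappa> (real n * \<Delta> - s)) has_integral g (n - k)) {real k * \<Delta>..real (Suc k) * \<Delta>}"
    and \<zeta>: "\<zeta> \<in> H10_space \<Omega>"
  shows "\<bar>(LINT s|lebesgue_on {0..real n * \<Delta>}. \<beta> (real n * \<Delta> - s) * elastic_form \<Omega> BB (v s) \<zeta>) -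
       (\<Sum>k<n. g (n - k) * elastic_form \<Omega> BB (v (real k * \<Delta>)) \<zeta>)\<bar> \<le>
    CB * (T * \<delta> * (H_norm 2 \<Omega> v0 + (LINT x|lebesgue_on {0..real n * \<Delta>}. H_norm 2 \<Omega> (vt x))) +
      G * \<Delta> * (LINT x|lebesgue_on {0..real n * \<Delta>}. H_norm 2 \<Omega> (vt x))) * seminrm (L2_inner \<Omega>) \<zeta>"
proof -
  define t where "t = real n * \<Delta>"
  define f where "f = (\<lambda>s. elastic_form \<Omega> BB (v s) \<zeta>)"
  define P where "P = (\<lambda>s. LINT x|lebesgue_on {0..s}. H_norm 2 \<Omega> (vt x))"
  have t: "0 \<le> t" "t \<le> T" using \<Delta> by (auto simp: t_def)
  have vti: "integrable (lebesgue_on {0..T}) (\<lambda>t. H_norm 2 \<Omega> (vt t))" using vt by (simp add: L1_curve_def)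
  have vtH: "AE x in lebesgue_on {0..T}. 0 \<le> H_norm 2 \<Omega> (vt x)"
  proof -
    have "AE x in lebesgue_on {0..T}. vt x \<in> H_space 2 \<Omega>" using vt by (simp add: L1_curve_def strongly_measurable_curve_def)
    then show ?thesis by (rule eventually_mono) (simp add: H_norm_eq semi_inner.seminrm_nonneg[OF H_semi_inner])
  qed
  have Pd: "(LINT x|lebesgue_on {a..b}. H_norm 2 \<Omega> (vt x)) = P b - P a" if "0 \<le> a" "a \<le> b" "b \<le> T" for a b
    unfolding P_def using lebesgue_integral_interval_combine[of 0 b _ a, OF integrable_subinterval[OF vti]] that by auto
  have Pmono: "P a \<le> P b" if "0 \<le> a" "a \<le> b" "b \<le> T" for a b
  proof -
    have "{a..b} \<subseteq> {0..T}" using that by auto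
    then have "0 \<le> (LINT x|lebesgue_on {a..b}. H_norm 2 \<Omega> (vt x))"
      by (intro integral_nonneg_AE AE_lebesgue_on_subset[OF vtH])
    then show ?thesis using Pd[OF that] by simp
  qed
  define z where "z = seminrm (L2_inner \<Omega>) \<zeta>"
  have z: "0 \<le> z" unfolding z_def by (rule semi_inner.seminrm_nonneg[OF L2_semi_inner H_space_L2[OF H10_H1[OF \<zeta>]]])
  have inc: "\<bar>f b - f a\<bar> \<le> CB * z * (P b - P a)" if "0 \<le> a" "a \<le> b" "b \<le> T" for a b
    using elastic_form_increment[OF T sol v0 vt that BB CB \<zeta>] Pd[OF that] by (simp add: f_def z_def)
  have fc: "continuous_on {0..T} f" unfolding f_def
    by (rule continuous_on_increment_bound[OF vti elastic_form_increment[OF T sol v0 vt _ _ _ BB CB \<zeta>]])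
  have fb: "\<bar>f s\<bar> \<le> CB * z * (H_norm 2 \<Omega> v0 + P t)" if s: "s \<in> {0..t}" for s
  proof -
    have "\<bar>f s\<bar> \<le> CB * z * H_norm 2 \<Omega> (v s)"
      unfolding f_def z_def using s t by (intro CB(2) solution_regularity(1)[OF T sol v0 vt] \<zeta>) auto
    also have "\<dots> \<le> CB * z * (H_norm 2 \<Omega> v0 + P t)"
    proof (rule mult_left_mono)
      have "H_norm 2 \<Omega> (v s) \<le> H_norm 2 \<Omega> v0 + P s"
        unfolding P_def using s t by (intro solution_regularity(2)[OF T sol v0 vt]) auto
      also have "\<dots> \<le> H_norm 2 \<Omega> v0 + P t" using Pmono[of s t] s t by simp
      finally show "H_norm 2 \<Omega> (v s) \<le> H_norm 2 \<Omega> v0 + P t" .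
    qed (use CB(1) z in simp)
    finally show ?thesis .
  qed
  have le: "real k * \<Delta> \<le> t" if "k \<le> n" for k unfolding t_def using that \<Delta> by (intro mult_right_mono) auto
  have "\<bar>(LINT s|lebesgue_on {0..t}. \<beta> (t - s) * f s) - (\<Sum>k<n. g (n - k) * f (real k * \<Delta>))\<bar>
     \<le> t * \<delta> * (CB * z * (H_norm 2 \<Omega> v0 + P t)) + G * \<Delta> * (\<Sum>k<n. CB * z * (P (real (Suc k) * \<Delta>) - P (real k * \<Delta>)))"
    unfolding t_def
  proof (rule memory_quadrature_error[OF \<Delta>(1) \<beta>(1) _ \<beta>(3) \<kappa>(1)])
    show "\<bar>f s\<bar> \<le> CB * z * (H_norm 2 \<Omega> v0 + P (real n * \<Delta>))" if "s \<in> {0..real n * \<Delta>}" for s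
      using fb[of s] that by (simp add: t_def)
    show "continuous_on {0..real n * \<Delta>} f" using continuous_on_subset[OF fc] t by (auto simp: t_def)
    show "\<bar>f s - f (real k * \<Delta>)\<bar> \<le> CB * z * (P (real (Suc k) * \<Delta>) - P (real k * \<Delta>))"
      if k: "k < n" and s: "s \<in> {real k * \<Delta>..real (Suc k) * \<Delta>}" for k s
    proof -
      have S: "real (Suc k) * \<Delta> \<le> T" using le[of "Suc k"] k t by simp
      have k0: "0 \<le> real k * \<Delta>" using \<Delta> by simp
      have "\<bar>f s - f (real k * \<Delta>)\<bar> \<le> CB * z * (P s - P (real k * \<Delta>))" using s S k0 by (intro inc) auto
      also have "\<dots> \<le> CB * z * (P (real (Suc k) * \<Delta>) - P (real k * \<Delta>))"
        using Pmono[of s "real (Suc k) * \<Delta>"] s S k0 CB(1) z by (intro mult_left_mono) auto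
      finally show ?thesis .
    qed
  qed (use \<beta>(2) \<kappa>(2) g t in \<open>auto simp: t_def\<close>)
  also have "(\<Sum>k<n. CB * z * (P (real (Suc k) * \<Delta>) - P (real k * \<Delta>))) = CB * z * (P t - P 0)"
    using sum_lessThan_telescope[of "\<lambda>k. P (real k * \<Delta>)" n] by (simp add: t_def flip: sum_distrib_left)
  also have "P 0 = 0"
  proof -
    have "integral {0..0::real} (\<lambda>x. H_norm 2 \<Omega> (vt x)) = 0" by simp
    moreover have "P 0 = integral {0..0} (\<lambda>x. H_norm 2 \<Omega> (vt x))"
      unfolding P_def using integrable_subinterval[OF vti, of 0 0] T by (intro lebesgue_integral_eq_integral) auto
    ultimately show ?thesis by simp
  qed
  also have "t * \<delta> * (CB * z * (H_norm 2 \<Omega> v0 + P t)) + G * \<Delta> * (CB * z * (P t - 0)) \<le>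
      T * \<delta> * (CB * z * (H_norm 2 \<Omega> v0 + P t)) + G * \<Delta> * (CB * z * P t)"
    using t \<beta>(3) order_trans[OF abs_ge_zero fb[of 0]] by (intro add_mono mult_right_mono) auto
  also have "\<dots> = CB * (T * \<delta> * (H_norm 2 \<Omega> v0 + P t) + G * \<Delta> * P t) * z"
    by (simp add: algebra_simps)
  finally show ?thesis by (simp only: t_def f_def P_def z_def)
qed

end

section \<open>Finite element spaces\<close>

text \<open>A coordinate of a linear map attains its extremes over a box at vertices selected by the
  signs of the coefficients, and over the image box these extremes are the two end points of that
  coordinate.\<close>

lemma box_image_width:
  fixes Q :: "real ^ 'd \<Rightarrow> real ^ 'd"
  assumes Q: "linear Q" and im: "Q ` cbox a b = cbox a' b'" and ne: "box a b \<noteq> {}" "box a' b' \<noteq> {}"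
  shows "b' $ i - a' $ i = (\<Sum>k\<in>UNIV. \<bar>Q (axis k 1) $ i\<bar> * (b $ k - a $ k))"
proof -
  define m where "m = (\<lambda>k. Q (axis k 1) $ i)"
  have ab: "a $ k < b $ k" "a' $ k < b' $ k" for k using ne by (auto simp: interval_ne_empty_cart)
  have Qi: "Q y $ i = (\<Sum>k\<in>UNIV. m k * y $ k)" for y
  proof -
    have "Q y = Q (\<Sum>k\<in>UNIV. y $ k *\<^sub>R axis k 1)" by (simp add: basis_expansion flip: scalar_mult_eq_scaleR)
    also have "\<dots> = (\<Sum>k\<in>UNIV. y $ k *\<^sub>R Q (axis k 1))" using Q by (simp add: linear_sum linear_scale)
    finally show ?thesis by (simp add: m_def mult.commute)
  qed
  \<comment> \<open>The vertices at which coordinate \<open>i\<close> of the image is largest and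
    smallest.\<close>
  define yp where "yp = (\<chi> k. if 0 \<le> m k then b $ k else a $ k)"
  define ym where "ym = (\<chi> k. if 0 \<le> m k then a $ k else b $ k)"
  have mem: "yp \<in> cbox a b" "ym \<in> cbox a b" using ab(1) by (auto simp: mem_box_cart yp_def ym_def less_imp_le)
  have le: "Q ym $ i \<le> Q y $ i" "Q y $ i \<le> Q yp $ i" if "y \<in> cbox a b" for y
  proof -
    have "m k * ym $ k \<le> m k * y $ k \<and> m k * y $ k \<le> m k * yp $ k" for k
    proof (cases "0 \<le> m k")
      case True
      then show ?thesis using that by (simp add: yp_def ym_def mem_box_cart mult_left_mono)
    next
      case False
      then show ?thesis using that by (simp add: yp_def ym_def mem_box_cart mult_left_mono_neg)
    qed
    then show "Q ym $ i \<le> Q y $ i" "Q y $ i \<le> Q yp $ i" unfolding Qi by (auto intro!: sum_mono)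
  qed
  have rng: "a' $ i \<le> Q y $ i" "Q y $ i \<le> b' $ i" if "y \<in> cbox a b" for y
    using im that by (auto simp: mem_box_cart dest!: equalityD1 subsetD[OF _ imageI])
  have "a' \<in> cbox a' b'" "b' \<in> cbox a' b'" using ab(2) by (auto simp: mem_box_cart less_imp_le)
  then obtain y1 y2 where "y1 \<in> cbox a b" "Q y1 = a'" "y2 \<in> cbox a b" "Q y2 = b'" using im by (metis imageE)
  then have "Q ym $ i = a' $ i" "Q yp $ i = b' $ i"
    using le(1)[of y1] le(2)[of y2] rng(1)[OF mem(2)] rng(2)[OF mem(1)] by auto
  then have "b' $ i - a' $ i = (\<Sum>k\<in>UNIV. m k * yp $ k - m k * ym $ k)" unfolding Qi by (simp add: sum_subtractf)
  also have "\<dots> = (\<Sum>k\<in>UNIV. \<bar>m k\<bar> * (b $ k - a $ k))"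
    by (intro sum.cong) (auto simp: yp_def ym_def algebra_simps)
  finally show ?thesis by (simp add: m_def)
qed

text \<open>The matrix of absolute values of an orthogonal matrix that maps a box onto a box maps the vector of
  edge lengths to that of the image, and its transpose maps it back; so the columns of the nonnegative
  matrix are orthogonal and each row has a single nonzero entry.\<close>

lemma orthogonal_box_signed_permutation:
  fixes Q :: "real ^ 'd \<Rightarrow> real ^ 'd"
  assumes Q: "orthogonal_transformation Q" and im: "Q ` cbox a b = cbox a' b'" and ne: "box a b \<noteq> {}" "box a' b' \<noteq> {}"
  obtains \<sigma> \<epsilon> where "bij \<sigma>" "\<And>i. \<epsilon> i * \<epsilon> i = 1" "\<And>y i. Q y $ i = \<epsilon> i * y $ (\<sigma> i)"
proof -
  define m where "m = (\<lambda>i k. Q (axis k 1) $ i)"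
  have lin: "linear Q" using Q by (simp add: orthogonal_transformation_def)
  have bijQ: "bij Q" using orthogonal_transformation_bij[OF Q] .
  have linv: "linear (inv Q)" using orthogonal_transformation_inv[OF Q] by (simp add: orthogonal_transformation_def)
  have adj: "inv Q x \<bullet> y = x \<bullet> Q y" for x y
    using Q bijQ unfolding orthogonal_transformation_def by (metis bij_inv_eq_iff)
  have minv: "inv Q (axis i 1) $ k = m i k" for i k
    using adj[of "axis i 1" "axis k 1"] by (simp add: m_def inner_axis inner_axis')
  have imv: "inv Q ` cbox a' b' = cbox a b" using im bijQ by (metis bij_is_inj image_inv_f_f)
  have orth: "(\<Sum>i\<in>UNIV. m i k * m i l) = (if k = l then 1 else 0)" for k l
  proof -
    have "(\<Sum>i\<in>UNIV. m i k * m i l) = Q (axis k 1) \<bullet> Q (axis l 1)" by (simp add: inner_vec_def m_def)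
    also have "\<dots> = axis k 1 \<bullet> (axis l 1 :: real ^ 'd)" using Q by (simp add: orthogonal_transformation_def)
    finally show ?thesis by (simp add: inner_axis_axis)
  qed
  define r where "r = (\<lambda>k. b $ k - a $ k)"
  define r' where "r' = (\<lambda>k. b' $ k - a' $ k)"
  have rpos: "0 < r k" for k using ne by (auto simp: interval_ne_empty_cart r_def)
  have r1: "r' i = (\<Sum>k\<in>UNIV. \<bar>m i k\<bar> * r k)" for i
    unfolding r'_def r_def m_def by (rule box_image_width[OF lin im ne])
  have r2: "r k = (\<Sum>i\<in>UNIV. \<bar>m i k\<bar> * r' i)" for k
    using box_image_width[OF linv imv ne(2,1), of k] by (simp add: minv r_def r'_def)
  \<comment> \<open>The Gram matrix of the columns of absolute values. It fixes the positive vector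
    \<open>r\<close> of edge lengths and has unit diagonal, so its nonnegative off-diagonal entries
    must vanish.\<close>
  define p where "p = (\<lambda>k l. \<Sum>i\<in>UNIV. \<bar>m i k\<bar> * \<bar>m i l\<bar>)"
  have pk: "p k k = 1" for k using orth[of k k] by (simp add: p_def flip: abs_mult)
  have p0: "0 \<le> p k l" for k l unfolding p_def by (intro sum_nonneg) auto
  have rp: "r k = (\<Sum>l\<in>UNIV. p k l * r l)" for k
  proof -
    have "r k = (\<Sum>i\<in>UNIV. \<Sum>l\<in>UNIV. \<bar>m i k\<bar> * \<bar>m i l\<bar> * r l)"
      by (subst r2) (simp add: r1 sum_distrib_left mult.assoc)
    also have "\<dots> = (\<Sum>l\<in>UNIV. \<Sum>i\<in>UNIV. \<bar>m i k\<bar> * \<bar>m i l\<bar> * r l)" by (rule sum.swap)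
    finally show ?thesis by (simp add: p_def sum_distrib_right)
  qed
  have rest: "\<forall>l\<in>UNIV - {k}. p k l * r l = 0" for k
  proof -
    have "(\<Sum>l\<in>UNIV. p k l * r l) = p k k * r k + (\<Sum>l\<in>UNIV - {k}. p k l * r l)" by (rule sum.remove) auto
    then have "(\<Sum>l\<in>UNIV - {k}. p k l * r l) = 0" using rp[of k] pk[of k] by simp
    moreover have "0 \<le> p k l * r l" for l using p0[of k l] rpos[of l] by simp
    ultimately show ?thesis using sum_nonneg_eq_0_iff[of "UNIV - {k}" "\<lambda>l. p k l * r l"] by simp
  qed
  have pz: "p k l = 0" if "k \<noteq> l" for k l using rest[of k] that rpos[of l] by auto
  have single: "m i k = 0 \<or> m i l = 0" if "k \<noteq> l" for i k l
  proof -
    have "\<forall>i\<in>UNIV. \<bar>m i k\<bar> * \<bar>m i l\<bar> = 0" using pz[OF that] sum_nonneg_eq_0_iff[of UNIV "\<lambda>i. \<bar>m i k\<bar> * \<bar>m i l\<bar>"] by (simp add: p_def)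
    then show ?thesis by auto
  qed
  have Qi: "Q y $ i = (\<Sum>k\<in>UNIV. m i k * y $ k)" for y i
  proof -
    have "Q y $ i = axis i 1 \<bullet> Q y" by (simp add: inner_axis')
    also have "\<dots> = inv Q (axis i 1) \<bullet> y" by (rule adj[symmetric])
    finally show ?thesis by (simp add: inner_vec_def minv)
  qed
  have rowsq: "(\<Sum>k\<in>UNIV. m i k * m i k) = 1" for i
  proof -
    have "(\<Sum>k\<in>UNIV. m i k * m i k) = inv Q (axis i 1) \<bullet> inv Q (axis i 1)" by (simp add: inner_vec_def minv)
    also have "\<dots> = axis i 1 \<bullet> Q (inv Q (axis i 1))" by (rule adj)
    also have "\<dots> = 1" using bijQ by (simp add: bij_is_surj surj_f_inv_f inner_axis_axis)
    finally show ?thesis .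
  qed
  have "\<exists>k. m i k \<noteq> 0" for i
  proof (rule ccontr)
    assume "\<nexists>k. m i k \<noteq> 0"
    then show False using rowsq[of i] by simp
  qed
  then obtain \<sigma> where \<sigma>: "\<And>i. m i (\<sigma> i) \<noteq> 0" by metis
  have off: "m i k = 0" if "k \<noteq> \<sigma> i" for i k using single[OF that, of i] \<sigma>[of i] by auto
  have sum_row: "(\<Sum>k\<in>UNIV. m i k * f k) = m i (\<sigma> i) * f (\<sigma> i)" for i f
  proof -
    have "(\<Sum>k\<in>UNIV. m i k * f k) = (\<Sum>k\<in>UNIV. if k = \<sigma> i then m i (\<sigma> i) * f (\<sigma> i) else 0)"
      by (intro sum.cong) (auto simp: off)
    then show ?thesis by simp
  qed
  have "inj \<sigma>"
  proof (rule injI)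
    fix i j assume eq: "\<sigma> i = \<sigma> j"
    have "inv Q (axis i 1) \<bullet> inv Q (axis j 1) = axis i 1 \<bullet> (axis j 1 :: real ^ 'd)"
      using adj[of "axis i 1" "inv Q (axis j 1)"] bijQ by (simp add: bij_is_surj surj_f_inv_f)
    moreover have "inv Q (axis i 1) \<bullet> inv Q (axis j 1) = m i (\<sigma> i) * m j (\<sigma> i)"
      by (simp add: inner_vec_def minv sum_row)
    ultimately have "axis i 1 \<bullet> (axis j 1 :: real ^ 'd) \<noteq> 0" using \<sigma>[of i] \<sigma>[of j] eq by (metis mult_eq_0_iff)
    then show "i = j" by (auto simp: inner_axis_axis split: if_splits)
  qed
  then have "bij \<sigma>" by (simp add: finite_UNIV_inj_surj bij_def)
  show ?thesis
  proof (rule that)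
    show "m i (\<sigma> i) * m i (\<sigma> i) = 1" for i using rowsq[of i] unfolding sum_row .
    show "Q y $ i = m i (\<sigma> i) * y $ \<sigma> i" for y i unfolding Qi sum_row ..
  qed fact
qed

text \<open>Each function may describe the same cell by its own rotation and box. Two descriptions
  differ by an orthogonal map between boxes, a signed permutation of the axes, and this maps
  products of distinct coordinates to such products up to sign. Sums of multilinear functions rely
  on it.\<close>

lemma multilinear_change_coordinates:
  fixes R :: "('d::finite) vfield"
  assumes R: "orthogonal_transformation R" "box a b \<noteq> {}" and K: "K = R ` cbox a b" and w: "multilinear_on_cell K w"
  shows "\<exists>c. \<forall>y\<in>cbox a b. w (R y) = (\<Sum>S\<in>UNIV. (\<Prod>i\<in>S. y $ i) *\<^sub>R c S)"
proof -
  obtain R' :: "'d vfield" and a' b' c' where R': "orthogonal_transformation R'" "box a' b' \<noteq> {}" "K = R' ` cbox a' b'"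
    and w': "\<forall>y\<in>cbox a' b'. w (R' y) = (\<Sum>S\<in>UNIV. (\<Prod>i\<in>S. y $ i) *\<^sub>R c' S)"
    using w unfolding multilinear_on_cell_def by blast
  define Q where "Q = inv R' \<circ> R"
  have bij: "bij R'" using orthogonal_transformation_bij[OF R'(1)] .
  have Q: "orthogonal_transformation Q" unfolding Q_def
    by (intro orthogonal_transformation_compose orthogonal_transformation_inv R R')
  have "Q ` cbox a b = inv R' ` (R' ` cbox a' b')" unfolding Q_def image_comp[symmetric] using K R'(3) by simp
  also have "\<dots> = cbox a' b'" using bij by (simp add: bij_is_inj image_inv_f_f)
  finally have im: "Q ` cbox a b = cbox a' b'" .
  obtain \<sigma> \<epsilon> where \<sigma>: "bij \<sigma>" "\<And>y i. Q y $ i = \<epsilon> i * y $ (\<sigma> i)"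
    using orthogonal_box_signed_permutation[OF Q im R(2) R'(2)] by metis
  define c where "c = (\<lambda>S. (\<Prod>i\<in>\<sigma> -` S. \<epsilon> i) *\<^sub>R c' (\<sigma> -` S))"
  have "w (R y) = (\<Sum>S\<in>UNIV. (\<Prod>i\<in>S. y $ i) *\<^sub>R c S)" if y: "y \<in> cbox a b" for y
  proof -
    have "R y = R' (Q y)" unfolding Q_def using bij by (simp add: bij_is_surj surj_f_inv_f)
    moreover have "Q y \<in> cbox a' b'" using im y by blast
    ultimately have "w (R y) = (\<Sum>S\<in>UNIV. (\<Prod>i\<in>S. \<epsilon> i * y $ (\<sigma> i)) *\<^sub>R c' S)" using w' by (simp add: \<sigma>(2))
    also have "\<dots> = (\<Sum>S\<in>UNIV. (\<Prod>i\<in>\<sigma> -` S. \<epsilon> i * y $ (\<sigma> i)) *\<^sub>R c' (\<sigma> -` S))"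
    proof (rule sum.reindex_bij_betw[symmetric])
      show "bij_betw (\<lambda>S. \<sigma> -` S) UNIV UNIV"
        using \<sigma>(1) by (intro bij_betw_byWitness[where f' = "\<lambda>S. \<sigma> ` S"]) (auto simp: bij_is_inj bij_is_surj inj_vimage_image_eq surj_image_vimage_eq)
    qed
    also have "\<dots> = (\<Sum>S\<in>UNIV. (\<Prod>i\<in>S. y $ i) *\<^sub>R c S)"
    proof (rule sum.cong[OF refl])
      fix S
      have "(\<Prod>i\<in>\<sigma> -` S. y $ (\<sigma> i)) = (\<Prod>i\<in>S. y $ i)"
        using \<sigma>(1) by (intro prod.reindex_bij_betw) (auto simp: bij_betw_def surj_image_vimage_eq intro: inj_on_subset)
      then show "(\<Prod>i\<in>\<sigma> -` S. \<epsilon> i * y $ (\<sigma> i)) *\<^sub>R c' (\<sigma> -` S) = (\<Prod>i\<in>S. y $ i) *\<^sub>R c S"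
        by (simp add: c_def prod.distrib mult.commute)
    qed
    finally show ?thesis .
  qed
  then show ?thesis by blast
qed

lemma multilinear_on_cell_add:
  fixes v w :: "('d::finite) vfield"
  assumes "multilinear_on_cell K v" "multilinear_on_cell K w"
  shows "multilinear_on_cell K (\<lambda>x. v x + w x)"
proof -
  obtain R :: "'d vfield" and a b c where R: "orthogonal_transformation R" "box a b \<noteq> {}" "K = R ` cbox a b"
    and v: "\<forall>y\<in>cbox a b. v (R y) = (\<Sum>S\<in>UNIV. (\<Prod>i\<in>S. y $ i) *\<^sub>R c S)"
    using assms(1) unfolding multilinear_on_cell_def by blast
  obtain c' where "\<forall>y\<in>cbox a b. w (R y) = (\<Sum>S\<in>UNIV. (\<Prod>i\<in>S. y $ i) *\<^sub>R c' S)"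
    using multilinear_change_coordinates[OF R assms(2)] by blast
  with v have "\<forall>y\<in>cbox a b. v (R y) + w (R y) = (\<Sum>S\<in>UNIV. (\<Prod>i\<in>S. y $ i) *\<^sub>R (c S + c' S))"
    by (simp add: scaleR_add_right sum.distrib)
  then show ?thesis unfolding multilinear_on_cell_def using R by (intro exI[of _ R] exI[of _ a] exI[of _ b]) auto
qed

lemma multilinear_on_cell_scaleR:
  fixes v :: "('d::finite) vfield"
  assumes "multilinear_on_cell K v" shows "multilinear_on_cell K (\<lambda>x. r *\<^sub>R v x)"
proof -
  obtain R :: "'d vfield" and a b c where R: "orthogonal_transformation R" "box a b \<noteq> {}" "K = R ` cbox a b"
    and v: "\<forall>y\<in>cbox a b. v (R y) = (\<Sum>S\<in>UNIV. (\<Prod>i\<in>S. y $ i) *\<^sub>R c S)"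
    using assms unfolding multilinear_on_cell_def by blast
  have "\<forall>y\<in>cbox a b. r *\<^sub>R v (R y) = (\<Sum>S\<in>UNIV. (\<Prod>i\<in>S. y $ i) *\<^sub>R (r *\<^sub>R c S))"
    using v by (simp add: scaleR_sum_right mult.commute)
  then show ?thesis unfolding multilinear_on_cell_def using R
    by (intro exI[of _ R] exI[of _ a] exI[of _ b] exI[of _ "\<lambda>S. r *\<^sub>R c S"] conjI)
qed

lemma linear_on_cell_add:
  fixes v w :: "('d::finite) vfield"
  assumes "linear_on_cell K v" "linear_on_cell K w" shows "linear_on_cell K (\<lambda>x. v x + w x)"
proof -
  obtain c M c' M' where "\<forall>x\<in>K. v x = c + M *v x" "\<forall>x\<in>K. w x = c' + M' *v x"
    using assms unfolding linear_on_cell_def by blast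
  then have "\<forall>x\<in>K. v x + w x = (c + c') + (M + M') *v x" by (simp add: matrix_vector_mult_add_rdistrib)
  then show ?thesis unfolding linear_on_cell_def by blast
qed

lemma linear_on_cell_scaleR:
  fixes v :: "('d::finite) vfield"
  assumes "linear_on_cell K v" shows "linear_on_cell K (\<lambda>x. r *\<^sub>R v x)"
proof -
  obtain c M where "\<forall>x\<in>K. v x = c + M *v x"
    using assms unfolding linear_on_cell_def by blast
  then have "\<forall>x\<in>K. r *\<^sub>R v x = r *\<^sub>R c + (r *\<^sub>R M) *v x" by (simp add: scaleR_add_right scaleR_matrix_vector_assoc)
  then show ?thesis unfolding linear_on_cell_def by blast
qed

text \<open>Generators are the constant fields, indexed by \<open>None\<close>, and the coordinate
  functions in each component, indexed by \<open>Some k\<close>.\<close>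

lemma linear_local_span:
  fixes K :: "(real ^ 'd::finite) set"
  shows "\<exists>G. finite G \<and> (\<forall>w. linear_on_cell K w \<longrightarrow> (\<exists>f\<in>span G. \<forall>x\<in>K. w x = f x))"
proof -
  define G :: "'d vfield set" where "G = (\<lambda>(i, j) x. case j of None \<Rightarrow> axis i 1 | Some k \<Rightarrow> x $ k *\<^sub>R axis i 1) ` UNIV"
  have g1: "(\<lambda>x. axis i 1) \<in> G" for i unfolding G_def by (intro image_eqI[of _ _ "(i, None)"]) auto
  have g2: "(\<lambda>x. x $ k *\<^sub>R axis i 1) \<in> G" for i k unfolding G_def by (intro image_eqI[of _ _ "(i, Some k)"]) auto
  have "\<exists>f\<in>span G. \<forall>x\<in>K. w x = f x" if w: "linear_on_cell K w" for w
  proof -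
    obtain c M where cM: "\<forall>x\<in>K. w x = c + M *v x" using w unfolding linear_on_cell_def by blast
    define f :: "'d vfield" where "f = (\<Sum>i\<in>UNIV. c $ i *\<^sub>R (\<lambda>x. axis i 1)) + (\<Sum>k\<in>UNIV. \<Sum>i\<in>UNIV. M $ i $ k *\<^sub>R (\<lambda>x. x $ k *\<^sub>R axis i 1))"
    have "f \<in> span G" unfolding f_def by (intro span_add span_sum span_scale span_base g1 g2)
    moreover have "c + M *v x = f x" for x
      by (simp add: f_def sum_fun_apply vec_eq_iff matrix_vector_mult_def axis_def if_distrib cong: if_cong)
    ultimately show ?thesis using cM by auto
  qed
  moreover have "finite G" unfolding G_def by simp
  ultimately show ?thesis by blast
qed

text \<open>One frame of the cell is fixed, and by the change of coordinates every multilinear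
  function is a combination of products of distinct coordinates in that frame.\<close>

lemma multilinear_local_span:
  fixes K :: "(real ^ 'd::finite) set"
  assumes "box_cell K"
  shows "\<exists>G. finite G \<and> (\<forall>w. multilinear_on_cell K w \<longrightarrow> (\<exists>f\<in>span G. \<forall>x\<in>K. w x = f x))"
proof -
  obtain R :: "'d vfield" and a b where R: "orthogonal_transformation R" "box a b \<noteq> {}" "K = R ` cbox a b"
    using assms unfolding box_cell_def by blast
  have bij: "bij R" using orthogonal_transformation_bij[OF R(1)] .
  define G :: "'d vfield set" where "G = (\<lambda>(S, j) x. (\<Prod>i\<in>S. inv R x $ i) *\<^sub>R axis j 1) ` UNIV"
  have g: "(\<lambda>x. (\<Prod>i\<in>S. inv R x $ i) *\<^sub>R axis j 1) \<in> G" for S j unfolding G_def by (intro image_eqI[of _ _ "(S, j)"]) auto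
  have "\<exists>f\<in>span G. \<forall>x\<in>K. w x = f x" if w: "multilinear_on_cell K w" for w
  proof -
    obtain c where c: "\<forall>y\<in>cbox a b. w (R y) = (\<Sum>S\<in>UNIV. (\<Prod>i\<in>S. y $ i) *\<^sub>R c S)"
      using multilinear_change_coordinates[OF R w] by blast
    define f :: "'d vfield" where "f = (\<Sum>S\<in>UNIV. \<Sum>j\<in>UNIV. c S $ j *\<^sub>R (\<lambda>x. (\<Prod>i\<in>S. inv R x $ i) *\<^sub>R axis j 1))"
    have "f \<in> span G" unfolding f_def by (intro span_sum span_scale span_base g)
    moreover have "w x = f x" if "x \<in> K" for x
    proof -
      obtain y where y: "y \<in> cbox a b" "x = R y" using \<open>x \<in> K\<close> R(3) by blast
      have "inv R x = y" using bij y by (simp add: bij_is_inj)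
      then have "f x = (\<Sum>S\<in>UNIV. (\<Prod>i\<in>S. y $ i) *\<^sub>R c S)"
        by (simp add: f_def sum_fun_apply vec_eq_iff axis_def if_distrib mult.commute cong: if_cong)
      then show ?thesis using c y by simp
    qed
    ultimately show ?thesis by blast
  qed
  moreover have "finite G" unfolding G_def by simp
  ultimately show ?thesis by blast
qed

text \<open>Local generators become global by cutting them off to their cell; finitely many cells
  then give finitely many generators for the functions truncated to the union.\<close>

lemma piecewise_span:
  fixes \<T> :: "(real ^ 'd) set set" and V :: "'d vfield set"
  assumes fin: "finite \<T>" and loc: "\<And>K. K \<in> \<T> \<Longrightarrow> \<exists>G. finite G \<and> (\<forall>w\<in>V. \<exists>f\<in>span G. \<forall>x\<in>K. w x = f x)"
  shows "\<exists>G. finite G \<and> (\<forall>w\<in>V. (\<lambda>x. if x \<in> \<Union>\<T> then w x else 0) \<in> span G)"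
proof -
  \<comment> \<open>Cells share faces. Assigning each point to one cell keeps the sum of the cut-off
    pieces from counting a point twice.\<close>
  define \<kappa> where "\<kappa> = (\<lambda>x. SOME K. K \<in> \<T> \<and> x \<in> K)"
  have \<kappa>: "\<kappa> x \<in> \<T>" "x \<in> \<kappa> x" if "x \<in> \<Union>\<T>" for x
    using someI_ex[of "\<lambda>K. K \<in> \<T> \<and> x \<in> K"] that by (auto simp: \<kappa>_def)
  define \<Phi> where "\<Phi> = (\<lambda>K f x. if x \<in> \<Union>\<T> \<and> \<kappa> x = K then f x else (0 :: real ^ 'd))"
  have lin: "linear (\<Phi> K)" for K by (intro linearI) (auto simp: \<Phi>_def fun_eq_iff)
  obtain G where G: "\<And>K. K \<in> \<T> \<Longrightarrow> finite (G K)" "\<And>K w. K \<in> \<T> \<Longrightarrow> w \<in> V \<Longrightarrow> \<exists>f\<in>span (G K). \<forall>x\<in>K. w x = f x"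
    using loc by metis
  define H where "H = (\<Union>K\<in>\<T>. \<Phi> K ` G K)"
  have "(\<lambda>x. if x \<in> \<Union>\<T> then w x else 0) \<in> span H" if w: "w \<in> V" for w
  proof -
    obtain f where f: "\<And>K. K \<in> \<T> \<Longrightarrow> f K \<in> span (G K)" "\<And>K x. K \<in> \<T> \<Longrightarrow> x \<in> K \<Longrightarrow> w x = f K x"
      using G(2)[OF _ w] by metis
    have "(\<Sum>K\<in>\<T>. \<Phi> K (f K)) \<in> span H"
    proof (rule span_sum)
      fix K assume K: "K \<in> \<T>"
      have "\<Phi> K (f K) \<in> span (\<Phi> K ` G K)" using linear_span_image[OF lin, of K "G K"] f(1)[OF K] by blast
      then show "\<Phi> K (f K) \<in> span H" using K span_mono[of "\<Phi> K ` G K" H] by (auto simp: H_def)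
    qed
    moreover have "(\<Sum>K\<in>\<T>. \<Phi> K (f K)) = (\<lambda>x. if x \<in> \<Union>\<T> then w x else 0)"
    proof
      fix x
      show "(\<Sum>K\<in>\<T>. \<Phi> K (f K)) x = (if x \<in> \<Union>\<T> then w x else 0)"
      proof (cases "x \<in> \<Union>\<T>")
        case True
        have "(\<Sum>K\<in>\<T>. \<Phi> K (f K) x) = (\<Sum>K\<in>\<T>. if K = \<kappa> x then f (\<kappa> x) x else 0)"
          using True by (intro sum.cong) (auto simp: \<Phi>_def)
        also have "\<dots> = w x" using fin \<kappa>[OF True] f(2) by simp
        finally show ?thesis using True by (simp add: sum_fun_apply)
      next
        case False
        then show ?thesis by (auto simp: sum_fun_apply \<Phi>_def)
      qed
    qed
    ultimately show ?thesis by simp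
  qed
  moreover have "finite H" unfolding H_def using fin G(1) by auto
  ultimately show ?thesis by blast
qed

section \<open>The finite element space as a subspace with finitely many representatives\<close>

context bounded_open_set
begin

lemma fe_space_subspace:
  assumes "fe_space \<Omega> \<T> V"
  shows "subspace V" "V \<subseteq> H10_space \<Omega>"
proof -
  have gen: "subspace {w \<in> H10_space \<Omega>. continuous_on (closure \<Omega>) w \<and> (\<forall>K\<in>\<T>. P K w)}"
    if P: "\<And>K v w. P K v \<Longrightarrow> P K w \<Longrightarrow> P K (\<lambda>x. v x + w x)" "\<And>K v r. P K v \<Longrightarrow> P K (\<lambda>x. r *\<^sub>R v x)" and z: "\<forall>K\<in>\<T>. P K 0"
    for P :: "(real ^ 'd) set \<Rightarrow> 'd vfield \<Rightarrow> bool"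
  proof -
    have "continuous_on (closure \<Omega>) (0 :: 'd vfield)" by (simp add: zero_fun_def)
    moreover have "(\<lambda>x. v x + w x) \<in> H10_space \<Omega>" if "v \<in> H10_space \<Omega>" "w \<in> H10_space \<Omega>" for v w :: "'d vfield"
      using subspace_add[OF H10_subspace that] by (simp add: plus_fun_def)
    moreover have "(\<lambda>x. c *\<^sub>R v x) \<in> H10_space \<Omega>" if "v \<in> H10_space \<Omega>" for c and v :: "'d vfield"
      using subspace_scale[OF H10_subspace that] by (simp add: scaleR_fun_def)
    ultimately show ?thesis unfolding subspace_def plus_fun_def scaleR_fun_def
      using z P subspace_0[OF H10_subspace]
      by (intro conjI ballI allI CollectI) (auto intro!: continuous_on_add continuous_on_scaleR continuous_on_const)
  qed
  have V: "(V = {w \<in> H10_space \<Omega>. continuous_on (closure \<Omega>) w \<and> (\<forall>K\<in>\<T>. linear_on_cell K w)}) \<or>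
    (\<forall>K\<in>\<T>. box_cell K) \<and> V = {w \<in> H10_space \<Omega>. continuous_on (closure \<Omega>) w \<and> (\<forall>K\<in>\<T>. multilinear_on_cell K w)}"
    using assms by (auto simp: fe_space_def)
  then show "V \<subseteq> H10_space \<Omega>" by blast
  from V show "subspace V"
  proof (elim disjE conjE)
    have z: "linear_on_cell K 0" for K :: "(real ^ 'd) set"
      unfolding linear_on_cell_def by (intro exI[of _ 0]) simp
    assume V: "V = {w \<in> H10_space \<Omega>. continuous_on (closure \<Omega>) w \<and> (\<forall>K\<in>\<T>. linear_on_cell K w)}"
    show ?thesis unfolding V
    proof (rule gen[of linear_on_cell])
      show "\<forall>K\<in>\<T>. linear_on_cell K 0" using z by blast
    qed (rule linear_on_cell_add linear_on_cell_scaleR; assumption)+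
  next
    assume b: "\<forall>K\<in>\<T>. box_cell K" and V: "V = {w \<in> H10_space \<Omega>. continuous_on (closure \<Omega>) w \<and> (\<forall>K\<in>\<T>. multilinear_on_cell K w)}"
    \<comment> \<open>Even for the zero function \<open>multilinear_on_cell\<close> demands that the
      cell is a rotated box, which \<open>box_cell\<close> supplies.\<close>
    have "\<forall>K\<in>\<T>. multilinear_on_cell K 0"
    proof
      fix K assume "K \<in> \<T>"
      with b have "box_cell K" by (rule bspec)
      then obtain R :: "'d vfield" and a b' where "orthogonal_transformation R" "box a b' \<noteq> {}" "K = R ` cbox a b'"
        unfolding box_cell_def by (elim exE conjE)
      moreover have "\<forall>y\<in>cbox a b'. (0 :: 'd vfield) (R y) = (\<Sum>S\<in>UNIV. (\<Prod>i\<in>S. y $ i) *\<^sub>R (\<lambda>_. 0) S)"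
        by (simp only: zero_fun_apply scaleR_zero_right sum.neutral_const) simp
      ultimately show "multilinear_on_cell K 0" unfolding multilinear_on_cell_def
        by (intro exI[of _ R] exI[of _ a] exI[of _ b'] exI[of _ "\<lambda>_. 0"] conjI)
    qed
    note z = this
    show ?thesis unfolding V
    proof (rule gen[of multilinear_on_cell])
      show "\<forall>K\<in>\<T>. multilinear_on_cell K 0" using z by blast
    qed (rule multilinear_on_cell_add multilinear_on_cell_scaleR; assumption)+
  qed
qed

text \<open>Values outside the closure of \<Omega> are arbitrary, so \<open>V\<close> itself has no
  finite basis. The truncation \<open>E\<close> to the closure is linear, stays in \<open>V\<close>,
  changes nothing almost everywhere on \<Omega>, and has its range in a finitely generated
  space.\<close>

lemma fe_space_basis:
  assumes part: "shape_regular_partition \<Omega> \<kappa> \<T>" and fe: "fe_space \<Omega> \<T> V"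
  shows "\<exists>Z. finite Z \<and> span Z \<subseteq> V \<and> (\<forall>w\<in>V. \<exists>z\<in>span Z. AE x in lebesgue_on \<Omega>. w x = z x)"
proof -
  have fin: "finite \<T>" and un: "\<Union>\<T> = closure \<Omega>" using part by (auto simp: shape_regular_partition_def)
  define E where "E = (\<lambda>w x. if x \<in> \<Union>\<T> then w x else (0 :: real ^ 'd))"
  have loc: "\<exists>G. finite G \<and> (\<forall>w\<in>V. \<exists>f\<in>span G. \<forall>x\<in>K. w x = f x)" if K: "K \<in> \<T>" for K
  proof -
    from fe consider "V = {w \<in> H10_space \<Omega>. continuous_on (closure \<Omega>) w \<and> (\<forall>K\<in>\<T>. linear_on_cell K w)}"
      | "\<forall>K\<in>\<T>. box_cell K" "V = {w \<in> H10_space \<Omega>. continuous_on (closure \<Omega>) w \<and> (\<forall>K\<in>\<T>. multilinear_on_cell K w)}"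
      by (auto simp: fe_space_def)
    then show ?thesis
    proof cases
      case 1
      then show ?thesis using linear_local_span[of K] K by blast
    next
      case 2
      then show ?thesis using multilinear_local_span[of K] K by blast
    qed
  qed
  obtain G where G: "finite G" "\<And>w. w \<in> V \<Longrightarrow> E w \<in> span G"
    using piecewise_span[OF fin loc] unfolding E_def by blast
  have Eeq: "E w x = w x" if "x \<in> closure \<Omega>" for w x using that un by (simp add: E_def)
  have EAE: "AE x in lebesgue_on \<Omega>. w x = E w x" for w
    using Eeq closure_subset[of \<Omega>] by (intro AE_I2) (auto simp: space_restrict_space)
  have cell: "K \<subseteq> closure \<Omega>" if "K \<in> \<T>" for K using that un by blast
  \<comment> \<open>Truncation alters a function only off the closure of \<Omega>, that is, off all
    cells, so every condition that defines \<open>V\<close> is preserved.\<close>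
  have EV: "E w \<in> V" if w: "w \<in> V" for w
  proof -
    have wH: "w \<in> H10_space \<Omega>" using fe_space_subspace(2)[OF fe] w by blast
    have c: "continuous_on (closure \<Omega>) (E w) = continuous_on (closure \<Omega>) w" by (rule continuous_on_cong) (auto simp: Eeq)
    have l: "linear_on_cell K (E w) = linear_on_cell K w" if "K \<in> \<T>" for K
      using cell[OF that] Eeq[of _ w] unfolding linear_on_cell_def by (metis subsetD)
    have m: "multilinear_on_cell K (E w) = multilinear_on_cell K w" if "K \<in> \<T>" for K
    proof -
      have "(\<forall>y\<in>cbox a b. E w (R y) = h y) \<longleftrightarrow> (\<forall>y\<in>cbox a b. w (R y) = h y)" if "K = R ` cbox a b"
        for R :: "'d vfield" and a b h
        using cell[OF \<open>K \<in> \<T>\<close>] Eeq[of _ w] that by (metis imageI subsetD)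
      then show ?thesis unfolding multilinear_on_cell_def by (intro ex_cong1 conj_cong refl)
    qed
    show ?thesis using fe w H10_AE[OF wH EAE] c l m unfolding fe_space_def by blast
  qed
  have lin: "linear E" by (intro linearI) (auto simp: E_def fun_eq_iff)
  have sub: "subspace (E ` V)" by (rule linear_subspace_image[OF lin fe_space_subspace(1)[OF fe]])
  obtain Z where Z: "Z \<subseteq> E ` V" "independent Z" "E ` V \<subseteq> span Z"
    using maximal_independent_subset by blast
  have "Z \<subseteq> span G" using Z(1) G(2) by blast
  then have "finite Z" using independent_span_bound[OF G(1) Z(2)] by blast
  moreover have "span Z \<subseteq> V" using span_minimal[OF Z(1) sub] EV by blast
  ultimately show ?thesis using Z(3) EAE by blast
qed

text \<open>The functional is represented on the finite-dimensional space of representatives. An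
  arbitrary element of \<open>V\<close> differs from a representative by a function of seminorm 0,
  on which both the form and the bounded functional vanish.\<close>

lemma fe_riesz:
  assumes part: "shape_regular_partition \<Omega> \<kappa> \<T>" and fe: "fe_space \<Omega> \<T> V"
    and A: "semi_inner (H10_space \<Omega>) a" and null: "\<And>w. w \<in> H10_space \<Omega> \<Longrightarrow> AE x in lebesgue_on \<Omega>. w x = 0 \<Longrightarrow> seminrm a w = 0"
    and l: "\<And>x y. x \<in> V \<Longrightarrow> y \<in> V \<Longrightarrow> l (x + y) = l x + l y" "\<And>x c. x \<in> V \<Longrightarrow> l (c *\<^sub>R x) = c * l x"
      "\<And>x. x \<in> V \<Longrightarrow> \<bar>l x\<bar> \<le> K * seminrm a x"
  shows "\<exists>w\<in>V. \<forall>x\<in>V. a w x = l x"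
proof -
  interpret semi_inner "H10_space \<Omega>" a by (rule A)
  note V = fe_space_subspace[OF fe]
  obtain Z where Z: "finite Z" "span Z \<subseteq> V" "\<And>w. w \<in> V \<Longrightarrow> \<exists>z\<in>span Z. AE x in lebesgue_on \<Omega>. w x = z x"
    using fe_space_basis[OF part fe] by blast
  have ZH: "Z \<subseteq> H10_space \<Omega>" using Z(2) V(2) span_superset[of Z] by blast
  have "\<exists>w\<in>span Z. \<forall>x\<in>span Z. a w x = l x"
    by (rule riesz_span[OF Z(1) ZH, of l K]) (use Z(2) l in blast)+
  then obtain w where w: "w \<in> span Z" "\<And>x. x \<in> span Z \<Longrightarrow> a w x = l x" by blast
  have wH: "w \<in> H10_space \<Omega>" using w(1) Z(2) V(2) by blast
  have "a w x = l x" if x: "x \<in> V" for x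
  proof -
    obtain z where z: "z \<in> span Z" "AE y in lebesgue_on \<Omega>. x y = z y" using Z(3)[OF x] by blast
    have zV: "z \<in> V" using z(1) Z(2) by blast
    define d where "d = x - z"
    have dV: "d \<in> V" unfolding d_def by (rule subspace_diff[OF V(1) x zV])
    have dH: "d \<in> H10_space \<Omega>" using dV V(2) by blast
    have "AE y in lebesgue_on \<Omega>. d y = 0" using z(2) by (rule eventually_mono) (simp add: d_def)
    then have n: "seminrm a d = 0" by (rule null[OF dH])
    have "a w d = 0" using Cauchy_Schwarz[OF wH dH] n by simp
    moreover have "l d = 0" using l(3)[OF dV] n by simp
    moreover have e: "x = z + d" by (simp add: d_def)
    moreover have "a w (z + d) = a w z + a w d" using zV V(2) by (intro add_right dH wH) blast
    moreover have "l (z + d) = l z + l d" by (rule l(1)[OF zV dV])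
    ultimately show ?thesis using w(2)[OF z(1)] by (simp only: e)
  qed
  then show ?thesis using w(1) Z(2) by blast
qed

lemma mesh_size_pos:
  assumes part: "shape_regular_partition \<Omega> \<kappa> \<T>" and h: "h = Max (diameter ` \<T>)" and ne: "\<Omega> \<noteq> {}"
  shows "0 < h"
proof -
  have fin: "finite \<T>" and un: "\<Union>\<T> = closure \<Omega>" using part by (auto simp: shape_regular_partition_def)
  obtain K where K: "K \<in> \<T>" using un ne closure_subset[of \<Omega>] by blast
  obtain x r where r: "0 < r" "cball x r \<subseteq> K" using part K by (auto simp: shape_regular_partition_def)
  have "bounded K" using K un bounded_closure[OF bd] bounded_subset by blast
  then have "diameter (cball x r) \<le> diameter K" by (rule diameter_subset[OF r(2)])
  then have "0 < diameter K" using r(1) by simp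
  also have "\<dots> \<le> h" unfolding h using fin K by (intro Max_ge) auto
  finally show ?thesis .
qed

text \<open>The best approximation is an infimum, so a slack is needed; it is taken as
  \<open>h * \<delta>\<close>, because the estimate is divided by \<open>h\<close> at the end. The
  absolute value is there because \<open>Capp\<close> has no prescribed sign.\<close>

lemma fe_approximation:
  assumes fe: "fe_discretization \<Omega> \<kappa> Capp Cinv \<T> h V" and ne: "\<Omega> \<noteq> {}"
    and u: "u \<in> H_space 2 \<Omega> \<inter> H10_space \<Omega>" and \<delta>: "0 < \<delta>"
  shows "\<exists>\<zeta>\<in>V. H_norm 1 \<Omega> (u - \<zeta>) \<le> \<bar>Capp\<bar> * h * H_norm 2 \<Omega> u + \<delta>"
proof -
  have h: "0 < h" using fe mesh_size_pos[of \<kappa> \<T> h] ne by (simp add: fe_discretization_def)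
  have V: "subspace V" "V \<subseteq> H10_space \<Omega>" using fe fe_space_subspace[of \<T> V] by (auto simp: fe_discretization_def)
  have Vne: "V \<noteq> {}" using subspace_0[OF V(1)] by blast
  have "(INF z\<in>V. H_norm 0 \<Omega> (\<lambda>x. u x - z x) + h * H_norm 1 \<Omega> (\<lambda>x. u x - z x)) \<le> Capp * h\<^sup>2 * H_norm 2 \<Omega> u"
    using fe u unfolding fe_discretization_def by blast
  also have "\<dots> < Capp * h\<^sup>2 * H_norm 2 \<Omega> u + h * \<delta>" using h \<delta> by simp
  finally obtain z where z: "z \<in> V" "H_norm 0 \<Omega> (\<lambda>x. u x - z x) + h * H_norm 1 \<Omega> (\<lambda>x. u x - z x) < Capp * h\<^sup>2 * H_norm 2 \<Omega> u + h * \<delta>"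
    using cInf_lessD[of "(\<lambda>z. H_norm 0 \<Omega> (\<lambda>x. u x - z x) + h * H_norm 1 \<Omega> (\<lambda>x. u x - z x)) ` V"] Vne by auto
  have e: "(\<lambda>x. u x - z x) = u - z" by (auto simp: fun_eq_iff)
  have dH: "u - z \<in> H_space 0 \<Omega>"
  proof -
    have "u - z \<in> H10_space \<Omega>" using u z(1) V(2) by (intro subspace_diff[OF H10_subspace]) auto
    then show ?thesis using H_space_L2[OF H10_H1] by simp
  qed
  have "0 \<le> H_norm 0 \<Omega> (u - z)" unfolding H_norm_eq by (rule semi_inner.seminrm_nonneg[OF H_semi_inner dH])
  moreover have "0 \<le> H_norm 2 \<Omega> u" unfolding H_norm_eq using u by (intro semi_inner.seminrm_nonneg[OF H_semi_inner]) auto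
  then have "Capp * (h\<^sup>2 * H_norm 2 \<Omega> u) \<le> \<bar>Capp\<bar> * (h\<^sup>2 * H_norm 2 \<Omega> u)" by (intro mult_right_mono) auto
  ultimately have "h * H_norm 1 \<Omega> (u - z) \<le> h * (\<bar>Capp\<bar> * h * H_norm 2 \<Omega> u + \<delta>)"
    using z(2)[unfolded e] by (simp add: distrib_left power2_eq_square mult_ac)
  then have "H_norm 1 \<Omega> (u - z) \<le> \<bar>Capp\<bar> * h * H_norm 2 \<Omega> u + \<delta>" using h by simp
  then show ?thesis using z(1) by blast
qed

end

section \<open>Sums of exponentials\<close>

text \<open>If the left end point were a node, the rule would give \<open>0\<close> for the nonnegative polynomial that is
  the product of \<open>1 + x\<close> and the squares of the linear factors of the other nodes.\<close>

lemma gauss_quadrature_node_gt: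
  assumes g: "gauss_quadrature J \<omega> \<xi>" and j: "j \<in> {1..J}"
  shows "- 1 < \<xi> j"
proof (rule ccontr)
  assume "\<not> - 1 < \<xi> j"
  moreover have "\<xi> j \<in> {-1..1}" using g j unfolding gauss_quadrature_def by blast
  ultimately have \<xi>j: "\<xi> j = - 1" by auto
  define p where "p = [:1, 1:] * (\<Prod>i\<in>{1..J} - {j}. [:- \<xi> i, 1:]) ^ 2"
  have nz: "p \<noteq> 0" unfolding p_def by (simp only: mult_eq_0_iff power_eq_0_iff) (simp add: prod_zero_iff)
  \<comment> \<open>This is the largest degree for which the rule is exact.\<close>
  have "degree p = 1 + 2 * (J - 1)"
    unfolding p_def using j by (subst degree_mult_eq) (auto simp: degree_power_eq degree_prod_eq_sum_degree prod_zero_iff)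
  then have deg: "degree p \<le> 2 * J - 1" using j by auto
  have pv: "poly p x = (1 + x) * (\<Prod>i\<in>{1..J} - {j}. x - \<xi> i)\<^sup>2" for x
    by (simp add: p_def poly_prod distrib_right)
  have "\<omega> i * poly p (\<xi> i) = 0" if "i \<in> {1..J}" for i
  proof (cases "i = j")
    case True
    then show ?thesis by (simp add: pv \<xi>j)
  next
    case False
    then have "(\<Prod>k\<in>{1..J} - {j}. \<xi> i - \<xi> k) = 0" using that by (intro prod_zero) auto
    then show ?thesis by (simp add: pv)
  qed
  then have "(\<Sum>i=1..J. \<omega> i * poly p (\<xi> i)) = 0" by (intro sum.neutral) auto
  moreover have "(\<Sum>i=1..J. \<omega> i * poly p (\<xi> i)) = integral {-1..1} (poly p)"
    using g deg unfolding gauss_quadrature_def by blast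
  ultimately have "integral {-1..1} (poly p) = 0" by simp
  moreover have "continuous_on {-1..1} (poly p)" by (intro continuous_intros)
  moreover have "0 \<le> poly p x" if "x \<in> {-1..1}" for x using that by (simp add: pv)
  ultimately have "\<forall>x\<in>{-1..1}. poly p x = 0" using integral_eq_0_iff[of "-1" 1 "poly p"] by auto
  then have "{-1..1} \<subseteq> {x. poly p x = 0}" by auto
  then have "finite {-1..1::real}" using poly_roots_finite[OF nz] finite_subset by blast
  then show False by (simp add: infinite_Icc)
qed

text \<open>Since \<open>soe_r q k \<le> soe_c q k\<close>, a node above -1 keeps the base of the
  power positive. For \<open>k = 0\<close> the two constants are equal, so the strict inequality for
  the node is essential.\<close>

lemma soe_pairs_rate_pos:
  assumes "soe_pairs \<alpha> q K J a b" "1 < q" "i \<in> {1..(K + 1) * J}"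
  shows "0 < a i"
proof -
  obtain \<omega> \<xi> e where g: "gauss_quadrature J \<omega> \<xi>" and e: "bij_betw e {1..(K + 1) * J} ({0..K} \<times> {1..J})"
    and ab: "\<forall>i\<in>{1..(K + 1) * J}. a i = soe_a \<alpha> q \<xi> (fst (e i)) (snd (e i)) \<and> b i = soe_b \<alpha> q \<omega> \<xi> (fst (e i)) (snd (e i))"
    using assms(1) unfolding soe_pairs_def by (elim exE conjE)
  have a: "a i = soe_a \<alpha> q \<xi> (fst (e i)) (snd (e i))" using bspec[OF ab assms(3)] by (rule conjunct1)
  have "snd (e i) \<in> {1..J}" using bspec[OF bij_betwE[OF e] assms(3)] by (simp add: mem_Times_iff)
  then have \<xi>: "- 1 < \<xi> (snd (e i))" by (rule gauss_quadrature_node_gt[OF g])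
  have r: "0 < soe_r q k" "soe_r q k \<le> soe_c q k" for k
    using assms(2) by (auto simp: soe_r_def soe_c_def divide_right_mono mult_right_mono)
  have "0 < soe_r q k * \<xi> (snd (e i)) + soe_c q k" for k
  proof -
    have "0 < soe_r q k * (\<xi> (snd (e i)) + 1)" using r \<xi> by (intro mult_pos_pos) auto
    then show ?thesis using r(2)[of k] by (simp add: distrib_left)
  qed
  from this[of "fst (e i)"] show ?thesis by (simp add: a soe_a_def)
qed

section \<open>The exponential sum, its cell integrals and the history variables\<close>

definition soe_kernel :: "real \<Rightarrow> nat \<Rightarrow> (nat \<Rightarrow> real) \<Rightarrow> (nat \<Rightarrow> real) \<Rightarrow> real \<Rightarrow> real" where
  "soe_kernel \<tau> M a b t = (\<Sum>j=1..M. b j * exp (- (a j / \<tau>) * t))"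

text \<open>The integral of \<open>soe_kernel\<close> over the cell from (m - 1) \<Delta> to m
  \<Delta>, in closed form. The convolutions use \<open>m \<ge> 1\<close>, where the subtraction is
  not truncated.\<close>

definition soe_weight :: "real \<Rightarrow> real \<Rightarrow> nat \<Rightarrow> (nat \<Rightarrow> real) \<Rightarrow> (nat \<Rightarrow> real) \<Rightarrow> nat \<Rightarrow> real" where
  "soe_weight \<tau> \<Delta> M a b m =
     (\<Sum>j=1..M. b j * \<tau> / a j * (1 - exp (- (a j / \<tau>) * \<Delta>)) * exp (- (a j / \<tau>) * \<Delta>) ^ (m - 1))"

lemma soe_kernel_continuous: "continuous_on A (soe_kernel \<tau> M a b)"
  unfolding soe_kernel_def by (intro continuous_intros)

lemma soe_weight_has_integral:
  assumes a: "\<And>j. j \<in> {1..M} \<Longrightarrow> 0 < a j" and \<tau>: "0 < \<tau>" and \<Delta>: "0 < \<Delta>" and k: "k < n"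
  shows "((\<lambda>s. soe_kernel \<tau> M a b (real n * \<Delta> - s)) has_integral soe_weight \<tau> \<Delta> M a b (n - k)) {real k * \<Delta>..real (Suc k) * \<Delta>}"
  unfolding soe_kernel_def soe_weight_def
proof (rule has_integral_sum)
  fix j assume "j \<in> {1..M}"
  define c where "c = a j / \<tau>"
  have c: "0 < c" using a[OF \<open>j \<in> {1..M}\<close>] \<tau> by (simp add: c_def)
  define \<Phi> where "\<Phi> = (\<lambda>s. b j / c * exp (- c * (real n * \<Delta> - s)))"
  have "((\<lambda>s. b j * exp (- c * (real n * \<Delta> - s))) has_integral (\<Phi> (real (Suc k) * \<Delta>) - \<Phi> (real k * \<Delta>))) {real k * \<Delta>..real (Suc k) * \<Delta>}"
  proof (rule fundamental_theorem_of_calculus)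
    show "real k * \<Delta> \<le> real (Suc k) * \<Delta>" using \<Delta> by (intro mult_right_mono) auto
    show "(\<Phi> has_vector_derivative b j * exp (- c * (real n * \<Delta> - s))) (at s within {real k * \<Delta>..real (Suc k) * \<Delta>})" for s
      unfolding \<Phi>_def has_real_derivative_iff_has_vector_derivative[symmetric] using c
      by (auto intro!: derivative_eq_intros)
  qed
  moreover have "\<Phi> (real (Suc k) * \<Delta>) - \<Phi> (real k * \<Delta>) = b j * \<tau> / a j * (1 - exp (- (a j / \<tau>) * \<Delta>)) * exp (- (a j / \<tau>) * \<Delta>) ^ (n - k - 1)"
  proof -
    obtain m where m: "n = Suc (k + m)" using k less_iff_Suc_add by blast
    have "exp (- c * (real n * \<Delta> - real (Suc k) * \<Delta>)) = exp (- c * \<Delta>) ^ m"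
      "exp (- c * (real n * \<Delta> - real k * \<Delta>)) = exp (- c * \<Delta>) ^ m * exp (- c * \<Delta>)"
      unfolding m exp_of_nat_mult[symmetric] exp_add[symmetric] by (simp_all add: algebra_simps)
    moreover have "b j / c = b j * \<tau> / a j" by (simp add: c_def)
    ultimately show ?thesis unfolding \<Phi>_def using m by (simp add: c_def algebra_simps)
  qed
  ultimately show "((\<lambda>s. b j * exp (- (a j / \<tau>) * (real n * \<Delta> - s))) has_integral
      b j * \<tau> / a j * (1 - exp (- (a j / \<tau>) * \<Delta>)) * exp (- (a j / \<tau>) * \<Delta>) ^ (n - k - 1)) {real k * \<Delta>..real (Suc k) * \<Delta>}"
    by (simp add: c_def)
qed simp

text \<open>As a cell integral the weight is bounded by the maximum of the whole sum, with no
  reference to the number, rates or coefficients of the exponentials.\<close>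

lemma soe_weight_bound:
  assumes a: "\<And>j. j \<in> {1..M} \<Longrightarrow> 0 < a j" and \<tau>: "0 < \<tau>" and \<Delta>: "0 < \<Delta>"
    and G: "\<And>r. 0 \<le> r \<Longrightarrow> r \<le> T \<Longrightarrow> \<bar>soe_kernel \<tau> M a b r\<bar> \<le> G" and m: "1 \<le> m" "real m * \<Delta> \<le> T"
  shows "\<bar>soe_weight \<tau> \<Delta> M a b m\<bar> \<le> G * \<Delta>"
proof -
  have T: "0 \<le> T" using m \<Delta> by (meson mult_nonneg_nonneg of_nat_0_le_iff less_imp_le order_trans)
  have "((\<lambda>s. soe_kernel \<tau> M a b (real m * \<Delta> - s)) has_integral soe_weight \<tau> \<Delta> M a b m) {0..\<Delta>}"
    using soe_weight_has_integral[where k = 0 and n = m and b = b, OF a \<tau> \<Delta>] m(1) by simp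
  moreover have "\<bar>soe_kernel \<tau> M a b (real m * \<Delta> - s)\<bar> \<le> G" if "s \<in> {0..\<Delta>}" for s
  proof (rule G)
    have "1 * \<Delta> \<le> real m * \<Delta>" using m(1) \<Delta> by (intro mult_right_mono) auto
    then show "0 \<le> real m * \<Delta> - s" using that by simp
    show "real m * \<Delta> - s \<le> T" using that m(2) by simp
  qed
  ultimately have "norm (soe_weight \<tau> \<Delta> M a b m) \<le> G * measure lborel {0..\<Delta>}"
    using G[of 0] T by (intro has_integral_bound_real[where f = "\<lambda>s. soe_kernel \<tau> M a b (real m * \<Delta> - s)"]) auto
  then show ?thesis using \<Delta> by simp
qed

text \<open>The recursion unrolls into powers of the decay factor over one step. The newest term is
  \<open>U (n - 1)\<close>, so the history at level \<open>n\<close> is explicit.\<close>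

lemma soe_history_eq:
  "soe_history \<tau> \<Delta> a b U j n =
     (\<Sum>k<n. (b j * \<tau> / a j * (1 - exp (- (a j / \<tau>) * \<Delta>)) * exp (- (a j / \<tau>) * \<Delta>) ^ (n - k - 1)) *\<^sub>R U k)"
proof (induction n)
  case 0
  show ?case by (simp add: zero_fun_def)
next
  case (Suc n)
  define e where "e = exp (- (a j / \<tau>) * \<Delta>)"
  define w where "w = b j * \<tau> / a j * (1 - e)"
  have "soe_history \<tau> \<Delta> a b U j (Suc n) = e *\<^sub>R soe_history \<tau> \<Delta> a b U j n + w *\<^sub>R U n"
    by (simp add: fun_eq_iff e_def w_def)
  also have "e *\<^sub>R soe_history \<tau> \<Delta> a b U j n = (\<Sum>k<n. (w * e ^ (Suc n - k - 1)) *\<^sub>R U k)"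
    unfolding Suc.IH e_def[symmetric] w_def[symmetric] scaleR_sum_right
  proof (rule sum.cong[OF refl])
    fix k assume "k \<in> {..<n}"
    then have "Suc n - k - 1 = Suc (n - k - 1)" by auto
    then show "e *\<^sub>R (w * e ^ (n - k - 1)) *\<^sub>R U k = (w * e ^ (Suc n - k - 1)) *\<^sub>R U k" by (simp add: mult_ac)
  qed
  moreover have "(w * e ^ (Suc n - n - 1)) *\<^sub>R U n = w *\<^sub>R U n" by simp
  ultimately show ?case unfolding e_def[symmetric] w_def[symmetric] by (simp only: sum.lessThan_Suc)
qed

lemma relax_kernel_measurable: "relax_kernel \<alpha> \<tau> \<in> borel_measurable borel"
  unfolding relax_kernel_def mittag_leffler_def by measurable

lemma soe_kernel_bounded_on_interval:
  "\<exists>G. \<forall>t\<in>{0..T}. \<bar>soe_kernel \<tau> M a b t\<bar> \<le> G"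
proof -
  have "compact (soe_kernel \<tau> M a b ` {0..T})" by (intro compact_continuous_image soe_kernel_continuous) auto
  then show ?thesis using compact_imp_bounded bounded_iff by (metis imageI real_norm_def)
qed

text \<open>The accuracy, and with it the bound on the sum, is available for positive times;
  continuity extends it to 0.\<close>

lemma bound_at_left_end:
  fixes \<kappa> :: "real \<Rightarrow> real"
  assumes T: "0 < T" and \<kappa>: "continuous_on UNIV \<kappa>" and G: "\<And>r. 0 < r \<Longrightarrow> r \<le> T \<Longrightarrow> \<bar>\<kappa> r\<bar> \<le> G"
    and r: "0 \<le> r" "r \<le> T"
  shows "\<bar>\<kappa> r\<bar> \<le> G"
proof (cases "r = 0")
  case True
  have "(\<kappa> \<longlongrightarrow> \<kappa> 0) (at_right 0)" using \<kappa> by (auto simp: continuous_on_eq_continuous_at isCont_def intro: tendsto_mono at_within_le_at)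
  then have "((\<lambda>x. \<bar>\<kappa> x\<bar>) \<longlongrightarrow> \<bar>\<kappa> 0\<bar>) (at_right 0)" by (rule tendsto_rabs)
  moreover have "eventually (\<lambda>x. \<bar>\<kappa> x\<bar> \<le> G) (at_right 0)"
    using eventually_at_right_real[OF T] by (rule eventually_mono) (auto intro: G)
  ultimately show ?thesis unfolding True by (rule tendsto_upperbound) simp
qed (use G r in auto)

section \<open>The fully discrete scheme\<close>

lemma bilinear_on_subset:
  assumes B: "bilinear_on S B" and S': "S' \<subseteq> S" "subspace S'"
  shows "bilinear_on S' B"
proof -
  interpret bilinear_on S B by (rule B)
  show ?thesis
    by unfold_locales (rule S' | (rule add_left add_right scale_left scale_right; rule subsetD[OF S'(1)]; assumption))+
qed

lemma semi_inner_subset: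
  assumes B: "semi_inner S B" and S': "S' \<subseteq> S" "subspace S'"
  shows "semi_inner S' B"
proof -
  interpret semi_inner S B by (rule B)
  interpret S': bilinear_on S' B by (rule bilinear_on_subset[OF bilinear_on_axioms S'])
  show ?thesis by unfold_locales (rule commute nonneg; rule subsetD[OF S'(1)]; assumption)+
qed

context bounded_open_set
begin

lemma H10_L2: "u \<in> H10_space \<Omega> \<Longrightarrow> u \<in> L2_space \<Omega>"
  using H10_H1 H_space_L2 by blast

text \<open>Exchanging the sums merges all histories into a single convolution. From here on the
  exponentials appear only through their sum.\<close>

lemma elastic_form_soe_history:
  assumes M: "bounded_tensor \<Omega> K BB" and U: "\<And>k. k < n \<Longrightarrow> U k \<in> H10_space \<Omega>" and \<zeta>: "\<zeta> \<in> H10_space \<Omega>"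
  shows "(\<Sum>j=1..N. elastic_form \<Omega> BB (soe_history \<tau> \<Delta> a b U j n) \<zeta>) =
    (\<Sum>k<n. soe_weight \<tau> \<Delta> N a b (n - k) * elastic_form \<Omega> BB (U k) \<zeta>)"
proof -
  interpret bilinear_on "H10_space \<Omega>" "elastic_form \<Omega> BB"
    by (rule bilinear_on_subset[OF elastic_form_bilinear[OF M] _ H10_subspace]) (use H10_H1 in blast)
  define w where "w = (\<lambda>j m. b j * \<tau> / a j * (1 - exp (- (a j / \<tau>) * \<Delta>)) * exp (- (a j / \<tau>) * \<Delta>) ^ (m - 1))"
  have "elastic_form \<Omega> BB (soe_history \<tau> \<Delta> a b U j n) \<zeta> = (\<Sum>k<n. w j (n - k) * elastic_form \<Omega> BB (U k) \<zeta>)" for j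
  proof -
    have "elastic_form \<Omega> BB (soe_history \<tau> \<Delta> a b U j n) \<zeta> = (\<Sum>k<n. elastic_form \<Omega> BB (w j (n - k) *\<^sub>R U k) \<zeta>)"
      unfolding soe_history_eq w_def using U \<zeta> by (intro sum_left subspace_scale[OF sub]) auto
    also have "\<dots> = (\<Sum>k<n. w j (n - k) * elastic_form \<Omega> BB (U k) \<zeta>)"
      using U \<zeta> by (intro sum.cong scale_left) auto
    finally show ?thesis .
  qed
  then have "(\<Sum>j=1..N. elastic_form \<Omega> BB (soe_history \<tau> \<Delta> a b U j n) \<zeta>) =
      (\<Sum>j=1..N. \<Sum>k<n. w j (n - k) * elastic_form \<Omega> BB (U k) \<zeta>)" by simp
  also have "\<dots> = (\<Sum>k<n. \<Sum>j=1..N. w j (n - k) * elastic_form \<Omega> BB (U k) \<zeta>)" by (rule sum.swap)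
  also have "\<dots> = (\<Sum>k<n. soe_weight \<tau> \<Delta> N a b (n - k) * elastic_form \<Omega> BB (U k) \<zeta>)"
    unfolding soe_weight_def w_def by (simp only: sum_distrib_right)
  finally show ?thesis .
qed

text \<open>Origin of the constants: \<open>KB / c\<close> bounds \<open>b\<close> by strains and
  then uses coercivity twice; \<open>sqrt KA * \<bar>Capp\<bar>\<close> passes from the H^1
  approximation error to the energy seminorm; \<open>CB\<close> and \<open>CR\<close> come from
  Green's formula and elliptic regularity.\<close>

lemma elastic_galerkin_volterra:
  fixes AA BB :: "real ^ 'd \<Rightarrow> 'd tensor4"
  assumes ne: "\<Omega> \<noteq> {}" and fe: "fe_discretization \<Omega> \<kappa> Capp Cinv \<T> h V"
    and AA: "bounded_tensor \<Omega> KA AA" and c: "0 < c" "\<And>u. u \<in> H_space 1 \<Omega> \<Longrightarrow>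
      c * (seminrm (L2_inner \<Omega>) (strain \<Omega> u))\<^sup>2 \<le> elastic_form \<Omega> AA u u"
    and BB: "bounded_tensor \<Omega> KB BB" and CB: "0 \<le> CB" "\<And>u w. u \<in> H_space 2 \<Omega> \<inter> H10_space \<Omega> \<Longrightarrow> w \<in> H10_space \<Omega> \<Longrightarrow>
      \<bar>elastic_form \<Omega> BB u w\<bar> \<le> CB * seminrm (L2_inner \<Omega>) w * H_norm 2 \<Omega> u"
    and CR: "0 \<le> CR" "\<And>u. u \<in> L2_space \<Omega> \<Longrightarrow> \<exists>\<psi>\<in>H_space 2 \<Omega> \<inter> H10_space \<Omega>.
      (\<forall>w\<in>H10_space \<Omega>. elastic_form \<Omega> AA w \<psi> = L2_inner \<Omega> w u) \<and> H_norm 2 \<Omega> \<psi> \<le> CR * seminrm (L2_inner \<Omega>) u"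
  shows "galerkin_volterra (H10_space \<Omega>) (L2_inner \<Omega>) (elastic_form \<Omega> AA) (elastic_form \<Omega> BB)
    (H_space 2 \<Omega> \<inter> H10_space \<Omega>) V (H_norm 2 \<Omega>) h (KB / c) CB CR (sqrt KA * \<bar>Capp\<bar>)"
proof -
  define s where "s = (\<lambda>u. seminrm (L2_inner \<Omega>) (strain \<Omega> u))"
  have H10: "(H10_space \<Omega> :: 'd vfield set) \<subseteq> H_space 1 \<Omega>" using H10_H1 by blast
  interpret A: bilinear_on "H10_space \<Omega>" "elastic_form \<Omega> AA"
    by (rule bilinear_on_subset[OF elastic_form_bilinear[OF AA] H10 H10_subspace])
  interpret B: bilinear_on "H10_space \<Omega>" "elastic_form \<Omega> BB"
    by (rule bilinear_on_subset[OF elastic_form_bilinear[OF BB] H10 H10_subspace])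
  have L: "semi_inner (H10_space \<Omega> :: 'd vfield set) (L2_inner \<Omega>)"
    by (rule semi_inner_subset[OF L2_semi_inner _ H10_subspace]) (use H10_L2 in blast)
  have s0: "0 \<le> s u" if "u \<in> H10_space \<Omega>" for u
    unfolding s_def by (rule semi_inner.seminrm_nonneg[OF L2_semi_inner strain_L2(1)[OF H10_H1[OF that]]])
  have coer: "c * (s u)\<^sup>2 \<le> elastic_form \<Omega> AA u u" if "u \<in> H10_space \<Omega>" for u
    unfolding s_def by (rule c(2)[OF H10_H1[OF that]])
  have A: "semi_inner (H10_space \<Omega>) (elastic_form \<Omega> AA)"
  proof unfold_locales
    fix x y :: "'d vfield" assume xy: "x \<in> H10_space \<Omega>" "y \<in> H10_space \<Omega>"
    show "elastic_form \<Omega> AA x y = elastic_form \<Omega> AA y x" by (rule elastic_form_commute[OF AA H10_H1[OF xy(1)] H10_H1[OF xy(2)]])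
    have "0 \<le> c * (s x)\<^sup>2" using c(1) by simp
    also have "\<dots> \<le> elastic_form \<Omega> AA x x" by (rule coer[OF xy(1)])
    finally show "0 \<le> elastic_form \<Omega> AA x x" .
  qed
  have low: "sqrt c * s u \<le> seminrm (elastic_form \<Omega> AA) u" if u: "u \<in> H10_space \<Omega>" for u
  proof -
    have "sqrt c * s u = sqrt (c * (s u)\<^sup>2)" using s0[OF u] by (simp add: real_sqrt_mult)
    also have "\<dots> \<le> seminrm (elastic_form \<Omega> AA) u" unfolding seminrm_def using coer[OF u] by (rule real_sqrt_le_mono)
    finally show ?thesis .
  qed
  have KA: "0 \<le> KA" by (rule bounded_tensor_nonneg[OF AA])
  have KB: "0 \<le> KB" by (rule bounded_tensor_nonneg[OF BB])
  have up: "seminrm (elastic_form \<Omega> AA) u \<le> sqrt KA * H_norm 1 \<Omega> u" if u: "u \<in> H10_space \<Omega>" for u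
  proof -
    have "elastic_form \<Omega> AA u u \<le> KA * (s u)\<^sup>2"
      using elastic_form_bound[OF AA H10_H1[OF u] H10_H1[OF u]] by (simp add: s_def power2_eq_square mult.assoc)
    then have "seminrm (elastic_form \<Omega> AA) u \<le> sqrt (KA * (s u)\<^sup>2)" unfolding seminrm_def by (rule real_sqrt_le_mono)
    also have "\<dots> = sqrt KA * s u" using s0[OF u] by (simp add: real_sqrt_mult)
    also have "\<dots> \<le> sqrt KA * H_norm 1 \<Omega> u" unfolding s_def using KA by (intro mult_left_mono strain_L2(2)[OF H10_H1[OF u]]) simp
    finally show ?thesis .
  qed
  have part: "shape_regular_partition \<Omega> \<kappa> \<T>" and hmax: "h = Max (diameter ` \<T>)" and sp: "fe_space \<Omega> \<T> V"
    using fe unfolding fe_discretization_def by blast+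
  note V = fe_space_subspace[OF sp]
  \<comment> \<open>Changing a function on a null set of \<Omega> does not change the form; this is
    the compatibility that \<open>fe_riesz\<close> needs between representatives and the energy
    seminorm.\<close>
  have null: "seminrm (elastic_form \<Omega> AA) w = 0" if w: "w \<in> H10_space \<Omega>" and ae: "AE x in lebesgue_on \<Omega>. w x = 0" for w
  proof -
    have ae': "AE x in lebesgue_on \<Omega>. w x = (0 :: 'd vfield) x" using ae by simp
    have "elastic_form \<Omega> AA w w = elastic_form \<Omega> AA 0 w" by (rule elastic_form_AE[OF AA H10_H1[OF w] H10_H1[OF w] ae'])
    also have "\<dots> = 0" by (rule A.zero_left[OF w])
    finally show ?thesis by (simp add: seminrm_def)
  qed
  show ?thesis
  proof (intro galerkin_volterra.intro galerkin_volterra_axioms.intro)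
    show "semi_inner (H10_space \<Omega> :: 'd vfield set) (L2_inner \<Omega>)" by (rule L)
    show "semi_inner (H10_space \<Omega>) (elastic_form \<Omega> AA)" by (rule A)
    show "bilinear_on (H10_space \<Omega>) (elastic_form \<Omega> BB)" by unfold_locales
    show "H_space 2 \<Omega> \<inter> H10_space \<Omega> \<subseteq> (H10_space \<Omega> :: 'd vfield set)" by blast
    show "subspace (H_space 2 \<Omega> \<inter> H10_space \<Omega> :: 'd vfield set)" by (intro subspace_inter H1_subspace H10_subspace)
    show "subspace V" "V \<subseteq> H10_space \<Omega>" by (rule V)+
    show "0 \<le> h" using mesh_size_pos[OF part hmax ne] by simp
    show "0 \<le> KB / c" using KB c(1) by simp
    show "0 \<le> CB" "0 \<le> CR" by (rule CB CR)+
    show "0 \<le> sqrt KA * \<bar>Capp\<bar>" using KA by simp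
    show "0 \<le> H_norm 2 \<Omega> u" if "u \<in> H_space 2 \<Omega> \<inter> H10_space \<Omega>" for u :: "'d vfield"
      unfolding H_norm_eq using that by (intro semi_inner.seminrm_nonneg[OF H_semi_inner]) blast
    show "\<bar>elastic_form \<Omega> BB u w\<bar> \<le> KB / c * seminrm (elastic_form \<Omega> AA) u * seminrm (elastic_form \<Omega> AA) w"
      if u: "u \<in> H10_space \<Omega>" and w: "w \<in> H10_space \<Omega>" for u w
    proof -
      have "\<bar>elastic_form \<Omega> BB u w\<bar> \<le> KB * s u * s w"
        unfolding s_def by (rule elastic_form_bound[OF BB H10_H1[OF u] H10_H1[OF w]])
      also have "\<dots> = KB / c * ((sqrt c * s u) * (sqrt c * s w))" using c(1) by (simp add: field_simps flip: real_sqrt_mult)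
      also have "\<dots> \<le> KB / c * (seminrm (elastic_form \<Omega> AA) u * seminrm (elastic_form \<Omega> AA) w)"
      proof (intro mult_left_mono mult_mono low u w)
        show "0 \<le> seminrm (elastic_form \<Omega> AA) u" by (rule semi_inner.seminrm_nonneg[OF A u])
        show "0 \<le> sqrt c * s w" using c(1) s0[OF w] by simp
        show "0 \<le> KB / c" using KB c(1) by simp
      qed
      finally show ?thesis by (simp only: mult.assoc)
    qed
    show "\<bar>elastic_form \<Omega> BB u w\<bar> \<le> CB * seminrm (L2_inner \<Omega>) u * H_norm 2 \<Omega> w"
      if u: "u \<in> H10_space \<Omega>" and w: "w \<in> H_space 2 \<Omega> \<inter> H10_space \<Omega>" for u w
    proof -
      have "elastic_form \<Omega> BB u w = elastic_form \<Omega> BB w u"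
        by (rule elastic_form_commute[OF BB H10_H1[OF u] H10_H1]) (use w in blast)
      then show ?thesis using CB(2)[OF w u] by simp
    qed
    show "\<exists>\<psi>\<in>H_space 2 \<Omega> \<inter> H10_space \<Omega>. (\<forall>w\<in>H10_space \<Omega>. elastic_form \<Omega> AA w \<psi> = L2_inner \<Omega> w u) \<and>
        H_norm 2 \<Omega> \<psi> \<le> CR * seminrm (L2_inner \<Omega>) u" if "u \<in> H10_space \<Omega>" for u
      by (rule CR(2)[OF H10_L2[OF that]])
    show "\<exists>\<zeta>\<in>V. seminrm (elastic_form \<Omega> AA) (u - \<zeta>) \<le> sqrt KA * \<bar>Capp\<bar> * h * H_norm 2 \<Omega> u + \<delta>"
      if u: "u \<in> H_space 2 \<Omega> \<inter> H10_space \<Omega>" and \<delta>: "0 < \<delta>" for u \<delta>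
    proof -
      have KA1: "0 < sqrt KA + 1" using KA by (simp add: add_nonneg_pos)
      obtain \<zeta> where \<zeta>: "\<zeta> \<in> V" "H_norm 1 \<Omega> (u - \<zeta>) \<le> \<bar>Capp\<bar> * h * H_norm 2 \<Omega> u + \<delta> / (sqrt KA + 1)"
        using fe_approximation[OF fe ne u, of "\<delta> / (sqrt KA + 1)"] \<delta> KA1 by auto
      have d: "u - \<zeta> \<in> H10_space \<Omega>" using u \<zeta>(1) V(2) by (intro subspace_diff[OF H10_subspace]) blast+
      have "seminrm (elastic_form \<Omega> AA) (u - \<zeta>) \<le> sqrt KA * H_norm 1 \<Omega> (u - \<zeta>)" by (rule up[OF d])
      also have "\<dots> \<le> sqrt KA * (\<bar>Capp\<bar> * h * H_norm 2 \<Omega> u + \<delta> / (sqrt KA + 1))" using KA by (intro mult_left_mono \<zeta>(2)) simp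
      also have "\<dots> = sqrt KA * \<bar>Capp\<bar> * h * H_norm 2 \<Omega> u + sqrt KA * (\<delta> / (sqrt KA + 1))" by (simp only: distrib_left mult.assoc)
      also have "sqrt KA * (\<delta> / (sqrt KA + 1)) \<le> \<delta>" using KA1 \<delta> by (simp add: field_simps)
      finally show ?thesis using \<zeta>(1) by auto
    qed
    show "\<exists>w\<in>V. \<forall>x\<in>V. elastic_form \<Omega> AA w x = l x"
      if "\<And>x y. x \<in> V \<Longrightarrow> y \<in> V \<Longrightarrow> l (x + y) = l x + l y" "\<And>x c. x \<in> V \<Longrightarrow> l (c *\<^sub>R x) = c * l x"
        "\<And>x. x \<in> V \<Longrightarrow> \<bar>l x\<bar> \<le> K * seminrm (elastic_form \<Omega> AA) x" for l K
      by (rule fe_riesz[OF part sp A null that])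
  qed
qed

end

lemma H_norm_nonneg: "0 \<le> H_norm r \<Omega> f"
proof -
  have "0 \<le> H_norm_sq r \<Omega> f" by (induction r arbitrary: f) (auto intro!: add_nonneg_nonneg sum_nonneg)
  then show ?thesis by (simp add: H_norm_def)
qed

context bounded_open_set
begin

text \<open>The scheme and the weak equation at the grid time have the same load, so subtracting
  them leaves two residuals: the backward difference against \<open>vt\<close>, and the memory
  integral against its quadrature.\<close>

lemma fully_discrete_consistency:
  fixes AA BB :: "real ^ 'd \<Rightarrow> 'd tensor4"
  assumes T: "0 < T" and sol: "weak_solution \<Omega> T \<beta> AA BB F v0 v vt" and v0: "v0 \<in> H_space 2 \<Omega> \<inter> H10_space \<Omega>"
    and vt: "L1_curve 2 \<Omega> (H_space 2 \<Omega>) T vt" and F: "continuous_L2_curve \<Omega> T F"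
    and Dvt: "has_weak_time_derivative \<Omega> T vt vtt" and vtt: "L1_curve 0 \<Omega> (L2_space \<Omega>) T vtt"
    and AA: "bounded_tensor \<Omega> KA AA" and CA: "0 \<le> CA" "\<And>u w. u \<in> H_space 2 \<Omega> \<inter> H10_space \<Omega> \<Longrightarrow> w \<in> H10_space \<Omega> \<Longrightarrow>
      \<bar>elastic_form \<Omega> AA u w\<bar> \<le> CA * seminrm (L2_inner \<Omega>) w * H_norm 2 \<Omega> u"
    and BB: "bounded_tensor \<Omega> KB BB" and CB: "0 \<le> CB" "\<And>u w. u \<in> H_space 2 \<Omega> \<inter> H10_space \<Omega> \<Longrightarrow> w \<in> H10_space \<Omega> \<Longrightarrow>
      \<bar>elastic_form \<Omega> BB u w\<bar> \<le> CB * seminrm (L2_inner \<Omega>) w * H_norm 2 \<Omega> u"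
    and \<beta>: "\<beta> \<in> borel_measurable borel" "\<And>r. 0 < r \<Longrightarrow> r \<le> T \<Longrightarrow> \<bar>\<beta> r\<bar> \<le> B"
      "\<And>r. 0 < r \<Longrightarrow> r \<le> T \<Longrightarrow> \<bar>\<beta> r - soe_kernel \<tau> M a b r\<bar> \<le> \<delta>" "0 \<le> \<delta>"
    and G: "\<And>r. 0 \<le> r \<Longrightarrow> r \<le> T \<Longrightarrow> \<bar>soe_kernel \<tau> M a b r\<bar> \<le> G"
    and a: "\<And>j. j \<in> {1..M} \<Longrightarrow> 0 < a j" and \<tau>: "0 < \<tau>" and \<Delta>: "0 < \<Delta>"
    and V: "subspace V" "V \<subseteq> H10_space \<Omega>"
    and U: "fully_discrete_solution \<Omega> \<beta> \<tau> AA BB V N \<Delta> M a b F v0 U"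
    and m: "1 \<le> m" "m \<le> N" "real m * \<Delta> \<le> T" and \<zeta>: "\<zeta> \<in> V"
  shows "\<bar>(L2_inner \<Omega> (U m - U (m - 1)) \<zeta> + \<Delta> * elastic_form \<Omega> AA (U m) \<zeta> -
        \<Delta> * (\<Sum>k<m. soe_weight \<tau> \<Delta> M a b (m - k) * elastic_form \<Omega> BB (U k) \<zeta>)) -
      (L2_inner \<Omega> (v (real m * \<Delta>) - v (real (m - 1) * \<Delta>)) \<zeta> + \<Delta> * elastic_form \<Omega> AA (v (real m * \<Delta>)) \<zeta> -
        \<Delta> * (\<Sum>k<m. soe_weight \<tau> \<Delta> M a b (m - k) * elastic_form \<Omega> BB (v (real k * \<Delta>)) \<zeta>))\<bar>
    \<le> \<Delta> * ((LINT x|lebesgue_on {real (m - 1) * \<Delta>..real m * \<Delta>}. H_norm 0 \<Omega> (vtt x)) +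
        CB * (T * \<delta> * (H_norm 2 \<Omega> v0 + (LINT x|lebesgue_on {0..real m * \<Delta>}. H_norm 2 \<Omega> (vt x))) +
          G * \<Delta> * (LINT x|lebesgue_on {0..real m * \<Delta>}. H_norm 2 \<Omega> (vt x)))) * seminrm (L2_inner \<Omega>) \<zeta>"
proof -
  define t where "t = real m * \<Delta>"
  define s where "s = real (m - 1) * \<Delta>"
  have ts: "t - s = \<Delta>" using m(1) by (simp add: t_def s_def of_nat_diff algebra_simps)
  have st: "0 \<le> s" "s < t" "t \<le> T" using \<Delta> ts m by (auto simp: s_def t_def)
  have \<zeta>H: "\<zeta> \<in> H10_space \<Omega>" using \<zeta> V by blast
  define g where "g = soe_weight \<tau> \<Delta> M a b"
  define mem where "mem = (LINT r|lebesgue_on {0..t}. \<beta> (t - r) * elastic_form \<Omega> BB (v r) \<zeta>)"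
  define R where "R = (\<Sum>k<m. g (m - k) * elastic_form \<Omega> BB (v (real k * \<Delta>)) \<zeta>)"
  define Q where "Q = (\<Sum>k<m. g (m - k) * elastic_form \<Omega> BB (U k) \<zeta>)"
  define z where "z = seminrm (L2_inner \<Omega>) \<zeta>"
  have U0: "U 0 \<in> V" using U unfolding fully_discrete_solution_def ritz_volterra_def by auto
  have Un: "U k \<in> V" if "k \<le> N" for k
    using U U0 that unfolding fully_discrete_solution_def by (cases "k = 0") auto
  have diff: "(1 / \<Delta>) *\<^sub>R (U m - U (m - 1)) = (\<lambda>x. (1 / \<Delta>) *\<^sub>R (U m x - U (m - 1) x))" by (simp add: fun_eq_iff)
  have "L2_inner \<Omega> ((1 / \<Delta>) *\<^sub>R (U m - U (m - 1))) \<zeta> + elastic_form \<Omega> AA (U m) \<zeta> -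
      (\<Sum>j=1..M. elastic_form \<Omega> BB (soe_history \<tau> \<Delta> a b U j m) \<zeta>) = L2_inner \<Omega> (F t) \<zeta>"
    using U m(1,2) \<zeta> unfolding diff t_def fully_discrete_solution_def by auto
  moreover have "(\<Sum>j=1..M. elastic_form \<Omega> BB (soe_history \<tau> \<Delta> a b U j m) \<zeta>) = Q"
    unfolding Q_def g_def by (rule elastic_form_soe_history[OF BB _ \<zeta>H]) (use Un V m(2) in auto)
  moreover have "L2_inner \<Omega> ((1 / \<Delta>) *\<^sub>R (U m - U (m - 1))) \<zeta> = 1 / \<Delta> * L2_inner \<Omega> (U m - U (m - 1)) \<zeta>"
  proof (rule bilinear_on.scale_left[where B = "L2_inner \<Omega>" and S = "L2_space \<Omega>"])
    show "bilinear_on (L2_space \<Omega>) (L2_inner \<Omega> :: 'd vfield \<Rightarrow> _)" by (rule semi_inner.axioms(1)[OF L2_semi_inner])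
    have "U m - U (m - 1) \<in> V" using m(2) by (intro subspace_diff[OF V(1)] Un) auto
    then show "U m - U (m - 1) \<in> L2_space \<Omega>" using V H10_L2 by blast
    show "\<zeta> \<in> L2_space \<Omega>" by (rule H10_L2[OF \<zeta>H])
  qed
  ultimately have "1 / \<Delta> * L2_inner \<Omega> (U m - U (m - 1)) \<zeta> + elastic_form \<Omega> AA (U m) \<zeta> - Q = L2_inner \<Omega> (F t) \<zeta>" by simp
  then have "\<Delta> * (1 / \<Delta> * L2_inner \<Omega> (U m - U (m - 1)) \<zeta> + elastic_form \<Omega> AA (U m) \<zeta> - Q) = \<Delta> * L2_inner \<Omega> (F t) \<zeta>" by simp
  then have sch: "L2_inner \<Omega> (U m - U (m - 1)) \<zeta> + \<Delta> * elastic_form \<Omega> AA (U m) \<zeta> - \<Delta> * Q = \<Delta> * L2_inner \<Omega> (F t) \<zeta>"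
    using \<Delta> by (simp add: distrib_left right_diff_distrib)
  have "L2_inner \<Omega> (vt t) \<zeta> + elastic_form \<Omega> AA (v t) \<zeta> - mem = L2_inner \<Omega> (F t) \<zeta>"
    using sol st \<zeta>H unfolding weak_solution_def mem_def by auto
  then have "\<Delta> * L2_inner \<Omega> (F t) \<zeta> = \<Delta> * L2_inner \<Omega> (vt t) \<zeta> + \<Delta> * elastic_form \<Omega> AA (v t) \<zeta> - \<Delta> * mem"
    by (metis distrib_left right_diff_distrib)
  with sch have "(L2_inner \<Omega> (U m - U (m - 1)) \<zeta> + \<Delta> * elastic_form \<Omega> AA (U m) \<zeta> - \<Delta> * Q) -
      (L2_inner \<Omega> (v t - v s) \<zeta> + \<Delta> * elastic_form \<Omega> AA (v t) \<zeta> - \<Delta> * R) =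
      - (L2_inner \<Omega> (v t - v s) \<zeta> - \<Delta> * L2_inner \<Omega> (vt t) \<zeta>) - \<Delta> * (mem - R)" by (simp add: right_diff_distrib)
  moreover have "\<bar>L2_inner \<Omega> (v t - v s) \<zeta> - \<Delta> * L2_inner \<Omega> (vt t) \<zeta>\<bar> \<le> \<Delta> * (LINT x|lebesgue_on {s..t}. H_norm 0 \<Omega> (vtt x)) * z"
    using time_difference_consistency[OF T sol v0 vt F Dvt vtt AA CA BB CB \<beta>(1,2) st \<zeta>H] unfolding ts z_def .
  moreover have "\<bar>mem - R\<bar> \<le> CB * (T * \<delta> * (H_norm 2 \<Omega> v0 + (LINT x|lebesgue_on {0..t}. H_norm 2 \<Omega> (vt x))) +
      G * \<Delta> * (LINT x|lebesgue_on {0..t}. H_norm 2 \<Omega> (vt x))) * z" (is "_ \<le> ?r * z")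
    unfolding mem_def R_def t_def g_def z_def
    by (rule memory_consistency[OF T sol v0 vt BB CB \<beta>(1,3,4) soe_kernel_continuous G \<Delta> m(3) soe_weight_has_integral[OF a \<tau> \<Delta>] \<zeta>H])
  then have "\<bar>\<Delta> * (mem - R)\<bar> \<le> \<Delta> * (?r * z)" using \<Delta> by (simp add: abs_mult)
  moreover have "\<bar>- x - y\<bar> \<le> p + q" if "\<bar>x\<bar> \<le> p" "\<bar>y\<bar> \<le> q" for x y p q :: real using that by linarith
  ultimately have "\<bar>(L2_inner \<Omega> (U m - U (m - 1)) \<zeta> + \<Delta> * elastic_form \<Omega> AA (U m) \<zeta> - \<Delta> * Q) -
      (L2_inner \<Omega> (v t - v s) \<zeta> + \<Delta> * elastic_form \<Omega> AA (v t) \<zeta> - \<Delta> * R)\<bar> \<le>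
      \<Delta> * (LINT x|lebesgue_on {s..t}. H_norm 0 \<Omega> (vtt x)) * z + \<Delta> * (?r * z)" by metis
  also have "\<dots> = \<Delta> * ((LINT x|lebesgue_on {s..t}. H_norm 0 \<Omega> (vtt x)) + ?r) * z" by (simp only: distrib_left distrib_right mult.assoc)
  finally show ?thesis unfolding Q_def R_def g_def t_def s_def z_def .
qed

text \<open>The abstract error bound with the consistency bounds summed over the levels. By
  additivity of integrals the contributions of single steps add up to the integrals \<open>P\<close>
  and \<open>Q\<close> over the elapsed time.\<close>

lemma fully_discrete_error:
  fixes AA BB :: "real ^ 'd \<Rightarrow> 'd tensor4"
  assumes ne: "\<Omega> \<noteq> {}" and fe: "fe_discretization \<Omega> \<kappa> Capp Cinv \<T> h V"
    and T: "0 < T" and sol: "weak_solution \<Omega> T \<beta> AA BB F v0 v vt" and v0: "v0 \<in> H_space 2 \<Omega> \<inter> H10_space \<Omega>"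
    and vt: "L1_curve 2 \<Omega> (H_space 2 \<Omega>) T vt" and F: "continuous_L2_curve \<Omega> T F"
    and Dvt: "has_weak_time_derivative \<Omega> T vt vtt" and vtt: "L1_curve 0 \<Omega> (L2_space \<Omega>) T vtt"
    and AA: "bounded_tensor \<Omega> KA AA" and CA: "0 \<le> CA" "\<And>u w. u \<in> H_space 2 \<Omega> \<inter> H10_space \<Omega> \<Longrightarrow> w \<in> H10_space \<Omega> \<Longrightarrow>
      \<bar>elastic_form \<Omega> AA u w\<bar> \<le> CA * seminrm (L2_inner \<Omega>) w * H_norm 2 \<Omega> u"
    and c: "0 < c" "\<And>u. u \<in> H_space 1 \<Omega> \<Longrightarrow>
      c * (seminrm (L2_inner \<Omega>) (strain \<Omega> u))\<^sup>2 \<le> elastic_form \<Omega> AA u u"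
    and BB: "bounded_tensor \<Omega> KB BB" and CB: "0 \<le> CB" "\<And>u w. u \<in> H_space 2 \<Omega> \<inter> H10_space \<Omega> \<Longrightarrow> w \<in> H10_space \<Omega> \<Longrightarrow>
      \<bar>elastic_form \<Omega> BB u w\<bar> \<le> CB * seminrm (L2_inner \<Omega>) w * H_norm 2 \<Omega> u"
    and CR: "0 \<le> CR" "\<And>u. u \<in> L2_space \<Omega> \<Longrightarrow> \<exists>\<psi>\<in>H_space 2 \<Omega> \<inter> H10_space \<Omega>.
      (\<forall>w\<in>H10_space \<Omega>. elastic_form \<Omega> AA w \<psi> = L2_inner \<Omega> w u) \<and> H_norm 2 \<Omega> \<psi> \<le> CR * seminrm (L2_inner \<Omega>) u"
    and \<beta>: "\<beta> \<in> borel_measurable borel" "\<And>r. 0 < r \<Longrightarrow> r \<le> T \<Longrightarrow> \<bar>\<beta> r\<bar> \<le> B"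
      "\<And>r. 0 < r \<Longrightarrow> r \<le> T \<Longrightarrow> \<bar>\<beta> r - soe_kernel \<tau> M a b r\<bar> \<le> \<delta>" "0 \<le> \<delta>"
    and G: "\<And>r. 0 \<le> r \<Longrightarrow> r \<le> T \<Longrightarrow> \<bar>soe_kernel \<tau> M a b r\<bar> \<le> G"
    and a: "\<And>j. j \<in> {1..M} \<Longrightarrow> 0 < a j" and \<tau>: "0 < \<tau>" and \<Delta>: "0 < \<Delta>"
    and U: "fully_discrete_solution \<Omega> \<beta> \<tau> AA BB V N \<Delta> M a b F v0 U"
    and n: "n \<le> N" "real n * \<Delta> \<le> T"
    and E: "E = exp ((KB / c * G)\<^sup>2 * T * T)" and Ca: "Ca = sqrt KA * \<bar>Capp\<bar>"
    and P: "P = (LINT x|lebesgue_on {0..real n * \<Delta>}. H_norm 2 \<Omega> (vt x))"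
    and Q: "Q = (LINT x|lebesgue_on {0..real n * \<Delta>}. H_norm 0 \<Omega> (vtt x))"
  shows "H_norm 0 \<Omega> (\<lambda>x. U n x - v (real n * \<Delta>) x) \<le>
    2 * E * (\<Delta> * Q + T * (CB * (T * \<delta> * (H_norm 2 \<Omega> v0 + P) + G * \<Delta> * P))) +
    (2 * E + 1) * (Ca * CR * (1 + KB / c * G * T) * exp (CB * CR * G * T) * (2 * Ca) * exp (2 * (KB / c) * G * T)) *
      h\<^sup>2 * (H_norm 2 \<Omega> v0 + P)"
proof -
  have sp: "fe_space \<Omega> \<T> V" using fe unfolding fe_discretization_def by blast
  note V = fe_space_subspace[OF sp]
  interpret galerkin_volterra "H10_space \<Omega>" "L2_inner \<Omega>" "elastic_form \<Omega> AA" "elastic_form \<Omega> BB"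
    "H_space 2 \<Omega> \<inter> H10_space \<Omega>" V "H_norm 2 \<Omega>" h "KB / c" CB CR "sqrt KA * \<bar>Capp\<bar>"
    by (rule elastic_galerkin_volterra[OF ne fe AA c BB CB CR])
  have vc: "continuous_L2_curve \<Omega> T v" and D: "has_weak_time_derivative \<Omega> T v vt" and v0eq: "AE x in lebesgue_on \<Omega>. v 0 x = v0 x"
    using sol unfolding weak_solution_def by blast+
  \<comment> \<open>The abstract bound takes a sequence that lies in the smooth space at every
    index. Freezing the time at \<open>T\<close> extends the samples of \<open>v\<close>.\<close>
  define w where "w = (\<lambda>m. v (min (real m * \<Delta>) T))"
  have wY: "w m \<in> H_space 2 \<Omega> \<inter> H10_space \<Omega>" for m
    unfolding w_def using T \<Delta> by (intro solution_regularity(1)[OF T sol v0 vt]) auto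
  have le: "real m * \<Delta> \<le> real n * \<Delta>" if "m \<le> n" for m using that \<Delta> by (intro mult_right_mono) auto
  have weq: "w m = v (real m * \<Delta>)" if "m \<le> n" for m
    using le[OF that] n(2) by (simp add: w_def min_absorb1)
  have w0: "w 0 = v 0" using T by (simp add: w_def)
  have U0: "U 0 \<in> V" using U unfolding fully_discrete_solution_def ritz_volterra_def by auto
  have Un: "U k \<in> V" if "k \<le> n" for k
    using U U0 that n(1) unfolding fully_discrete_solution_def by (cases "k = 0") auto
  \<comment> \<open>Likewise the weights must be bounded at every index, so they are set to 0
    outside the range that the scheme can reach; \<open>geq\<close> shows that the convolutions are
    unchanged.\<close>
  define g where "g = (\<lambda>m. if 1 \<le> m \<and> real m * \<Delta> \<le> T then soe_weight \<tau> \<Delta> M a b m else 0)"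
  have G0: "0 \<le> G" using G[of 0] T by simp
  have gb: "\<bar>g m\<bar> \<le> G * \<Delta>" for m
  proof (cases "1 \<le> m \<and> real m * \<Delta> \<le> T")
    case True
    then have "\<bar>soe_weight \<tau> \<Delta> M a b m\<bar> \<le> G * \<Delta>" by (intro soe_weight_bound[OF a \<tau> \<Delta> G]) auto
    then show ?thesis using True by (simp add: g_def)
  next
    case False
    then show ?thesis using G0 \<Delta> by (auto simp: g_def)
  qed
  have geq: "(\<Sum>k<m. g (m - k) * f k) = (\<Sum>k<m. soe_weight \<tau> \<Delta> M a b (m - k) * f k)" if "m \<le> n" for m and f :: "nat \<Rightarrow> real"
  proof (rule sum.cong[OF refl])
    fix k assume "k \<in> {..<m}"
    moreover have "m - k \<le> n" using that by simp
    ultimately have "1 \<le> m - k" "real (m - k) * \<Delta> \<le> T" using order_trans[OF le n(2), of "m - k"] by auto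
    then show "g (m - k) * f k = soe_weight \<tau> \<Delta> M a b (m - k) * f k" by (simp add: g_def)
  qed
  define I where "I = (\<lambda>s t. LINT x|lebesgue_on {s..t}. H_norm 2 \<Omega> (vt x))"
  define J where "J = (\<lambda>s t. LINT x|lebesgue_on {s..t}. H_norm 0 \<Omega> (vtt x))"
  have I0: "0 \<le> I s t" and J0: "0 \<le> J s t" for s t
    unfolding I_def J_def by (intro Bochner_Integration.integral_nonneg H_norm_nonneg)+
  have vti: "integrable (lebesgue_on {0..T}) (\<lambda>t. H_norm 2 \<Omega> (vt t))"
    and vtti: "integrable (lebesgue_on {0..T}) (\<lambda>t. H_norm 0 \<Omega> (vtt t))" using vt vtt by (simp_all add: L1_curve_def)
  have sub: "{s..t} \<subseteq> {0..T}" if "0 \<le> s" "t \<le> T" for s t using that by auto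
  have Iadd: "I 0 t = I 0 s + I s t" and Jadd: "J 0 t = J 0 s + J s t" if "0 \<le> s" "s \<le> t" "t \<le> T" for s t
    unfolding I_def J_def
    by (rule lebesgue_integral_interval_combine[OF integrable_subinterval[OF vti sub[OF order_refl that(3)]] that(1,2)]
        lebesgue_integral_interval_combine[OF integrable_subinterval[OF vtti sub[OF order_refl that(3)]] that(1,2)])+
  have telescope: "(\<Sum>m=1..k. f (real (m - 1) * \<Delta>) (real m * \<Delta>)) = f 0 (real k * \<Delta>)"
    if k: "k \<le> n" and add: "\<And>s t. 0 \<le> s \<Longrightarrow> s \<le> t \<Longrightarrow> t \<le> T \<Longrightarrow> f 0 t = f 0 s + f s t" for k and f :: "real \<Rightarrow> real \<Rightarrow> real"
    using k
  proof (induction k)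
    case 0
    then show ?case using add[of 0 0] T by simp
  next
    case (Suc k)
    have o: "0 \<le> real k * \<Delta>" "real k * \<Delta> \<le> real (Suc k) * \<Delta>" "real (Suc k) * \<Delta> \<le> T"
      using \<Delta> order_trans[OF le[OF Suc.prems] n(2)] by (auto intro: mult_right_mono simp del: of_nat_Suc)
    have "(\<Sum>m=1..Suc k. f (real (m - 1) * \<Delta>) (real m * \<Delta>)) = (\<Sum>m=1..k. f (real (m - 1) * \<Delta>) (real m * \<Delta>)) + f (real k * \<Delta>) (real (Suc k) * \<Delta>)"
      by simp
    then show ?case using Suc.IH Suc.prems add[OF o] by (simp only: Suc_leD)
  qed
  have PQ: "P = I 0 (real n * \<Delta>)" "Q = J 0 (real n * \<Delta>)" by (simp_all only: P Q I_def J_def)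
  have Imono: "I 0 (real m * \<Delta>) \<le> P" if "m \<le> n" for m
    using Iadd[OF _ le[OF that] n(2)] \<Delta> I0 by (simp add: PQ)
  have P0: "0 \<le> P" unfolding PQ by (rule I0)
  \<comment> \<open>The memory residual with the integrals taken up to the final level, a bound that
    is the same for all levels; its sum with step \<Delta> is at most \<open>T * e\<close>.\<close>
  define e where "e = CB * (T * \<delta> * (H_norm 2 \<Omega> v0 + P) + G * \<Delta> * P)"
  have e0: "0 \<le> e" unfolding e_def using CB(1) T \<beta>(4) P0 G0 \<Delta> H_norm_nonneg[of 2 \<Omega> v0]
    by (intro mult_nonneg_nonneg add_nonneg_nonneg) auto
  define \<rho> where "\<rho> = (\<lambda>m. \<Delta> * (J (real (m - 1) * \<Delta>) (real m * \<Delta>) + e))"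
  \<comment> \<open>Over the degenerate interval [0,0] the memory integral vanishes, so the initial
    condition says that \<open>U 0\<close> is the elliptic projection; \<open>v 0\<close> and
    \<open>v0\<close> agree almost everywhere.\<close>
  have init: "elastic_form \<Omega> AA (U 0 - w 0) \<zeta> = 0" if \<zeta>: "\<zeta> \<in> V" for \<zeta>
  proof -
    have \<zeta>H: "\<zeta> \<in> H10_space \<Omega>" using \<zeta> V(2) by blast
    have d: "U 0 - v 0 \<in> H10_space \<Omega>" using U0 V(2) wY[of 0] unfolding w0 by (intro subspace_diff[OF H10_subspace]) auto
    have "elastic_form \<Omega> AA (\<lambda>x. U 0 x - v0 x) \<zeta> =
        (LINT s|lebesgue_on {0..0}. \<beta> (0 - s) * elastic_form \<Omega> BB (\<lambda>x. U 0 x - v0 x) \<zeta>)"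
      using U \<zeta> unfolding fully_discrete_solution_def ritz_volterra_def by auto
    also have "\<dots> = 0"
    proof (rule integral_eq_zero_AE)
      have "{0..0::real} \<in> null_sets lebesgue" by (simp add: null_sets_def)
      then have "AE s in lebesgue. s \<in> {0..0::real} \<longrightarrow> \<beta> (0 - s) * elastic_form \<Omega> BB (\<lambda>x. U 0 x - v0 x) \<zeta> = 0"
        by (rule AE_not_in[THEN eventually_mono]) blast
      then show "AE s in lebesgue_on {0..0}. \<beta> (0 - s) * elastic_form \<Omega> BB (\<lambda>x. U 0 x - v0 x) \<zeta> = 0"
        by (subst AE_restrict_space_iff) simp_all
    qed
    finally have z: "elastic_form \<Omega> AA (\<lambda>x. U 0 x - v0 x) \<zeta> = 0" .
    have ae: "AE x in lebesgue_on \<Omega>. (U 0 - v 0) x = U 0 x - v0 x" using v0eq by (rule eventually_mono) simp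
    show ?thesis unfolding w0 elastic_form_AE[OF AA H10_H1[OF d] H10_H1[OF \<zeta>H] ae] by (rule z)
  qed
  have cons: "\<bar>(L2_inner \<Omega> (U m - U (m - 1)) \<zeta> + \<Delta> * elastic_form \<Omega> AA (U m) \<zeta> - \<Delta> * (\<Sum>k<m. g (m - k) * elastic_form \<Omega> BB (U k) \<zeta>)) -
      (L2_inner \<Omega> (w m - w (m - 1)) \<zeta> + \<Delta> * elastic_form \<Omega> AA (w m) \<zeta> - \<Delta> * (\<Sum>k<m. g (m - k) * elastic_form \<Omega> BB (w k) \<zeta>))\<bar>
      \<le> \<rho> m * seminrm (L2_inner \<Omega>) \<zeta>" if m: "1 \<le> m" "m \<le> n" and \<zeta>: "\<zeta> \<in> V" for m \<zeta>
  proof -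
    have mT: "real m * \<Delta> \<le> T" using le[OF m(2)] n(2) by simp
    have mN: "m \<le> N" using m(2) n(1) by simp
    have wk: "(\<Sum>k<m. soe_weight \<tau> \<Delta> M a b (m - k) * elastic_form \<Omega> BB (w k) \<zeta>) =
        (\<Sum>k<m. soe_weight \<tau> \<Delta> M a b (m - k) * elastic_form \<Omega> BB (v (real k * \<Delta>)) \<zeta>)"
      using m(2) by (intro sum.cong refl) (simp add: weq)
    have wm: "w m = v (real m * \<Delta>)" "w (m - 1) = v (real (m - 1) * \<Delta>)" using m(2) by (auto intro!: weq)
    have z: "0 \<le> seminrm (L2_inner \<Omega>) \<zeta>" using \<zeta> V(2) by (intro L.seminrm_nonneg) blast
    have "CB * (T * \<delta> * (H_norm 2 \<Omega> v0 + I 0 (real m * \<Delta>)) + G * \<Delta> * I 0 (real m * \<Delta>)) \<le> e"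
      unfolding e_def using Imono[OF m(2)] CB(1) T \<beta>(4) G0 \<Delta> by (intro mult_left_mono add_mono) auto
    then have "\<Delta> * (J (real (m - 1) * \<Delta>) (real m * \<Delta>) + CB * (T * \<delta> * (H_norm 2 \<Omega> v0 + I 0 (real m * \<Delta>)) + G * \<Delta> * I 0 (real m * \<Delta>))) *
        seminrm (L2_inner \<Omega>) \<zeta> \<le> \<rho> m * seminrm (L2_inner \<Omega>) \<zeta>"
      unfolding \<rho>_def using z \<Delta> by (intro mult_right_mono mult_left_mono add_left_mono) auto
    then show ?thesis unfolding geq[OF m(2)] wk wm
      using fully_discrete_consistency[OF T sol v0 vt F Dvt vtt AA CA BB CB \<beta> G a \<tau> \<Delta> V U m(1) mN mT \<zeta>]
      unfolding I_def J_def by (rule order_trans[rotated])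
  qed
  have \<rho>0: "0 \<le> \<rho> m" for m unfolding \<rho>_def using \<Delta> J0 e0 by (intro mult_nonneg_nonneg add_nonneg_nonneg) auto
  have err: "seminrm (L2_inner \<Omega>) (U n - w n) \<le> 2 * E * (\<Sum>m=1..n. \<rho> m) +
    (2 * E + 1) * (Ca * CR * (1 + KB / c * G * T) * exp (CB * CR * G * T) * (2 * Ca) * exp (2 * (KB / c) * G * T)) *
    h\<^sup>2 * (H_norm 2 \<Omega> (w 0) + (\<Sum>m=1..n. H_norm 2 \<Omega> (w m - w (m - 1))))"
    unfolding E Ca by (rule galerkin_error[OF gb \<Delta> G0 n(2) wY Un init \<rho>0 cons])
  have "(\<Sum>m=1..n. J (real (m - 1) * \<Delta>) (real m * \<Delta>)) = Q" unfolding PQ by (rule telescope[where f = J, OF order_refl Jadd])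
  then have "(\<Sum>m=1..n. \<rho> m) = \<Delta> * (Q + (\<Sum>m=1..n. e))" unfolding \<rho>_def sum_distrib_left[symmetric] sum.distrib by simp
  also have "\<dots> = \<Delta> * Q + real n * \<Delta> * e" by (simp add: distrib_left)
  also have "\<dots> \<le> \<Delta> * Q + T * e" using n(2) e0 by (intro add_left_mono mult_right_mono)
  finally have s1: "(\<Sum>m=1..n. \<rho> m) \<le> \<Delta> * Q + T * e" .
  have v0H: "v 0 \<in> H_space 2 \<Omega>" using wY[of 0] unfolding w0 by blast
  have "H_norm 2 \<Omega> (w m - w (m - 1)) \<le> I (real (m - 1) * \<Delta>) (real m * \<Delta>)" if "m \<in> {1..n}" for m
  proof -
    have m: "m \<le> n" "m - 1 \<le> n" using that by auto
    have o: "0 \<le> real (m - 1) * \<Delta>" "real (m - 1) * \<Delta> \<le> real m * \<Delta>" "real m * \<Delta> \<le> T"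
      using \<Delta> order_trans[OF le[OF m(1)] n(2)] by (auto intro: mult_right_mono)
    show ?thesis unfolding weq[OF m(1)] weq[OF m(2)] I_def by (rule curve_increment(3)[OF T vc D vt subset_refl o])
  qed
  then have "(\<Sum>m=1..n. H_norm 2 \<Omega> (w m - w (m - 1))) \<le> (\<Sum>m=1..n. I (real (m - 1) * \<Delta>) (real m * \<Delta>))" by (rule sum_mono)
  also have "\<dots> = P" unfolding PQ by (rule telescope[where f = I, OF order_refl Iadd])
  finally have s2: "H_norm 2 \<Omega> (w 0) + (\<Sum>m=1..n. H_norm 2 \<Omega> (w m - w (m - 1))) \<le> H_norm 2 \<Omega> v0 + P"
    unfolding w0 H_norm_AE[OF v0H v0eq] by simp
  have Ca0: "0 \<le> Ca" and Cb0: "0 \<le> KB / c" using consts_nonneg unfolding Ca by auto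
  have "2 * E * (\<Sum>m=1..n. \<rho> m) \<le> 2 * E * (\<Delta> * Q + T * e)" using s1 by (intro mult_left_mono) (auto simp: E)
  moreover have "(2 * E + 1) * (Ca * CR * (1 + KB / c * G * T) * exp (CB * CR * G * T) * (2 * Ca) * exp (2 * (KB / c) * G * T)) *
    h\<^sup>2 * (H_norm 2 \<Omega> (w 0) + (\<Sum>m=1..n. H_norm 2 \<Omega> (w m - w (m - 1)))) \<le>
    (2 * E + 1) * (Ca * CR * (1 + KB / c * G * T) * exp (CB * CR * G * T) * (2 * Ca) * exp (2 * (KB / c) * G * T)) *
    h\<^sup>2 * (H_norm 2 \<Omega> v0 + P)"
    using s2 CR(1) Ca0 Cb0 G0 T by (intro mult_left_mono mult_nonneg_nonneg add_nonneg_nonneg) (auto simp: E)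
  moreover have "H_norm 0 \<Omega> (\<lambda>x. U n x - v (real n * \<Delta>) x) = seminrm (L2_inner \<Omega>) (U n - w n)"
  proof -
    have "(\<lambda>x. U n x - v (real n * \<Delta>) x) = U n - v (real n * \<Delta>)" by (simp add: fun_eq_iff)
    then show ?thesis unfolding weq[OF order_refl] H_norm_0_eq by simp
  qed
  ultimately show ?thesis using err unfolding e_def by linarith
qed

end

text \<open>The bound \<open>B\<close> is chosen before any approximation is given. If some
  exponential sum attains the accuracy, continuity of that one sum on a compact interval bounds the
  kernel; if none does, the claim is vacuous.\<close>

lemma kernel_bounded_if_approximated:
  fixes \<beta> :: "real \<Rightarrow> real"
  shows "\<exists>B. \<forall>\<tau> M a b \<epsilon>. 0 < \<epsilon> \<longrightarrow> \<epsilon> < 1 \<longrightarrow> (\<forall>t\<in>{0<..T}. \<bar>\<beta> t - soe_kernel \<tau> M a b t\<bar> \<le> C0 * \<epsilon>) \<longrightarrow>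
    (\<forall>t\<in>{0<..T}. \<bar>\<beta> t\<bar> \<le> B)"
proof (cases "\<exists>\<tau> M a b \<epsilon>. 0 < \<epsilon> \<and> \<epsilon> < 1 \<and> (\<forall>t\<in>{0<..T}. \<bar>\<beta> t - soe_kernel \<tau> M a b t\<bar> \<le> C0 * \<epsilon>)")
  case True
  then obtain \<tau> M a b \<epsilon> where e: "0 < \<epsilon>" "\<epsilon> < 1" and acc: "\<forall>t\<in>{0<..T}. \<bar>\<beta> t - soe_kernel \<tau> M a b t\<bar> \<le> C0 * \<epsilon>"
    by blast
  obtain G where G: "\<forall>t\<in>{0..T}. \<bar>soe_kernel \<tau> M a b t\<bar> \<le> G" using soe_kernel_bounded_on_interval by blast
  have "\<bar>\<beta> t\<bar> \<le> C0 * \<epsilon> + G" if t: "t \<in> {0<..T}" for t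
  proof -
    have "\<bar>\<beta> t - soe_kernel \<tau> M a b t\<bar> \<le> C0 * \<epsilon>" "\<bar>soe_kernel \<tau> M a b t\<bar> \<le> G" using acc G t by auto
    then show ?thesis by linarith
  qed
  then show ?thesis by blast
qed blast

text \<open>Collects the terms with \<Delta>, with \<open>h\<^sup>2\<close> and with the accuracy:
  \<open>C\<close> dominates the coefficient of each group. The 1 in \<open>C\<close> makes the
  constant strictly positive.\<close>

lemma error_constant:
  fixes E K T CB G c0 :: real
  assumes nn: "0 \<le> E" "0 \<le> K" "0 \<le> T" "0 \<le> CB" "0 \<le> G" "0 \<le> c0" "0 \<le> \<Delta>" "0 \<le> h\<^sup>2" "0 \<le> N0" "0 \<le> Li" "0 \<le> P" "0 \<le> Q"
    and \<delta>: "\<delta> \<le> c0 * \<epsilon>" and \<epsilon>: "0 \<le> \<epsilon>" and C: "C = 2 * E * (1 + T * CB * G + T * CB * c0) + K + 1"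
  shows "2 * E * (\<Delta> * Q + T * (CB * (T * \<delta> * (N0 + P) + G * \<Delta> * P))) + K * h\<^sup>2 * (N0 + P) \<le>
    C * (h\<^sup>2 + \<Delta>) * (N0 + Li + (P + Q)) + C * T * \<epsilon> * (N0 + P)"
proof -
  define S where "S = N0 + Li + (P + Q)"
  define D where "D = 2 * E * (1 + T * CB * G)"
  have S: "Q \<le> S" "P \<le> S" "N0 + P \<le> S" "0 \<le> S" using nn by (auto simp: S_def)
  have D0: "0 \<le> D" unfolding D_def using nn by simp
  have DC: "D \<le> C" "K \<le> C" "2 * E * T * CB * c0 \<le> C"
  proof -
    have "0 \<le> 2 * E * T * CB * c0" using nn by simp
    moreover have "C = D + 2 * E * T * CB * c0 + K + 1" by (simp add: C D_def distrib_left mult_ac)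
    ultimately show "D \<le> C" "K \<le> C" "2 * E * T * CB * c0 \<le> C" using nn D0 by linarith+
  qed
  have "2 * E * (\<Delta> * Q + T * (CB * (G * \<Delta> * P))) \<le> 2 * E * (\<Delta> * S + T * (CB * (G * \<Delta> * S)))"
    using nn S by (intro mult_left_mono add_mono) auto
  also have "\<dots> = D * (\<Delta> * S)" by (simp add: D_def algebra_simps)
  also have "\<dots> \<le> C * (\<Delta> * S)" using DC nn S by (intro mult_right_mono) auto
  finally have 1: "2 * E * (\<Delta> * Q + T * (CB * (G * \<Delta> * P))) \<le> C * (\<Delta> * S)" .
  have "K * (h\<^sup>2 * (N0 + P)) \<le> C * (h\<^sup>2 * S)"
    using DC nn S by (intro mult_mono) auto
  moreover have "2 * E * (T * (CB * (T * \<delta> * (N0 + P)))) \<le> 2 * E * (T * (CB * (T * (c0 * \<epsilon>) * (N0 + P))))"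
    using nn \<delta> by (intro mult_left_mono mult_right_mono) auto
  moreover have "\<dots> = 2 * E * T * CB * c0 * (T * \<epsilon> * (N0 + P))" by (simp add: mult_ac)
  moreover have "\<dots> \<le> C * (T * \<epsilon> * (N0 + P))" using DC nn \<epsilon> by (intro mult_right_mono) auto
  moreover have "2 * E * (\<Delta> * Q + T * (CB * (T * \<delta> * (N0 + P) + G * \<Delta> * P))) =
      2 * E * (\<Delta> * Q + T * (CB * (G * \<Delta> * P))) + 2 * E * (T * (CB * (T * \<delta> * (N0 + P))))"
    by (simp only: distrib_left)
  moreover have "C * (h\<^sup>2 + \<Delta>) * S = C * (h\<^sup>2 * S) + C * (\<Delta> * S)" by (simp add: distrib_left distrib_right mult.assoc)
  ultimately show ?thesis using 1 unfolding S_def[symmetric] by (simp only: mult.assoc)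
qed

theorem theorem5p1:
  fixes \<Omega> :: "(real ^ 'd) set"
    and CC DD :: "real ^ 'd \<Rightarrow> 'd tensor4"
    and T \<alpha> \<rho> \<tau>\<sigma> \<tau>\<epsilon> M0 M1 \<kappa> Capp Cinv C0 :: real
  assumes dim: "CARD('d) = 2 \<or> CARD('d) = 3"
    and domain: "open \<Omega>" "\<Omega> \<noteq> {}" "convex \<Omega>" "polytope (closure \<Omega>)"
    and params: "0 < T" "0 < \<alpha>" "\<alpha> < 1" "0 < \<rho>" "0 < \<tau>\<sigma>" "0 \<le> \<tau>\<epsilon>" "0 < M0" "0 < M1"
    and tensors: "elastic_tensor \<Omega> M0 M1 CC" "elastic_tensor \<Omega> M0 M1 DD"
    and bounded_A: "bounded_elastic_op \<Omega> (tensor_A \<rho> CC)"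
    and bounded_B: "bounded_elastic_op \<Omega> (tensor_B \<alpha> \<rho> \<tau>\<sigma> \<tau>\<epsilon> CC DD)"
    and regularity: "elliptic_regularity \<Omega> (tensor_A \<rho> CC)"
  shows "\<exists>C>0. \<forall>\<T> h V (N::nat) \<Delta>t q (K::nat) (J::nat) a b \<epsilon> F F' F'' v0 v vt vtt vh.
      fe_discretization \<Omega> \<kappa> Capp Cinv \<T> h V \<longrightarrow>
      1 \<le> N \<longrightarrow> \<Delta>t = T / real N \<longrightarrow>
      1 < q \<longrightarrow> 1 \<le> K \<longrightarrow> 1 \<le> J \<longrightarrow> soe_pairs \<alpha> q K J a b \<longrightarrow>
      0 < \<epsilon> \<longrightarrow> \<epsilon> < 1 \<longrightarrow>
      (\<forall>t\<in>{0<..T}. \<bar>relax_kernel \<alpha> \<tau>\<sigma> t - (\<Sum>j=1..(K + 1) * J. b j * exp (- (a j / \<tau>\<sigma>) * t))\<bar> \<le> C0 * \<epsilon>) \<longrightarrow>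
      C1_L2_curve \<Omega> T F F' \<longrightarrow>
      has_weak_time_derivative \<Omega> T F' F'' \<longrightarrow> L1_curve 0 \<Omega> (L2_space \<Omega>) T F'' \<longrightarrow>
      v0 \<in> H_space 2 \<Omega> \<inter> H10_space \<Omega> \<longrightarrow>
      (\<lambda>x. elastic_op \<Omega> (tensor_A \<rho> CC) v0 x - F 0 x) \<in> H10_space \<Omega> \<longrightarrow>
      weak_solution \<Omega> T (relax_kernel \<alpha> \<tau>\<sigma>) (tensor_A \<rho> CC) (tensor_B \<alpha> \<rho> \<tau>\<sigma> \<tau>\<epsilon> CC DD) F v0 v vt \<longrightarrow>
      Linf_curve 2 \<Omega> (H_space 2 \<Omega> \<inter> H10_space \<Omega>) T v \<longrightarrow>
      Linf_curve 0 \<Omega> (L2_space \<Omega>) T vt \<longrightarrow> L1_curve 2 \<Omega> (H_space 2 \<Omega>) T vt \<longrightarrow>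
      has_weak_time_derivative \<Omega> T vt vtt \<longrightarrow> L1_curve 0 \<Omega> (L2_space \<Omega>) T vtt \<longrightarrow>
      fully_discrete_solution \<Omega> (relax_kernel \<alpha> \<tau>\<sigma>) \<tau>\<sigma> (tensor_A \<rho> CC) (tensor_B \<alpha> \<rho> \<tau>\<sigma> \<tau>\<epsilon> CC DD)
        V N \<Delta>t ((K + 1) * J) a b F v0 vh \<longrightarrow>
      (\<forall>n\<in>{1..N}.
        H_norm 0 \<Omega> (\<lambda>x. vh n x - v (real n * \<Delta>t) x)
        \<le> C * (h\<^sup>2 + \<Delta>t) *
            (H_norm 2 \<Omega> v0 + Linf_curve_norm 2 \<Omega> T v +
             (LINT s|lebesgue_on {0..real n * \<Delta>t}. H_norm 2 \<Omega> (vt s) + H_norm 0 \<Omega> (vtt s)))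
          + C * T * \<epsilon> *
            (H_norm 2 \<Omega> v0 + (LINT s|lebesgue_on {0..real n * \<Delta>t}. H_norm 2 \<Omega> (vt s))))"
proof -
  have "bounded \<Omega>" using polytope_imp_bounded[OF domain(4)] closure_subset bounded_subset by blast
  then interpret bounded_open_set \<Omega> using domain(1) by unfold_locales
  define AA where "AA = tensor_A \<rho> CC"
  define BB where "BB = tensor_B \<alpha> \<rho> \<tau>\<sigma> \<tau>\<epsilon> CC DD"
  define \<beta> where "\<beta> = relax_kernel \<alpha> \<tau>\<sigma>"
  have AA: "bounded_tensor \<Omega> (M1 / \<rho>) AA" unfolding AA_def by (rule bounded_tensor_A[OF tensors(1) params(7,8,4)])
  obtain KB where BB: "bounded_tensor \<Omega> KB BB" unfolding BB_def using bounded_tensor_B[OF tensors params(7,8)] by blast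
  obtain CA where CA: "0 \<le> CA" "\<And>u w. u \<in> H_space 2 \<Omega> \<inter> H10_space \<Omega> \<Longrightarrow> w \<in> H10_space \<Omega> \<Longrightarrow>
      \<bar>elastic_form \<Omega> AA u w\<bar> \<le> CA * seminrm (L2_inner \<Omega>) w * H_norm 2 \<Omega> u"
    using elastic_form_dual_bound[OF AA bounded_A[folded AA_def]] by blast
  obtain CB where CB: "0 \<le> CB" "\<And>u w. u \<in> H_space 2 \<Omega> \<inter> H10_space \<Omega> \<Longrightarrow> w \<in> H10_space \<Omega> \<Longrightarrow>
      \<bar>elastic_form \<Omega> BB u w\<bar> \<le> CB * seminrm (L2_inner \<Omega>) w * H_norm 2 \<Omega> u"
    using elastic_form_dual_bound[OF BB bounded_B[folded BB_def]] by blast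
  obtain CR where CR: "0 \<le> CR" "\<And>u. u \<in> L2_space \<Omega> \<Longrightarrow> \<exists>\<psi>\<in>H_space 2 \<Omega> \<inter> H10_space \<Omega>.
      (\<forall>w\<in>H10_space \<Omega>. elastic_form \<Omega> AA w \<psi> = L2_inner \<Omega> w u) \<and> H_norm 2 \<Omega> \<psi> \<le> CR * seminrm (L2_inner \<Omega>) u"
    using elliptic_dual_solution[OF AA bounded_A[folded AA_def] regularity[folded AA_def]] by blast
  define c where "c = M0 / \<rho>"
  have c: "0 < c" "\<And>u. u \<in> H_space 1 \<Omega> \<Longrightarrow> c * (seminrm (L2_inner \<Omega>) (strain \<Omega> u))\<^sup>2 \<le> elastic_form \<Omega> AA u u"
    unfolding c_def AA_def using params elastic_form_coercive[OF tensors(1) params(7,8,4)] by auto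
  \<comment> \<open>Fixed before the mesh, the step size and the exponential sum are introduced, so
    that \<open>C\<close> cannot depend on them.\<close>
  obtain B where B: "\<And>\<tau> M a b \<epsilon>. 0 < \<epsilon> \<Longrightarrow> \<epsilon> < 1 \<Longrightarrow> \<forall>t\<in>{0<..T}. \<bar>\<beta> t - soe_kernel \<tau> M a b t\<bar> \<le> C0 * \<epsilon> \<Longrightarrow>
      \<forall>t\<in>{0<..T}. \<bar>\<beta> t\<bar> \<le> B"
    using kernel_bounded_if_approximated[of T \<beta> C0] by blast
  \<comment> \<open>Bounds every admissible exponential sum: kernel bound plus accuracy, where
    \<epsilon> below 1 removes the dependence on \<epsilon>.\<close>
  define G where "G = \<bar>B\<bar> + \<bar>C0\<bar>"
  define E where "E = exp ((KB / c * G)\<^sup>2 * T * T)"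
  define Ca where "Ca = sqrt (M1 / \<rho>) * \<bar>Capp\<bar>"
  \<comment> \<open>The constant of the second-order projection error, with the factor
    \<open>2 * E + 1\<close>: once for \<eta> itself and \<open>2 * E\<close> for its effect on
    \<theta>.\<close>
  define K' where "K' = (2 * E + 1) * (Ca * CR * (1 + KB / c * G * T) * exp (CB * CR * G * T) * (2 * Ca) * exp (2 * (KB / c) * G * T))"
  define C where "C = 2 * E * (1 + T * CB * G + T * CB * \<bar>C0\<bar>) + K' + 1"
  have KB: "0 \<le> KB / c" using bounded_tensor_nonneg[OF BB] c(1) by simp
  have Ca0: "0 \<le> Ca" unfolding Ca_def using params by simp
  have E0: "0 \<le> E" unfolding E_def by simp
  have G0: "0 \<le> G" by (simp add: G_def)
  have K'0: "0 \<le> K'" unfolding K'_def using KB Ca0 E0 G0 CR(1) params(1) by (intro mult_nonneg_nonneg add_nonneg_nonneg) auto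
  have "0 \<le> 2 * E * (1 + T * CB * G + T * CB * \<bar>C0\<bar>)" using E0 G0 CB(1) params(1) by simp
  then have C0pos: "0 < C" unfolding C_def using K'0 by linarith
  show ?thesis
  proof (intro exI[of _ C] conjI C0pos allI impI ballI)
    fix \<T> h V N \<Delta>t q K J a b \<epsilon> F F' F'' v0 v vt vtt vh n
    assume fe: "fe_discretization \<Omega> \<kappa> Capp Cinv \<T> h V" and N: "1 \<le> N" and \<Delta>t: "\<Delta>t = T / real N" and q: "1 < q"
      and soe: "soe_pairs \<alpha> q K J a b" and \<epsilon>: "0 < \<epsilon>" "\<epsilon> < 1"
      and acc: "\<forall>t\<in>{0<..T}. \<bar>relax_kernel \<alpha> \<tau>\<sigma> t - (\<Sum>j=1..(K + 1) * J. b j * exp (- (a j / \<tau>\<sigma>) * t))\<bar> \<le> C0 * \<epsilon>"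
      and F: "C1_L2_curve \<Omega> T F F'"
      and v0: "v0 \<in> H_space 2 \<Omega> \<inter> H10_space \<Omega>"
      and sol: "weak_solution \<Omega> T (relax_kernel \<alpha> \<tau>\<sigma>) (tensor_A \<rho> CC) (tensor_B \<alpha> \<rho> \<tau>\<sigma> \<tau>\<epsilon> CC DD) F v0 v vt"
      and vt: "L1_curve 2 \<Omega> (H_space 2 \<Omega>) T vt"
      and Dvt: "has_weak_time_derivative \<Omega> T vt vtt" and vtt: "L1_curve 0 \<Omega> (L2_space \<Omega>) T vtt"
      and vh: "fully_discrete_solution \<Omega> (relax_kernel \<alpha> \<tau>\<sigma>) \<tau>\<sigma> (tensor_A \<rho> CC) (tensor_B \<alpha> \<rho> \<tau>\<sigma> \<tau>\<epsilon> CC DD)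
        V N \<Delta>t ((K + 1) * J) a b F v0 vh"
      and n: "n \<in> {1..N}"
    define M where "M = (K + 1) * J"
    have acc': "\<forall>t\<in>{0<..T}. \<bar>\<beta> t - soe_kernel \<tau>\<sigma> M a b t\<bar> \<le> C0 * \<epsilon>" using acc unfolding \<beta>_def soe_kernel_def M_def .
    have a: "0 < a j" if "j \<in> {1..M}" for j using soe_pairs_rate_pos[OF soe q] that unfolding M_def by blast
    have \<Delta>: "0 < \<Delta>t" using params(1) N by (simp add: \<Delta>t)
    have "real n * \<Delta>t \<le> real N * \<Delta>t" using n \<Delta> by (intro mult_right_mono) auto
    then have nT: "real n * \<Delta>t \<le> T" using N by (simp add: \<Delta>t)
    have T: "T \<in> {0<..T}" using params(1) by simp
    \<comment> \<open>No sign of \<open>C0\<close> is assumed; the accuracy at time \<open>T\<close>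
      shows that \<open>C0 * \<epsilon>\<close> is nonnegative.\<close>
    have \<delta>0: "0 \<le> C0 * \<epsilon>" using order_trans[OF abs_ge_zero bspec[OF acc' T]] .
    have Linf0: "0 \<le> Linf_curve_norm 2 \<Omega> T v" by (simp add: Linf_curve_norm_def)
    have \<delta>2: "C0 * \<epsilon> \<le> \<bar>C0\<bar> * \<epsilon>" using \<epsilon> by (intro mult_right_mono) auto
    also have "\<bar>C0\<bar> * \<epsilon> \<le> \<bar>C0\<bar>" using \<epsilon> by (simp add: mult_left_le)
    finally have \<delta>1: "C0 * \<epsilon> \<le> \<bar>C0\<bar>" .
    have \<beta>B: "\<bar>\<beta> r\<bar> \<le> B" if "0 < r" "r \<le> T" for r using B[OF \<epsilon> acc'] that by simp
    have d: "\<bar>\<beta> r - soe_kernel \<tau>\<sigma> M a b r\<bar> \<le> C0 * \<epsilon>" if "0 < r" "r \<le> T" for r using acc' that by simp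
    have "\<bar>soe_kernel \<tau>\<sigma> M a b r\<bar> \<le> G" if r: "0 < r" "r \<le> T" for r
      using \<beta>B[OF r] d[OF r] \<delta>1 unfolding G_def by linarith
    then have Gb: "\<bar>soe_kernel \<tau>\<sigma> M a b r\<bar> \<le> G" if "0 \<le> r" "r \<le> T" for r
      by (rule bound_at_left_end[OF params(1) soe_kernel_continuous _ that])
    have \<beta>m: "\<beta> \<in> borel_measurable borel" unfolding \<beta>_def by (rule relax_kernel_measurable)
    have Fc: "continuous_L2_curve \<Omega> T F" using F unfolding C1_L2_curve_def by blast
    have nN: "n \<le> N" using n by simp
    define P where "P = (LINT x|lebesgue_on {0..real n * \<Delta>t}. H_norm 2 \<Omega> (vt x))"
    define Q where "Q = (LINT x|lebesgue_on {0..real n * \<Delta>t}. H_norm 0 \<Omega> (vtt x))"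
    have PQ0: "0 \<le> P" "0 \<le> Q" unfolding P_def Q_def by (intro Bochner_Integration.integral_nonneg H_norm_nonneg)+
    have PQ: "(LINT s|lebesgue_on {0..real n * \<Delta>t}. H_norm 2 \<Omega> (vt s) + H_norm 0 \<Omega> (vtt s)) = P + Q"
    proof -
      have sub: "{0..real n * \<Delta>t} \<subseteq> {0..T}" using nT by simp
      have "integrable (lebesgue_on {0..T}) (\<lambda>s. H_norm 2 \<Omega> (vt s))" "integrable (lebesgue_on {0..T}) (\<lambda>s. H_norm 0 \<Omega> (vtt s))"
        using vt vtt unfolding L1_curve_def by blast+
      then show ?thesis unfolding P_def Q_def by (intro Bochner_Integration.integral_add integrable_subinterval[OF _ sub])
    qed
    have "H_norm 0 \<Omega> (\<lambda>x. vh n x - v (real n * \<Delta>t) x) \<le>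
      2 * E * (\<Delta>t * Q + T * (CB * (T * (C0 * \<epsilon>) * (H_norm 2 \<Omega> v0 + P) + G * \<Delta>t * P))) + K' * h\<^sup>2 * (H_norm 2 \<Omega> v0 + P)"
      unfolding K'_def
      by (rule fully_discrete_error[OF domain(2) fe params(1) sol[folded AA_def BB_def \<beta>_def] v0 vt Fc Dvt vtt AA CA c BB CB CR
            \<beta>m \<beta>B d \<delta>0 Gb a params(5) \<Delta> vh[folded AA_def BB_def \<beta>_def M_def] nN nT E_def Ca_def P_def Q_def])
    also have "\<dots> \<le> C * (h\<^sup>2 + \<Delta>t) * (H_norm 2 \<Omega> v0 + Linf_curve_norm 2 \<Omega> T v + (P + Q)) + C * T * \<epsilon> * (H_norm 2 \<Omega> v0 + P)"
      by (rule error_constant[OF E0 K'0 less_imp_le[OF params(1)] CB(1) G0 abs_ge_zero less_imp_le[OF \<Delta>] zero_le_power2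
            H_norm_nonneg Linf0 PQ0 \<delta>2 less_imp_le[OF \<epsilon>(1)] C_def])
    finally show "H_norm 0 \<Omega> (\<lambda>x. vh n x - v (real n * \<Delta>t) x)
        \<le> C * (h\<^sup>2 + \<Delta>t) *
            (H_norm 2 \<Omega> v0 + Linf_curve_norm 2 \<Omega> T v +
             (LINT s|lebesgue_on {0..real n * \<Delta>t}. H_norm 2 \<Omega> (vt s) + H_norm 0 \<Omega> (vtt s)))
          + C * T * \<epsilon> *
            (H_norm 2 \<Omega> v0 + (LINT s|lebesgue_on {0..real n * \<Delta>t}. H_norm 2 \<Omega> (vt s)))"
      unfolding PQ P_def .
  qed
qed

end
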